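(* Let $M$ be a smooth oriented manifold, let $(f,X)$ be a Morse–Smale pair on $M$, and fix orientations of all unstable manifolds. Let $\xi,\gamma,\zeta\in\mathrm{Crit}(f)$ have Morse indices $k+1$, $k$, $k-1$ respectively, let $u\in\mathcal{M}_{\xi,\gamma}$, $v\in\mathcal{M}_{\gamma,\zeta}$, and let $\omega_\eta=u\,\mathfrak{S}_\eta\,v\in\mathcal{M}_{\xi,\zeta}$, $\eta\in[\eta_0,\infty)$, be the glued trajectories. Then the gluing map on orientations $\mathcal{O}^{\omega_\eta}$ is compatible with the induced orientations, i.e. $$\mathcal{O}^{\omega_\eta}\bigl(\mathcal{O}(M^u_{\xi,\gamma})_{\mathrm{Ind}},\ \mathcal{O}(M^v_{\gamma,\zeta})_{\mathrm{Ind}}\bigr)=\mathcal{O}(M^{\omega_\eta}_{\xi,\zeta})_{\mathrm{Ind}}.$$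
   Context: $(f,X)$ Morse–Smale pair: $f:M\to\mathbb{R}$ is a Morse function, $X$ is a pseudo-gradient adapted to $f$ (so $df(X)\le0$ with equality exactly at critical points, and $X$ is minus the standard gradient in Morse charts), and all stable manifolds $W^s$ and unstable manifolds $W^u$ of the flow $\phi_t$ of $X$ intersect transversally. $\mathrm{Ind}(\xi)=\dim W^u(\xi)$. Set $M_{\xi,\gamma}=W^u(\xi)\cap W^s(\gamma)$ and, for $\xi\ne\gamma$, $\mathcal{M}_{\xi,\gamma}=M_{\xi,\gamma}\cap f^{-1}(c)$ with $c$ a regular value in $(f(\gamma),f(\xi))$; this is identified with the space of flow lines from $\xi$ to $\gamma$ modulo time translation. For $u\in\mathcal{M}_{\xi,\gamma}$, $M^u_{\xi,\gamma}$ denotes the connected component of $M_{\xi,\gamma}$ containing $u$. Induced orientations: $W^s(\gamma)$ is oriented by $\mathcal{O}_{W^u}(\gamma)\oplus\mathcal{O}_{W^s}(\gamma)=\mathcal{O}_M(\gamma)$ at $\gamma$; $NW^s(\gamma)$ is oriented by $TM|_{W^s(\gamma)}\cong NW^s(\gamma)\oplus TW^s(\gamma)$ (equivalently, by the identification $N_\gamma W^s(\gamma)\cong T_\gamma W^u(\gamma)$ at $\gamma$); $M_{\xi,\gamma}$ gets the induced orientation $\mathcal{O}(M_{\xi,\gamma})_{\mathrm{Ind}}$ determined by $TW^u(\xi)|_{M_{\xi,\gamma}}\cong TM_{\xi,\gamma}\oplus NW^s(\gamma)|_{M_{\xi,\gamma}}$. Gluing map (standard): for $\xi,\gamma,\zeta$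 of indices $k+1,k,k-1$ there are $\eta_0>0$ and an embedding $\mathfrak{S}:\mathcal{M}_{\xi,\gamma}\times[\eta_0,\infty)\times\mathcal{M}_{\gamma,\zeta}\to\mathcal{M}_{\xi,\zeta}$, $(u,\eta,v)\mapsto u\,\mathfrak{S}_\eta\,v=:\omega_\eta$, such that $\omega_\eta$ converges to the broken trajectory $(u,v)$ as $\eta\to\infty$. Gluing map on orientations: let $\mathcal{O}^{\dot\phi}(u)$ be the orientation of the one-dimensional manifold $M^u_{\xi,\gamma}$ given by the flow direction $X$, and similarly $\mathcal{O}^{\dot\phi}(v)$ on $M^v_{\gamma,\zeta}$. The vectors $X(\omega_\eta)$ and $\frac{d}{d\eta}\omega_\eta$ are linearly independent and span the tangent space of the two-dimensional manifold $M^{\omega_\eta}_{\xi,\zeta}$ at $\omega_\eta$; let $\mathcal{O}\bigl(X(\omega_\eta),-\tfrac{d}{d\eta}\omega_\eta\bigr)$ be the orientation of $M^{\omega_\eta}_{\xi,\zeta}$ given by this ordered frame. For orientations $\mathcal{O}(M^u_{\xi,\gamma})=\alpha\,\mathcal{O}^{\dot\phi}(u)$ and $\mathcal{O}(M^v_{\gamma,\zeta})=\beta\,\mathcal{O}^{\dot\phi}(v)$ with $\alpha,\beta\in\{\pm1\}$, define $$\mathcal{O}^{\omega_\eta}\bigl(\mathcal{O}(M^u_{\xi,\gamma}),\mathcal{O}(M^v_{\gamma,\zeta})\bigr):=\alpha\beta\,\mathcal{O}\bigl(X(\omega_\eta),-\tfrac{d}{d\eta}\omega_\eta\bigr).$$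 *)

theory Defs
  imports "HOL-Analysis.Analysis" "Jordan_Normal_Form.Determinant"
begin

section \<open>Smooth maps between Euclidean spaces\<close>

text \<open>The set is meant to be open here.\<close>

primrec Ck_on :: "nat \<Rightarrow> 'e::real_normed_vector set \<Rightarrow> ('e \<Rightarrow> 'b::real_normed_vector) \<Rightarrow> bool" where
  "Ck_on 0 U g = continuous_on U g"
| "Ck_on (Suc k) U g =
    ((\<forall>x\<in>U. g differentiable (at x)) \<and> (\<forall>v. Ck_on k U (\<lambda>x. frechet_derivative g (at x) v)))"

text \<open>On an arbitrary set, e.g. a half-line, smooth maps are those that locally extend to
  smooth maps on open sets.\<close>

definition smooth_on :: "'e::real_normed_vector set \<Rightarrow> ('e \<Rightarrow> 'b::real_normed_vector) \<Rightarrow> bool" where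
  "smooth_on S g \<longleftrightarrow>
    (\<forall>x\<in>S. \<exists>U h. open U \<and> x \<in> U \<and> (\<forall>k. Ck_on k U h) \<and> (\<forall>y\<in>U \<inter> S. h y = g y))"

section \<open>Smooth manifolds\<close>

text \<open>A smooth manifold of dimension \<open>DIM('e)\<close> is a Hausdorff second countable
  type \<open>'a\<close> together with a smooth atlas. A chart is a pair of its domain and its coordinate map;
  the values of the coordinate map outside of the domain are irrelevant.\<close>

type_synonym ('a, 'e) chart = "'a set \<times> ('a \<Rightarrow> 'e)"

abbreviation chart_inv :: "('a, 'e) chart \<Rightarrow> 'e \<Rightarrow> 'a" where
  "chart_inv c \<equiv> inv_into (fst c) (snd c)"

definition is_chart :: "('a::topological_space, 'e::euclidean_space) chart \<Rightarrow> bool" where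
  "is_chart c \<longleftrightarrow> open (fst c) \<and> open (snd c ` fst c) \<and>
     homeomorphism (fst c) (snd c ` fst c) (snd c) (chart_inv c)"

definition smooth_transition ::
  "('a::topological_space, 'e::euclidean_space) chart \<Rightarrow> ('a, 'e) chart \<Rightarrow> bool" where
  "smooth_transition c d \<longleftrightarrow> smooth_on (snd c ` (fst c \<inter> fst d)) (snd d \<circ> chart_inv c)"

definition smooth_atlas ::
  "('a::{t2_space,second_countable_topology}, 'e::euclidean_space) chart set \<Rightarrow> bool" where
  "smooth_atlas A \<longleftrightarrow> (\<forall>c\<in>A. is_chart c) \<and> (\<forall>c\<in>A. \<forall>d\<in>A. smooth_transition c d) \<and>
     (\<Union>c\<in>A. fst c) = UNIV"

definition maximal_atlas ::
  "('a::topological_space, 'e::euclidean_space) chart set \<Rightarrow> ('a, 'e) chart set" where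
  "maximal_atlas A =
     {c. is_chart c \<and> (\<forall>d\<in>A. smooth_transition c d \<and> smooth_transition d c)}"

text \<open>For every point \<open>p\<close> a chart around \<open>p\<close> is chosen once and for all, and the tangent space
  at \<open>p\<close> is identified with \<open>'e\<close> by means of this chart. Thus a vector field is a function
  \<open>'a \<Rightarrow> 'e\<close>, and \<open>push A c p v\<close> is the coordinate vector with respect to the chart \<open>c\<close> of the
  tangent vector \<open>v\<close> at \<open>p\<close>. The chosen chart may jump from point to point, so regularity
  of vector fields has to be expressed through \<open>push\<close>.\<close>

definition chart_at :: "('a, 'e) chart set \<Rightarrow> 'a \<Rightarrow> ('a, 'e) chart" where
  "chart_at A p = (SOME c. c \<in> A \<and> p \<in> fst c)"

definition push ::
  "('a::topological_space, 'e::euclidean_space) chart set \<Rightarrow> ('a, 'e) chart \<Rightarrow> 'a \<Rightarrow> 'e \<Rightarrow> 'e" where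
  "push A c p v =
     frechet_derivative (snd c \<circ> chart_inv (chart_at A p)) (at (snd (chart_at A p) p)) v"

definition smooth_function ::
  "('a::topological_space, 'e::euclidean_space) chart set \<Rightarrow> ('a \<Rightarrow> real) \<Rightarrow> bool" where
  "smooth_function A f \<longleftrightarrow> (\<forall>c\<in>A. smooth_on (snd c ` fst c) (f \<circ> chart_inv c))"

definition differential ::
  "('a::topological_space, 'e::euclidean_space) chart set \<Rightarrow> ('a \<Rightarrow> real) \<Rightarrow> 'a \<Rightarrow> 'e \<Rightarrow> real" where
  "differential A f p v =
     frechet_derivative (f \<circ> chart_inv (chart_at A p)) (at (snd (chart_at A p) p)) v"

definition smooth_field ::
  "('a::topological_space, 'e::euclidean_space) chart set \<Rightarrow> ('a \<Rightarrow> 'e) \<Rightarrow> bool" where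
  "smooth_field A X \<longleftrightarrow>
     (\<forall>c\<in>A. smooth_on (snd c ` fst c) (\<lambda>x. push A c (chart_inv c x) (X (chart_inv c x))))"

definition continuous_field_on ::
  "('a::topological_space, 'e::euclidean_space) chart set \<Rightarrow> 'a set \<Rightarrow> ('a \<Rightarrow> 'e) \<Rightarrow> bool" where
  "continuous_field_on A S E \<longleftrightarrow> (\<forall>c\<in>A. continuous_on (S \<inter> fst c) (\<lambda>q. push A c q (E q)))"

definition smooth_curve_on ::
  "('a::topological_space, 'e::euclidean_space) chart set \<Rightarrow> real set \<Rightarrow> (real \<Rightarrow> 'a) \<Rightarrow> bool" where
  "smooth_curve_on A T x \<longleftrightarrow>
     continuous_on T x \<and> (\<forall>c\<in>A. smooth_on (T \<inter> x -` fst c) (snd c \<circ> x))"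

definition velocity ::
  "('a::topological_space, 'e::euclidean_space) chart set \<Rightarrow> real set \<Rightarrow> (real \<Rightarrow> 'a) \<Rightarrow> real \<Rightarrow> 'e" where
  "velocity A T x t = vector_derivative (snd (chart_at A (x t)) \<circ> x) (at t within T)"

text \<open>The tangent space of a submanifold \<open>W\<close> at \<open>p \<in> W\<close>, as a subspace of the tangent space of
  the ambient manifold.\<close>

definition tangent_space ::
  "('a::topological_space, 'e::euclidean_space) chart set \<Rightarrow> 'a set \<Rightarrow> 'a \<Rightarrow> 'e set" where
  "tangent_space A W p =
     {v. \<exists>x \<epsilon>. \<epsilon> > 0 \<and> smooth_curve_on A {-\<epsilon><..<\<epsilon>} x \<and> x ` {-\<epsilon><..<\<epsilon>} \<subseteq> W \<and> x 0 = p \<and>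
       velocity A {-\<epsilon><..<\<epsilon>} x 0 = v}"

definition is_submanifold ::
  "('a::topological_space, 'e::euclidean_space) chart set \<Rightarrow> nat \<Rightarrow> 'a set \<Rightarrow> bool" where
  "is_submanifold A d W \<longleftrightarrow>
     (\<forall>p\<in>W. \<exists>c\<in>maximal_atlas A. \<exists>L. p \<in> fst c \<and> subspace L \<and> dim L = d \<and>
        snd c ` (W \<inter> fst c) = {y \<in> snd c ` fst c. y - snd c p \<in> L})"

definition dim_submanifold ::
  "('a::topological_space, 'e::euclidean_space) chart set \<Rightarrow> 'a set \<Rightarrow> nat" where
  "dim_submanifold A W = (THE d. is_submanifold A d W)"

section \<open>Orientations\<close>

text \<open>An orientation of a finite-dimensional vector space \<open>V\<close> is a map that assigns a
  sign to each ordered basis, equivariantly under change of basis. In contrast to an equivalence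
  class of bases this also yields two orientations of the zero space, by the
  sign of the empty basis. Orientations vanish on all other lists so that they
  can be compared by equality.\<close>

definition ordered_basis :: "'e::euclidean_space set \<Rightarrow> 'e list \<Rightarrow> bool" where
  "ordered_basis V bs \<longleftrightarrow> distinct bs \<and> independent (set bs) \<and> span (set bs) = V"

definition vs_orientation :: "'e::euclidean_space set \<Rightarrow> ('e list \<Rightarrow> real) \<Rightarrow> bool" where
  "vs_orientation V sg \<longleftrightarrow>
     (\<forall>bs. ordered_basis V bs \<longrightarrow> sg bs \<in> {1, -1}) \<and>
     (\<forall>bs. \<not> ordered_basis V bs \<longrightarrow> sg bs = 0) \<and>
     (\<forall>bs cs C. ordered_basis V bs \<and> ordered_basis V cs \<and>
        C \<in> carrier_mat (length bs) (length bs) \<and>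
        (\<forall>j<length bs. cs ! j = (\<Sum>i<length bs. C $$ (i, j) *\<^sub>R bs ! i)) \<longrightarrow>
        sg cs = sgn (Determinant.det C) * sg bs)"

text \<open>An orientation of a submanifold \<open>W\<close> is a family of orientations of its tangent spaces for
  which the sign of every continuous local frame is continuous, i.e. locally constant.\<close>

definition orientation ::
  "('a::topological_space, 'e::euclidean_space) chart set \<Rightarrow> 'a set \<Rightarrow> ('a \<Rightarrow> 'e list \<Rightarrow> real) \<Rightarrow> bool" where
  "orientation A W Or \<longleftrightarrow>
     (\<forall>p\<in>W. vs_orientation (tangent_space A W p) (Or p)) \<and>
     (\<forall>p bs. p \<notin> W \<longrightarrow> Or p bs = 0) \<and>
     (\<forall>S Es. openin (top_of_set W) S \<and> (\<forall>E\<in>set Es. continuous_field_on A S E) \<and>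
        (\<forall>q\<in>S. ordered_basis (tangent_space A W q) (map (\<lambda>E. E q) Es)) \<longrightarrow>
        continuous_on S (\<lambda>q. Or q (map (\<lambda>E. E q) Es)))"

definition restrict_or :: "'a set \<Rightarrow> ('a \<Rightarrow> 'e list \<Rightarrow> real) \<Rightarrow> 'a \<Rightarrow> 'e list \<Rightarrow> real" where
  "restrict_or S Or = (\<lambda>p bs. if p \<in> S then Or p bs else 0)"

definition scale_or :: "real \<Rightarrow> ('a \<Rightarrow> 'e list \<Rightarrow> real) \<Rightarrow> 'a \<Rightarrow> 'e list \<Rightarrow> real" where
  "scale_or a Or = (\<lambda>p bs. a * Or p bs)"

text \<open>The orientation of a connected manifold \<open>W\<close> given by an ordered basis of its tangent space
  at one point \<open>p\<close>.\<close>

definition frame_orientation ::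
  "('a::topological_space, 'e::euclidean_space) chart set \<Rightarrow> 'a set \<Rightarrow> 'a \<Rightarrow> 'e list \<Rightarrow>
    'a \<Rightarrow> 'e list \<Rightarrow> real" where
  "frame_orientation A W p bs = (THE Or. orientation A W Or \<and> Or p bs = 1)"

section \<open>Morse--Smale pairs\<close>

definition Crit ::
  "('a::topological_space, 'e::euclidean_space) chart set \<Rightarrow> ('a \<Rightarrow> real) \<Rightarrow> 'a set" where
  "Crit A f = {p. \<forall>v. differential A f p v = 0}"

definition hessian ::
  "('a::topological_space, 'e::euclidean_space) chart set \<Rightarrow> ('a \<Rightarrow> real) \<Rightarrow> 'a \<Rightarrow> 'e \<Rightarrow> 'e \<Rightarrow> real" where
  "hessian A f p v w =
     frechet_derivative (\<lambda>x. frechet_derivative (f \<circ> chart_inv (chart_at A p)) (at x) v)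
       (at (snd (chart_at A p) p)) w"

definition morse_function ::
  "('a::topological_space, 'e::euclidean_space) chart set \<Rightarrow> ('a \<Rightarrow> real) \<Rightarrow> bool" where
  "morse_function A f \<longleftrightarrow> smooth_function A f \<and>
     (\<forall>p\<in>Crit A f. \<forall>v. (\<forall>w. hessian A f p v w = 0) \<longrightarrow> v = 0)"

text \<open>The set \<open>B\<close> consists of the coordinate directions in which \<open>f\<close> decreases.\<close>

definition morse_chart ::
  "('a::topological_space, 'e::euclidean_space) chart set \<Rightarrow> ('a \<Rightarrow> real) \<Rightarrow> 'a \<Rightarrow> ('a, 'e) chart \<Rightarrow> bool" where
  "morse_chart A f p c \<longleftrightarrow> c \<in> maximal_atlas A \<and> p \<in> fst c \<and> snd c p = 0 \<and>
     (\<exists>B\<subseteq>Basis. \<forall>x\<in>snd c ` fst c.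
        f (chart_inv c x) = f p - (\<Sum>b\<in>B. (inner x b)\<^sup>2) + (\<Sum>b\<in>Basis - B. (inner x b)\<^sup>2))"

definition pseudo_gradient ::
  "('a::topological_space, 'e::euclidean_space) chart set \<Rightarrow> ('a \<Rightarrow> real) \<Rightarrow> ('a \<Rightarrow> 'e) \<Rightarrow> bool" where
  "pseudo_gradient A f X \<longleftrightarrow> smooth_field A X \<and>
     (\<forall>p. differential A f p (X p) \<le> 0) \<and>
     (\<forall>p. differential A f p (X p) = 0 \<longleftrightarrow> p \<in> Crit A f) \<and>
     (\<forall>p\<in>Crit A f. \<exists>c. morse_chart A f p c \<and>
        (\<forall>q\<in>fst c. GDERIV (f \<circ> chart_inv c) (snd c q) :> - push A c q (X q)))"

text \<open>Stable and unstable manifolds are defined by integral curves on half-lines, so that the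
  vector field need not be complete.\<close>

definition integral_curve_on ::
  "('a::topological_space, 'e::euclidean_space) chart set \<Rightarrow> ('a \<Rightarrow> 'e) \<Rightarrow> real set \<Rightarrow>
    (real \<Rightarrow> 'a) \<Rightarrow> bool" where
  "integral_curve_on A X T x \<longleftrightarrow> continuous_on T x \<and>
     (\<forall>t\<in>T. ((snd (chart_at A (x t)) \<circ> x) has_vector_derivative X (x t)) (at t within T))"

definition Wu ::
  "('a::topological_space, 'e::euclidean_space) chart set \<Rightarrow> ('a \<Rightarrow> 'e) \<Rightarrow> 'a \<Rightarrow> 'a set" where
  "Wu A X \<xi> = {p. \<exists>x. integral_curve_on A X {..0} x \<and> x 0 = p \<and> (x \<longlongrightarrow> \<xi>) at_bot}"

definition Ws ::
  "('a::topological_space, 'e::euclidean_space) chart set \<Rightarrow> ('a \<Rightarrow> 'e) \<Rightarrow> 'a \<Rightarrow> 'a set" where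
  "Ws A X \<xi> = {p. \<exists>x. integral_curve_on A X {0..} x \<and> x 0 = p \<and> (x \<longlongrightarrow> \<xi>) at_top}"

definition Ind ::
  "('a::topological_space, 'e::euclidean_space) chart set \<Rightarrow> ('a \<Rightarrow> 'e) \<Rightarrow> 'a \<Rightarrow> nat" where
  "Ind A X \<xi> = dim_submanifold A (Wu A X \<xi>)"

definition transverse ::
  "('a::topological_space, 'e::euclidean_space) chart set \<Rightarrow> 'a set \<Rightarrow> 'a set \<Rightarrow> bool" where
  "transverse A V W \<longleftrightarrow>
     (\<forall>p\<in>V \<inter> W. {v + w | v w. v \<in> tangent_space A V p \<and> w \<in> tangent_space A W p} = UNIV)"

definition morse_smale_pair ::
  "('a::topological_space, 'e::euclidean_space) chart set \<Rightarrow> ('a \<Rightarrow> real) \<Rightarrow> ('a \<Rightarrow> 'e) \<Rightarrow> bool" where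
  "morse_smale_pair A f X \<longleftrightarrow> morse_function A f \<and> pseudo_gradient A f X \<and>
     (\<forall>\<xi>\<in>Crit A f. \<forall>\<gamma>\<in>Crit A f. transverse A (Wu A X \<xi>) (Ws A X \<gamma>))"

definition connecting ::
  "('a::topological_space, 'e::euclidean_space) chart set \<Rightarrow> ('a \<Rightarrow> 'e) \<Rightarrow> 'a \<Rightarrow> 'a \<Rightarrow> 'a set" where
  "connecting A X \<xi> \<gamma> = Wu A X \<xi> \<inter> Ws A X \<gamma>"

definition trajectories ::
  "('a::topological_space, 'e::euclidean_space) chart set \<Rightarrow> ('a \<Rightarrow> real) \<Rightarrow> ('a \<Rightarrow> 'e) \<Rightarrow> real \<Rightarrow>
    'a \<Rightarrow> 'a \<Rightarrow> 'a set" where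
  "trajectories A f X c \<xi> \<gamma> = connecting A X \<xi> \<gamma> \<inter> f -` {c}"

definition regular_level_between ::
  "('a::topological_space, 'e::euclidean_space) chart set \<Rightarrow> ('a \<Rightarrow> real) \<Rightarrow> 'a \<Rightarrow> 'a \<Rightarrow> real \<Rightarrow> bool" where
  "regular_level_between A f \<xi> \<gamma> c \<longleftrightarrow> c \<in> {f \<gamma><..<f \<xi>} \<and> c \<notin> f ` Crit A f"

abbreviation connecting_component ::
  "('a::topological_space, 'e::euclidean_space) chart set \<Rightarrow> ('a \<Rightarrow> 'e) \<Rightarrow> 'a \<Rightarrow> 'a \<Rightarrow> 'a \<Rightarrow> 'a set" where
  "connecting_component A X \<xi> \<gamma> u \<equiv> connected_component_set (connecting A X \<xi> \<gamma>) u"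

section \<open>Induced orientations\<close>

text \<open>In this section \<open>OM\<close> is an orientation of the manifold and \<open>OU \<xi>\<close> one of the
  unstable manifold of \<open>\<xi>\<close>.\<close>

definition stable_orientation ::
  "('a::topological_space, 'e::euclidean_space) chart set \<Rightarrow> ('a \<Rightarrow> 'e) \<Rightarrow>
    ('a \<Rightarrow> 'e list \<Rightarrow> real) \<Rightarrow> ('a \<Rightarrow> 'a \<Rightarrow> 'e list \<Rightarrow> real) \<Rightarrow> 'a \<Rightarrow> 'a \<Rightarrow> 'e list \<Rightarrow> real" where
  "stable_orientation A X OM OU \<gamma> = (THE Or. orientation A (Ws A X \<gamma>) Or \<and>
     (\<forall>us ws. ordered_basis (tangent_space A (Wu A X \<gamma>) \<gamma>) us \<and>
        ordered_basis (tangent_space A (Ws A X \<gamma>) \<gamma>) ws \<longrightarrow>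
        OM \<gamma> (us @ ws) = OU \<gamma> \<gamma> us * Or \<gamma> ws))"

text \<open>The orientation of the normal space of \<open>Ws A X \<gamma>\<close> at a point \<open>p\<close> of it. An ordered basis
  of this quotient of tangent spaces is represented by a list of tangent vectors \<open>ns\<close>; the
  result is \<open>0\<close> if \<open>ns\<close> does not represent a basis.\<close>

definition normal_orientation ::
  "('a::topological_space, 'e::euclidean_space) chart set \<Rightarrow> ('a \<Rightarrow> 'e) \<Rightarrow>
    ('a \<Rightarrow> 'e list \<Rightarrow> real) \<Rightarrow> ('a \<Rightarrow> 'a \<Rightarrow> 'e list \<Rightarrow> real) \<Rightarrow> 'a \<Rightarrow> 'a \<Rightarrow> 'e list \<Rightarrow> real" where
  "normal_orientation A X OM OU \<gamma> p ns = (THE s. \<forall>ws.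
     ordered_basis (tangent_space A (Ws A X \<gamma>) p) ws \<longrightarrow>
       OM p (ns @ ws) = s * stable_orientation A X OM OU \<gamma> p ws)"

definition induced_orientation ::
  "('a::topological_space, 'e::euclidean_space) chart set \<Rightarrow> ('a \<Rightarrow> 'e) \<Rightarrow>
    ('a \<Rightarrow> 'e list \<Rightarrow> real) \<Rightarrow> ('a \<Rightarrow> 'a \<Rightarrow> 'e list \<Rightarrow> real) \<Rightarrow> 'a \<Rightarrow> 'a \<Rightarrow> 'a \<Rightarrow> 'e list \<Rightarrow> real" where
  "induced_orientation A X OM OU \<xi> \<gamma> = (THE Or. orientation A (connecting A X \<xi> \<gamma>) Or \<and>
     (\<forall>p\<in>connecting A X \<xi> \<gamma>. \<forall>ms ns.
        ordered_basis (tangent_space A (connecting A X \<xi> \<gamma>) p) ms \<and>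
        ordered_basis (tangent_space A (Wu A X \<xi>) p) (ms @ ns) \<longrightarrow>
        OU \<xi> p (ms @ ns) = Or p ms * normal_orientation A X OM OU \<gamma> p ns))"

section \<open>Gluing\<close>

definition flow_line ::
  "('a::topological_space, 'e::euclidean_space) chart set \<Rightarrow> ('a \<Rightarrow> 'e) \<Rightarrow> 'a \<Rightarrow> real \<Rightarrow> 'a" where
  "flow_line A X p = (THE x. integral_curve_on A X UNIV x \<and> x 0 = p)"

text \<open>Convergence of trajectories to a broken trajectory: up to time shifts, the flow lines
  converge locally uniformly in time to both parts of the broken trajectory.
  Locally uniform convergence to a continuous limit is expressed as continuous convergence, which
  requires no metric.\<close>

definition converges_to_broken ::
  "('a::topological_space, 'e::euclidean_space) chart set \<Rightarrow> ('a \<Rightarrow> 'e) \<Rightarrow> (real \<Rightarrow> 'a) \<Rightarrow>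
    'a \<Rightarrow> 'a \<Rightarrow> bool" where
  "converges_to_broken A X \<omega> u v \<longleftrightarrow> (\<exists>\<sigma> \<tau> :: real \<Rightarrow> real. \<forall>r.
     ((\<lambda>(\<eta>, t). flow_line A X (\<omega> \<eta>) (\<sigma> \<eta> + t)) \<longlongrightarrow> flow_line A X u r) (at_top \<times>\<^sub>F nhds r) \<and>
     ((\<lambda>(\<eta>, t). flow_line A X (\<omega> \<eta>) (\<tau> \<eta> + t)) \<longlongrightarrow> flow_line A X v r) (at_top \<times>\<^sub>F nhds r))"

text \<open>This is for \<open>P\<close> and \<open>Q\<close> of dimension \<open>0\<close>: then smoothness and
  immersivity on \<open>P \<times> {\<eta>\<^sub>0..} \<times> Q\<close> only concern the parameter \<open>\<eta>\<close>.\<close>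

definition gluing_map ::
  "('a::topological_space, 'e::euclidean_space) chart set \<Rightarrow> ('a \<Rightarrow> 'e) \<Rightarrow>
    'a set \<Rightarrow> 'a set \<Rightarrow> 'a set \<Rightarrow> real \<Rightarrow> ('a \<Rightarrow> real \<Rightarrow> 'a \<Rightarrow> 'a) \<Rightarrow> bool" where
  "gluing_map A X P Q R \<eta>\<^sub>0 G \<longleftrightarrow> \<eta>\<^sub>0 > 0 \<and>
     embedding_map (top_of_set (P \<times> {\<eta>\<^sub>0..} \<times> Q)) (top_of_set R) (\<lambda>(u, \<eta>, v). G u \<eta> v) \<and>
     (\<forall>u\<in>P. \<forall>v\<in>Q. smooth_curve_on A {\<eta>\<^sub>0..} (\<lambda>\<eta>. G u \<eta> v) \<and>
        (\<forall>\<eta>\<ge>\<eta>\<^sub>0. velocity A {\<eta>\<^sub>0..} (\<lambda>\<eta>. G u \<eta> v) \<eta> \<noteq> 0) \<and>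
        converges_to_broken A X (\<lambda>\<eta>. G u \<eta> v) u v)"

definition flow_orientation ::
  "('a::topological_space, 'e::euclidean_space) chart set \<Rightarrow> ('a \<Rightarrow> 'e) \<Rightarrow> 'a set \<Rightarrow>
    'a \<Rightarrow> 'e list \<Rightarrow> real" where
  "flow_orientation A X W = (THE Or. orientation A W Or \<and> (\<forall>p\<in>W. Or p [X p] = 1))"

text \<open>The sign of an orientation of the one-dimensional manifold \<open>W\<close> relative to the flow.\<close>

definition flow_sign ::
  "('a::topological_space, 'e::euclidean_space) chart set \<Rightarrow> ('a \<Rightarrow> 'e) \<Rightarrow> 'a set \<Rightarrow>
    ('a \<Rightarrow> 'e list \<Rightarrow> real) \<Rightarrow> real" where
  "flow_sign A X W Or = (THE a. a \<in> {1, -1} \<and> Or = scale_or a (flow_orientation A X W))"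

text \<open>Here \<open>U\<close>, \<open>V\<close> and \<open>W\<close> are the components of the connecting manifolds that contain \<open>u\<close>, \<open>v\<close> and
  \<open>\<omega> \<eta>\<close>, respectively, where \<open>\<omega>\<close> is the curve of glued trajectories.\<close>

definition gluing_orientation ::
  "('a::topological_space, 'e::euclidean_space) chart set \<Rightarrow> ('a \<Rightarrow> 'e) \<Rightarrow>
    'a set \<Rightarrow> 'a set \<Rightarrow> 'a set \<Rightarrow> real \<Rightarrow> (real \<Rightarrow> 'a) \<Rightarrow> real \<Rightarrow>
    ('a \<Rightarrow> 'e list \<Rightarrow> real) \<Rightarrow> ('a \<Rightarrow> 'e list \<Rightarrow> real) \<Rightarrow> 'a \<Rightarrow> 'e list \<Rightarrow> real" where
  "gluing_orientation A X U V W \<eta>\<^sub>0 \<omega> \<eta> O1 O2 =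
     scale_or (flow_sign A X U O1 * flow_sign A X V O2)
       (frame_orientation A W (\<omega> \<eta>) [X (\<omega> \<eta>), - velocity A {\<eta>\<^sub>0..} \<omega> \<eta>])"

end

theory Submission
 imports Defs
begin

text \<open>In a Morse chart at \<open>\<gamma>\<close> with unstable and stable coordinates \<open>P\<close> and \<open>R\<close>, the product
  \<open>|P|\<^sup>2 |R|\<^sup>2\<close> is a first integral that is positive on the glued trajectories and tends to \<open>0\<close> as
  \<open>\<eta> \<rightarrow> \<infinity>\<close>, so its derivative is negative for some arbitrarily large \<open>\<eta>\<close>. For these \<open>\<eta>\<close> a positive
  multiple of \<open>- d\<omega>/d\<eta>\<close>, taken modulo \<open>X\<close>, converges near \<open>u\<close> to a vector tangent to the unstable
  manifold of \<open>\<xi>\<close> whose \<open>P\<close>-coordinate is that of \<open>X\<close> at \<open>v\<close>. Comparing the induced orientations at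
  both ends of the passage of the saddle then gives \<open>\<alpha>\<beta>\<close>, and the sign does not depend on \<open>\<eta>\<close> because
  the induced orientation is continuous.\<close>

text \<open>Convergence to a broken trajectory says nothing about derivatives in eta, so
  \<open>- d omega / d eta\<close> cannot be followed to a limit directly; this is why a scalar
  quantity has to supply its sign. The limit of the normalised vector rests on two bounds. Near u it
  is tangent to the unstable manifold of xi, where the unstable coordinates determine a vector up to
  X; its image near v, after subtracting a multiple of X, is tangent to the stable manifold of zeta,
  where the stable coordinates do so. The passage multiplies the unstable part by E = exp (2T) and
  the stable part by 1/E, so a bounded error at the exit is of order 1/E at the entry
  (\<open>saddle_estimate\<close>). X need not be complete, hence there is no global flow: charts,
  slices and derivatives of families of flow lines are carried along trajectories from one chart
  with an explicit local flow to the next. Such charts exist at critical points by assumption and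
  elsewhere by straightening, which rests on smooth local flows and a smooth inverse function
  theorem.\<close>

hide_const (open) Determinants.det

notation tendsto (infixr "--->" 55)

section \<open>C^k maps between normed spaces\<close>

abbreviation fd :: "('a::real_normed_vector => 'b::real_normed_vector) => 'a => 'a => 'b" where
 "fd g x \<equiv> frechet_derivative g (at x)"

lemma Ck_on_cong:
 assumes "open U" "!!x. x : U ==> f x = g x" "Ck_on k U f"
 shows "Ck_on k U g" using assms(2,3)
proof (induction k arbitrary: f g)
 case 0
 then show ?case by simp
next
 case (Suc k)
 have eq: "g differentiable (at x) & fd g x = fd f x" if "x : U" for x
 proof -
  have "(f has_derivative fd f x) (at x)" using Suc.prems(2) that by (simp add: frechet_derivative_works)
  then have "(g has_derivative fd f x) (at x)" by (rule has_derivative_transform_within_open[OF _ assms(1) that Suc.prems(1)])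
  then show ?thesis by (metis differentiable_def frechet_derivative_at)
 qed
 have "Ck_on k U (%x. fd g x v)" for v by (rule Suc.IH[of "%x. fd f x v"]) (use eq Suc.prems(2) in auto)
 then show ?case using eq by auto
qed

lemma Ck_on_subset: "Ck_on k U f ==> V \<subseteq> U ==> Ck_on k V f" by (induction k arbitrary: f) (auto intro: continuous_on_subset)

lemma Ck_on_Suc_imp: "Ck_on (Suc k) U f ==> Ck_on k U f"
proof (induction k arbitrary: f)
 case 0
 then show ?case by (auto simp: differentiable_imp_continuous_within intro!: continuous_at_imp_continuous_on)
qed auto

lemma Ck_on_le: "Ck_on k U f ==> j <= k ==> Ck_on j U f"
proof (induction k)
 case (Suc k)
 then show ?case using Ck_on_Suc_imp[of k U f] by (cases "j = Suc k") (simp_all only: le_Suc_eq, blast+)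
qed simp

lemma Ck_on_continuous: "Ck_on k U f ==> continuous_on U f" using Ck_on_le[of k U f 0] by simp

lemma Ck_on_local:
 assumes "!!x. x : U ==> EX V. open V & x : V & Ck_on k V f"
 shows "Ck_on k U f" using assms
proof (induction k arbitrary: f)
 case 0
 have "isCont f x" if "x : U" for x using 0[OF that] by (auto simp: continuous_on_eq_continuous_at)
 then show ?case by (simp add: continuous_at_imp_continuous_on)
next
 case (Suc k)
 have "f differentiable (at x)" if "x : U" for x using Suc.prems[OF that] by auto
 moreover have "Ck_on k U (%x. fd f x v)" for v by (rule Suc.IH) (use Suc.prems in fastforce)
 ultimately show ?case by simp
qed

text \<open>Inductions on the order of differentiability can use an explicit formula for the
  derivative in place of the choice term \<open>frechet_derivative\<close>.\<close>

lemma Ck_on_SucI: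
 assumes "open U" "!!x. x : U ==> (f has_derivative f' x) (at x)"
  "!!v. Ck_on k U (%x. f' x v)"
 shows "Ck_on (Suc k) U f"
proof -
 have "Ck_on k U (%x. fd f x v)" for v by (rule Ck_on_cong[OF assms(1) _ assms(3)[of v]]) (simp add: frechet_derivative_at[OF assms(2)])
 then show ?thesis using assms(2) by (auto simp: differentiable_def)
qed

lemma Ck_on_SucD:
 assumes "Ck_on (Suc k) U f" "x : U"
 shows "(f has_derivative fd f x) (at x)" using assms by (simp add: frechet_derivative_works)

lemma Ck_on_const: "open U ==> Ck_on k U (%x. c)" by (induction k arbitrary: c) (auto)

lemma Ck_on_bounded_linear:
 assumes "open U" "bounded_linear h" "Ck_on k U f"
 shows "Ck_on k U (%x. h (f x))" using assms(3)
proof (induction k arbitrary: f)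
 case 0
 then show ?case using bounded_linear.continuous_on[OF assms(2)] by simp
next
 case (Suc k)
 show ?case
 proof (rule Ck_on_SucI[OF assms(1)])
  fix x assume "x : U"
  then show "((%x. h (f x)) has_derivative (%x v. h (fd f x v)) x) (at x)"
   by (intro bounded_linear.has_derivative[OF assms(2) Ck_on_SucD[OF Suc.prems]])
 qed (use Suc in simp)
qed

lemma Ck_on_id: "open U ==> Ck_on k U (%x. x)" by (cases k) (auto intro!: Ck_on_const)

lemma Ck_on_add:
 assumes "open U" "Ck_on k U f" "Ck_on k U g"
 shows "Ck_on k U (%x. f x + g x)" using assms(2,3)
proof (induction k arbitrary: f g)
 case 0
 then show ?case by (simp add: continuous_on_add)
next
 case (Suc k)
 show ?case
 proof (rule Ck_on_SucI[OF assms(1)])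
  fix x assume "x : U"
  then show "((%x. f x + g x) has_derivative
    (%x v. fd f x v + fd g x v) x) (at x)" by (intro has_derivative_add Ck_on_SucD[OF Suc.prems(1)] Ck_on_SucD[OF Suc.prems(2)])
 qed (use Suc in simp)
qed

lemma Ck_on_sum:
 assumes "open U" "!!i. i : I ==> Ck_on k U (f i)"
 shows "Ck_on k U (%x. \<Sum>i\<in>I. f i x)" using assms(2)
 by (induction I rule: infinite_finite_induct) (auto intro!: Ck_on_const Ck_on_add assms(1))

lemma Ck_on_bilinear:
 assumes "open U" "bounded_bilinear B" "Ck_on k U f" "Ck_on k U g"
 shows "Ck_on k U (%x. B (f x) (g x))" using assms(3,4)
proof (induction k arbitrary: f g)
 case 0
 then show ?case using bounded_bilinear.continuous_on[OF assms(2)] by simp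
next
 case (Suc k)
 have f: "Ck_on k U f" and g: "Ck_on k U g" by (rule Ck_on_Suc_imp, fact Suc.prems)+
 show ?case
 proof (rule Ck_on_SucI[OF assms(1)])
  fix x assume x: "x : U"
  show "((%x. B (f x) (g x)) has_derivative
   (%x v. B (f x) (fd g x v) + B (fd f x v) (g x)) x) (at x)"
   by (rule bounded_bilinear.FDERIV[OF assms(2) Ck_on_SucD[OF Suc.prems(1) x] Ck_on_SucD[OF Suc.prems(2) x]])
 next
  fix v
  show "Ck_on k U (%x. B (f x) (fd g x v) + B (fd f x v) (g x))" by (intro Ck_on_add assms(1) Suc.IH) (use f g Suc.prems in auto)
 qed
qed

text \<open>\<open>Ck_on\<close> only speaks of derivatives in fixed directions. A derivative
  applied to a direction that varies with the point becomes a finite sum over the basis of such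
  directional derivatives with scalar coefficients.\<close>

lemma linear_euclidean_expand:
 fixes h :: "'a::euclidean_space => 'b::real_vector"
 assumes "linear h"
 shows "h v = (\<Sum>b\<in>Basis. (inner v b) *\<^sub>R h b)"
proof -
 have "h v = h (\<Sum>b\<in>Basis. (inner v b) *\<^sub>R b)" by (simp add: euclidean_representation)
 also have "\<dots> = (\<Sum>b\<in>Basis. (inner v b) *\<^sub>R h b)" by (simp only: linear_sum[OF assms] linear_scale[OF assms])
 finally show ?thesis .
qed

lemma linear_norm_le_Basis:
 fixes h :: "'a::euclidean_space => 'b::real_normed_vector"
 assumes h: "linear h" and M: "!!b. b : Basis ==> norm (h b) <= M"
 shows "norm (h x) <= real DIM('a) * M * norm x"
proof -
 have "norm (\<Sum>b\<in>Basis. inner x b *\<^sub>R h b) <= (\<Sum>b\<in>(Basis :: 'a set). norm x * M)"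
  using M by (intro sum_norm_le) (auto intro!: mult_mono Basis_le_norm)
 then show ?thesis by (subst linear_euclidean_expand[OF h]) (simp add: mult_ac)
qed

text \<open>The chain rule produces \<open>fd g (f x)\<close> in the moving direction
  \<open>fd f x v\<close>. Since the middle space is Euclidean, expansion in its basis reduces this
  to sums of products to which the induction hypothesis applies.\<close>

lemma Ck_on_compose:
 fixes f :: "'a::real_normed_vector => 'b::euclidean_space" and g :: "'b => 'c::real_normed_vector"
 assumes "open U" "f ` U \<subseteq> V" "Ck_on k U f" "Ck_on k V g"
 shows "Ck_on k U (%x. g (f x))" using assms(3,4)
proof (induction k arbitrary: g)
 case 0
 then show ?case using continuous_on_compose2[of V g U f] assms(2) by simp
next
 case (Suc k)
 have f: "Ck_on k U f" by (rule Ck_on_Suc_imp[OF Suc.prems(1)])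
 show ?case
 proof (rule Ck_on_SucI[OF assms(1)])
  fix x assume x: "x : U"
  then have g': "(g has_derivative fd g (f x)) (at (f x))" using assms(2) by (intro Ck_on_SucD[OF Suc.prems(2)]) auto
  have "((%x. g (f x)) has_derivative (%v. fd g (f x) (fd f x v))) (at x)" using has_derivative_compose[OF Ck_on_SucD[OF Suc.prems(1) x] g'] .
  then show "((%x. g (f x)) has_derivative
   (%x v. \<Sum>b\<in>Basis. (inner (fd f x v) b) *\<^sub>R fd g (f x) b) x) (at x)"
   by (subst (asm) linear_euclidean_expand[OF has_derivative_linear[OF g']])
 next
  fix v
  show "Ck_on k U (%x. \<Sum>b\<in>Basis. (inner (fd f x v) b) *\<^sub>R fd g (f x) b)"
  proof (intro Ck_on_sum Ck_on_bilinear[OF _ bounded_bilinear_scaleR] assms(1))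
   fix b :: 'b
   show "Ck_on k U (%x. inner (fd f x v) b)" using Suc.prems by (intro Ck_on_bounded_linear[OF assms(1) bounded_linear_inner_left]) auto
   show "Ck_on k U (%x. fd g (f x) b)" using Suc.prems f by (intro Suc.IH) auto
  qed
 qed
qed

definition Cinf_on :: "'e::real_normed_vector set => ('e => 'b::real_normed_vector) => bool" where
 "Cinf_on U g \<longleftrightarrow> (ALL k. Ck_on k U g)"

lemma Cinf_on_deriv: "Cinf_on U g ==> Cinf_on U (%x. fd g x v)" unfolding Cinf_on_def
proof
 fix k assume "ALL k. Ck_on k U g"
 then have "Ck_on (Suc k) U g" ..
 then show "Ck_on k U (%x. fd g x v)" by simp
qed

lemma Cinf_deriv: "Cinf_on U g ==> x : U ==> (g has_derivative fd g x) (at x)" unfolding Cinf_on_def by (rule Ck_on_SucD[of 0]) auto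

lemma Cinf_on_continuous: "Cinf_on U g ==> continuous_on U g" unfolding Cinf_on_def by (rule Ck_on_continuous[of 0]) auto

lemma Cinf_on_cong: "open U ==> (!!x. x : U ==> f x = g x) ==> Cinf_on U f ==> Cinf_on U g" unfolding Cinf_on_def by (meson Ck_on_cong)

lemma Cinf_on_subset: "Cinf_on U f ==> V \<subseteq> U ==> Cinf_on V f" unfolding Cinf_on_def by (auto intro: Ck_on_subset)

lemma Cinf_on_compose:
 fixes f :: "'a::real_normed_vector => 'b::euclidean_space" and g :: "'b => 'c::real_normed_vector"
 shows "open U ==> Cinf_on U f ==> Cinf_on V g ==> f ` U \<subseteq> V ==> Cinf_on U (%x. g (f x))"
 unfolding Cinf_on_def by (auto intro: Ck_on_compose)

lemma Cinf_on_add: "open U ==> Cinf_on U f ==> Cinf_on U g ==> Cinf_on U (%x. f x + g x)" unfolding Cinf_on_def by (auto intro: Ck_on_add)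

lemma Cinf_on_const: "open U ==> Cinf_on U (%x. c)" unfolding Cinf_on_def by (auto intro: Ck_on_const)

lemma Cinf_on_bounded_linear: "open U ==> bounded_linear h ==> Cinf_on U f ==> Cinf_on U (%x. h (f x))"
 unfolding Cinf_on_def by (auto intro: Ck_on_bounded_linear)

lemma Cinf_on_linear: "open U ==> bounded_linear h ==> Cinf_on U h"
 using Cinf_on_bounded_linear[of U h "%x. x"] Ck_on_id unfolding Cinf_on_def by blast

lemma Cinf_on_derivative_apply:
 fixes g :: "'a::euclidean_space => 'b::real_normed_vector"
 assumes U: "open U" and g: "Cinf_on V g" and h: "Cinf_on U h" "h ` U \<subseteq> V" and w: "Cinf_on U w"
 shows "Cinf_on U (%x. fd g (h x) (w x))"
proof -
 have "Cinf_on U (%x. \<Sum>b\<in>Basis. inner (w x) b *\<^sub>R fd g (h x) b)" unfolding Cinf_on_def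
 proof (intro allI Ck_on_sum[OF U])
  fix k and b :: 'a
  have "Ck_on k U (%x. inner (w x) b)" using w by (intro Ck_on_bounded_linear[OF U bounded_linear_inner_left]) (simp add: Cinf_on_def)
  moreover have "Cinf_on U (%x. fd g (h x) b)" by (rule Cinf_on_compose[OF U h(1) Cinf_on_deriv[OF g] h(2)])
  then have "Ck_on k U (%x. fd g (h x) b)" by (simp add: Cinf_on_def)
  ultimately show "Ck_on k U (%x. inner (w x) b *\<^sub>R fd g (h x) b)" by (rule Ck_on_bilinear[OF U bounded_bilinear_scaleR])
 qed
 then show ?thesis
 proof (rule Cinf_on_cong[OF U, rotated])
  fix x assume "x : U"
  then have "linear (fd g (h x))" using h(2) by (intro has_derivative_linear[OF Cinf_deriv[OF g]]) auto
  from linear_euclidean_expand[OF this]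
  show "(\<Sum>b\<in>Basis. inner (w x) b *\<^sub>R fd g (h x) b) = fd g (h x) (w x)" by metis
 qed
qed

lemma smooth_on_open:
 assumes "open U"
 shows "smooth_on U g \<longleftrightarrow> Cinf_on U g"
proof
 assume s: "smooth_on U g"
 have "Ck_on k U g" for k
 proof (rule Ck_on_local)
  fix x assume "x : U"
  then obtain V h where V: "open V" "x : V" "ALL k. Ck_on k V h" "ALL y:V \<inter> U. h y = g y" using s unfolding smooth_on_def by blast
  have "Ck_on k (V \<inter> U) g" by (rule Ck_on_cong[of _ h]) (use V assms Ck_on_subset[of k V h "V \<inter> U"] in auto)
  then show "EX V. open V & x : V & Ck_on k V g" using V assms \<open>x : U\<close> by auto
 qed
 then show "Cinf_on U g" by (simp add: Cinf_on_def)
next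
 assume "Cinf_on U g"
 then show "smooth_on U g" using assms unfolding smooth_on_def Cinf_on_def by blast
qed

section \<open>Smooth dependence of fixed points and the smooth inverse function theorem\<close>

lemma contraction_resolvent:
 fixes T :: "'a::banach => 'a"
 assumes T: "bounded_linear T" and half: "!!h. norm (T h) <= norm h / 2"
 obtains J where "bounded_linear J" "!!h. J h - T (J h) = h" "!!h. J (h - T h) = h"
proof -
 interpret T: bounded_linear T by fact
 \<comment> \<open>The fixed point of this contraction is the value at \<open>h\<close> of the
   inverse of id - T; linearity of the inverse follows from uniqueness.\<close>
 have ex: "EX! w. h + T w = w" for h
 proof (rule banach_fix_type[of "1/2"])
  show "ALL x y. dist (h + T x) (h + T y) <= 1/2 * dist x y" using half by (auto simp: dist_norm simp flip: T.diff)
 qed auto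
 define J where "J h = (THE w. h + T w = w)" for h
 have J: "h + T (J h) = J h" for h unfolding J_def by (rule theI'[OF ex])
 have Ju: "J h = w" if "h + T w = w" for h w using ex J that by metis
 have "norm (J h) <= norm h * 2" for h using norm_triangle_ineq[of h "T (J h)"] J half[of "J h"] by auto
 then have "bounded_linear J" by (intro bounded_linear_intro[where K=2] Ju) (auto simp: T.add T.scaleR algebra_simps J,
   metis J add.assoc add.left_commute T.add, metis J T.scaleR scaleR_add_right)
 moreover have "J h - T (J h) = h" for h using J[of h] by (simp add: algebra_simps)
 moreover have "J (h - T h) = h" for h by (rule Ju) simp
 ultimately show ?thesis using that by blast
qed

text \<open>Since \<open>F\<close> vanishes at \<open>x\<close>, the increment of \<open>w\<close>
  multiplies a first-order term and contributes o(|y - x|); continuity of \<open>w\<close> therefore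
  suffices. This differentiates products with a fixed point before it is known to be
  differentiable.\<close>

lemma has_derivative_bilinear_vanishing:
 assumes B: "bounded_bilinear B" and w: "isCont w x" and F: "(F has_derivative F') (at x)" "F x = 0"
 shows "((%y. B (w y) (F y)) has_derivative (%v. B (w x) (F' v))) (at x)"
proof -
 interpret B: bounded_bilinear B by fact
 have 1: "((%y. B (w x) (F y)) has_derivative (%v. B (w x) (F' v))) (at x)" by (rule bounded_linear.has_derivative[OF B.bounded_linear_right F(1)])
 obtain K where K: "K > 0" "!!a b. norm (B a b) <= norm a * norm b * K" using B.pos_bounded by blast
 have F': "bounded_linear F'" using F(1) by auto
 obtain C where C: "C > 0" "!!v. norm (F' v) <= norm v * C" using bounded_linear.pos_bounded[OF F'] by blast
 have 2: "((%y. B (w y - w x) (F y)) has_derivative (%v. 0)) (at x)" unfolding has_derivative_within_alt2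
 proof (intro conjI allI impI bounded_linear_zero)
  fix e :: real assume e: "e > 0"
  have "\<forall>\<^sub>F y in at x. norm (F y - F x - F' (y - x)) <= 1 * norm (y - x)"
   by (rule F(1)[unfolded has_derivative_within_alt2, THEN conjunct2, rule_format]) simp
  moreover have "\<forall>\<^sub>F y in at x. dist (w y) (w x) < e / (K * (1 + C))" using w K C e unfolding isCont_def tendsto_iff by auto
  ultimately show "\<forall>\<^sub>F y in at x. norm (B (w y - w x) (F y) - B (w x - w x) (F x) - 0) <= e * norm (y - x)"
  proof eventually_elim
   case (elim y)
   have "norm (F y) <= norm (F y - F x - F' (y - x)) + norm (F' (y - x))"
    using F(2) norm_triangle_ineq[of "F y - F x - F' (y - x)" "F' (y - x)"] by simp
   also have "\<dots> <= norm (y - x) * (1 + C)" using elim(1) C(2)[of "y - x"] by (simp add: algebra_simps)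
   finally have Fy: "norm (F y) <= norm (y - x) * (1 + C)" .
   have "norm (B (w y - w x) (F y)) <= norm (w y - w x) * norm (F y) * K" by (rule K(2))
   also have "\<dots> <= (e / (K * (1 + C))) * (norm (y - x) * (1 + C)) * K"
    using elim(2) Fy K C e by (intro mult_mono mult_right_mono) (auto simp: dist_norm)
   also have "\<dots> = e * norm (y - x)" using K(1) C(1) by auto
   finally show ?case by (simp add: B.zero_right F(2))
  qed
 qed
 show ?thesis using has_derivative_add[OF 2 1] by (simp flip: B.add_left)
qed

text \<open>Differentiating the equation gives an equation of the same shape for each directional
 derivative of the solution, so smoothness follows by induction.\<close>

lemma Ck_on_linear_fixpoint:
 fixes w :: "'p::real_normed_vector => 'w::banach" and a :: "'c => 'p => 'f::real_normed_vector"
 assumes P: "open P" and B: "!!c. c : I ==> bounded_bilinear (B c)"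
  and half: "!!x h. x : P ==> norm (\<Sum>c\<in>I. B c h (a c x)) <= norm h / 2"
  and w: "!!x. x : P ==> w x = b x + (\<Sum>c\<in>I. B c (w x) (a c x))"
  and a: "!!c. c : I ==> Ck_on k P (a c)" and b: "Ck_on k P b"
 shows "Ck_on k P w" using w a b
proof (induction k arbitrary: b w)
 case (0 b w)
 have "isCont w x" if x: "x : P" for x
 proof -
  have c: "isCont (a c) x" if "c : I" for c using 0(2)[OF that] x P by (simp add: continuous_on_eq_continuous_at)
  have cb: "isCont b x" using 0(3) x P by (simp add: continuous_on_eq_continuous_at)
  define R where "R y = b y - b x + (\<Sum>c\<in>I. B c (w x) (a c y - a c x))" for y
  have "(R ---> b x - b x + (\<Sum>c\<in>I. B c (w x) (a c x - a c x))) (at x)" unfolding R_def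
   by (intro tendsto_intros bounded_bilinear.tendsto[OF B] cb[unfolded isCont_def] c[unfolded isCont_def])
  then have R: "((%y. 2 * norm (R y)) ---> 0) (at x)" using B by (simp add: bounded_bilinear.zero_right tendsto_norm_zero_iff tendsto_mult_right_zero)
  have "\<forall>\<^sub>F y in at x. y : P" using P x by (simp add: eventually_at_in_open')
  then have "\<forall>\<^sub>F y in at x. norm (w y - w x) <= 2 * norm (R y)"
  proof eventually_elim
   case (elim y)
   have "w y - w x = R y + (\<Sum>c\<in>I. B c (w y - w x) (a c y))"
   proof -
    have 1: "(\<Sum>c\<in>I. B c (w y - w x) (a c y)) = (\<Sum>c\<in>I. B c (w y) (a c y)) - (\<Sum>c\<in>I. B c (w x) (a c y))"
     "(\<Sum>c\<in>I. B c (w x) (a c y - a c x)) = (\<Sum>c\<in>I. B c (w x) (a c y)) - (\<Sum>c\<in>I. B c (w x) (a c x))"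
     using B by (simp_all add: bounded_bilinear.diff_left bounded_bilinear.diff_right sum_subtractf)
    have 2: "w y - w x = (b y + (\<Sum>c\<in>I. B c (w y) (a c y))) - (b x + (\<Sum>c\<in>I. B c (w x) (a c x)))"
     by (rule arg_cong2[where f="(-)", OF 0(1)[OF elim] 0(1)[OF x]])
    show ?thesis unfolding R_def 1 by (subst 2) (simp add: algebra_simps)
   qed
   then have "norm (w y - w x) <= norm (R y) + norm (\<Sum>c\<in>I. B c (w y - w x) (a c y))" using norm_triangle_ineq by metis
   then show ?case using half[OF elim, of "w y - w x"] by simp
  qed
  then have "((%y. w y - w x) ---> 0) (at x)" using R by (rule Lim_null_comparison)
  then show "isCont w x" unfolding isCont_def by (simp add: LIM_zero_cancel)
 qed
 then show ?case by (simp add: continuous_at_imp_continuous_on)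
next
 case (Suc k)
 have ak: "Ck_on k P (a c)" if "c : I" for c by (rule Ck_on_Suc_imp[OF Suc.prems(2)[OF that]])
 have bk: "Ck_on k P b" by (rule Ck_on_Suc_imp[OF Suc.prems(3)])
 have wk: "Ck_on k P w" by (rule Suc.IH[OF Suc.prems(1) ak bk])
 define d where "d v x = fd b x v +
  (\<Sum>c\<in>I. B c (w x) (fd (a c) x v))" for v x
 have Db: "Ck_on k P (%x. fd b x v)" for v using Suc.prems(3) by simp
 have Da: "Ck_on k P (%x. fd (a c) x v)" if "c : I" for c v using Suc.prems(2)[OF that] by simp
 have dk: "Ck_on k P (d v)" for v unfolding d_def
 proof (rule Ck_on_add[OF P Db], rule Ck_on_sum[OF P])
  fix c assume c: "c : I"
  show "Ck_on k P (%x. B c (w x) (fd (a c) x v))" by (rule Ck_on_bilinear[OF P B[OF c] wk Da[OF c]])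
 qed
 have ex: "EX w'. (w has_derivative w') (at x) & (ALL v. w' v = d v x + (\<Sum>c\<in>I. B c (w' v) (a c x)))"
  if x: "x : P" for x
 proof -
  \<comment> \<open>The coefficients are frozen at \<open>x\<close>: w - T w equals b plus terms
    bilinear in \<open>w\<close> and a c y - a c x. The latter vanish at \<open>x\<close>, so the
    derivative of w - T w exists although that of \<open>w\<close> is still unknown, and
    \<open>J\<close> recovers \<open>w\<close> from it.\<close>
  define T where "T h = (\<Sum>c\<in>I. B c h (a c x))" for h
  have T: "bounded_linear T" unfolding T_def by (intro bounded_linear_sum bounded_bilinear.bounded_linear_left B)
  obtain J where J: "bounded_linear J" "!!h. J h - T (J h) = h" "!!h. J (h - T h) = h"
   using contraction_resolvent[OF T] half[OF x] unfolding T_def by blast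
  have cont: "isCont w x" using Ck_on_continuous[OF wk] P x by (simp add: continuous_on_eq_continuous_at)
  have "((%y. b y + (\<Sum>c\<in>I. B c (w y) (a c y - a c x))) has_derivative (%v. d v x)) (at x)" unfolding d_def
  proof (rule has_derivative_add[OF Ck_on_SucD[OF Suc.prems(3) x]], rule has_derivative_sum)
   fix c assume c: "c : I"
   have "((%y. a c y - a c x) has_derivative fd (a c) x) (at x)"
    using has_derivative_diff[OF Ck_on_SucD[OF Suc.prems(2)[OF c] x] has_derivative_const[of "a c x"]] by simp
   from has_derivative_bilinear_vanishing[OF B[OF c] cont this]
   show "((%y. B c (w y) (a c y - a c x)) has_derivative
     (%v. B c (w x) (fd (a c) x v))) (at x)" by simp
  qed
  then have "((%y. w y - T (w y)) has_derivative (%v. d v x)) (at x)"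
  proof (rule has_derivative_transform_within_open[OF _ P x])
   fix y assume "y : P"
   show "b y + (\<Sum>c\<in>I. B c (w y) (a c y - a c x)) = w y - T (w y)"
   proof -
    have "(\<Sum>c\<in>I. B c (w y) (a c y - a c x)) = (\<Sum>c\<in>I. B c (w y) (a c y)) - (\<Sum>c\<in>I. B c (w y) (a c x))"
     using B by (simp add: bounded_bilinear.diff_right sum_subtractf)
    then show ?thesis unfolding T_def by (simp only: add_diff_eq Suc.prems(1)[OF \<open>y : P\<close>, symmetric])
   qed
  qed
  then have "((%y. J (w y - T (w y))) has_derivative (%v. J (d v x))) (at x)" by (rule bounded_linear.has_derivative[OF J(1)])
  then have "(w has_derivative (%v. J (d v x))) (at x)" by (simp add: J(3))
  moreover have "J (d v x) = d v x + (\<Sum>c\<in>I. B c (J (d v x)) (a c x))" for v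
   using J(2)[of "d v x"] unfolding T_def by (simp add: algebra_simps)
  ultimately show ?thesis by blast
 qed
 have fd: "(w has_derivative fd w x) (at x)"
  "fd w x v = d v x + (\<Sum>c\<in>I. B c (fd w x v) (a c x))"
  if "x : P" for x v
 proof -
  obtain w' where w': "(w has_derivative w') (at x)" "ALL v. w' v = d v x + (\<Sum>c\<in>I. B c (w' v) (a c x))"
   using ex[OF \<open>x : P\<close>] by blast
  have "fd w x = w'" using frechet_derivative_at[OF w'(1)] by simp
  then show "(w has_derivative fd w x) (at x)"
   "fd w x v = d v x + (\<Sum>c\<in>I. B c (fd w x v) (a c x))"
   using w'(1) by simp (simp only: w'(2)[rule_format, symmetric] \<open>fd w x = w'\<close>)
 qed
 have "Ck_on k P (%x. fd w x v)" for v by (rule Suc.IH[of _ "d v", OF fd(2) ak dk])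
 moreover have "w differentiable (at x)" if "x : P" for x unfolding differentiable_def using fd(1)[OF that] by blast
 ultimately show ?case by simp
qed

text \<open>The point is the regularity of the inverse. Its derivative satisfies g'(y) v = g'(y0) v
  + (id - g'(y0) Df(g y)) g'(y) v, which near \<open>y0\<close> is a contracting linear equation
  with coefficients as regular as \<open>g\<close>; so each order of differentiability of
  \<open>g\<close> yields the next.\<close>

theorem smooth_inverse_function:
 fixes f :: "'a::euclidean_space => 'a"
 assumes U: "open U" and f: "Cinf_on U f" and x0: "x0 : U" and inj: "inj (fd f x0)"
 obtains U' V g where "open U'" "U' \<subseteq> U" "x0 : U'" "open V" "f x0 : V" "homeomorphism U' V f g"
  "Cinf_on V g"
proof -
 define f' where "f' x = Blinfun (fd f x)" for x
 have bl: "bounded_linear (fd f x)" if "x : U" for x using Cinf_deriv[OF f that] by blast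
 have f': "blinfun_apply (f' x) = fd f x" if "x : U" for x unfolding f'_def using bl[OF that] by (rule bounded_linear_Blinfun_apply)
 have der: "(f has_derivative blinfun_apply (f' x)) (at x)" if "x : U" for x using Cinf_deriv[OF f that] f'[OF that] by simp
 have cont: "continuous_on U f'"
 proof (rule continuous_on_blinfun_componentwise)
  fix i :: 'a
  show "continuous_on U (%x. blinfun_apply (f' x) i)" using f' Cinf_on_continuous[OF Cinf_on_deriv[OF f]] by simp
 qed
 obtain h where h: "linear h" "h o fd f x0 = id" using linear_injective_left_inverse[OF bounded_linear.linear[OF bl[OF x0]] inj] by blast
 have "blinfun_apply (Blinfun h) = h" using h(1) by (intro bounded_linear_Blinfun_apply) (simp add: linear_conv_bounded_linear)
 then have "Blinfun h o\<^sub>L f' x0 = id_blinfun" using h(2) f'[OF x0] by (intro blinfun_eqI) (simp add: fun_eq_iff)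
 from inverse_function_theorem[OF U der cont x0 this]
 obtain U' V g g' where *: "open U'" "U' \<subseteq> U" "x0 : U'" "open V" "f x0 : V" "homeomorphism U' V f g"
  "!!y. y : V ==> (g has_derivative (g' y)) (at y)"
  "!!y. y : V ==> g' y = inv_into UNIV (blinfun_apply (f' (g y)))"
  "!!y. y : V ==> bij (blinfun_apply (f' (g y)))" by metis
 have gU: "g y : U" if "y : V" for y using *(2,6) that unfolding homeomorphism_def by blast
 have fg': "fd f (g y) (g' y v) = v" "g' y (fd f (g y) v) = v"
  if "y : V" for y v using *(8,9)[OF that] f'[OF gU[OF that]] by (simp_all add: bij_is_surj surj_f_inv_f bij_is_inj)
 have "Ck_on k V g" for k
 proof (induction k)
  case 0
  show ?case using *(6) by (simp add: homeomorphism_def)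
 next
  case (Suc k)
  have Df: "Ck_on k V (%y. fd f (g y) c)" for c
  proof (rule Ck_on_compose[OF *(4) _ Suc])
   show "g ` V \<subseteq> U" using gU by blast
   show "Ck_on k U (%x. fd f x c)" using Cinf_on_deriv[OF f] unfolding Cinf_on_def by blast
  qed
  show ?case
  proof (rule Ck_on_SucI[OF *(4,7)])
   fix v
   show "Ck_on k V (%y. g' y v)"
   proof (rule Ck_on_local)
    fix y0 assume y0: "y0 : V"
    have L0: "bounded_linear (g' y0)" using *(7)[OF y0] by auto
    then interpret L0: bounded_linear "g' y0" .
    define a where "a c y = c - g' y0 (fd f (g y) c)" for c y
    have a: "Ck_on k V (a c)" for c
    proof -
     have "Ck_on k V (%y. c + (%h. - g' y0 h) (fd f (g y) c))" by (intro Ck_on_add[OF *(4) Ck_on_const[OF *(4)] Ck_on_bounded_linear[OF *(4) _ Df]]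
        bounded_linear_minus L0)
     then show ?thesis unfolding a_def by simp
    qed
    define P where "P = V \<inter> (%y. \<Sum>c\<in>Basis. norm (a c y)) -` {..<1/2}"
    have "continuous_on V (%y. \<Sum>c\<in>Basis. norm (a c y))" by (intro continuous_on_sum continuous_on_norm Ck_on_continuous[OF a])
    then have "open P" unfolding P_def using *(4) by (intro continuous_open_preimage) auto
    moreover have "a c y0 = 0" for c unfolding a_def using fg'[OF y0] by simp
    then have "y0 : P" unfolding P_def using y0 by simp
    moreover have "Ck_on k P (%y. g' y v)"
    proof (rule Ck_on_linear_fixpoint[where I=Basis and B="%c h y. inner h c *\<^sub>R y" and a=a
       and b="%y. g' y0 v"])
     show "bounded_bilinear (%h y. inner h c *\<^sub>R (y::'a))" for c :: 'a
      by (rule bounded_bilinear.comp1[OF bounded_bilinear_scaleR bounded_linear_inner_left])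
     show "norm (\<Sum>c\<in>Basis. inner h c *\<^sub>R a c y) <= norm h / 2" if "y : P" for y h
     proof -
      have "norm (\<Sum>c\<in>Basis. inner h c *\<^sub>R a c y) <= (\<Sum>c\<in>Basis. norm h * norm (a c y))"
       by (intro sum_norm_le) (simp add: Basis_le_norm mult_right_mono)
      also have "\<dots> <= norm h * (1/2)" using that unfolding P_def by (subst sum_distrib_left[symmetric]) (intro mult_left_mono, auto)
      finally show ?thesis by simp
     qed
     show "g' y v = g' y0 v + (\<Sum>c\<in>Basis. inner (g' y v) c *\<^sub>R a c y)" if "y : P" for y
     proof -
      have y: "y : V" using that unfolding P_def by simp
      have "linear (%c. a c y)" using bl[OF gU[OF y]] bounded_linear.linear unfolding a_def by (intro linear_compose_sub linear_compose[OF _ L0.linear, unfolded o_def] linear_ident)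
      then have "(\<Sum>c\<in>Basis. inner (g' y v) c *\<^sub>R a c y) = a (g' y v) y" by (rule linear_euclidean_expand[symmetric])
      then show ?thesis by (simp add: a_def fg'[OF y])
     qed
     show "Ck_on k P (a c)" for c using a Ck_on_subset unfolding P_def by blast
     show "Ck_on k P (%y. g' y0 v)" by (rule Ck_on_const[OF \<open>open P\<close>])
    qed (rule \<open>open P\<close>)
    ultimately show "EX W. open W & y0 : W & Ck_on k W (%y. g' y v)" by blast
   qed
  qed
 qed
 then show ?thesis using that[OF *(1-6)] by (simp add: Cinf_on_def)
qed

section \<open>Smooth local flows\<close>

text \<open>Integral curves with initial value \<open>x\<close> and time scale \<open>\<lambda>\<close> are the solutions \<open>z\<close> of
 \<open>z = x + \<lambda> \<cdot> I (g \<circ> z)\<close> in the Banach space of bounded continuous functions, where \<open>I\<close> is integration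
 from \<open>0\<close>.\<close>

definition clamp01 :: "real => real" where
 "clamp01 t = max 0 (min 1 t)"

definition int_op :: "(real \<Rightarrow>\<^sub>C 'e::euclidean_space) => real \<Rightarrow>\<^sub>C 'e" where
 "int_op y = Bcontfun (%t. integral {0..clamp01 t} (apply_bcontfun y))"

text \<open>One coordinate of \<open>h\<close> times \<open>y\<close>: the derivative of a
  superposition operator in direction \<open>h\<close> is a sum of such products over the
  basis.\<close>

definition comp_op :: "'e => (real \<Rightarrow>\<^sub>C 'e::euclidean_space) => (real \<Rightarrow>\<^sub>C 'e) => real \<Rightarrow>\<^sub>C 'e" where
 "comp_op b h y = Bcontfun (%t. inner (apply_bcontfun h t) b *\<^sub>R apply_bcontfun y t)"

lemma clamp01: "0 <= clamp01 t" "clamp01 t <= 1" "t : {0..1} ==> clamp01 t = t" by (auto simp: clamp01_def)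

lemma int_op_bound:
 fixes y :: "real \<Rightarrow>\<^sub>C 'e::euclidean_space"
 shows "norm (integral {0..clamp01 t} (apply_bcontfun y)) <= norm y"
proof -
 have "norm (integral {0..clamp01 t} (apply_bcontfun y)) <= norm y * (clamp01 t - 0)" by (rule integral_bound) (auto simp: clamp01 norm_bounded)
 also have "\<dots> <= norm y * 1" by (intro mult_left_mono) (auto simp: clamp01)
 finally show ?thesis by simp
qed

lemma int_op_apply:
 fixes y :: "real \<Rightarrow>\<^sub>C 'e::euclidean_space"
 shows "apply_bcontfun (int_op y) t = integral {0..clamp01 t} (apply_bcontfun y)"
proof -
 have "continuous_on {0..1} (%x. integral {0..x} (apply_bcontfun y))" by (intro indefinite_integral_continuous_1 integrable_continuous_interval) simp
 then have "continuous_on UNIV (%t. integral {0..clamp01 t} (apply_bcontfun y))"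
  by (rule continuous_on_compose2[where g="%x. integral {0..x} (apply_bcontfun y)"])
   (auto simp: clamp01_def intro!: continuous_intros)
 then have "(%t. integral {0..clamp01 t} (apply_bcontfun y)) : bcontfun" using int_op_bound by (intro bcontfun_normI) auto
 then show ?thesis unfolding int_op_def by (simp add: Bcontfun_inverse)
qed

lemma norm_int_op: "norm (int_op y) <= norm y" by (rule norm_bound) (simp add: int_op_apply int_op_bound)

lemma bounded_linear_int_op: "bounded_linear int_op"
proof (rule bounded_linear_intro[where K=1])
 have i: "apply_bcontfun y integrable_on {0..clamp01 t}" for y :: "real \<Rightarrow>\<^sub>C 'e::euclidean_space" and t
  by (intro integrable_continuous_interval) simp
 show "int_op (x + y) = int_op x + int_op y" for x y :: "real \<Rightarrow>\<^sub>C 'e::euclidean_space"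
  by (rule bcontfun_eqI) (simp add: int_op_apply integral_add[OF i i])
 show "int_op (r *\<^sub>R x) = r *\<^sub>R int_op x" for r and x :: "real \<Rightarrow>\<^sub>C 'e::euclidean_space"
  by (rule bcontfun_eqI) (simp add: int_op_apply)
 show "norm (int_op x) <= norm x * 1" for x :: "real \<Rightarrow>\<^sub>C 'e::euclidean_space" using norm_int_op by simp
qed

lemma comp_op_apply: "apply_bcontfun (comp_op b h y) t = inner (apply_bcontfun h t) b *\<^sub>R apply_bcontfun y t"
proof -
 have "(%t. inner (apply_bcontfun h t) b *\<^sub>R apply_bcontfun y t) : bcontfun"
 proof (rule bcontfun_normI)
  show "norm (inner (apply_bcontfun h t) b *\<^sub>R apply_bcontfun y t) <= norm h * norm b * norm y" for t
   using order_trans[OF Cauchy_Schwarz_ineq2 mult_right_mono[OF norm_bounded norm_ge_zero]] by (auto intro!: mult_mono norm_bounded)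
 qed (intro continuous_intros; simp)
 then show ?thesis unfolding comp_op_def by (simp add: Bcontfun_inverse)
qed

lemma norm_comp_op: "b : Basis ==> norm (comp_op b h y) <= norm h * norm y" by (rule norm_bound)
  (auto simp: comp_op_apply intro!: mult_mono norm_bounded order_trans[OF Basis_le_norm norm_bounded])

lemma bounded_bilinear_comp_op: "b : Basis ==> bounded_bilinear (comp_op b)"
proof
 assume b: "b : (Basis :: 'a set)"
 show "EX K. ALL h y. norm (comp_op b h y) <= norm h * norm y * K" using norm_comp_op[OF b] by (intro exI[of _ 1]) simp
qed (auto intro!: bcontfun_eqI simp: comp_op_apply inner_add_left scaleR_add_left scaleR_add_right)

locale field_on_ball =
 fixes g :: "'e::euclidean_space => 'e" and V :: "'e set" and x0 :: 'e and r :: real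
 assumes V: "open V" and r: "r > 0" and K: "cball x0 r \<subseteq> V" and g: "Cinf_on V g"
begin

text \<open>The nearest-point retraction does not increase distances, so a field composed with it is
  defined on all curves, bounded, and keeps the Lipschitz constant that it has on the ball.\<close>

definition clip :: "'e => 'e" where
 "clip = closest_point (cball x0 r)"

text \<open>The superposition (Nemytskii) operator of \<open>a\<close>, cut off by
  \<open>clip\<close>.\<close>

definition Nem :: "('e => 'e) => (real \<Rightarrow>\<^sub>C 'e) => real \<Rightarrow>\<^sub>C 'e" where
 "Nem a z = Bcontfun (%t. a (clip (apply_bcontfun z t)))"

definition ball_curves :: "(real \<Rightarrow>\<^sub>C 'e) set" where
 "ball_curves = {z. ALL t. apply_bcontfun z t : cball x0 r}"

lemma clip_in: "clip y : cball x0 r" unfolding clip_def using r by (intro closest_point_in_set) auto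

lemma clip_id: "y : cball x0 r ==> clip y = y" unfolding clip_def by (rule closest_point_self)

lemma clip_lipschitz: "norm (clip x - clip y) <= norm (x - y)"
 using closest_point_lipschitz[of "cball x0 r" x y] r unfolding clip_def dist_norm by auto

lemma continuous_clip: "continuous_on UNIV clip" unfolding clip_def using r by (intro continuous_on_closest_point) auto

lemma Nem_apply:
 assumes "continuous_on (cball x0 r) a"
 shows "apply_bcontfun (Nem a z) t = a (clip (apply_bcontfun z t))"
proof -
 have "bounded (a ` cball x0 r)" using assms by (intro compact_imp_bounded compact_continuous_image) auto
 then obtain B where B: "!!x. x : cball x0 r ==> norm (a x) <= B" unfolding bounded_iff by blast
 have "continuous_on UNIV (%t. clip (apply_bcontfun z t))" by (rule continuous_on_compose2[OF continuous_clip]) auto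
 then have "continuous_on UNIV (%t. a (clip (apply_bcontfun z t)))" by (rule continuous_on_compose2[OF assms]) (use clip_in in auto)
 then have "(%t. a (clip (apply_bcontfun z t))) : bcontfun" using B clip_in by (intro bcontfun_normI) auto
 then show ?thesis unfolding Nem_def by (simp add: Bcontfun_inverse)
qed

lemma Cinf_continuous_cball: "Cinf_on V a ==> continuous_on (cball x0 r) a" using Cinf_on_continuous continuous_on_subset K by blast

text \<open>The partial derivatives are uniformly continuous on the compact ball. The uniformity is
  what differentiability in the supremum norm requires.\<close>

lemma uniform_linearization:
 fixes a :: "'e => 'e"
 assumes a: "Cinf_on V a" and e: "e > 0"
 obtains d where "d > 0" "!!x y. x : cball x0 r ==> y : cball x0 r ==> norm (y - x) < d ==>
  norm (a y - a x - (\<Sum>b\<in>Basis. inner (y - x) b *\<^sub>R fd a x b)) <= e * norm (y - x)"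
proof -
 define n where "n = real DIM('e)"
 have n: "n > 0" unfolding n_def by simp
 have "EX d>0. ALL x:cball x0 r. ALL y:cball x0 r. dist y x < d -->
   dist (fd a y b) (fd a x b) < e / n" for b
 proof -
  have "uniformly_continuous_on (cball x0 r) (%x. fd a x b)" by (intro compact_uniformly_continuous Cinf_continuous_cball Cinf_on_deriv a) auto
  moreover have "e / n > 0" using e n by simp
  ultimately show ?thesis unfolding uniformly_continuous_on_def by blast
 qed
 then obtain de where de: "!!b. de b > 0" "!!b x y. x : cball x0 r ==> y : cball x0 r ==> dist y x < de b ==>
   dist (fd a y b) (fd a x b) < e / n" by metis
 define d where "d = Min (de ` Basis)"
 have d: "d > 0" "!!b. b : Basis ==> d <= de b" unfolding d_def using de(1) by auto
 show ?thesis
 proof (rule that[OF d(1)])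
  fix x y assume xy: "x : cball x0 r" "y : cball x0 r" "norm (y - x) < d"
  have der: "(a has_derivative fd a z) (at z within S)" if "z : cball x0 r" for z S using Cinf_deriv[OF a] that K has_derivative_at_withinI by blast
  have lin: "linear (fd a z)" if "z : cball x0 r" for z using der[OF that] has_derivative_linear by blast
  have "norm (a y - a x - fd a x (y - x)) <= norm (y - x) * e"
  proof (rule differentiable_bound_linearization[where S="cball x0 r \<inter> ball x d"
     and f'="%z. fd a z" and ?x0.0=x])
   show "x : cball x0 r \<inter> ball x d" using xy d by simp
   have cv: "convex (cball x0 r \<inter> ball x d)" by (intro convex_Int) auto
   show "x + t *\<^sub>R (y - x) : cball x0 r \<inter> ball x d" if "t : {0..1}" for t
    using convexD_alt[OF cv, of x y t] xy d that by (simp add: dist_norm norm_minus_commute algebra_simps)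
   fix z assume z: "z : cball x0 r \<inter> ball x d"
   show "(a has_derivative fd a z) (at z within cball x0 r \<inter> ball x d)" using z der by blast
   have b: "norm (fd a z b - fd a x b) <= e / n" if "b : Basis" for b
    using de(2)[of x z b] z xy d(2)[OF that] by (simp add: dist_norm norm_minus_commute)
   have "linear (%h. fd a z h - fd a x h)" using z xy by (intro linear_compose_sub lin) auto
   from linear_norm_le_Basis[OF this b]
   have "norm (fd a z h - fd a x h) <= e * norm h" for h by (simp add: n_def)
   then show "onorm (fd a z - fd a x) <= e" by (intro onorm_le) (simp add: fun_diff_def)
  qed
  moreover have "fd a x (y - x)
    = (\<Sum>b\<in>Basis. inner (y - x) b *\<^sub>R fd a x b)" by (rule linear_euclidean_expand[OF lin[OF xy(1)]])
  ultimately show "norm (a y - a x - (\<Sum>b\<in>Basis. inner (y - x) b *\<^sub>R fd a x b))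
   <= e * norm (y - x)" by (simp add: mult.commute)
 qed
qed

lemma bcontfun_sum_apply: "apply_bcontfun (\<Sum>b\<in>I. F b) t = (\<Sum>b\<in>I. apply_bcontfun (F b) t)"
 by (induction I rule: infinite_finite_induct) auto

definition dNem :: "('e => 'e) => (real \<Rightarrow>\<^sub>C 'e) => (real \<Rightarrow>\<^sub>C 'e) => real \<Rightarrow>\<^sub>C 'e" where
 "dNem a z h = (\<Sum>b\<in>Basis. comp_op b h (Nem (%x. fd a x b) z))"

lemma bounded_linear_dNem: "bounded_linear (dNem a z)" unfolding dNem_def
 by (intro bounded_linear_sum bounded_bilinear.bounded_linear_left bounded_bilinear_comp_op)

text \<open>In the supremum norm a pointwise expansion has to be uniform, which
  \<open>uniform_linearization\<close> supplies. The derivative is taken within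
  \<open>ball_curves\<close>, where \<open>clip\<close> is the identity; the retraction is not
  smooth at the boundary of the ball.\<close>

lemma Nem_has_derivative:
 assumes a: "Cinf_on V a" and z: "z : ball_curves"
 shows "(Nem a has_derivative dNem a z) (at z within ball_curves)" unfolding has_derivative_within_alt
proof (intro conjI allI impI bounded_linear_dNem)
 fix e :: real assume "e > 0"
 then obtain d where d: "d > 0" "!!x y. x : cball x0 r ==> y : cball x0 r ==> norm (y - x) < d ==>
  norm (a y - a x - (\<Sum>b\<in>Basis. inner (y - x) b *\<^sub>R fd a x b)) <= e * norm (y - x)" by (rule uniform_linearization[OF a]) blast
 note Na = Nem_apply[OF Cinf_continuous_cball[OF a]] Nem_apply[OF Cinf_continuous_cball[OF Cinf_on_deriv[OF a]]]
 have "norm (Nem a y - Nem a z - dNem a z (y - z)) <= e * norm (y - z)"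
  if y: "y : ball_curves" "norm (y - z) < d" for y
 proof (rule norm_bound)
  fix t
  have yz: "y t : cball x0 r" "z t : cball x0 r" using y z by (auto simp: ball_curves_def)
  have n: "norm (apply_bcontfun y t - apply_bcontfun z t) <= norm (y - z)" using norm_bounded[of "y - z" t] by simp
  have "(Nem a y - Nem a z - dNem a z (y - z)) t =
   a (apply_bcontfun y t) - a (apply_bcontfun z t) - (\<Sum>b\<in>Basis.
    inner (apply_bcontfun y t - apply_bcontfun z t) b *\<^sub>R fd a (apply_bcontfun z t) b)"
   unfolding dNem_def by (simp add: Na clip_id[OF yz(1)] clip_id[OF yz(2)] bcontfun_sum_apply comp_op_apply)
  also have "norm \<dots> <= e * norm (apply_bcontfun y t - apply_bcontfun z t)" using d(2)[OF yz(2,1)] n y(2) by simp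
  also have "\<dots> <= e * norm (y - z)" using n \<open>e > 0\<close> by simp
  finally show "norm (apply_bcontfun (Nem a y - Nem a z - dNem a z (y - z)) t) <= e * norm (y - z)" .
 qed
 then show "EX d>0. ALL y:ball_curves. norm (y - z) < d -->
   norm (Nem a y - Nem a z - dNem a z (y - z)) <= e * norm (y - z)" using d(1) by blast
qed

lemma Nem_Ck:
 assumes P: "open P" and z: "!!p. p : P ==> z p : ball_curves" and zk: "Ck_on k P z" and a: "Cinf_on V a"
 shows "Ck_on k P (%p. Nem a (z p))" using zk a
proof (induction k arbitrary: a)
 case (0 a)
 have "continuous_on ball_curves (Nem a)" using Nem_has_derivative[OF 0(2)] has_derivative_continuous continuous_on_eq_continuous_within by blast
 then have "continuous_on P (%p. Nem a (z p))" by (rule continuous_on_compose2) (use 0 z in auto)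
 then show ?case by simp
next
 case (Suc k)
 show ?case
 proof (rule Ck_on_SucI[OF P])
  fix p assume p: "p : P"
  have zd: "(z has_derivative fd z p) (at p within P)" using Ck_on_SucD[OF Suc.prems(1) p] by (rule has_derivative_at_withinI)
  have "(Nem a has_derivative dNem a (z p)) (at (z p) within z ` P)"
   by (rule has_derivative_subset[OF Nem_has_derivative[OF Suc.prems(2) z[OF p]]]) (use z in auto)
  from has_derivative_in_compose[OF zd this]
  show "((%p. Nem a (z p)) has_derivative (%p v. dNem a (z p) (fd z p v)) p) (at p)" using at_within_open[OF p P] by simp
 next
  fix v
  have zk: "Ck_on k P z" by (rule Ck_on_Suc_imp[OF Suc.prems(1)])
  have Dz: "Ck_on k P (%p. fd z p v)" using Suc.prems(1) by simp
  show "Ck_on k P (%p. dNem a (z p) (fd z p v))" unfolding dNem_def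
  proof (rule Ck_on_sum[OF P])
   fix b :: 'e assume b: "b : Basis"
   show "Ck_on k P (%p. comp_op b (fd z p v) (Nem (%x. fd a x b) (z p)))"
    by (rule Ck_on_bilinear[OF P bounded_bilinear_comp_op[OF b] Dz Suc.IH[OF zk Cinf_on_deriv[OF Suc.prems(2)]]])
  qed
 qed
qed

end

text \<open>A remainder with vanishing derivative stays o(|y - x|) after composition with a map that
  is merely Lipschitz at \<open>x\<close>. It is applied to the nonlinear part of the fixed point
  equation.\<close>

lemma has_derivative_zero_compose_lipschitz:
 assumes R: "(R has_derivative (%_. 0)) (at (z x) within D)"
  and D: "\<forall>\<^sub>F y in at x. z y : D" and L: "\<forall>\<^sub>F y in at x. norm (z y - z x) <= C * norm (y - x)"
 shows "((%y. R (z y)) has_derivative (%_. 0)) (at x)" unfolding has_derivative_within_alt2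
proof (intro conjI allI impI bounded_linear_zero)
 fix e :: real assume e: "e > 0"
 define c where "c = e / (\<bar>C\<bar> + 1)"
 have c: "c > 0" using e by (simp add: c_def)
 then obtain d where d: "d > 0" "!!y. y : D ==> norm (y - z x) < d ==> norm (R y - R (z x) - 0) <= c * norm (y - z x)"
  using R unfolding has_derivative_within_alt by blast
 have "\<forall>\<^sub>F y in at x. dist y x < d / (\<bar>C\<bar> + 1)"
  using d(1) by (intro eventually_at_ball[THEN eventually_mono] ) (auto simp: dist_commute)
 with D L show "\<forall>\<^sub>F y in at x. norm (R (z y) - R (z x) - 0) <= e * norm (y - x)"
 proof eventually_elim
  case (elim y)
  have n: "norm (z y - z x) <= (\<bar>C\<bar> + 1) * norm (y - x)" by (rule order_trans[OF elim(2)], rule mult_right_mono) auto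
  also have "\<dots> < d" using elim(3) by (simp add: dist_norm field_simps)
  finally have "norm (R (z y) - R (z x) - 0) <= c * norm (z y - z x)" by (intro d(2) elim(1))
  also have "\<dots> <= c * ((\<bar>C\<bar> + 1) * norm (y - x))" using n c by simp
  also have "\<dots> = e * norm (y - x)" by (auto simp: c_def)
  finally show ?case .
 qed
qed

instance bcontfun :: (metric_space, banach) banach ..

lemma bounded_linear_const_bcontfun: "bounded_linear (const_bcontfun :: 'e::real_normed_vector => real \<Rightarrow>\<^sub>C 'e)"
proof (rule bounded_linear_intro[where K=1])
 fix x y :: 'e and s :: real
 show "const_bcontfun (x + y) = (const_bcontfun x + const_bcontfun y :: real \<Rightarrow>\<^sub>C 'e)" by (rule bcontfun_eqI) simp
 show "const_bcontfun (s *\<^sub>R x) = (s *\<^sub>R const_bcontfun x :: real \<Rightarrow>\<^sub>C 'e)" by (rule bcontfun_eqI) simp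
 show "norm (const_bcontfun x :: real \<Rightarrow>\<^sub>C 'e) <= norm x * 1" by (rule norm_bound) simp
qed

lemma bounded_linear_apply_bcontfun:
 "bounded_linear (%z :: 'a::topological_space \<Rightarrow>\<^sub>C 'e::real_normed_vector. apply_bcontfun z t)"
 by (rule bounded_linear_intro[where K=1]) (auto simp: norm_bounded)

context field_on_ball
begin

theorem local_flow:
 obtains ep ro :: real and Ph :: "real \<times> 'e => 'e" where "ep > 0" "ro > 0" "Cinf_on ({-ep<..<ep} \<times> ball x0 ro) Ph"
  "!!x. x : ball x0 ro ==> Ph (0, x) = x"
  "!!p. p : {-ep<..<ep} \<times> ball x0 ro ==> Ph p : V"
  "!!t x. t : {-ep<..<ep} ==> x : ball x0 ro ==>
   fd Ph (t, x) (1, 0) = g (Ph (t, x))"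
proof -
 define n where "n = real DIM('e)"
 have n: "n > 0" unfolding n_def by simp
 note gc = Cinf_continuous_cball[OF g]
 note Dgc = Cinf_continuous_cball[OF Cinf_on_deriv[OF g]]
 note Ng = Nem_apply[OF gc]
 note NDg = Nem_apply[OF Dgc]
 interpret I: bounded_linear "int_op :: (real \<Rightarrow>\<^sub>C 'e) => real \<Rightarrow>\<^sub>C 'e" by (rule bounded_linear_int_op)
 have "EX M. ALL x:cball x0 r. norm (fd g x b) <= M" for b
 proof -
  have "bounded ((%x. fd g x b) ` cball x0 r)" by (intro compact_imp_bounded compact_continuous_image Dgc) auto
  then show ?thesis unfolding bounded_iff by blast
 qed
 then obtain Mb where Mb: "!!b x. x : cball x0 r ==> norm (fd g x b) <= Mb b" by metis
 define M where "M = Max (Mb ` Basis)"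
 have M: "norm (fd g x b) <= M" if "x : cball x0 r" "b : Basis" for x b
  using Mb[OF that(1), of b] that(2) unfolding M_def by (meson Max_ge finite_imageI finite_Basis imageI order_trans)
 have M0: "M >= 0" by (rule order_trans[OF norm_ge_zero M[of x0, OF _ SOME_Basis]]) (use r in simp)
 have "bounded (g ` cball x0 r)" by (intro compact_imp_bounded compact_continuous_image gc) auto
 then obtain G where G: "!!x. x : cball x0 r ==> norm (g x) <= G" unfolding bounded_iff by blast
 have G0: "G >= 0" by (rule order_trans[OF norm_ge_zero G[of x0]]) (use r in simp)
 have lip: "norm (g x - g y) <= n * M * norm (x - y)" if "x : cball x0 r" "y : cball x0 r" for x y
 proof (rule differentiable_bound[OF convex_cball _ _ that])
  fix z assume z: "z : cball x0 r"
  have d: "(g has_derivative fd g z) (at z)" using Cinf_deriv[OF g] K z by blast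
  then show "(g has_derivative (%z. fd g z) z) (at z within cball x0 r)" using has_derivative_at_withinI by blast
  show "onorm (fd g z) <= n * M" using linear_norm_le_Basis[OF has_derivative_linear[OF d] M[OF z]] by (intro onorm_le) (simp add: n_def)
 qed
 have Nlip: "norm (Nem g y - Nem g z) <= n * M * norm (y - z)" for y z
 proof (rule norm_bound)
  fix t
  have "norm (apply_bcontfun (Nem g y - Nem g z) t) <= n * M * norm (clip (apply_bcontfun y t) - clip (apply_bcontfun z t))"
   using lip[OF clip_in clip_in] by (simp add: Ng)
  also have "\<dots> <= n * M * norm (y - z)" using clip_lipschitz norm_bounded[of "y - z" t] n M0 by (intro mult_left_mono) (auto intro: order_trans)
  finally show "norm (apply_bcontfun (Nem g y - Nem g z) t) <= n * M * norm (y - z)" .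
 qed
 have NG: "norm (Nem g y) <= G" for y by (rule norm_bound) (simp add: Ng G[OF clip_in])
 \<comment> \<open>The first bound makes the fixed point map contract by 1/2; the second keeps
   curves that start in the ball of radius r/2 inside the ball of radius r. The added 1 avoids
   division by 0 when \<open>M\<close> or \<open>G\<close> vanishes.\<close>
 define ep where "ep = min (1 / (2 * n * M + 1)) (r / (2 * G + 1))"
 have eps: "ep > 0" "ep <= 1 / (2 * n * M + 1)" "ep <= r / (2 * G + 1)"
  unfolding ep_def using r G0 n M0 by (auto intro!: add_nonneg_pos divide_pos_pos)
 have small: "\<bar>l\<bar> * (n * M) <= 1/2" "\<bar>l\<bar> * G <= r/2" if "\<bar>l\<bar> < ep" for l
 proof -
  have "2 * n * M + 1 > 0" "2 * G + 1 > 0" using n M0 G0 by (auto intro!: add_nonneg_pos mult_nonneg_nonneg)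
  moreover from this have "ep * (2 * n * M + 1) <= 1" "ep * (2 * G + 1) <= r" using eps(2,3) by (simp_all only: pos_le_divide_eq)
  ultimately have "\<bar>l\<bar> * (2 * n * M + 1) <= 1" "\<bar>l\<bar> * (2 * G + 1) <= r"
   using that by (meson less_imp_le mult_right_mono order_trans)+
  then show "\<bar>l\<bar> * (n * M) <= 1/2" "\<bar>l\<bar> * G <= r/2" by (simp_all add: algebra_simps)
 qed
 define P where "P = {-ep<..<ep} \<times> ball x0 (r/2)"
 have P: "open P" unfolding P_def by (intro open_Times) auto
 have fstP: "\<bar>fst p\<bar> < ep" if "p : P" for p using that unfolding P_def by auto
 have ex: "EX! z. const_bcontfun x + l *\<^sub>R int_op (Nem g z) = z" if "\<bar>l\<bar> < ep" for l x
 proof (rule banach_fix_type[of "1/2"])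
  show "ALL y z. dist (const_bcontfun x + l *\<^sub>R int_op (Nem g y)) (const_bcontfun x + l *\<^sub>R int_op (Nem g z)) <= 1/2 * dist y z"
  proof (intro allI)
   fix y z
   have "dist (const_bcontfun x + l *\<^sub>R int_op (Nem g y)) (const_bcontfun x + l *\<^sub>R int_op (Nem g z))
    = \<bar>l\<bar> * norm (int_op (Nem g y - Nem g z))" by (simp add: dist_norm I.diff flip: scaleR_diff_right)
   also have "\<dots> <= \<bar>l\<bar> * (n * M * norm (y - z))" by (intro mult_left_mono order_trans[OF norm_int_op Nlip]) auto
   also have "\<dots> <= 1/2 * dist y z" using mult_right_mono[OF small(1)[OF that], of "norm (y - z)"] by (simp add: dist_norm mult.assoc)
   finally show "dist (const_bcontfun x + l *\<^sub>R int_op (Nem g y)) (const_bcontfun x + l *\<^sub>R int_op (Nem g z)) <= 1/2 * dist y z" .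
  qed
 qed auto
 define z where "z p = (THE z. const_bcontfun (snd p) + fst p *\<^sub>R int_op (Nem g z) = z)" for p :: "real \<times> 'e"
 have z: "z p = const_bcontfun (snd p) + fst p *\<^sub>R int_op (Nem g (z p))" if "p : P" for p
  using theI'[OF ex[OF fstP[OF that]]] unfolding z_def by metis
 have zD: "z p : ball_curves" if p: "p : P" for p unfolding ball_curves_def
 proof (intro CollectI allI)
  fix t
  have "(z p) t = snd p + fst p *\<^sub>R (int_op (Nem g (z p))) t" by (subst z[OF p]) simp
  then have "norm (apply_bcontfun (z p) t - x0) <= norm (snd p - x0) + \<bar>fst p\<bar> * norm (apply_bcontfun (int_op (Nem g (z p))) t)"
   using norm_triangle_ineq[of "snd p - x0" "fst p *\<^sub>R (int_op (Nem g (z p))) t"] by (simp add: algebra_simps)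
  also have "\<dots> <= r/2 + \<bar>fst p\<bar> * G"
   using p by (intro add_mono mult_left_mono order_trans[OF norm_bounded order_trans[OF norm_int_op NG]])
    (auto simp: P_def dist_norm norm_minus_commute)
  also have "\<dots> <= r" using small(2)[OF fstP[OF p]] by simp
  finally show "(z p) t : cball x0 r" by (simp add: dist_norm norm_minus_commute)
 qed
 \<comment> \<open>A Lipschitz bound in the parameters follows from the contraction before
   differentiability is known.\<close>
 have zlip: "norm (z q - z p) <= 2 * (1 + G) * norm (q - p)" if p: "p : P" and q: "q : P" for p q
 proof -
  have "z q - z p = const_bcontfun (snd q - snd p) + (fst q - fst p) *\<^sub>R int_op (Nem g (z q))
    + fst p *\<^sub>R int_op (Nem g (z q) - Nem g (z p))" by (subst z[OF p], subst z[OF q])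
    (simp add: I.diff algebra_simps linear_diff[OF bounded_linear.linear[OF bounded_linear_const_bcontfun]])
  also have "norm \<dots> <= norm (snd q - snd p) + \<bar>fst q - fst p\<bar> * G + \<bar>fst p\<bar> * (n * M * norm (z q - z p))"
  proof (intro norm_triangle_mono)
   show "norm (const_bcontfun (snd q - snd p) :: real \<Rightarrow>\<^sub>C 'e) <= norm (snd q - snd p)" by (rule norm_bound) simp
   show "norm ((fst q - fst p) *\<^sub>R int_op (Nem g (z q))) <= \<bar>fst q - fst p\<bar> * G"
    unfolding norm_scaleR by (intro mult_left_mono order_trans[OF norm_int_op NG]) auto
   show "norm (fst p *\<^sub>R int_op (Nem g (z q) - Nem g (z p))) <= \<bar>fst p\<bar> * (n * M * norm (z q - z p))"
    unfolding norm_scaleR by (intro mult_left_mono order_trans[OF norm_int_op Nlip]) auto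
  qed
  also have "\<dots> <= norm (q - p) + norm (q - p) * G + 1/2 * norm (z q - z p)"
  proof (intro add_mono mult_right_mono)
   show "norm (snd q - snd p) <= norm (q - p)" by (cases p; cases q) (simp add: norm_snd_le)
   show "\<bar>fst q - fst p\<bar> <= norm (q - p)" by (cases p; cases q) (use norm_fst_le real_norm_def in \<open>simp flip: real_norm_def\<close>)
   show "\<bar>fst p\<bar> * (n * M * norm (z q - z p)) <= 1/2 * norm (z q - z p)"
    using mult_right_mono[OF small(1)[OF fstP[OF p]], of "norm (z q - z p)"] by simp
  qed (rule G0)
  finally show ?thesis by (simp add: algebra_simps)
 qed
 have half: "norm (\<Sum>c\<in>Basis. int_op (comp_op c h (l *\<^sub>R Nem (%x. fd g x c) y))) <= norm h / 2"
  if l: "\<bar>l\<bar> < ep" for l h y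
 proof -
  have "norm (\<Sum>c\<in>Basis. int_op (comp_op c h (l *\<^sub>R Nem (%x. fd g x c) y)))
   <= (\<Sum>c\<in>(Basis::'e set). norm h * (\<bar>l\<bar> * M))"
  proof (rule sum_norm_le)
   fix c :: 'e assume c: "c : Basis"
   have "norm (Nem (%x. fd g x c) y) <= M" by (rule norm_bound) (simp add: NDg M[OF clip_in c])
   then have "norm (l *\<^sub>R Nem (%x. fd g x c) y) <= \<bar>l\<bar> * M" by (simp add: mult_left_mono)
   then show "norm (int_op (comp_op c h (l *\<^sub>R Nem (%x. fd g x c) y))) <= norm h * (\<bar>l\<bar> * M)"
    by (intro order_trans[OF norm_int_op] order_trans[OF norm_comp_op[OF c]] mult_left_mono) auto
  qed
  also have "\<dots> = (\<bar>l\<bar> * (n * M)) * norm h" by (simp add: n_def)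
  also have "\<dots> <= 1/2 * norm h" by (intro mult_right_mono small(1)[OF l]) auto
  finally show ?thesis by simp
 qed
 have Teq: "(\<Sum>c\<in>Basis. int_op (comp_op c h (l *\<^sub>R Nem (%x. fd g x c) y))) = l *\<^sub>R int_op (dNem g y h)" for l h y
  unfolding dNem_def I.sum scaleR_right.sum by (rule sum.cong) (simp_all add: I.scaleR bounded_bilinear.scaleR_right[OF bounded_bilinear_comp_op])
 have dz: "EX z'. (z has_derivative z') (at p) & (ALL v. z' v = const_bcontfun (snd v) + fst v *\<^sub>R int_op (Nem g (z p))
   + fst p *\<^sub>R int_op (dNem g (z p) (z' v)))" if p: "p : P" for p
 proof -
  define T where "T h = fst p *\<^sub>R int_op (dNem g (z p) h)" for h
  have T: "bounded_linear T" unfolding T_def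
   by (intro bounded_linear_const_scaleR bounded_linear_compose[OF bounded_linear_int_op] bounded_linear_dNem)
  have "norm (T h) <= norm h / 2" for h using half[OF fstP[OF p], of h "z p"] unfolding T_def Teq .
  from contraction_resolvent[OF T this]
  obtain J where J: "bounded_linear J" "!!h. J h - T (J h) = h" "!!h. J (h - T h) = h" by blast
  have evP: "\<forall>\<^sub>F q in at p. q : P" using P p by (simp add: eventually_at_in_open')
  have zl: "\<forall>\<^sub>F q in at p. norm (z q - z p) <= 2 * (1 + G) * norm (q - p)" using evP by eventually_elim (rule zlip[OF p])
  have zcont: "isCont z p"
  proof -
   have "((%q. z q - z p) ---> 0) (at p)"
   proof (rule Lim_null_comparison[OF zl])
    show "((%q. 2 * (1 + G) * norm (q - p)) ---> 0) (at p)" by (intro tendsto_mult_right_zero tendsto_norm_zero) (simp add: LIM_zero)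
   qed
   then show ?thesis unfolding isCont_def by (rule LIM_zero_cancel)
  qed
  have Ngcont: "isCont (%q. int_op (Nem g (z q))) p"
  proof -
   have "\<forall>\<^sub>F q in at p. norm (Nem g (z q) - Nem g (z p)) <= n * M * norm (z q - z p)" using Nlip by simp
   moreover have "((%q. n * M * norm (z q - z p)) ---> 0) (at p)"
    by (intro tendsto_mult_right_zero tendsto_norm_zero LIM_zero) (use zcont isCont_def in auto)
   ultimately have "((%q. Nem g (z q) - Nem g (z p)) ---> 0) (at p)" by (rule Lim_null_comparison)
   then have "isCont (%q. Nem g (z q)) p" unfolding isCont_def by (rule LIM_zero_cancel)
   then show ?thesis by (rule I.isCont)
  qed
  \<comment> \<open>Removing the linearisation leaves a map with zero derivative at
    \<open>z p\<close>; hence z - T z is differentiable at \<open>p\<close>, and \<open>J\<close>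
    returns the derivative of \<open>z\<close>.\<close>
  define R where "R y = Nem g y - dNem g (z p) y" for y
  have "(R has_derivative (%h. dNem g (z p) h - dNem g (z p) h)) (at (z p) within ball_curves)"
   unfolding R_def by (intro has_derivative_diff Nem_has_derivative[OF g zD[OF p]]
     bounded_linear_imp_has_derivative bounded_linear_dNem)
  then have "(R has_derivative (%_. 0)) (at (z p) within ball_curves)" by simp
  then have R: "((%q. R (z q)) has_derivative (%_. 0)) (at p)"
   by (rule has_derivative_zero_compose_lipschitz[OF _ _ zl]) (use evP zD in \<open>auto elim: eventually_mono\<close>)
  have "((%q. const_bcontfun (snd q) + (fst q - fst p) *\<^sub>R int_op (Nem g (z q)) + fst p *\<^sub>R int_op (R (z q)))
   has_derivative (%v. const_bcontfun (snd v) + fst v *\<^sub>R int_op (Nem g (z p)) + fst p *\<^sub>R int_op 0)) (at p)"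
  proof (rule has_derivative_add[OF has_derivative_add])
   show "((%q. const_bcontfun (snd q)) has_derivative (%v. const_bcontfun (snd v) :: real \<Rightarrow>\<^sub>C 'e)) (at p)"
    by (intro bounded_linear_imp_has_derivative bounded_linear_compose[OF bounded_linear_const_bcontfun bounded_linear_snd])
   have sw: "bounded_bilinear (%(w :: real \<Rightarrow>\<^sub>C 'e) (s::real). s *\<^sub>R w)"
    using bounded_bilinear.flip[OF bounded_bilinear_scaleR] .
   have "((%q. fst q - fst p) has_derivative (%v. fst v)) (at p)" by (auto intro!: derivative_eq_intros)
   from has_derivative_bilinear_vanishing[OF sw Ngcont this]
   show "((%q. (fst q - fst p) *\<^sub>R int_op (Nem g (z q))) has_derivative (%v. fst v *\<^sub>R int_op (Nem g (z p)))) (at p)" by simp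
   show "((%q. fst p *\<^sub>R int_op (R (z q))) has_derivative (%v. fst p *\<^sub>R int_op 0)) (at p)"
    by (rule bounded_linear.has_derivative[OF _ R])
     (intro bounded_linear_const_scaleR bounded_linear_int_op)
  qed
  then have "((%q. z q - T (z q)) has_derivative (%v. const_bcontfun (snd v) + fst v *\<^sub>R int_op (Nem g (z p)) + fst p *\<^sub>R int_op 0)) (at p)"
  proof (rule has_derivative_transform_within_open[OF _ P p])
   fix q assume q: "q : P"
   have "z q = const_bcontfun (snd q) + fst q *\<^sub>R int_op (Nem g (z q))" by (rule z[OF q])
   then have "z q - T (z q) = const_bcontfun (snd q) + fst q *\<^sub>R int_op (Nem g (z q)) - T (z q)" by (rule arg_cong)
   then show "const_bcontfun (snd q) + (fst q - fst p) *\<^sub>R int_op (Nem g (z q)) + fst p *\<^sub>R int_op (R (z q)) = z q - T (z q)"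
    by (simp add: R_def T_def I.diff algebra_simps)
  qed
  then have "((%q. J (z q - T (z q))) has_derivative (%v. J (const_bcontfun (snd v) + fst v *\<^sub>R int_op (Nem g (z p)) + fst p *\<^sub>R int_op 0))) (at p)"
   by (rule bounded_linear.has_derivative[OF J(1)])
  then have "(z has_derivative (%v. J (const_bcontfun (snd v) + fst v *\<^sub>R int_op (Nem g (z p))))) (at p)" by (simp add: J(3) I.zero)
  moreover have "J h = h + fst p *\<^sub>R int_op (dNem g (z p) (J h))" for h using J(2)[of h] unfolding T_def by (simp only: diff_eq_eq)
  ultimately show ?thesis by blast
 qed
 have fd: "(z has_derivative fd z p) (at p)"
  "fd z p v = const_bcontfun (snd v) + fst v *\<^sub>R int_op (Nem g (z p))
   + fst p *\<^sub>R int_op (dNem g (z p) (fd z p v))" if p: "p : P" for p v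
 proof -
  obtain z' where z': "(z has_derivative z') (at p)" "ALL v. z' v = const_bcontfun (snd v) + fst v *\<^sub>R int_op (Nem g (z p))
   + fst p *\<^sub>R int_op (dNem g (z p) (z' v))" using dz[OF p] by blast
  have e: "fd z p = z'" using frechet_derivative_at[OF z'(1)] by simp
  show "(z has_derivative fd z p) (at p)" unfolding e by (rule z'(1))
  show "fd z p v = const_bcontfun (snd v) + fst v *\<^sub>R int_op (Nem g (z p))
   + fst p *\<^sub>R int_op (dNem g (z p) (fd z p v))" unfolding e using z'(2) by blast
 qed
 have zCk: "Ck_on k P z" for k
 proof (induction k)
  case 0
  have "isCont z p" if "p : P" for p using fd(1)[OF that] has_derivative_continuous by blast
  then show ?case by (simp add: continuous_at_imp_continuous_on)
 next
  case (Suc k)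
  show ?case
  proof (rule Ck_on_SucI[OF P fd(1)])
   fix v
   show "Ck_on k P (%p. fd z p v)"
   proof (rule Ck_on_linear_fixpoint[where I=Basis and B="%c h y. int_op (comp_op c h y)"
      and a="%c p. fst p *\<^sub>R Nem (%x. fd g x c) (z p)"
      and b="%p. const_bcontfun (snd v) + fst v *\<^sub>R int_op (Nem g (z p))", OF P])
    show "bounded_bilinear (%h y. int_op (comp_op c h y))" if "c : Basis" for c :: 'e
    proof -
     interpret B: bounded_bilinear "comp_op c" by (rule bounded_bilinear_comp_op[OF that])
     show ?thesis
     proof
      show "EX K. ALL a b. norm (int_op (comp_op c a b)) <= norm a * norm b * K"
       using order_trans[OF norm_int_op norm_comp_op[OF that]] by (intro exI[of _ 1]) simp
     qed (simp_all add: B.add_left B.add_right B.scaleR_left B.scaleR_right I.add I.scaleR)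
    qed
    show "norm (\<Sum>c\<in>Basis. int_op (comp_op c h (fst p *\<^sub>R Nem (%x. fd g x c) (z p)))) <= norm h / 2"
     if "p : P" for p h by (rule half[OF fstP[OF that]])
    show "fd z p v = const_bcontfun (snd v) + fst v *\<^sub>R int_op (Nem g (z p)) +
     (\<Sum>c\<in>Basis. int_op (comp_op c (fd z p v) (fst p *\<^sub>R Nem (%x. fd g x c) (z p))))"
     if "p : P" for p unfolding Teq by (rule fd(2)[OF that])
    show "Ck_on k P (%p. fst p *\<^sub>R Nem (%x. fd g x c) (z p))" for c by (rule Ck_on_bilinear[OF P bounded_bilinear_scaleR
        Ck_on_bounded_linear[OF P bounded_linear_fst Ck_on_id[OF P]] Nem_Ck[OF P zD Suc Cinf_on_deriv[OF g]]])
    show "Ck_on k P (%p. const_bcontfun (snd v) + fst v *\<^sub>R int_op (Nem g (z p)))"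
     by (rule Ck_on_add[OF P Ck_on_const[OF P] Ck_on_bounded_linear[OF P _ Nem_Ck[OF P zD Suc g]]])
      (intro bounded_linear_const_scaleR bounded_linear_int_op)
   qed
  qed
 qed
 have zint: "apply_bcontfun (z p) s = snd p + fst p *\<^sub>R integral {0..clamp01 s} (%s. g (apply_bcontfun (z p) s))"
  if p: "p : P" for p s
 proof -
  have zb: "(z p) t : cball x0 r" for t using zD[OF p] by (simp add: ball_curves_def)
  have "apply_bcontfun (Nem g (z p)) = (%s. g (apply_bcontfun (z p) s))" by (rule ext) (simp only: Ng clip_id[OF zb])
  then show ?thesis by (subst z[OF p]) (simp add: int_op_apply)
 qed
 define Ph where "Ph p = (z p) 1" for p
 have Phi: "Cinf_on P Ph" unfolding Ph_def Cinf_on_def using Ck_on_bounded_linear[OF P bounded_linear_apply_bcontfun zCk] by blast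
 have flow: "fd Ph p (1, 0) = g (Ph p)" if p: "p : P" for p
 proof -
  define y where "y = apply_bcontfun (z p)"
  define l where "l = fst p"
  have zb: "y t : cball x0 r" for t using zD[OF p] by (simp add: ball_curves_def y_def)
  have yc: "continuous_on S y" for S unfolding y_def by simp
  have gy: "continuous_on S (%s. g (y s))" for S by (rule continuous_on_compose2[OF gc yc]) (use zb in auto)
  have ycl: "y t = y (clamp01 t)" for t
  proof -
   have "clamp01 (clamp01 t) = clamp01 t" by (simp add: clamp01)
   then show ?thesis using zint[OF p] unfolding y_def by metis
  qed
  \<comment> \<open>The curve with parameter (l, x) is s -> flow of x at time l s, so its derivative
    in l should be s g(y s). This candidate solves the linearised fixed point equation, whose
    solution is unique by \<open>half\<close>.\<close>
  have "continuous_on UNIV (%s. clamp01 s *\<^sub>R g (y s))" unfolding clamp01_def by (intro continuous_intros gy)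
  moreover have "norm (clamp01 s *\<^sub>R g (y s)) <= 1 * G" for s unfolding norm_scaleR using G[OF zb] by (intro mult_mono) (auto simp: clamp01)
  ultimately have "(%s. clamp01 s *\<^sub>R g (y s)) : bcontfun" by (rule bcontfun_normI)
  define w where "w = Bcontfun (%s. clamp01 s *\<^sub>R g (y s))"
  have w: "w s = clamp01 s *\<^sub>R g (y s)" for s unfolding w_def using \<open>_ : bcontfun\<close> by (simp add: Bcontfun_inverse)
  have yd: "(y has_vector_derivative l *\<^sub>R g (y s)) (at s within {0..1})" if s: "s : {0..1}" for s
  proof -
   have "((%u. integral {0..u} (%s. g (y s))) has_vector_derivative g (y s)) (at s within {0..1})" by (rule integral_has_vector_derivative[OF gy s])
   then have "((%u. snd p + l *\<^sub>R integral {0..u} (%s. g (y s))) has_vector_derivative 0 + l *\<^sub>R g (y s)) (at s within {0..1})"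
    by (intro has_vector_derivative_add has_vector_derivative_const
      bounded_linear.has_vector_derivative[OF bounded_linear_scaleR_right])
   moreover have "y u = snd p + l *\<^sub>R integral {0..u} (%s. g (y s))" if "u : {0..1}" for u
    using zint[OF p, of u] clamp01(3)[OF that] unfolding y_def l_def by simp
   ultimately have "(y has_vector_derivative 0 + l *\<^sub>R g (y s)) (at s within {0..1})" by (rule has_vector_derivative_transform[OF s, rotated])
   then show ?thesis by simp
  qed
  have lin: "linear (fd g (y s))" for s by (rule has_derivative_linear[OF Cinf_deriv[OF g]]) (use zb[of s] K in blast)
  have wfix: "w = int_op (Nem g (z p)) + l *\<^sub>R int_op (dNem g (z p) w)"
  proof (rule bcontfun_eqI)
   fix t
   define ta where "ta = clamp01 t"
   have ta: "0 <= ta" "ta <= 1" by (auto simp: ta_def clamp01)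
   have N: "(Nem g (z p)) s = g (y s)" for s using zb unfolding y_def by (simp only: Ng clip_id)
   have D: "(dNem g (z p) w) s = fd g (y s) (clamp01 s *\<^sub>R g (y s))" for s using zb unfolding dNem_def
    by (subst linear_euclidean_expand[OF lin]) (simp add: bcontfun_sum_apply comp_op_apply w NDg clip_id y_def)
   have "((%s. g (y s) + l *\<^sub>R apply_bcontfun (dNem g (z p) w) s) has_integral ta *\<^sub>R g (y ta) - 0 *\<^sub>R g (y 0)) {0..ta}"
   proof (rule fundamental_theorem_of_calculus[OF ta(1)])
    fix s assume s: "s : {0..ta}"
    then have s1: "s : {0..1}" using ta by auto
    have yd': "(y has_vector_derivative l *\<^sub>R g (y s)) (at s within {0..ta})"
     by (rule has_vector_derivative_within_subset[OF yd[OF s1]]) (use ta in auto)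
    have "(g has_derivative fd g (y s)) (at (y s) within y ` {0..ta})" using Cinf_deriv[OF g, of "y s"] zb[of s] K has_derivative_at_withinI by blast
    from vector_derivative_diff_chain_within[OF yd' this]
    have "((%s. g (y s)) has_vector_derivative fd g (y s) (l *\<^sub>R g (y s))) (at s within {0..ta})" by (simp add: o_def)
    then have "((%s. s *\<^sub>R g (y s)) has_vector_derivative s *\<^sub>R fd g (y s) (l *\<^sub>R g (y s)) + 1 *\<^sub>R g (y s)) (at s within {0..ta})"
     by (intro has_vector_derivative_scaleR DERIV_ident)
    moreover have "s *\<^sub>R fd g (y s) (l *\<^sub>R g (y s)) + 1 *\<^sub>R g (y s)
      = g (y s) + l *\<^sub>R (dNem g (z p) w) s" by (simp add: D clamp01(3)[OF s1] linear_scale[OF lin])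
    ultimately show "((%s. s *\<^sub>R g (y s)) has_vector_derivative g (y s) + l *\<^sub>R (dNem g (z p) w) s) (at s within {0..ta})" by metis
   qed
   then have "integral {0..ta} (%s. g (y s) + l *\<^sub>R (dNem g (z p) w) s) = ta *\<^sub>R g (y ta)" by force
   moreover have "integral {0..ta} (%s. g (y s) + l *\<^sub>R (dNem g (z p) w) s)
    = integral {0..ta} (%s. g (y s)) + l *\<^sub>R integral {0..ta} (apply_bcontfun (dNem g (z p) w))"
    by (subst integral_add) (auto intro!: integrable_continuous_interval gy continuous_intros)
   moreover have "ta *\<^sub>R g (y ta) = w t" using ycl[of t] by (simp add: w ta_def)
   moreover have "integral {0..ta} (%s. g (y s)) = (int_op (Nem g (z p))) t" by (simp add: int_op_apply N[abs_def] ta_def)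
   ultimately show "w t = (int_op (Nem g (z p)) + l *\<^sub>R int_op (dNem g (z p) w)) t" by (simp add: int_op_apply ta_def)
  qed
  define w' where "w' = fd z p (1, 0)"
  have w'fix: "w' = int_op (Nem g (z p)) + l *\<^sub>R int_op (dNem g (z p) w')" using fd(2)[OF p, of "(1, 0)"] unfolding w'_def l_def by simp
  have "w' - w = l *\<^sub>R int_op (dNem g (z p) (w' - w))"
  proof -
   have "w' - w = (int_op (Nem g (z p)) + l *\<^sub>R int_op (dNem g (z p) w')) - (int_op (Nem g (z p)) + l *\<^sub>R int_op (dNem g (z p) w))"
    by (rule arg_cong2[where f="(-)", OF w'fix wfix])
   also have "\<dots> = l *\<^sub>R int_op (dNem g (z p) (w' - w))"
    unfolding linear_diff[OF bounded_linear.linear[OF bounded_linear_dNem]] I.diff scaleR_diff_right by simp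
   finally show ?thesis .
  qed
  then have "w' = w" using half[OF fstP[OF p], of "w' - w" "z p"] unfolding Teq l_def by simp
  have "(Ph has_derivative (%v. (fd z p v) 1)) (at p)"
   unfolding Ph_def by (rule bounded_linear.has_derivative[OF bounded_linear_apply_bcontfun fd(1)[OF p]])
  then have "fd Ph p = (%v. (fd z p v) 1)" using frechet_derivative_at by metis
  then show ?thesis using \<open>w' = w\<close> unfolding w'_def by (simp add: w clamp01 Ph_def y_def)
 qed
 show ?thesis
 proof (rule that[of ep "r/2" Ph])
  show "Ph (0, x) = x" if "x : ball x0 (r/2)" for x
  proof -
   have "(0, x) : P" using that eps unfolding P_def by simp
   then show ?thesis unfolding Ph_def by (subst zint) auto
  qed
  show "Ph p : V" if "p : {-ep<..<ep} \<times> ball x0 (r/2)" for p using zD[of p] that K unfolding P_def Ph_def ball_curves_def by blast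
 qed (use eps r Phi flow in \<open>auto simp: P_def\<close>)
qed

end

section \<open>Diffeomorphisms and the straightening of vector fields\<close>

definition diffeo :: "'e::euclidean_space set => 'e set => ('e => 'e) => ('e => 'e) => bool" where
 "diffeo U W S R \<longleftrightarrow> open U & open W & homeomorphism U W S R & Cinf_on U S & Cinf_on W R"

lemma diffeo_sym: "diffeo U W S R ==> diffeo W U R S" unfolding diffeo_def using homeomorphism_symD by blast

lemma diffeo_open_image:
 assumes "diffeo U W S R" "open U'" "U' \<subseteq> U"
 shows "open (S ` U')"
proof -
 have "S ` U' = W \<inter> R -` U'" using assms unfolding diffeo_def homeomorphism_def by auto
 then show ?thesis using assms continuous_open_preimage[of W R U'] by (simp add: diffeo_def homeomorphism_def)
qed

lemma diffeo_restrict: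
 assumes "diffeo U W S R" "open U'" "U' \<subseteq> U"
 shows "diffeo U' (S ` U') S R"
proof -
 have "S ` U' \<subseteq> W" using assms by (auto simp: diffeo_def homeomorphism_def)
 then show ?thesis using assms diffeo_open_image[OF assms] by (auto simp: diffeo_def intro: Cinf_on_subset homeomorphism_of_subsets)
qed

lemma has_derivative_unique_at: "(f has_derivative f') (at x) ==> fd f x = f'" using frechet_derivative_at by metis

lemma diffeo_deriv_inverse:
 assumes "diffeo U W S R" "x : U"
 shows "fd R (S x) (fd S x v) = v"
proof -
 have SW: "S x : W" using assms by (auto simp: diffeo_def homeomorphism_def)
 have "((%x. R (S x)) has_derivative (%v. fd R (S x) (fd S x v))) (at x)"
  using assms SW by (intro has_derivative_compose[OF Cinf_deriv Cinf_deriv]) (auto simp: diffeo_def)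
 then have "((%x. x) has_derivative (%v. fd R (S x) (fd S x v))) (at x)"
  by (rule has_derivative_transform_within_open[of _ _ _ _ U]) (use assms in \<open>auto simp: diffeo_def homeomorphism_def\<close>)
 from has_derivative_unique[OF this has_derivative_ident] show ?thesis by meson
qed

lemma smooth_inverse_diffeo:
 fixes f :: "'a::euclidean_space => 'a"
 assumes "open U" "Cinf_on U f" "x0 : U" "inj (fd f x0)"
 obtains U' V g where "diffeo U' V f g" "U' \<subseteq> U" "x0 : U'"
proof -
 obtain U' V g where *: "open U'" "U' \<subseteq> U" "x0 : U'" "open V" "f x0 : V" "homeomorphism U' V f g" "Cinf_on V g"
  using smooth_inverse_function[OF assms] by blast
 then have "diffeo U' V f g" using assms(2) Cinf_on_subset by (auto simp: diffeo_def)
 with * that show ?thesis by blast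
qed

text \<open>Flow-box coordinates: \<open>y\<close> is sent to the point reached after time
  \<open>l y\<close>, its component along \<open>e\<close>, from \<open>x0\<close> plus the part of
  \<open>y\<close> orthogonal to \<open>e\<close>. The derivative at 0 is the identity, so this map
  is locally invertible, and its inverse turns the field into the constant
  \<open>g x0\<close>.\<close>

theorem straightening:
 fixes g :: "'e::euclidean_space => 'e"
 assumes V: "open V" and g: "Cinf_on V g" and x0: "x0 : V" and nz: "g x0 ~= 0"
 obtains U ro S R where "ro > 0" "diffeo U (ball 0 ro) S R" "U \<subseteq> V" "x0 : U" "S x0 = 0"
  "!!x. x : U ==> fd S x (g x) = g x0"
proof -
 obtain r where r: "r > 0" "cball x0 r \<subseteq> V" using V x0 open_contains_cball by blast
 interpret field_on_ball g V x0 r by standard (use V r g in auto)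
 obtain ep ro :: real and Ph where Ph: "ep > 0" "ro > 0" "Cinf_on ({-ep<..<ep} \<times> ball x0 ro) Ph"
  "!!x. x : ball x0 ro ==> Ph (0, x) = x"
  "!!p. p : {-ep<..<ep} \<times> ball x0 ro ==> Ph p : V"
  "!!t x. t : {-ep<..<ep} ==> x : ball x0 ro ==> fd Ph (t, x) (1, 0) = g (Ph (t, x))" using local_flow by blast
 define e where "e = g x0"
 define P where "P = {-ep<..<ep} \<times> ball x0 ro"
 have P: "open P" unfolding P_def by (intro open_Times) auto
 define l where "l y = inner y e / inner e e" for y
 have le: "l e = 1" using nz by (simp add: l_def e_def)
 have linl: "bounded_linear l" unfolding l_def divide_inverse by (intro bounded_linear_mult_const bounded_linear_inner_left)
 define h where "h y = (l y, y - l y *\<^sub>R e)" for y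
 have linh: "bounded_linear h" unfolding h_def by (intro bounded_linear_Pair bounded_linear_sub bounded_linear_ident linl
    bounded_linear_compose[OF bounded_linear_scaleR_left linl])
 have he: "h e = (1, 0)" using le by (simp add: h_def)
 define k where "k y = (0, x0) + h y" for y
 have kder: "(k has_derivative h) (at y)" for y
  unfolding k_def using has_derivative_add[OF has_derivative_const bounded_linear_imp_has_derivative[OF linh]] by simp
 define U0 where "U0 = k -` P"
 have kcont: "continuous_on UNIV k" using kder has_derivative_continuous by (blast intro: continuous_at_imp_continuous_on)
 have U0: "open U0" unfolding U0_def using P kcont by (rule open_vimage)
 have kC: "Cinf_on U0 k" unfolding k_def by (intro Cinf_on_add U0 Cinf_on_const Cinf_on_linear linh)
 define Ps where "Ps y = Ph (k y)" for y
 have PsC: "Cinf_on U0 Ps" unfolding Ps_def by (rule Cinf_on_compose[OF U0 kC Ph(3)]) (auto simp: U0_def P_def)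
 have Psder: "fd Ps y v = fd Ph (k y) (h v)" if "y : U0" for y v
 proof -
  have "(Ph has_derivative fd Ph (k y)) (at (k y))" using that by (intro Cinf_deriv[OF Ph(3)]) (simp add: U0_def P_def)
  from has_derivative_compose[OF kder this]
  show ?thesis unfolding Ps_def[abs_def] by (simp add: has_derivative_unique_at)
 qed
 have k0: "k 0 = (0, x0)" by (simp add: k_def h_def l_def)
 have U00: "0 : U0" using Ph(1,2) by (simp add: U0_def P_def k0)
 have D0: "fd Ph (0, x0) (0, v) = v" for v
 proof -
  have d: "(Ph has_derivative fd Ph (0, x0)) (at (0, x0))" using Ph(1,2) by (intro Cinf_deriv[OF Ph(3)]) simp
  have "((%x. (0::real, x)) has_derivative (%v. (0, v))) (at x0)" by (auto intro!: derivative_eq_intros)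
  from has_derivative_compose[OF this d]
  have "((%x. Ph (0, x)) has_derivative (%v. fd Ph (0, x0) (0, v))) (at x0)" .
  then have "((%x. x) has_derivative (%v. fd Ph (0, x0) (0, v))) (at x0)"
   by (rule has_derivative_transform_within_open[of _ _ _ _ "ball x0 ro"]) (use Ph(2,4) in auto)
  from has_derivative_unique[OF this has_derivative_ident] show ?thesis by meson
 qed
 have "fd Ps 0 v = v" for v
 proof -
  have lin: "linear (fd Ph (0, x0))" using Ph(1,2) by (intro has_derivative_linear[OF Cinf_deriv[OF Ph(3)]]) simp
  have "fd Ps 0 v = fd Ph (0, x0) (l v *\<^sub>R (1, 0) + (0, v - l v *\<^sub>R e))" using Psder[OF U00] by (simp add: k0 h_def)
  also have "\<dots> = l v *\<^sub>R e + (v - l v *\<^sub>R e)" unfolding linear_add[OF lin] linear_scale[OF lin] D0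
   using Ph(6)[of 0 x0] Ph(1,2,4) by (simp add: e_def)
  finally show ?thesis by simp
 qed
 then have "inj (fd Ps 0)" by (simp add: inj_def)
 from smooth_inverse_diffeo[OF U0 PsC U00 this]
 obtain U' W S where D: "diffeo U' W Ps S" "U' \<subseteq> U0" "0 : U'" by blast
 obtain d where d: "d > 0" "ball 0 d \<subseteq> U'" using D(1,3) open_contains_ball unfolding diffeo_def by blast
 have D': "diffeo (ball 0 d) (Ps ` ball 0 d) Ps S" by (rule diffeo_restrict[OF D(1)]) (use d in auto)
 have Ps0: "Ps 0 = x0" using Ph(2,4) by (simp add: Ps_def k0)
 show ?thesis
 proof (rule that[OF d(1) diffeo_sym[OF D']])
  show "Ps ` ball 0 d \<subseteq> V"
  proof
   fix x assume "x : Ps ` ball 0 d"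
   then obtain y where "y : U0" "x = Ph (k y)" using d D(2) unfolding Ps_def by blast
   then show "x : V" using Ph(5)[of "k y"] unfolding U0_def P_def by simp
  qed
  show "x0 : Ps ` ball 0 d" using Ps0 d(1) by auto
  show "S x0 = 0" using D' d(1) Ps0 by (metis centre_in_ball diffeo_def homeomorphism_apply1)
  fix x assume "x : Ps ` ball 0 d"
  then obtain y where y: "y : ball 0 d" "x = Ps y" by blast
  have yU: "y : U0" using y d D(2) by blast
  obtain a b where kab: "k y = (a, b)" by force
  show "fd S x (g x) = g x0" using Psder[OF yU, of e] Ph(6)[of a b] yU kab y(2) unfolding he using diffeo_deriv_inverse[OF D' y(1), of e] y(2) by (simp add: U0_def P_def Ps_def e_def)
 qed
qed

section \<open>Charts and tangent vectors\<close>

text \<open>Coordinate maps are arbitrary outside their chart domain, so differentiability of the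
  coordinate curve alone would not force \<open>x\<close> to approach \<open>x t\<close>; continuity
  is demanded as well.\<close>

definition has_velocity ::
 "('a::topological_space, 'e::euclidean_space) chart set => real set => (real => 'a) => real => 'e => bool" where
 "has_velocity A T x t v \<longleftrightarrow> continuous (at t within T) x &
  ((snd (chart_at A (x t)) o x) has_vector_derivative v) (at t within T)"

text \<open>Difference quotients lie in \<open>L\<close>, which is closed since the space is
  finite-dimensional.\<close>

lemma vector_derivative_in_subspace:
 fixes F :: "real => 'e::euclidean_space"
 assumes d: "(F has_vector_derivative w) (at t within T)" and L: "subspace L"
  and ev: "\<forall>\<^sub>F s in at t within T. F s - F t : L" and nt: "at t within T ~= bot"
 shows "w : L"
proof -
 have "((%s. (1 / norm (s - t)) *\<^sub>R (F s - (F t + (s - t) *\<^sub>R w))) ---> 0) (at t within T)"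
  using d unfolding has_vector_derivative_def has_derivative_within by blast
 then have "((%s. norm ((1 / norm (s - t)) *\<^sub>R (F s - (F t + (s - t) *\<^sub>R w)))) ---> 0) (at t within T)" by (rule tendsto_norm_zero)
 then have "((%s. norm ((F s - F t) /\<^sub>R (s - t) - w)) ---> 0) (at t within T)"
 proof (rule Lim_transform_eventually)
  show "\<forall>\<^sub>F s in at t within T. norm ((1 / norm (s - t)) *\<^sub>R (F s - (F t + (s - t) *\<^sub>R w)))
    = norm ((F s - F t) /\<^sub>R (s - t) - w)" unfolding eventually_at_filter
  proof (intro always_eventually allI impI)
   fix s assume "s ~= t"
   then have "(F s - F t) /\<^sub>R (s - t) - w = (1 / (s - t)) *\<^sub>R (F s - (F t + (s - t) *\<^sub>R w))"
    by (simp add: scaleR_diff_right diff_diff_eq[symmetric] inverse_eq_divide)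
   then show "norm ((1 / norm (s - t)) *\<^sub>R (F s - (F t + (s - t) *\<^sub>R w))) = norm ((F s - F t) /\<^sub>R (s - t) - w)" by simp
  qed
 qed
 then have "((%s. (F s - F t) /\<^sub>R (s - t)) ---> w) (at t within T)" by (simp add: tendsto_norm_zero_iff LIM_zero_iff)
 moreover have "\<forall>\<^sub>F s in at t within T. (F s - F t) /\<^sub>R (s - t) : L" using ev by eventually_elim (simp add: subspace_scale[OF L])
 ultimately show ?thesis by (rule Lim_in_closed_set[OF closed_subspace[OF L] _ nt, rotated])
qed

abbreviation "obasis \<equiv> ordered_basis"

locale manifold =
 fixes A :: "('a::{t2_space,second_countable_topology}, 'e::euclidean_space) chart set"
 assumes atlas: "smooth_atlas A"
begin

abbreviation "TS \<equiv> tangent_space A"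

abbreviation "icurve \<equiv> integral_curve_on A"

abbreviation charts :: "('a, 'e) chart set" where
 "charts \<equiv> maximal_atlas A"

abbreviation transition :: "('a, 'e) chart => ('a, 'e) chart => 'e => 'e" where
 "transition c d \<equiv> snd d o chart_inv c"

lemma chart_at: "chart_at A p : A" "p : fst (chart_at A p)"
proof -
 have "EX c. c : A & p : fst c" using atlas unfolding smooth_atlas_def by blast
 from someI_ex[OF this] show "chart_at A p : A" "p : fst (chart_at A p)" unfolding chart_at_def by auto
qed

lemma atlas_charts: "c : A ==> c : charts" using atlas unfolding smooth_atlas_def maximal_atlas_def by auto

lemma chart_at_in: "chart_at A p : charts" using atlas_charts chart_at by blast

lemma charts_is_chart: "c : charts ==> is_chart c" unfolding maximal_atlas_def by auto

lemma chart_open: "c : charts ==> open (fst c)"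
 and chart_open_range: "c : charts ==> open (snd c ` fst c)"
 and chart_homeo: "c : charts ==> homeomorphism (fst c) (snd c ` fst c) (snd c) (chart_inv c)" using charts_is_chart unfolding is_chart_def by auto

lemma chart_inv_snd [simp]: "c : charts ==> q : fst c ==> chart_inv c (snd c q) = q" using chart_homeo unfolding homeomorphism_def by blast

lemma snd_chart_inv [simp]: "c : charts ==> x : snd c ` fst c ==> snd c (chart_inv c x) = x" by auto

lemma chart_inv_in: "x : snd c ` fst c ==> chart_inv c x : fst c" by (rule inv_into_into)

lemma chart_inj: "c : charts ==> p : fst c ==> q : fst c ==> snd c p = snd c q ==> p = q" by (metis chart_inv_snd)

lemma chart_cont: "c : charts ==> continuous_on (fst c) (snd c)"
 and chart_inv_cont: "c : charts ==> continuous_on (snd c ` fst c) (chart_inv c)" using chart_homeo unfolding homeomorphism_def by blast+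

lemma chart_isCont: "c : charts ==> q : fst c ==> isCont (snd c) q" using chart_cont chart_open continuous_on_eq_continuous_at by blast

lemma chart_inv_isCont: "c : charts ==> x : snd c ` fst c ==> isCont (chart_inv c) x"
 using chart_inv_cont chart_open_range continuous_on_eq_continuous_at by blast

lemma chart_image_eq:
 assumes "c : charts" "U \<subseteq> fst c"
 shows "snd c ` U = snd c ` fst c \<inter> chart_inv c -` U" using assms by auto

lemma chart_open_image:
 assumes c: "c : charts" and "open U" "U \<subseteq> fst c"
 shows "open (snd c ` U)" unfolding chart_image_eq[OF c assms(3)]
 using continuous_open_preimage[OF chart_inv_cont[OF c] chart_open_range[OF c] assms(2)] .

lemma chart_open_preimage:
 assumes "c : charts" "open W"
 shows "open {q : fst c. snd c q : W}" using continuous_open_preimage[OF chart_cont chart_open, of c W] assms by (simp add: Int_def)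

text \<open>A transition between charts of the maximal atlas factors near each point through a chart
  of \<open>A\<close>, where smoothness holds by definition.\<close>

lemma transition_Cinf:
 assumes c: "c : charts" and d: "d : charts"
 shows "Cinf_on (snd c ` (fst c \<inter> fst d)) (transition c d)" unfolding Cinf_on_def
proof (intro allI Ck_on_local)
 fix k x assume x: "x : snd c ` (fst c \<inter> fst d)"
 then obtain q where q: "q : fst c" "q : fst d" "x = snd c q" by blast
 define a where "a = chart_at A q"
 have a: "a : A" "a : charts" "q : fst a" using chart_at chart_at_in by (auto simp: a_def)
 define U where "U = fst c \<inter> fst d \<inter> fst a"
 have U: "open U" "U \<subseteq> fst c" "U \<subseteq> fst a" "q : U"
  unfolding U_def using chart_open[OF c] chart_open[OF d] chart_open[OF a(2)] a q by auto
 have "smooth_transition c a" "smooth_transition a d" using c d a(1) unfolding maximal_atlas_def by blast+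
 moreover have "open (snd c ` (fst c \<inter> fst a))" "open (snd a ` (fst a \<inter> fst d))"
  using chart_open[OF c] chart_open[OF d] chart_open[OF a(2)] by (auto intro!: chart_open_image c a)
 ultimately have ca: "Cinf_on (snd c ` (fst c \<inter> fst a)) (snd a o chart_inv c)"
  and ad: "Cinf_on (snd a ` (fst a \<inter> fst d)) (snd d o chart_inv a)" unfolding smooth_transition_def by (simp_all add: smooth_on_open)
 have "Cinf_on (snd c ` U) (%x. (snd d o chart_inv a) ((snd a o chart_inv c) x))"
 proof (rule Cinf_on_compose[OF chart_open_image[OF c U(1,2)] _ ad])
  show "Cinf_on (snd c ` U) (snd a o chart_inv c)" by (rule Cinf_on_subset[OF ca]) (auto simp: U_def)
  show "(snd a o chart_inv c) ` snd c ` U \<subseteq> snd a ` (fst a \<inter> fst d)" using c by (auto simp: U_def)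
 qed
 then have "Cinf_on (snd c ` U) (transition c d)"
  by (rule Cinf_on_cong[OF chart_open_image[OF c U(1,2)], rotated]) (use c a in \<open>auto simp: U_def\<close>)
 then show "EX V. open V & x : V & Ck_on k V (transition c d)" using chart_open_image[OF c U(1,2)] U(4) q(3) unfolding Cinf_on_def by blast
qed

lemma transition_deriv:
 assumes "c : charts" "d : charts" "q : fst c" "q : fst d"
 shows "(transition c d has_derivative fd (transition c d) (snd c q)) (at (snd c q))" using assms by (intro Cinf_deriv[OF transition_Cinf]) auto

text \<open>The source of all adapted charts: flow boxes, slices of intersections and charts moved
  by the flow are a given chart followed by a diffeomorphism of its range.\<close>

lemma charts_diffeo:
 assumes c: "c : charts" and U: "open U" "U \<subseteq> fst c" and D: "diffeo (snd c ` U) W S R"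
 shows "(U, %q. S (snd c q)) : charts" "(%q. S (snd c q)) ` U = W"
  "!!y. y : W ==> chart_inv (U, %q. S (snd c q)) y = chart_inv c (R y)"
proof -
 define d where "d = (U, %q. S (snd c q))"
 have h: "homeomorphism (snd c ` U) W S R" and SC: "Cinf_on (snd c ` U) S" and RC: "Cinf_on W R"
  and W: "open W" using D by (auto simp: diffeo_def)
 have RS: "R (S x) = x" "S x : W" if "x : snd c ` U" for x using h that unfolding homeomorphism_def by auto
 have "homeomorphism U (snd c ` U) (snd c) (chart_inv c)" by (rule homeomorphism_of_subsets[OF chart_homeo[OF c] U(2)]) (use U(2) in auto)
 from homeomorphism_compose[OF this h]
 have hd: "homeomorphism U W (%q. S (snd c q)) (%y. chart_inv c (R y))" by (simp add: o_def)
 show im: "(%q. S (snd c q)) ` U = W" using hd by (rule homeomorphism_image1)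
 have inj: "inj_on (%q. S (snd c q)) U" using homeomorphism_apply1[OF hd] by (rule inj_on_inverseI)
 have inv: "chart_inv d y = chart_inv c (R y)" if y: "y : W" for y
  using inv_into_f_f[OF inj, of "chart_inv c (R y)"] homeomorphism_apply2[OF hd y] homeomorphism_image2[OF hd] y by (auto simp: d_def)
 then show "!!y. y : W ==> chart_inv (U, %q. S (snd c q)) y = chart_inv c (R y)" by (simp add: d_def)
 have "homeomorphism (fst d) (snd d ` fst d) (snd d) (chart_inv d)"
  by (rule homeomorphism_cong[OF hd]) (use im inv in \<open>auto simp: d_def\<close>)
 then have isch: "is_chart d" using U W im by (simp add: is_chart_def d_def)
 have "smooth_transition d a & smooth_transition a d" if a: "a : A" for a
 proof -
  have ac: "a : charts" by (rule atlas_charts[OF a])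
  define N where "N = U \<inter> fst a"
  have N: "open N" "N \<subseteq> fst c" "N \<subseteq> fst a" "N \<subseteq> U" using U chart_open[OF ac] by (auto simp: N_def)
  have Nc: "open (snd c ` N)" and Na: "open (snd a ` N)" by (intro chart_open_image c ac N)+
  have oN: "open (snd d ` N)"
  proof -
   have "snd d ` N = S ` (snd c ` N)" by (auto simp: d_def)
   then show ?thesis using diffeo_open_image[OF D Nc] N(4) by auto
  qed
  have "Cinf_on (snd d ` N) (%y. (snd a o chart_inv c) (R y))"
  proof (rule Cinf_on_compose[OF oN _ transition_Cinf[OF c ac]])
   show "Cinf_on (snd d ` N) R" by (rule Cinf_on_subset[OF RC]) (use N(4) im in \<open>auto simp: d_def\<close>)
   show "R ` snd d ` N \<subseteq> snd c ` (fst c \<inter> fst a)"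
   proof clarify
    fix q assume "q : N"
    then have "R (snd d q) = snd c q" "q : fst c \<inter> fst a" using N RS(1)[of "snd c q"] by (auto simp: d_def)
    then show "R (snd d q) : snd c ` (fst c \<inter> fst a)" by blast
   qed
  qed
  then have 1: "Cinf_on (snd d ` N) (snd a o chart_inv d)" by (rule Cinf_on_cong[OF oN, rotated]) (use inv N(4) im in \<open>auto simp: d_def\<close>)
  have "Cinf_on (snd a ` N) (%y. S ((snd c o chart_inv a) y))"
  proof (rule Cinf_on_compose[OF Na _ SC])
   show "Cinf_on (snd a ` N) (snd c o chart_inv a)" by (rule Cinf_on_subset[OF transition_Cinf[OF ac c]]) (use N in auto)
   show "(snd c o chart_inv a) ` snd a ` N \<subseteq> snd c ` U" using N ac by (force)
  qed
  then have 2: "Cinf_on (snd a ` N) (snd d o chart_inv a)" by (simp add: d_def o_def)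
  have "fst d \<inter> fst a = N" "fst a \<inter> fst d = N" by (auto simp: d_def N_def)
  then show ?thesis unfolding smooth_transition_def using 1 2 by (simp add: smooth_on_open[OF oN] smooth_on_open[OF Na])
 qed
 then show "(U, %q. S (snd c q)) : charts" using isch unfolding maximal_atlas_def d_def by blast
qed

lemma charts_restrict:
 assumes c: "c : charts" and U: "open U" "U \<subseteq> fst c"
 shows "(U, snd c) : charts" "!!x. x : snd c ` U ==> chart_inv (U, snd c) x = chart_inv c x"
proof -
 have "diffeo (snd c ` U) (snd c ` U) (%x. x) (%x. x)"
  using chart_open_image[OF c U] by (auto simp: diffeo_def homeomorphism_def Cinf_on_def Ck_on_id)
 from charts_diffeo[OF c U this] show "(U, snd c) : charts"
  "!!x. x : snd c ` U ==> chart_inv (U, snd c) x = chart_inv c x" by auto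
qed

lemma transition_deriv_compose:
 assumes "c : charts" "d : charts" "e : charts" "q : fst c" "q : fst d" "q : fst e"
 shows "fd (transition d e) (snd d q) (fd (transition c d) (snd c q) v)
  = fd (transition c e) (snd c q) v"
proof -
 define U where "U = fst c \<inter> fst d \<inter> fst e"
 have U: "open U" "U \<subseteq> fst c" "q : U"
  unfolding U_def using assms chart_open[OF assms(1)] chart_open[OF assms(2)] chart_open[OF assms(3)] by auto
 have "(transition d e has_derivative fd (transition d e) (snd d q)) (at (transition c d (snd c q)))"
  using transition_deriv[OF assms(2,3,5,6)] assms by simp
 from has_derivative_compose[OF transition_deriv[OF assms(1,2,4,5)] this]
 have "(transition c e has_derivative (%v. fd (transition d e) (snd d q) (fd (transition c d) (snd c q) v))) (at (snd c q))"
  by (rule has_derivative_transform_within_open[OF _ chart_open_image[OF assms(1) U(1,2)]]) (use U assms in \<open>auto simp: U_def\<close>)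
 from has_derivative_unique_at[OF this] show ?thesis by simp
qed

lemma push_eq: "push A c p v = fd (transition (chart_at A p) c) (snd (chart_at A p) p) v" by (simp add: push_def)

lemma push_change:
 assumes "c : charts" "d : charts" "p : fst c" "p : fst d"
 shows "push A d p v = fd (transition c d) (snd c p) (push A c p v)"
 unfolding push_eq by (rule transition_deriv_compose[symmetric]) (use assms chart_at chart_at_in in auto)

lemma push_linear: "c : charts ==> p : fst c ==> linear (push A c p)" using has_derivative_linear[OF transition_deriv[OF chart_at_in _ chart_at(2)]]
 unfolding push_eq[abs_def] by blast

lemma transition_self:
 assumes "c : charts" "p : fst c"
 shows "fd (transition c c) (snd c p) v = v"
proof -
 have "(transition c c has_derivative (%v. v)) (at (snd c p))"
  by (rule has_derivative_transform_within_open[OF has_derivative_ident chart_open_range[OF assms(1)]]) (use assms in auto)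
 from has_derivative_unique_at[OF this] show ?thesis by simp
qed

lemma push_chart_at: "push A (chart_at A p) p v = v" unfolding push_eq by (rule transition_self[OF chart_at_in chart_at(2)])

definition pull :: "('a, 'e) chart => 'a => 'e => 'e" where
 "pull c p w = fd (transition c (chart_at A p)) (snd c p) w"

lemma pull_push [simp]: "c : charts ==> p : fst c ==> pull c p (push A c p v) = v"
 unfolding pull_def using push_change[of c "chart_at A p" p v] chart_at chart_at_in push_chart_at by simp

lemma push_pull [simp]: "c : charts ==> p : fst c ==> push A c p (pull c p w) = w"
 unfolding pull_def push_eq using transition_deriv_compose[of c "chart_at A p" c p w] transition_self[of c p w]
  chart_at chart_at_in by simp

lemma pull_linear: "c : charts ==> p : fst c ==> linear (pull c p)" using has_derivative_linear[OF transition_deriv[OF _ chart_at_in _ chart_at(2)]]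
 unfolding pull_def[abs_def] by blast

lemma push_restrict:
 assumes c: "c : charts" and U: "open U" "U \<subseteq> fst c" "p : U" and "snd d = snd c"
 shows "push A d p v = push A c p v" by (simp add: push_def assms)

lemma push_diffeo:
 assumes c: "c : charts" and U: "open U" "U \<subseteq> fst c" "p : U" and D: "diffeo (snd c ` U) W S R"
 shows "push A (U, %q. S (snd c q)) p v = fd S (snd c p) (push A c p v)"
proof -
 have d: "(U, %q. S (snd c q)) : charts" by (rule charts_diffeo[OF c U(1,2) D])
 have "(S has_derivative fd S (snd c p)) (at (snd c p))" using D U(3) by (intro Cinf_deriv) (auto simp: diffeo_def)
 then have "(transition c (U, %q. S (snd c q)) has_derivative fd S (snd c p)) (at (snd c p))"
  by (rule has_derivative_transform_within_open[OF _ chart_open_image[OF c U(1,2)]]) (use c U in auto)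
 from has_derivative_unique_at[OF this] show ?thesis using push_change[OF c d, of p v] U by auto
qed

lemma chart_transform_has_derivative:
 fixes F :: "'b::real_normed_vector => 'a"
 assumes c: "c : charts" and d: "d : charts" and p: "F y : fst c" "F y : fst d" and yS: "y : S"
  and cont: "continuous (at y within S) F" and D: "((snd c o F) has_derivative D) (at y within S)"
 shows "((snd d o F) has_derivative (%v. fd (transition c d) (snd c (F y)) (D v))) (at y within S)"
proof -
 have "(transition c d has_derivative fd (transition c d) (snd c (F y))) (at ((snd c o F) y))" using transition_deriv[OF c d p] by simp
 from has_derivative_compose[OF D this]
 have 1: "((%x. transition c d ((snd c o F) x)) has_derivative (%v. fd (transition c d) (snd c (F y)) (D v))) (at y within S)" .
 have "\<forall>\<^sub>F x in at y within S. F x : fst c" using cont chart_open[OF c] p(1) unfolding continuous_within by (rule topological_tendstoD)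
 then have "\<forall>\<^sub>F x in at y within S. transition c d ((snd c o F) x) = (snd d o F) x" by eventually_elim (simp add: c)
 then show ?thesis by (rule has_derivative_transform_eventually[OF 1]) (use c p yS in auto)
qed

lemma has_velocity_iff:
 assumes c: "c : charts" and p: "x t : fst c" and t: "t : T"
 shows "has_velocity A T x t v \<longleftrightarrow> continuous (at t within T) x &
  ((snd c o x) has_vector_derivative push A c (x t) v) (at t within T)"
proof -
 define a where "a = chart_at A (x t)"
 have a: "a : charts" "x t : fst a" using chart_at chart_at_in by (auto simp: a_def)
 show ?thesis
 proof (intro iffI conjI)
  assume h: "has_velocity A T x t v"
  then show cont: "continuous (at t within T) x" by (simp add: has_velocity_def)
  from h have "((snd a o x) has_derivative (%h. h *\<^sub>R v)) (at t within T)" by (simp add: has_velocity_def a_def has_vector_derivative_def)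
  from chart_transform_has_derivative[OF a(1) c a(2) p t cont this]
  show "((snd c o x) has_vector_derivative push A c (x t) v) (at t within T)" unfolding has_vector_derivative_def push_eq a_def
   by (simp add: linear_scale[OF push_linear[OF c p, unfolded push_eq[abs_def]]])
 next
  assume h: "continuous (at t within T) x & ((snd c o x) has_vector_derivative push A c (x t) v) (at t within T)"
  then have "((snd c o x) has_derivative (%h. h *\<^sub>R push A c (x t) v)) (at t within T)" by (simp add: has_vector_derivative_def)
  from chart_transform_has_derivative[OF c a(1) p a(2) t _ this] h
  have "((snd a o x) has_derivative (%h. pull c (x t) (h *\<^sub>R push A c (x t) v))) (at t within T)" by (simp add: pull_def a_def)
  then show "has_velocity A T x t v" using h by (simp add: has_velocity_def has_vector_derivative_def a_def linear_scale[OF pull_linear[OF c p]] c p)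
 qed
qed

lemma has_velocityI:
 "c : charts ==> x t : fst c ==> t : T ==> continuous (at t within T) x ==>
  ((snd c o x) has_vector_derivative w) (at t within T) ==> has_velocity A T x t (pull c (x t) w)" by (simp add: has_velocity_iff)

lemma velocity_eq:
 assumes "has_velocity A T x t v" "at t within T ~= bot"
 shows "velocity A T x t = v"
 unfolding velocity_def by (rule vector_derivative_within[OF assms(2)]) (use assms(1) in \<open>simp add: has_velocity_def\<close>)

lemma icurve_iff:
 "icurve X T x \<longleftrightarrow> (ALL t:T. has_velocity A T x t (X (x t)))"
 unfolding integral_curve_on_def has_velocity_def continuous_on_eq_continuous_within by blast

text \<open>Smoothness on a half-line is given by local extensions, so the velocity, one-sided at
  the end point, is read off from the derivative of such an extension \<open>h\<close>.\<close>

lemma smooth_curve_chart: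
 assumes x: "smooth_curve_on A T x" and c: "c : A" and t: "t : T" "x t : fst c"
 obtains U h where "open U" "t : U" "Cinf_on U h"
  "!!s. s : T \<inter> U ==> x s : fst c ==> has_velocity A T x s (pull c (x s) (fd h s 1))"
proof -
 have c': "c : charts" by (rule atlas_charts[OF c])
 obtain U h where U: "open U" "t : U" "ALL k. Ck_on k U h" "ALL y:U \<inter> (T \<inter> x -` fst c). h y = (snd c o x) y" using x c unfolding smooth_curve_on_def unfolding smooth_on_def using t by blast
 have hC: "Cinf_on U h" using U(3) by (simp add: Cinf_on_def)
 have "has_velocity A T x s (pull c (x s) (fd h s 1))" if s: "s : T \<inter> U" "x s : fst c" for s
 proof (rule has_velocityI[where w="fd h s 1" and t=s and x=x, OF c' s(2)])
  show sT: "s : T" using s by blast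
  show cont: "continuous (at s within T) x" using x sT unfolding smooth_curve_on_def continuous_on_eq_continuous_within by blast
  have hd: "(h has_derivative fd h s) (at s)" by (rule Cinf_deriv[OF hC]) (use s in blast)
  have "fd h s = (%r. r *\<^sub>R fd h s 1)"
  proof
   fix r
   show "fd h s r = r *\<^sub>R fd h s 1" using linear_scale[OF has_derivative_linear[OF hd], of r 1] by simp
  qed
  with hd have "(h has_derivative (%r. r *\<^sub>R fd h s 1)) (at s within T)" by (simp add: has_derivative_at_withinI)
  moreover have "\<forall>\<^sub>F r in at s within T. h r = (snd c o x) r"
  proof -
   have "\<forall>\<^sub>F r in at s within T. x r : fst c"
    using cont chart_open[OF c'] s(2) unfolding continuous_within by (rule topological_tendstoD)
   moreover have "\<forall>\<^sub>F r in at s within T. r : U \<inter> T" using U(1) s by (auto simp: eventually_at_topological)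
   ultimately show ?thesis by eventually_elim (use U(4) in auto)
  qed
  ultimately show "((snd c o x) has_vector_derivative fd h s 1) (at s within T)"
   unfolding has_vector_derivative_def by (rule has_derivative_transform_eventually) (use U s in auto)
 qed
 then show ?thesis using that U(1,2) hC by blast
qed

lemma smooth_curve_has_velocity:
 assumes "smooth_curve_on A T x" "t : T" "at t within T ~= bot"
 shows "has_velocity A T x t (velocity A T x t)"
proof -
 obtain v where "has_velocity A T x t v"
  by (rule smooth_curve_chart[OF assms(1) chart_at(1) assms(2) chart_at(2)]) (use assms(2) chart_at(2) in blast)
 then show ?thesis using velocity_eq assms by metis
qed

section \<open>Submanifolds\<close>

text \<open>Unlike in \<open>is_submanifold\<close>, no base point is fixed: the condition compares
  any two points and makes sense for a chart that misses \<open>W\<close>. It is thus stable under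
  shrinking the chart and under moving it by the flow.\<close>

definition slice :: "('a, 'e) chart => 'e set => 'a set => bool" where
 "slice c L W \<longleftrightarrow> c : charts & subspace L &
  (ALL p:W \<inter> fst c. ALL q:fst c. q : W \<longleftrightarrow> snd c q - snd c p : L)"

lemma slice_iff:
 assumes c: "c : charts" and L: "subspace L" and p: "p : W" "p : fst c"
 shows "slice c L W \<longleftrightarrow> snd c ` (W \<inter> fst c) = {y : snd c ` fst c. y - snd c p : L}"
proof
 assume "slice c L W"
 then show "snd c ` (W \<inter> fst c) = {y : snd c ` fst c. y - snd c p : L}" using p unfolding slice_def by auto
next
 assume e: "snd c ` (W \<inter> fst c) = {y : snd c ` fst c. y - snd c p : L}"
 have 1: "q : W \<longleftrightarrow> snd c q - snd c p : L" if q: "q : fst c" for q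
 proof
  assume "q : W"
  then have "snd c q : snd c ` (W \<inter> fst c)" using q by blast
  then show "snd c q - snd c p : L" unfolding e by blast
 next
  assume "snd c q - snd c p : L"
  then have "snd c q : snd c ` (W \<inter> fst c)" unfolding e using q by blast
  then show "q : W" using chart_inj[OF c] q by blast
 qed
 have "q : W \<longleftrightarrow> snd c q - snd c p' : L" if "p' : W \<inter> fst c" "q : fst c" for p' q
 proof -
  have "snd c p' - snd c p : L" using 1 that by blast
  from subspace_add[OF L _ this, of "snd c q - snd c p'"] subspace_diff[OF L _ this, of "snd c q - snd c p"]
  show ?thesis using 1[OF that(2)] by auto
 qed
 then show "slice c L W" using c L unfolding slice_def by blast
qed

lemma submanifold_iff:
 "is_submanifold A d W \<longleftrightarrow> (ALL p:W. EX c L. slice c L W & p : fst c & dim L = d)"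
 (is "_ \<longleftrightarrow> ?R")
proof
 assume s: "is_submanifold A d W"
 show ?R
 proof
  fix p assume p: "p : W"
  then obtain c L where "c : charts" "p : fst c" "subspace L" "dim L = d"
   "snd c ` (W \<inter> fst c) = {y : snd c ` fst c. y - snd c p : L}" using s unfolding is_submanifold_def by blast
  then show "EX c L. slice c L W & p : fst c & dim L = d" using slice_iff[of c L p W] p by blast
 qed
next
 assume r: ?R
 show "is_submanifold A d W" unfolding is_submanifold_def
 proof
  fix p assume p: "p : W"
  then obtain c L where *: "slice c L W" "p : fst c" "dim L = d" using r by blast
  then have "c : charts" "subspace L" by (auto simp: slice_def)
  with * p show "EX c:charts. EX L. p : fst c & subspace L & dim L = d &
    snd c ` (W \<inter> fst c) = {y : snd c ` fst c. y - snd c p : L}" using slice_iff[of c L p W] by blast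
 qed
qed

lemma slice_restrict: "slice c L W ==> open U ==> U \<subseteq> fst c ==> slice (U, snd c) L W"
proof -
 assume sl: "slice c L W" and U: "open U" "U \<subseteq> fst c"
 then have "ALL p:W \<inter> U. ALL q:U. q : W \<longleftrightarrow> snd c q - snd c p : L" unfolding slice_def by blast
 moreover have "(U, snd c) : charts" "subspace L" using sl U by (auto simp: slice_def intro: charts_restrict(1))
 ultimately show ?thesis unfolding slice_def fst_conv snd_conv by blast
qed

lemma slice_curve_velocity:
 assumes sl: "slice c L W" and v: "has_velocity A T x t v" and t: "t : T" "at t within T ~= bot"
  and W: "ALL s:T. x s : W" and xt: "x t : fst c"
 shows "push A c (x t) v : L"
proof -
 have c: "c : charts" and L: "subspace L" using sl by (auto simp: slice_def)
 have d: "((snd c o x) has_vector_derivative push A c (x t) v) (at t within T)"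
  and cont: "continuous (at t within T) x" using v has_velocity_iff[of c x t T v, OF c xt t(1)] by auto
 show ?thesis
 proof (rule vector_derivative_in_subspace[OF d L])
  have "\<forall>\<^sub>F s in at t within T. x s : fst c" using cont chart_open[OF c] xt unfolding continuous_within by (rule topological_tendstoD)
  moreover have "\<forall>\<^sub>F s in at t within T. s : T" by (simp add: eventually_at_topological) blast
  ultimately show "\<forall>\<^sub>F s in at t within T. (snd c o x) s - (snd c o x) t : L"
  proof eventually_elim
   case (elim s)
   then show ?case using sl W t(1) xt unfolding slice_def comp_def by blast
  qed
 qed (rule t(2))
qed

text \<open>Curves in \<open>W\<close> have coordinate differences in \<open>L\<close>, hence
  velocities in \<open>L\<close>; conversely each direction of \<open>L\<close> is the velocity of a
  straight segment in the chart, which stays in \<open>W\<close>.\<close>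

lemma slice_tangent:
 assumes sl: "slice c L W" and p: "p : W" "p : fst c"
 shows "TS W p = {v. push A c p v : L}"
proof (intro equalityI subsetI CollectI)
 fix v assume "v : TS W p"
 then obtain x ep where x: "ep > 0" "smooth_curve_on A {-ep<..<ep} x" "x ` {-ep<..<ep} \<subseteq> W" "x 0 = p"
  "velocity A {-ep<..<ep} x 0 = v" unfolding tangent_space_def by blast
 have t: "(0::real) : {-ep<..<ep}" "at (0::real) within {-ep<..<ep} ~= bot" using x(1) at_within_open[of 0 "{-ep<..<ep}"] by auto
 have "has_velocity A {-ep<..<ep} x 0 v" using smooth_curve_has_velocity[OF x(2) t] x(5) by simp
 from slice_curve_velocity[OF sl this t] show "push A c p v : L" using x p by auto
next
 fix v assume "v : {v. push A c p v : L}"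
 define w where "w = push A c p v"
 have c: "c : charts" and L: "subspace L" using sl by (auto simp: slice_def)
 have w: "w : L" using \<open>v : _\<close> by (simp add: w_def)
 define l where "l s = snd c p + s *\<^sub>R w" for s
 have lC: "Cinf_on U l" if "open U" for U unfolding l_def by (intro Cinf_on_add Cinf_on_const Cinf_on_linear that bounded_linear_scaleR_left)
 have "open (l -` snd c ` fst c)" by (rule open_vimage[OF chart_open_range[OF c] Cinf_on_continuous[OF lC[OF open_UNIV]]])
 moreover have "0 : l -` snd c ` fst c" using p by (simp add: l_def)
 ultimately obtain ep where e: "ep > 0" "ball 0 ep \<subseteq> l -` snd c ` fst c" by (meson open_contains_ball)
 have l: "l s : snd c ` fst c" if "s : {-ep<..<ep}" for s using e(2) that by (auto simp: subset_eq)
 define x where "x s = chart_inv c (l s)" for s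
 have cont: "continuous_on {-ep<..<ep} x"
  unfolding x_def by (rule continuous_on_compose2[OF chart_inv_cont[OF c] Cinf_on_continuous[OF lC]]) (use l in auto)
 have xin: "x s : fst c" "snd c (x s) = l s" if "s : {-ep<..<ep}" for s using l[OF that] c by (auto simp: x_def)
 have x0: "x 0 = p" using c p by (simp add: x_def l_def)
 have "smooth_curve_on A {-ep<..<ep} x" unfolding smooth_curve_on_def
 proof (intro conjI ballI cont)
  fix a assume a: "a : A"
  have oU: "open ({-ep<..<ep} \<inter> x -` fst a)" by (rule continuous_open_preimage[OF cont _ chart_open[OF atlas_charts[OF a]]]) simp
  have "Cinf_on ({-ep<..<ep} \<inter> x -` fst a) (%s. transition c a (l s))"
  proof (rule Cinf_on_compose[OF oU lC[OF oU] transition_Cinf[OF c atlas_charts[OF a]]])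
   show "l ` ({-ep<..<ep} \<inter> x -` fst a) \<subseteq> snd c ` (fst c \<inter> fst a)" using xin by force
  qed
  then show "smooth_on ({-ep<..<ep} \<inter> x -` fst a) (snd a o x)" unfolding smooth_on_open[OF oU] by (simp add: x_def o_def)
 qed
 moreover have "x ` {-ep<..<ep} \<subseteq> W"
 proof
  fix q assume "q : x ` {-ep<..<ep}"
  then obtain s where s: "s : {-ep<..<ep}" "q = x s" by blast
  show "q : W" using xin[OF s(1)] s(2) w L using sl p xin[OF s(1)] s(2) unfolding slice_def by (simp add: l_def subspace_scale)
 qed
 moreover have "velocity A {-ep<..<ep} x 0 = v"
 proof (rule velocity_eq)
  have t: "0 : {-ep<..<ep}" using e by simp
  have "(l has_vector_derivative w) (at 0 within {-ep<..<ep})" unfolding l_def by (auto intro!: derivative_eq_intros)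
  then have "((snd c o x) has_vector_derivative w) (at 0 within {-ep<..<ep})" by (rule has_vector_derivative_transform[OF t, rotated]) (simp add: xin)
  then show "has_velocity A {-ep<..<ep} x 0 v" using has_velocity_iff[of c x 0 "{-ep<..<ep}" v] c p t cont
   by (simp add: x0 w_def continuous_on_eq_continuous_within)
 qed (use e at_within_open[of 0 "{-ep<..<ep}"] in auto)
 ultimately show "v : TS W p" unfolding tangent_space_def using e x0 by blast
qed

lemma tangent_space_pull:
 assumes "slice c L W" "p : W" "p : fst c"
 shows "TS W p = pull c p ` L" unfolding slice_tangent[OF assms] using assms by (auto simp: slice_def image_iff) (metis pull_push)

lemma slice_dim:
 assumes sl: "slice c L W" and p: "p : W" "p : fst c"
 shows "subspace (TS W p)" "dim (TS W p) = dim L"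
proof -
 have c: "c : charts" and L: "subspace L" using sl by (auto simp: slice_def)
 have lin: "linear (pull c p)" by (rule pull_linear[OF c p(2)])
 show "subspace (TS W p)" unfolding tangent_space_pull[OF assms] by (rule linear_subspace_image[OF lin L])
 have "inj_on (pull c p) (span L)" using c p by (intro inj_onI) (metis push_pull)
 then show "dim (TS W p) = dim L" unfolding tangent_space_pull[OF assms] by (rule dim_image_eq[OF lin])
qed

lemma sub_dim:
 assumes "is_submanifold A d W" "p : W"
 shows "subspace (TS W p)" "dim (TS W p) = d" using assms slice_dim unfolding submanifold_iff by blast+

lemma dim_submanifold_eq:
 assumes "is_submanifold A d W" "p : W"
 shows "dim_submanifold A W = d" unfolding dim_submanifold_def using assms sub_dim(2) by (metis the_equality)

lemma UNIV_slice: "c : charts ==> slice c UNIV UNIV" by (simp add: slice_def)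

lemma UNIV_submanifold: "is_submanifold A DIM('e) UNIV" unfolding submanifold_iff using UNIV_slice chart_at chart_at_in by (metis dim_UNIV)

lemma tangent_space_UNIV: "TS UNIV p = UNIV" using slice_tangent[OF UNIV_slice[OF chart_at_in]] chart_at by blast

section \<open>Convergence in the tangent bundle\<close>

text \<open>Tangent vectors at different points are written in unrelated charts, so
  \<open>v t\<close> and \<open>v0\<close> can only be compared in a common chart around the limit;
  asking for all charts makes the notion independent of the choice.\<close>

definition tb_tendsto :: "('b => 'a) => ('b => 'e) => 'a => 'e => 'b filter => bool" where
 "tb_tendsto q v q0 v0 F \<longleftrightarrow> (q ---> q0) F &
  (ALL c:charts. q0 : fst c --> ((%t. push A c (q t) (v t)) ---> push A c q0 v0) F)"

lemma transition_deriv_tendsto: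
 assumes c: "c : charts" and d: "d : charts" and q0: "q0 : fst c" "q0 : fst d"
  and x: "(x ---> snd c q0) F" and w: "(w ---> w0) F"
 shows "((%t. fd (transition c d) (x t) (w t)) ---> fd (transition c d) (snd c q0) w0) F"
proof -
 define U where "U = snd c ` (fst c \<inter> fst d)"
 have U: "open U" unfolding U_def using chart_open[OF c] chart_open[OF d] by (auto intro!: chart_open_image[OF c])
 have "Cinf_on (U \<times> UNIV) (%p. fd (transition c d) (fst p) (snd p))"
  by (rule Cinf_on_derivative_apply[OF _ transition_Cinf[OF c d, folded U_def]])
   (use U in \<open>auto intro!: open_Times Cinf_on_linear bounded_linear_fst bounded_linear_snd\<close>)
 from Cinf_on_continuous[OF this] have "isCont (%p. fd (transition c d) (fst p) (snd p)) (snd c q0, w0)"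
  unfolding continuous_on_eq_continuous_at[OF open_Times[OF U open_UNIV]] using q0 by (auto simp: U_def)
 from isCont_tendsto_compose[OF this tendsto_Pair[OF x w]] show ?thesis by simp
qed

lemma chart_tendsto: "c : charts ==> q0 : fst c ==> (q ---> q0) F ==> ((%t. snd c (q t)) ---> snd c q0) F"
 using isCont_tendsto_compose[OF chart_isCont] .

lemma ev_chart: "c : charts ==> q0 : fst c ==> (q ---> q0) F ==> \<forall>\<^sub>F t in F. q t : fst c" using topological_tendstoD chart_open by metis

lemma chart_tendstoD:
 assumes c: "c : charts" and q0: "q0 : fst c" and ev: "\<forall>\<^sub>F t in F. q t : fst c"
  and l: "((%t. snd c (q t)) ---> snd c q0) F"
 shows "(q ---> q0) F"
proof -
 have "((%t. chart_inv c (snd c (q t))) ---> q0) F" using isCont_tendsto_compose[OF chart_inv_isCont[OF c] l] q0 c q0 by simp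
 then show ?thesis by (rule Lim_transform_eventually) (use ev c in \<open>auto elim: eventually_mono\<close>)
qed

lemma tb_tendsto_iff:
 assumes c: "c : charts" and q0: "q0 : fst c"
 shows "tb_tendsto q v q0 v0 F \<longleftrightarrow> (q ---> q0) F & ((%t. push A c (q t) (v t)) ---> push A c q0 v0) F"
proof
 assume r: "(q ---> q0) F & ((%t. push A c (q t) (v t)) ---> push A c q0 v0) F"
 show "tb_tendsto q v q0 v0 F" unfolding tb_tendsto_def
 proof (intro conjI ballI impI)
  fix d assume d: "d : charts" "q0 : fst d"
  have "((%t. fd (transition c d) (snd c (q t)) (push A c (q t) (v t)))
   ---> fd (transition c d) (snd c q0) (push A c q0 v0)) F" using r chart_tendsto[OF c q0] by (intro transition_deriv_tendsto[OF c d(1) q0 d(2)]) auto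
  then have "((%t. fd (transition c d) (snd c (q t)) (push A c (q t) (v t)))
   ---> push A d q0 v0) F" by (simp add: push_change[OF c d(1) q0 d(2)])
  then show "((%t. push A d (q t) (v t)) ---> push A d q0 v0) F"
  proof (rule Lim_transform_eventually)
   have "\<forall>\<^sub>F t in F. q t : fst c" "\<forall>\<^sub>F t in F. q t : fst d" using r ev_chart c d q0 by blast+
   then show "\<forall>\<^sub>F t in F. fd (transition c d) (snd c (q t)) (push A c (q t) (v t)) = push A d (q t) (v t)"
    by eventually_elim (simp add: push_change[OF c d(1)])
  qed
 qed (use r in simp)
qed (use assms in \<open>auto simp: tb_tendsto_def\<close>)

end

section \<open>Coordinate projections and hyperbolic linear flows\<close>

definition proj :: "'e::euclidean_space set => 'e => 'e" where
 "proj B x = (\<Sum>b\<in>B. inner x b *\<^sub>R b)"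

text \<open>The flow of \<open>hfield B\<close>, which is minus the gradient of the Morse normal
  form - |proj B x|^2 + |x - proj B x|^2. The normal form carries no factor 1/2, whence the
  exponents 2t.\<close>

definition dflow :: "'e::euclidean_space set => real => 'e => 'e" where
 "dflow B t x = exp (2 * t) *\<^sub>R proj B x + exp (- (2 * t)) *\<^sub>R (x - proj B x)"

lemma linear_proj: "linear (proj B)" unfolding proj_def by (rule linearI) (simp_all add: inner_add_left scaleR_add_left sum.distrib scaleR_sum_right)

lemma bounded_linear_proj: "bounded_linear (proj B :: 'e::euclidean_space => 'e)" using linear_proj linear_conv_bounded_linear by blast

lemma inner_proj: "B \<subseteq> Basis ==> b : Basis ==> inner (proj B x) b = (if b : B then inner x b else 0)"
proof -
 assume B: "B \<subseteq> Basis" and b: "b : Basis"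
 have fB: "finite B" using B finite_subset finite_Basis by blast
 have "inner (proj B x) b = (\<Sum>c\<in>B. inner x c * inner c b)" by (simp add: proj_def inner_sum_left)
 also have "\<dots> = (\<Sum>c\<in>B. if c = b then inner x b else 0)" using B b by (intro sum.cong refl) (auto simp: inner_Basis)
 finally show ?thesis using fB by simp
qed

lemma proj_idem [simp]: "B \<subseteq> Basis ==> proj B (proj B x) = proj B x" by (rule euclidean_eqI) (simp add: inner_proj)

lemma proj_in_span: "proj B x : span B" unfolding proj_def by (intro span_sum span_scale span_base)

lemma in_span_iff: "B \<subseteq> Basis ==> x : span B \<longleftrightarrow> proj B x = x"
proof
 assume B: "B \<subseteq> Basis" and x: "x : span B"
 from x show "proj B x = x"
 proof (induction rule: span_induct_alt)
  case base
  show ?case by (simp add: linear_0[OF linear_proj])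
 next
  case (step c x y)
  have "proj B x = x" by (rule euclidean_eqI) (use B step in \<open>auto simp: inner_proj inner_Basis\<close>)
  then show ?case using step by (simp add: linear_add[OF linear_proj] linear_scale[OF linear_proj])
 qed
qed (metis proj_in_span)

lemma proj_compl: "B \<subseteq> Basis ==> proj (Basis - B) x = x - proj B x" by (rule euclidean_eqI) (auto simp: inner_proj inner_diff_left)

lemma in_span_compl_iff: "B \<subseteq> Basis ==> x : span (Basis - B) \<longleftrightarrow> proj B x = 0"
 using in_span_iff[of "Basis - B" x] by (auto simp: proj_compl)

lemma inner_proj_compl: "B \<subseteq> Basis ==> inner (proj B x) (y - proj B y) = 0"
 by (subst euclidean_inner) (auto intro!: sum.neutral simp: inner_proj inner_diff_left)

lemma norm_proj_sq: "B \<subseteq> Basis ==> (norm x)\<^sup>2 = (norm (proj B x))\<^sup>2 + (norm (x - proj B x))\<^sup>2"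
proof -
 assume B: "B \<subseteq> Basis"
 have "inner (proj B x + (x - proj B x)) (proj B x + (x - proj B x))
  = inner (proj B x) (proj B x) + inner (x - proj B x) (x - proj B x)"
  using inner_proj_compl[OF B, of x x] inner_commute[of "proj B x" "x - proj B x"] by (simp only: inner_add_left inner_add_right)
 then show ?thesis by (simp add: power2_norm_eq_inner)
qed

lemma norm_proj_le: "B \<subseteq> Basis ==> norm (proj B x) <= norm x" "B \<subseteq> Basis ==> norm (x - proj B x) <= norm x"
 using norm_proj_sq[of B x] by (auto intro!: power2_le_imp_le[OF _ norm_ge_zero])

lemma sum_inner_sq: "B \<subseteq> Basis ==> (\<Sum>b\<in>B. (inner x b)\<^sup>2) = (norm (proj B x))\<^sup>2"
proof -
 assume B: "B \<subseteq> Basis"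
 have "(norm (proj B x))\<^sup>2 = inner (proj B x) (proj B x)" by (simp add: power2_norm_eq_inner)
 also have "\<dots> = (\<Sum>b\<in>B. inner x b * inner (proj B x) b)" by (subst (2) proj_def) (simp add: inner_sum_right)
 also have "\<dots> = (\<Sum>b\<in>B. (inner x b)\<^sup>2)" using B by (intro sum.cong refl) (simp add: inner_proj subsetD power2_eq_square)
 finally show ?thesis by simp
qed

lemma dim_span_Basis_subset: "B \<subseteq> (Basis :: 'e::euclidean_space set) ==> dim (span B) = card B"
 by (simp add: dim_eq_card_independent[OF independent_mono[OF independent_Basis]])

lemma proj_dflow:
 assumes "B \<subseteq> Basis"
 shows "proj B (dflow B t x) = exp (2 * t) *\<^sub>R proj B x"
  "dflow B t x - proj B (dflow B t x) = exp (- (2 * t)) *\<^sub>R (x - proj B x)"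
 using assms by (simp_all add: dflow_def linear_add[OF linear_proj] linear_scale[OF linear_proj] linear_diff[OF linear_proj])

lemma dflow_0 [simp]: "dflow B 0 x = x" by (simp add: dflow_def)

lemma dflow_add: "B \<subseteq> Basis ==> dflow B (s + t) x = dflow B s (dflow B t x)"
proof -
 assume B: "B \<subseteq> Basis"
 have "dflow B s (dflow B t x) = exp (2 * s) *\<^sub>R proj B (dflow B t x)
   + exp (- (2 * s)) *\<^sub>R (dflow B t x - proj B (dflow B t x))" by (simp only: dflow_def[of B s])
 also have "\<dots> = dflow B (s + t) x"
  unfolding proj_dflow(2)[OF B] unfolding proj_dflow(1)[OF B] dflow_def[of B "s + t"] by (simp add: exp_add[symmetric])
 finally show ?thesis by simp
qed

lemma linear_dflow: "linear (dflow B t)" unfolding dflow_def by (rule linearI)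
  (simp_all add: linear_add[OF linear_proj] linear_scale[OF linear_proj] algebra_simps)

lemma bounded_linear_dflow: "bounded_linear (dflow B t :: 'e::euclidean_space => 'e)" using linear_dflow linear_conv_bounded_linear by blast

definition hfield :: "'e::euclidean_space set => 'e => 'e" where
 "hfield B x = 2 *\<^sub>R proj B x - 2 *\<^sub>R (x - proj B x)"

lemma dflow_has_vector_derivative:
 assumes "B \<subseteq> Basis"
 shows "((%s. dflow B s x) has_vector_derivative hfield B (dflow B s x)) (at s within T)"
proof -
 have "((%s. dflow B s x) has_vector_derivative
   (2 * exp (2 * s)) *\<^sub>R proj B x + (- 2 * exp (- (2 * s))) *\<^sub>R (x - proj B x)) (at s within T)"
  unfolding dflow_def by (auto intro!: derivative_eq_intros bounded_linear.has_vector_derivative[OF bounded_linear_scaleR_left] simp: mult.commute simp flip: has_real_derivative_iff_has_vector_derivative)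
 then show ?thesis unfolding hfield_def proj_dflow(2)[OF assms] unfolding proj_dflow(1)[OF assms] by simp
qed

lemma inner_hfield: "B \<subseteq> Basis ==> b : Basis ==> inner (hfield B x) b = (if b : B then 2 else - 2) * inner x b"
 by (simp add: hfield_def inner_diff_left inner_proj)

section \<open>Integral curves\<close>

text \<open>In each coordinate the difference times exp (- h t) has zero derivative. This elementary
  case suffices, because \<open>X\<close> is constant or diagonal in suitable charts around every
  point.\<close>

lemma diagonal_ode_unique:
 fixes u v :: "real => 'e::euclidean_space"
 assumes T: "convex T"
  and u: "!!r b. r : T ==> b : Basis ==> ((%r. inner (u r) b) has_real_derivative e b + h b * inner (u r) b) (at r within T)"
  and v: "!!r b. r : T ==> b : Basis ==> ((%r. inner (v r) b) has_real_derivative e b + h b * inner (v r) b) (at r within T)"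
  and t: "t : T" "u t = v t" and s: "s : T"
 shows "u s = v s"
proof (rule euclidean_eqI)
 fix b :: 'e assume b: "b : Basis"
 define d where "d r = inner (u r) b - inner (v r) b" for r
 have d': "(d has_real_derivative h b * d r) (at r within T)" if "r : T" for r
  unfolding d_def using DERIV_diff[OF u[OF that b] v[OF that b]] by (simp add: algebra_simps)
 have "((%r. exp (- h b * r) * d r) has_real_derivative 0) (at r within T)" if "r : T" for r
  by (rule derivative_eq_intros d'[OF that] refl)+ (simp add: algebra_simps)
 then have "((%r. exp (- h b * r) * d r) has_derivative (%_. 0)) (at r within T)" if "r : T" for r
  using that by (simp add: has_field_derivative_def lambda_zero)
 from has_derivative_zero_unique[OF T this s t(1)]
 show "inner (u s) b = inner (v s) b" using t(2) by (simp add: d_def)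
qed

context manifold
begin

lemma has_velocity_affine:
 assumes "has_velocity A T x (k * s + a) v"
 shows "has_velocity A {s. k * s + a : T} (%s. x (k * s + a)) s (k *\<^sub>R v)"
proof -
 let ?f = "%s. k * s + a" and ?S = "{s. k * s + a : T}"
 have sub: "?f ` ?S \<subseteq> T" by auto
 have cf: "continuous (at s within ?S) ?f" by (intro continuous_intros)
 have df: "(?f has_vector_derivative k) (at s within ?S)" by (auto intro!: derivative_eq_intros)
 have "continuous (at (?f s) within ?f ` ?S) x" using assms continuous_within_subset[OF _ sub] by (auto simp: has_velocity_def)
 from continuous_within_compose2[OF cf this]
 have 1: "continuous (at s within ?S) (%s. x (?f s))" .
 have "((snd (chart_at A (x (?f s))) o x) has_vector_derivative v) (at (?f s) within ?f ` ?S)"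
  using assms has_vector_derivative_within_subset[OF _ sub] by (auto simp: has_velocity_def)
 from vector_diff_chain_within[OF df this]
 have "((snd (chart_at A (x (?f s))) o (%s. x (?f s))) has_vector_derivative k *\<^sub>R v) (at s within ?S)" by (simp add: o_def)
 with 1 show ?thesis by (simp add: has_velocity_def)
qed

text \<open>The alternative \<open>= bot\<close> covers times that are isolated from one of the two
  sets.\<close>

lemma has_velocity_union:
 assumes "has_velocity A S x t v | at t within S = bot" "has_velocity A T x t v | at t within T = bot"
 shows "has_velocity A (S \<union> T) x t v"
proof -
 let ?g = "snd (chart_at A (x t)) o x"
 have e: "has_velocity A S x t v \<longleftrightarrow> (x ---> x t) (at t within S) &
  ((%s. (1 / norm (s - t)) *\<^sub>R (?g s - (?g t + (s - t) *\<^sub>R v))) ---> 0) (at t within S)" for S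
  unfolding has_velocity_def continuous_within has_vector_derivative_def has_derivative_within by (auto intro: bounded_linear_scaleR_left)
 show ?thesis using assms unfolding e at_within_union[of t S T] by (auto intro: filterlim_sup)
qed

lemma has_velocity_cong:
 assumes "has_velocity A T x t v" "!!s. s : T ==> y s = x s" "t : T"
 shows "has_velocity A T y t v"
proof -
 have yt: "y t = x t" using assms by blast
 have "continuous (at t within T) y" using assms(1) continuous_transform_within[of t T x 1 y] assms(2,3) by (auto simp: has_velocity_def)
 moreover have "((snd (chart_at A (y t)) o y) has_vector_derivative v) (at t within T)"
 proof (rule has_vector_derivative_transform[OF assms(3)])
  show "((snd (chart_at A (x t)) o x) has_vector_derivative v) (at t within T)" using assms(1) by (simp only: has_velocity_def)
 qed (simp add: assms(2) yt)
 ultimately show ?thesis by (simp add: has_velocity_def)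
qed

lemma has_velocity_subset: "has_velocity A T x t v ==> S \<subseteq> T ==> has_velocity A S x t v"
 unfolding has_velocity_def using continuous_within_subset has_vector_derivative_within_subset by blast

lemma icurve_subset: "icurve X T x ==> S \<subseteq> T ==> icurve X S x" unfolding icurve_iff using has_velocity_subset by blast

lemma integral_curve_affine:
 assumes "icurve X T x"
 shows "icurve (%p. k *\<^sub>R X p) {s. k * s + a : T} (%s. x (k * s + a))" using assms has_velocity_affine unfolding icurve_iff by blast

lemma integral_curve_shift:
 "icurve X T x ==> icurve X {s. s + a : T} (%s. x (s + a))" using integral_curve_affine[of X T x 1 a] by simp

lemma integral_curve_reverse:
 "icurve X T x ==> icurve (%p. - X p) {s. - s : T} (%s. x (- s))" using integral_curve_affine[of X T x "-1" 0] by simp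

lemma integral_curve_cong:
 "icurve X T x ==> (!!s. s : T ==> y s = x s) ==> icurve X T y" unfolding icurve_iff using has_velocity_cong by metis

lemma integral_curve_union:
 assumes "icurve X S x" "icurve X T x" "closed S" "closed T"
 shows "icurve X (S \<union> T) x" unfolding icurve_iff
proof
 have bot: "at t within R = bot" if "closed R" "t \<notin> R" for t and R :: "real set" using that closed_limpt trivial_limit_within by blast
 fix t assume "t : S \<union> T"
 show "has_velocity A (S \<union> T) x t (X (x t))" by (rule has_velocity_union) (use assms bot in \<open>auto simp: icurve_iff\<close>)
qed

lemma icurve_continuous: "icurve X T x ==> continuous_on T x" by (simp add: integral_curve_on_def)

lemma integral_curve_chart:
 assumes "icurve X T x" "c : charts" "t : T" "x t : fst c"
 shows "((%s. snd c (x s)) has_vector_derivative push A c (x t) (X (x t))) (at t within T)"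
 using assms has_velocity_iff[of c x t T "X (x t)"] by (auto simp: icurve_iff o_def)

lemma integral_curveI_chart:
 assumes c: "c : charts" and u: "!!t. t : T ==> u t : snd c ` fst c"
  and d: "!!t. t : T ==> (u has_vector_derivative push A c (chart_inv c (u t)) (X (chart_inv c (u t)))) (at t within T)"
 shows "icurve X T (%t. chart_inv c (u t))" unfolding icurve_iff
proof
 fix t assume t: "t : T"
 have in_c: "chart_inv c (u s) : fst c" if "s : T" for s by (rule chart_inv_in[OF u[OF that]])
 have "continuous (at t within T) u" using d[OF t] has_vector_derivative_continuous by blast
 then have "continuous (at t within T) (%t. chart_inv c (u t))"
  by (rule continuous_within_compose3[where f=u and x=t and s=T and g="chart_inv c", OF chart_inv_isCont[OF c u[OF t]]])
 moreover have "((snd c o (%t. chart_inv c (u t))) has_vector_derivative push A c (chart_inv c (u t)) (X (chart_inv c (u t)))) (at t within T)"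
  by (rule has_vector_derivative_transform[OF t _ d[OF t]]) (use c u in simp)
 ultimately show "has_velocity A T (%t. chart_inv c (u t)) t (X (chart_inv c (u t)))"
  using has_velocity_iff[of c "%t. chart_inv c (u t)" t T, OF c in_c[OF t] t] by blast
qed

text \<open>A common interface to the two normal forms of \<open>X\<close>: flow boxes away from
  critical points and Morse charts at them. \<open>ps\<close> is a global flow on the coordinate
  space, but represents \<open>X\<close> only while it stays in the range of the chart. By the last
  clause \<open>X\<close> is affine and diagonal in coordinates, which is what uniqueness of
  solutions uses.\<close>

definition model_chart :: "('a => 'e) => ('a, 'e) chart => (real => 'e => 'e) => bool" where
 "model_chart X c ps \<longleftrightarrow> c : charts & (ALL x. ps 0 x = x) & (ALL s t x. ps (s + t) x = ps s (ps t x)) &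
  (ALL s. Cinf_on UNIV (ps s)) & continuous_on UNIV (%(s, x). ps s x) &
  (ALL x s T. ps s x : snd c ` fst c --> ((%s. ps s x) has_vector_derivative
   push A c (chart_inv c (ps s x)) (X (chart_inv c (ps s x)))) (at s within T)) &
  (EX e h. ALL q:fst c. ALL b:Basis. inner (push A c q (X q)) b = e b + h b * inner (snd c q) b)"

lemma model_curve:
 assumes m: "model_chart X c ps" and T: "!!s. s : T ==> ps s x : snd c ` fst c"
 shows "icurve X T (%s. chart_inv c (ps s x))" by (rule integral_curveI_chart) (use assms in \<open>auto simp: model_chart_def\<close>)

lemma model_unique:
 assumes m: "model_chart X c ps" and x: "icurve X T x" and y: "icurve X T y"
  and cT: "convex T" and xc: "!!s. s : T ==> x s : fst c" and yc: "!!s. s : T ==> y s : fst c"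
  and t: "t : T" "x t = y t" and s: "s : T"
 shows "x s = y s"
proof -
 have c: "c : charts" using m by (simp add: model_chart_def)
 obtain e h where eh: "!!q b. q : fst c ==> b : Basis ==> inner (push A c q (X q)) b = e b + h b * inner (snd c q) b"
  using m unfolding model_chart_def by blast
 have ic: "((%r. inner (snd c (z r)) b) has_real_derivative e b + h b * inner (snd c (z r)) b) (at r within T)"
  if "icurve X T z" "!!s. s : T ==> z s : fst c" "r : T" "b : Basis" for z r b
  using bounded_linear.has_vector_derivative[OF bounded_linear_inner_left integral_curve_chart[OF that(1) c that(3)], of b] that
  by (simp add: eh has_real_derivative_iff_has_vector_derivative)
 have "snd c (x s) = snd c (y s)" by (rule diagonal_ode_unique[OF cT ic[OF x xc] ic[OF y yc] t(1) _ s]) (use t in auto)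
 then show ?thesis using chart_inj[OF c xc[OF s] yc[OF s]] by blast
qed

lemma openin_interval_ball:
 fixes T :: "real set"
 assumes "continuous_on T x" "t : T" "open U" "x t : U"
 obtains de where "de > 0" "!!s. s : T \<inter> ball t de ==> x s : U"
proof -
 have "openin (top_of_set T) (T \<inter> x -` U)" using continuous_openin_preimage_gen[OF assms(1,3)] .
 then obtain de where "de > 0" "ball t de \<inter> T \<subseteq> T \<inter> x -` U" unfolding openin_contains_ball using assms by blast
 then show ?thesis using that by blast
qed

lemma transition_diffeo:
 assumes c: "c : charts" and d: "d : charts"
 shows "diffeo (snd c ` (fst c \<inter> fst d)) (snd d ` (fst c \<inter> fst d)) (transition c d) (transition d c)"
proof -
 have o: "open (snd c ` (fst c \<inter> fst d))" "open (snd d ` (fst c \<inter> fst d))"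
  using chart_open[OF c] chart_open[OF d] by (auto intro!: chart_open_image c d)
 note C = transition_Cinf[OF c d] transition_Cinf[OF d c, unfolded Int_commute[of "fst d"]]
 have "homeomorphism (snd c ` (fst c \<inter> fst d)) (snd d ` (fst c \<inter> fst d)) (transition c d) (transition d c)"
  by (rule homeomorphismI[OF C[THEN Cinf_on_continuous]]) (use c d in auto)
 with o C show ?thesis by (simp add: diffeo_def)
qed

end

lemma Cinf_on_local:
 assumes "!!x. x : U ==> EX V. open V & x : V & Cinf_on V f"
 shows "Cinf_on U f" unfolding Cinf_on_def
proof (intro allI Ck_on_local)
 fix k x assume "x : U"
 then show "EX V. open V & x : V & Ck_on k V f" using assms unfolding Cinf_on_def by blast
qed

context manifold
begin

lemma chart_overlap:
 assumes c: "c : charts" and d: "d : charts"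
 shows "open (snd c ` (fst c \<inter> fst d))" "transition c d ` snd c ` (fst c \<inter> fst d) = snd d ` (fst c \<inter> fst d)"
 using chart_open_image[OF c, of "fst c \<inter> fst d"] chart_open[OF c] chart_open[OF d] c by (auto simp: image_image)

lemma function_Cinf:
 assumes f: "smooth_function A f" and c: "c : charts"
 shows "Cinf_on (snd c ` fst c) (f o chart_inv c)"
proof (rule Cinf_on_local)
 fix x assume "x : snd c ` fst c"
 then obtain q where q: "q : fst c" "x = snd c q" by blast
 define a where "a = chart_at A q"
 have a: "a : A" "a : charts" "q : fst a" using chart_at chart_at_in by (auto simp: a_def)
 note o = chart_overlap[OF c a(2)]
 have fa: "Cinf_on (snd a ` fst a) (f o chart_inv a)" using f a(1) smooth_on_open[OF chart_open_range[OF a(2)]] unfolding smooth_function_def by blast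
 have "Cinf_on (snd c ` (fst c \<inter> fst a)) (%x. (f o chart_inv a) (transition c a x))"
  by (rule Cinf_on_compose[OF o(1) transition_Cinf[OF c a(2)] fa]) (use o(2) in auto)
 then have "Cinf_on (snd c ` (fst c \<inter> fst a)) (f o chart_inv c)" by (rule Cinf_on_cong[OF o(1), rotated]) (use c a in auto)
 then show "EX V. open V & x : V & Cinf_on V (f o chart_inv c)" using o(1) q a by blast
qed

lemma field_Cinf:
 assumes X: "smooth_field A X" and c: "c : charts"
 shows "Cinf_on (snd c ` fst c) (%x. push A c (chart_inv c x) (X (chart_inv c x)))"
proof (rule Cinf_on_local)
 fix x assume "x : snd c ` fst c"
 then obtain q where q: "q : fst c" "x = snd c q" by blast
 define a where "a = chart_at A q"
 have a: "a : A" "a : charts" "q : fst a" using chart_at chart_at_in by (auto simp: a_def)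
 define U where "U = snd c ` (fst c \<inter> fst a)"
 note o = chart_overlap[OF c a(2), folded U_def]
 have Xa: "Cinf_on (snd a ` fst a) (%x. push A a (chart_inv a x) (X (chart_inv a x)))"
  using X a(1) smooth_on_open[OF chart_open_range[OF a(2)]] unfolding smooth_field_def by blast
 have t: "Cinf_on U (transition c a)" unfolding U_def by (rule transition_Cinf[OF c a(2)])
 have "Cinf_on U (%x. (%x. push A a (chart_inv a x) (X (chart_inv a x))) (transition c a x))"
  by (rule Cinf_on_compose[OF o(1) t Xa]) (use o(2) in auto)
 then have "Cinf_on U (%x. fd (transition a c) (transition c a x)
   (push A a (chart_inv a (transition c a x)) (X (chart_inv a (transition c a x)))))"
  by (intro Cinf_on_derivative_apply[OF o(1) transition_Cinf[OF a(2) c] t]) (use o(2) in auto)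
 then have "Cinf_on U (%x. push A c (chart_inv c x) (X (chart_inv c x)))"
 proof (rule Cinf_on_cong[OF o(1), rotated])
  fix y assume "y : U"
  then obtain p where p: "p : fst c" "p : fst a" "y = snd c p" by (auto simp: U_def)
  then show "fd (transition a c) (transition c a y)
   (push A a (chart_inv a (transition c a y)) (X (chart_inv a (transition c a y))))
   = push A c (chart_inv c y) (X (chart_inv c y))" using push_change[OF a(2) c p(2,1)] c a by simp
 qed
 then show "EX V. open V & x : V & Cinf_on V (%x. push A c (chart_inv c x) (X (chart_inv c x)))" using o(1) q a by (auto simp: U_def)
qed

lemma differential_chart:
 assumes f: "smooth_function A f" and c: "c : charts" and p: "p : fst c"
 shows "differential A f p v = fd (f o chart_inv c) (snd c p) (push A c p v)"
proof -
 define a where "a = chart_at A p"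
 have a: "a : A" "a : charts" "p : fst a" using chart_at chart_at_in by (auto simp: a_def)
 note o = chart_overlap[OF a(2) c]
 have "((f o chart_inv c) has_derivative fd (f o chart_inv c) (snd c p)) (at (transition a c (snd a p)))"
  using Cinf_deriv[OF function_Cinf[OF f c], of "snd c p"] p a by simp
 from has_derivative_compose[OF transition_deriv[OF a(2) c a(3) p] this]
 have "((f o chart_inv a) has_derivative (%v. fd (f o chart_inv c) (snd c p) (fd (transition a c) (snd a p) v))) (at (snd a p))"
  by (rule has_derivative_transform_within_open[OF _ o(1)]) (use a p c in auto)
 from has_derivative_unique_at[OF this] show ?thesis unfolding differential_def push_eq by (simp add: a_def)
qed

lemma straight_chart:
 assumes X: "smooth_field A X" and nz: "X p ~= 0"
 obtains c ro e where "c : charts" "p : fst c" "ro > 0" "snd c ` fst c = ball 0 ro" "e ~= 0"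
  "!!q. q : fst c ==> push A c q (X q) = e" "model_chart X c (%s x. x + s *\<^sub>R e)"
proof -
 define a where "a = chart_at A p"
 have a: "a : A" "a : charts" "p : fst a" using chart_at chart_at_in by (auto simp: a_def)
 define g where "g x = push A a (chart_inv a x) (X (chart_inv a x))" for x
 have g: "Cinf_on (snd a ` fst a) g" unfolding g_def by (rule field_Cinf[OF X a(2)])
 have gp: "g (snd a p) = X p" using a push_chart_at by (simp add: g_def a_def)
 obtain U ro S R where S: "ro > 0" "diffeo U (ball 0 ro) S R" "U \<subseteq> snd a ` fst a" "snd a p : U" "S (snd a p) = 0"
  "!!x. x : U ==> fd S x (g x) = g (snd a p)" using straightening[OF chart_open_range[OF a(2)] g] gp nz a(3) by (metis imageI)
 define U' where "U' = {q : fst a. snd a q : U}"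
 have U': "open U'" "U' \<subseteq> fst a" "p : U'" "snd a ` U' = U" using chart_open_preimage[OF a(2), of U] S a(3) by (auto simp: U'_def diffeo_def)
 define c where "c = (U', %q. S (snd a q))"
 note cd = charts_diffeo[OF a(2) U'(1,2) S(2)[folded U'(4)], folded c_def]
 have push: "push A c q (X q) = X p" if "q : fst c" for q
 proof -
  have q: "q : U'" using that by (simp add: c_def)
  have "push A c q (X q) = fd S (snd a q) (push A a q (X q))" unfolding c_def by (rule push_diffeo[OF a(2) U'(1,2) q S(2)[folded U'(4)]])
  also have "push A a q (X q) = g (snd a q)" using q U'(2) a(2) by (auto simp: g_def)
  finally show ?thesis using S(6)[of "snd a q"] q gp by (simp add: U'_def)
 qed
 have im: "snd c ` fst c = ball 0 ro" using cd(2) by (simp add: c_def)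
 have "model_chart X c (%s x. x + s *\<^sub>R X p)" unfolding model_chart_def
 proof (intro conjI allI impI)
  show "Cinf_on UNIV (%x. x + s *\<^sub>R X p)" for s by (intro Cinf_on_add Cinf_on_const Cinf_on_linear open_UNIV bounded_linear_ident)
  show "continuous_on UNIV (%(s, x). x + s *\<^sub>R X p)" by (auto simp: case_prod_beta intro!: continuous_intros)
  fix x s T assume "x + s *\<^sub>R X p : snd c ` fst c"
  then have "push A c (chart_inv c (x + s *\<^sub>R X p)) (X (chart_inv c (x + s *\<^sub>R X p))) = X p" by (intro push chart_inv_in)
  moreover have "((%s. x + s *\<^sub>R X p) has_vector_derivative X p) (at s within T)" by (auto intro!: derivative_eq_intros)
  ultimately show "((%s. x + s *\<^sub>R X p) has_vector_derivative
   push A c (chart_inv c (x + s *\<^sub>R X p)) (X (chart_inv c (x + s *\<^sub>R X p)))) (at s within T)" by simp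
 next
  show "EX e h. ALL q:fst c. ALL b:Basis. inner (push A c q (X q)) b = e b + h b * inner (snd c q) b"
   using push by (intro exI[of _ "inner (X p)"] exI[of _ "%_. 0"]) auto
 qed (use cd(1) in \<open>auto simp: scaleR_add_left algebra_simps\<close>)
 then show ?thesis using that[OF cd(1) _ S(1) im nz push] U'(3) by (simp add: c_def)
qed

end

section \<open>Normal forms and uniqueness of integral curves of a pseudo-gradient\<close>

locale gradient_like = manifold A
 for A :: "('a::{t2_space,second_countable_topology}, 'e::euclidean_space) chart set" +
 fixes f :: "'a => real" and X :: "'a => 'e"
 assumes smooth_f: "smooth_function A f" and pg: "pseudo_gradient A f X"
begin

abbreviation "WU \<equiv> Wu A X"

abbreviation "WS \<equiv> Ws A X"

abbreviation "CX \<equiv> connecting A X"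

lemma smooth_X: "smooth_field A X" using pg by (simp add: pseudo_gradient_def)

definition morse_model :: "'a => ('a, 'e) chart => 'e set => bool" where
 "morse_model p c B \<longleftrightarrow> c : charts & p : fst c & snd c p = 0 & B \<subseteq> Basis &
  (ALL x:snd c ` fst c. f (chart_inv c x) = f p - (norm (proj B x))\<^sup>2 + (norm (x - proj B x))\<^sup>2) &
  (ALL q:fst c. push A c q (X q) = hfield B (snd c q))"

lemma quadratic_has_derivative:
 assumes "B \<subseteq> Basis"
 shows "((%x. r - (norm (proj B x))\<^sup>2 + (norm (x - proj B x))\<^sup>2) has_derivative (%h. inner h (- hfield B x))) (at x)"
proof -
 have P: "(proj B has_derivative proj B) (at x)" by (rule bounded_linear_imp_has_derivative[OF bounded_linear_proj])
 have "((%x. r - inner (proj B x) (proj B x) + inner (x - proj B x) (x - proj B x)) has_derivative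
  (%h. 0 - (inner (proj B x) (proj B h) + inner (proj B h) (proj B x)) +
   (inner (x - proj B x) (h - proj B h) + inner (h - proj B h) (x - proj B x)))) (at x)"
  by (intro has_derivative_add has_derivative_diff has_derivative_const has_derivative_inner P has_derivative_ident)
 moreover have "0 - (inner (proj B x) (proj B h) + inner (proj B h) (proj B x)) +
   (inner (x - proj B x) (h - proj B h) + inner (h - proj B h) (x - proj B x)) = inner h (- hfield B x)" for h
  using inner_proj_compl[OF assms, of x h] inner_proj_compl[OF assms, of h x] by (simp add: hfield_def inner_commute algebra_simps)
 ultimately show ?thesis by (simp only: power2_norm_eq_inner)
qed

text \<open>In the chart supplied by the pseudo-gradient property, the coordinates of
  \<open>X\<close> and \<open>hfield B\<close> are both minus the gradient of the same quadratic
  function.\<close>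

lemma morse_model_exists:
 assumes "p : Crit A f"
 obtains c B where "morse_model p c B"
proof -
 obtain c where c: "morse_chart A f p c" "ALL q:fst c. GDERIV (f o chart_inv c) (snd c q) :> - push A c q (X q)"
  using pg assms unfolding pseudo_gradient_def by blast
 then obtain B where B: "B \<subseteq> Basis" "c : charts" "p : fst c" "snd c p = 0" "ALL x:snd c ` fst c.
    f (chart_inv c x) = f p - (\<Sum>b\<in>B. (inner x b)\<^sup>2) + (\<Sum>b\<in>Basis - B. (inner x b)\<^sup>2)" unfolding morse_chart_def by blast
 have fx: "f (chart_inv c x) = f p - (norm (proj B x))\<^sup>2 + (norm (x - proj B x))\<^sup>2" if "x : snd c ` fst c" for x
  using B(5)[rule_format, OF that] sum_inner_sq[OF B(1)] sum_inner_sq[of "Basis - B" x] proj_compl[OF B(1), of x] by simp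
 have "push A c q (X q) = hfield B (snd c q)" if q: "q : fst c" for q
 proof -
  have 1: "((f o chart_inv c) has_derivative (%h. inner h (- hfield B (snd c q)))) (at (snd c q))" using quadratic_has_derivative[OF B(1)] by (rule has_derivative_transform_within_open[OF _ chart_open_range[OF B(2)]]) (use q fx in auto)
  have 2: "((f o chart_inv c) has_derivative (%h. inner h (- push A c q (X q)))) (at (snd c q))" using c(2) q by (simp add: gderiv_def)
  have "inner h (- hfield B (snd c q)) = inner h (- push A c q (X q))" for h using has_derivative_unique[OF 1 2] by meson
  then have "- hfield B (snd c q) = - push A c q (X q)" using vector_eq_ldot by metis
  then show ?thesis by simp
 qed
 then show ?thesis using that[of c B] B fx by (simp add: morse_model_def)
qed

lemma morse_model_chart:
 assumes "morse_model p c B"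
 shows "model_chart X c (dflow B)" unfolding model_chart_def
proof (intro conjI allI impI)
 have B: "B \<subseteq> Basis" using assms by (simp add: morse_model_def)
 show "c : charts" using assms by (simp add: morse_model_def)
 show "dflow B 0 x = x" for x by simp
 show "dflow B (s + t) x = dflow B s (dflow B t x)" for s t x by (rule dflow_add[OF B])
 show "Cinf_on UNIV (dflow B s)" for s by (intro Cinf_on_linear open_UNIV bounded_linear_dflow)
 show "continuous_on UNIV (%(s, x). dflow B s x)" unfolding dflow_def case_prod_beta
  by (intro continuous_intros bounded_linear.continuous_on[OF bounded_linear_proj])
 show "EX e h. ALL q:fst c. ALL b:Basis. inner (push A c q (X q)) b = e b + h b * inner (snd c q) b"
  using assms by (intro exI[of _ "%_. 0"] exI[of _ "%b. if b : B then 2 else - 2"])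
   (auto simp: morse_model_def inner_hfield[OF B])
 fix x s T assume x: "dflow B s x : snd c ` fst c"
 then show "((%s. dflow B s x) has_vector_derivative
   push A c (chart_inv c (dflow B s x)) (X (chart_inv c (dflow B s x)))) (at s within T)" using assms chart_inv_in[OF x] dflow_has_vector_derivative[OF B] by (simp add: morse_model_def)
qed

lemma differential_X: "differential A f p (X p) <= 0" "differential A f p (X p) = 0 \<longleftrightarrow> p : Crit A f"
 using pg by (auto simp: pseudo_gradient_def)

lemma X_zero_iff: "X p = 0 \<longleftrightarrow> p : Crit A f"
proof
 assume "X p = 0"
 have "linear (differential A f p)" unfolding differential_def
  using has_derivative_linear[OF Cinf_deriv[OF function_Cinf[OF smooth_f chart_at_in]]] chart_at by blast
 then show "p : Crit A f" using \<open>X p = 0\<close> linear_0 differential_X by metis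
next
 assume "p : Crit A f"
 then obtain c B where m: "morse_model p c B" using morse_model_exists by blast
 then show "X p = 0" using m pull_push[of c p "X p"] linear_0[OF pull_linear] by (simp add: morse_model_def hfield_def linear_0[OF linear_proj])
qed

lemma model_exists: "EX c ps. model_chart X c ps & p : fst c"
proof (cases "X p = 0")
 case True
 then obtain c B where "morse_model p c B" using morse_model_exists X_zero_iff by blast
 then have "model_chart X c (dflow B)" "p : fst c" using morse_model_chart[of p c B] unfolding morse_model_def by blast+
 then show ?thesis by blast
next
 case False
 obtain c e where "p : fst c" "model_chart X c (%s x. x + s *\<^sub>R e)" by (rule straight_chart[OF smooth_X False]) blast
 then show ?thesis by blast
qed

text \<open>The set of times where the curves agree is open by uniqueness in a normal-form chart and
  closed by the Hausdorff property.\<close>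

lemma integral_unique:
 assumes x: "icurve X T x" and y: "icurve X T y" and T: "convex T"
  and t: "t : T" "x t = y t" and s: "s : T"
 shows "x s = y s"
proof -
 have cx: "continuous_on T x" and cy: "continuous_on T y" using x y icurve_continuous by auto
 show ?thesis
 proof (rule connected_induction_simple[where P="%s. x s = y s" and a=t and S=T])
  show "connected T" using T by (rule convex_connected)
  fix r assume r: "r : T"
  show "EX N. openin (top_of_set T) N & r : N & (ALL s:N. ALL s':N. x s = y s --> x s' = y s')"
  proof (cases "x r = y r")
   case True
   obtain c ps where m: "model_chart X c ps" "x r : fst c" using model_exists by blast
   have oc: "open (fst c)" using m chart_open by (auto simp: model_chart_def)
   obtain d1 where d1: "d1 > 0" "!!s. s : T \<inter> ball r d1 ==> x s : fst c" using openin_interval_ball[OF cx r oc m(2)] by blast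
   obtain d2 where d2: "d2 > 0" "!!s. s : T \<inter> ball r d2 ==> y s : fst c" using openin_interval_ball[OF cy r oc] m(2) True by metis
   define N where "N = T \<inter> (ball r d1 \<inter> ball r d2)"
   have cN: "convex N" unfolding N_def using T by (intro convex_Int) auto
   have "x s = y s" if "s : N" for s by (rule model_unique[OF m(1) icurve_subset[OF x] icurve_subset[OF y] cN, of r])
     (use d1 d2 r True that in \<open>auto simp: N_def\<close>)
   moreover have "openin (top_of_set T) N" unfolding N_def by auto
   moreover have "r : N" using r d1 d2 by (simp add: N_def)
   ultimately show ?thesis by blast
  next
   case False
   then obtain U V where UV: "open U" "open V" "x r : U" "y r : V" "U \<inter> V = {}" using hausdorff[OF False] by blast
   define N where "N = (T \<inter> x -` U) \<inter> (T \<inter> y -` V)"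
   have "openin (top_of_set T) N" unfolding N_def by (intro openin_Int continuous_openin_preimage_gen cx cy UV)
   moreover have "r : N" using r UV by (simp add: N_def)
   moreover have "x s ~= y s" if "s : N" for s using that UV(5) by (auto simp: N_def)
   ultimately show ?thesis by blast
  qed
 qed (use t s in auto)
qed

lemma crit_constant:
 assumes "icurve X T x" "convex T" "t : T" "X (x t) = 0" "s : T"
 shows "x s = x t"
proof -
 have "has_velocity A T (%_. x t) r (X (x t))" for r using assms(4) by (simp add: has_velocity_def)
 then have "icurve X T (%_. x t)" by (simp add: icurve_iff)
 from integral_unique[OF assms(1) this assms(2,3) refl assms(5)] show ?thesis .
qed

text \<open>On the overlap of the two segments the curves agree by uniqueness, so the times
  \<open>r\<close>, \<open>s\<close>, \<open>t\<close> may come in any order; this lets charts be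
  transported forward and backward.\<close>

lemma concat_curves:
 assumes w1: "icurve X (closed_segment r s) w1" and w2: "icurve X (closed_segment s t) w2"
  and eq_s: "w1 s = w2 s"
 obtains w where "icurve X (closed_segment r t) w" "w r = w1 r" "w t = w2 t"
proof -
 have agree: "w1 a = w2 a" if "a : closed_segment r s" "a : closed_segment s t" for a
  by (rule integral_unique[OF icurve_subset[OF w1] icurve_subset[OF w2],
     of "closed_segment r s \<inter> closed_segment s t" s]) (use that eq_s in \<open>auto intro: convex_Int\<close>)
 define w where "w a = (if a : closed_segment r s then w1 a else w2 a)" for a
 have "icurve X (closed_segment r s \<union> closed_segment s t) w"
 proof (rule integral_curve_union)
  show "icurve X (closed_segment r s) w" by (rule integral_curve_cong[OF w1]) (simp add: w_def)
  show "icurve X (closed_segment s t) w" by (rule integral_curve_cong[OF w2]) (use agree in \<open>auto simp: w_def\<close>)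
 qed auto
 moreover have "closed_segment r t \<subseteq> closed_segment r s \<union> closed_segment s t" by (auto simp: closed_segment_eq_real_ivl)
 ultimately have "icurve X (closed_segment r t) w" by (rule icurve_subset)
 moreover have "w r = w1 r" "w t = w2 t" using agree by (auto simp: w_def)
 ultimately show ?thesis using that by blast
qed

text \<open>That \<open>z\<close> stays in the chart is a conclusion: as long as the model flow
  stays in the range it is an integral curve through the same point, and uniqueness identifies it
  with \<open>z\<close>.\<close>

lemma model_curve_eq:
 assumes m: "model_chart X c ps" and z: "icurve X (closed_segment s t) z" and zs: "z s : fst c"
  and P: "!!r. r : closed_segment 0 (t - s) ==> ps r (snd c (z s)) : snd c ` fst c"
 shows "z t : fst c" "snd c (z t) = ps (t - s) (snd c (z s))"
proof -
 have c: "c : charts" and ps0: "!!x. ps 0 x = x" using m by (auto simp: model_chart_def)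
 have "icurve X (closed_segment 0 (t - s)) (%r. chart_inv c (ps r (snd c (z s))))" by (rule model_curve[OF m]) (use P in auto)
 from integral_curve_shift[OF this, of "- s"]
 have "icurve X {r. r - s : closed_segment 0 (t - s)} (%r. chart_inv c (ps (r - s) (snd c (z s))))" by simp
 then have w: "icurve X (closed_segment s t) (%r. chart_inv c (ps (r - s) (snd c (z s))))"
  by (rule icurve_subset) (auto simp: closed_segment_eq_real_ivl)
 show "z t : fst c" "snd c (z t) = ps (t - s) (snd c (z s))" using integral_unique[OF z w, of s t] c zs ps0 P[of "t - s"] c by auto
qed

lemma model_tube:
 assumes m: "model_chart X c ps" and x0: "x0 : snd c ` fst c"
 obtains d U where "d > 0" "open U" "x0 : U" "!!r x. \<bar>r\<bar> < d ==> x : U ==> ps r x : snd c ` fst c"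
proof -
 have c: "c : charts" and ps0: "!!x. ps 0 x = x" and psc: "continuous_on UNIV (%(s, x). ps s x)" using m by (auto simp: model_chart_def)
 define P where "P = (%(s, x). ps s x) -` (snd c ` fst c)"
 have "open P" unfolding P_def by (rule open_vimage[OF chart_open_range[OF c] psc])
 moreover have "(0, x0) : P" using x0 by (simp add: P_def ps0)
 ultimately obtain I U where IU: "open I" "open U" "0 : I" "x0 : U" "I \<times> U \<subseteq> P" by (rule open_prod_elim) auto
 obtain d where d: "d > 0" "ball 0 d \<subseteq> I" using IU open_contains_ball by blast
 have "ps r x : snd c ` fst c" if "\<bar>r\<bar> < d" "x : U" for r x using that d IU by (auto simp: subset_iff P_def)
 then show ?thesis using that d IU by blast
qed

section \<open>Transport of charts along trajectories\<close>

definition flow_invariant :: "'a set => bool" where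
 "flow_invariant W \<longleftrightarrow> (ALL w s t. icurve X (closed_segment s t) w --> w s : W --> w t : W)"

lemma flow_invariantD: "flow_invariant W ==> icurve X (closed_segment s t) w ==> w s : W \<longleftrightarrow> w t : W"
 unfolding flow_invariant_def by (metis closed_segment_commute)

lemma flow_invariant_curve:
 "flow_invariant W ==> icurve X T w ==> convex T ==> s : T ==> t : T ==> w s : W \<longleftrightarrow> w t : W"
 using flow_invariantD icurve_subset closed_segment_subset by metis

text \<open>The chart \<open>d'\<close> at time \<open>t\<close> is the image under the flow of the chart \<open>d\<close> at time \<open>s\<close>.\<close>

definition flow_chart :: "real => real => ('a, 'e) chart => ('a, 'e) chart => bool" where
 "flow_chart s t d d' \<longleftrightarrow> d' : charts & (ALL q:fst d'. EX w. icurve X (closed_segment s t) w &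
  w s : fst d & w t = q & snd d (w s) = snd d' q)"

text \<open>Near \<open>z r\<close> the flow is explicit, so a chart carried to time
  \<open>a\<close> is carried on to \<open>b\<close> by composing it with the model flow for time
  \<open>a - b\<close>. The new domain consists of the points that this flow sends into the old
  one.\<close>

lemma flow_chart_step:
 assumes z: "icurve X T z" "convex T" "r : T"
 obtains N where "openin (top_of_set T) N" "r : N"
  "!!a b d'. a : N ==> b : N ==> flow_chart s a d d' ==> z a : fst d' ==> EX d''. flow_chart s b d d'' & z b : fst d''"
proof -
 obtain c ps where m: "model_chart X c ps" "z r : fst c" using model_exists by blast
 have c: "c : charts" and ps0: "!!x. ps 0 x = x" and psadd: "!!s t x. ps (s + t) x = ps s (ps t x)"
  and psC: "!!s. Cinf_on UNIV (ps s)" using m by (auto simp: model_chart_def)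
 obtain de U where de: "de > 0" "open U" "snd c (z r) : U" "!!r x. \<bar>r\<bar> < de ==> x : U ==> ps r x : snd c ` fst c"
  using model_tube[OF m(1), of "snd c (z r)"] m(2) by blast
 define V where "V = {q : fst c. snd c q : U}"
 have V: "open V" "z r : V" using chart_open_preimage[OF c de(2)] m(2) de(3) by (auto simp: V_def)
 obtain ep where ep: "ep > 0" "!!s. s : T \<inter> ball r ep ==> z s : V" using openin_interval_ball[OF icurve_continuous[OF z(1)] z(3) V] by blast
 show ?thesis
 proof (rule that[of "T \<inter> ball r (min ep (de / 2))"])
  show "openin (top_of_set T) (T \<inter> ball r (min ep (de / 2)))" by auto
  show "r : T \<inter> ball r (min ep (de / 2))" using z(3) de(1) ep(1) by simp
  fix a b d'
  assume a: "a : T \<inter> ball r (min ep (de / 2))" and b: "b : T \<inter> ball r (min ep (de / 2))"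
   and d': "flow_chart s a d d'" "z a : fst d'"
  have dc: "d' : charts" using d'(1) by (simp add: flow_chart_def)
  have ab: "\<bar>a - b\<bar> < de" using dist_triangle_half_r[of r a de b] a b by (simp add: dist_real_def)
  have P: "ps t x : snd c ` fst c" if "t : closed_segment 0 (a - b)" "x : U" for t x
   by (rule de(4)[OF _ that(2)]) (use that(1) ab in \<open>auto simp: closed_segment_eq_real_ivl split: if_splits\<close>)
  define th where "th q = chart_inv c (ps (a - b) (snd c q))" for q
  have th: "th q : fst c" "snd c (th q) = ps (a - b) (snd c q)" if "q : V" for q using P[of "a - b" "snd c q"] that c by (auto simp: th_def V_def)
  define b1 where "b1 = (V, %q. ps (a - b) (snd c q))"
  have "diffeo UNIV UNIV (ps (a - b)) (ps (b - a))" using ps0 psadd[of "a - b" "b - a"] psadd[of "b - a" "a - b"] psC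
   by (auto simp: diffeo_def Cinf_on_continuous homeomorphism_def intro!: rangeI image_eqI)
  from diffeo_restrict[OF this chart_open_image[OF c V(1)]]
  have b1: "b1 : charts" unfolding b1_def by (intro charts_diffeo(1)[OF c V(1)]) (auto simp: V_def)
  define N where "N = fst c \<inter> fst d'"
  have N: "open N" "N \<subseteq> fst c" unfolding N_def using chart_open[OF c] chart_open[OF dc] by auto
  define d'' where "d'' = ({q : V. th q : fst d'}, %q. transition c d' (snd b1 q))"
  have V2: "{q : V. th q : fst d'} = {q : fst b1. snd b1 q : snd c ` N}" using th c by (auto simp: N_def b1_def th_def) (metis IntI image_eqI)
  have o2: "open {q : V. th q : fst d'}" unfolding V2 by (rule chart_open_preimage[OF b1 chart_open_image[OF c N]])
  have D2: "diffeo (snd b1 ` {q : V. th q : fst d'}) (transition c d' ` snd b1 ` {q : V. th q : fst d'})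
    (transition c d') (transition d' c)" by (rule diffeo_restrict[OF transition_diffeo[OF c dc]])
    (use V2 chart_open_image[OF b1 o2] in \<open>auto simp: N_def b1_def\<close>)
  have "d'' : charts" unfolding d''_def by (rule charts_diffeo(1)[OF b1 o2 _ D2]) (auto simp: b1_def)
  moreover have "EX w. icurve X (closed_segment s b) w & w s : fst d & w b = q & snd d (w s) = snd d'' q"
   if "q : fst d''" for q
  proof -
   have q: "q : V" "th q : fst d'" using that by (auto simp: d''_def)
   obtain w1 where w1: "icurve X (closed_segment s a) w1" "w1 s : fst d" "w1 a = th q" "snd d (w1 s) = snd d' (th q)"
    using d'(1) q(2) unfolding flow_chart_def by blast
   have "icurve X (closed_segment 0 (a - b)) (%r. chart_inv c (ps r (snd c q)))"
    by (rule model_curve[OF m(1)]) (use P q in \<open>auto simp: V_def\<close>)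
   from icurve_subset[OF integral_curve_shift[OF this, of "- b"]]
   have "icurve X (closed_segment a b) (%r. chart_inv c (ps (r - b) (snd c q)))" by (auto simp: closed_segment_eq_real_ivl subset_iff)
   from concat_curves[OF w1(1) this] w1(3)
   obtain w where "icurve X (closed_segment s b) w" "w s = w1 s" "w b = chart_inv c (ps (b - b) (snd c q))" by (auto simp: th_def)
   then show ?thesis using w1 q c ps0 by (intro exI[of _ w]) (auto simp: d''_def b1_def th_def V_def)
  qed
  moreover have "z b : fst d''"
  proof -
   have zb: "z b : V" using b ep by auto
   have "closed_segment b a \<subseteq> T" using a b z(2) by (simp add: closed_segment_subset)
   from model_curve_eq[OF m(1) icurve_subset[OF z(1) this], of] zb P c
   have "th (z b) = z a" by (metis (no_types, lifting) V_def th_def chart_inv_snd mem_Collect_eq)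
   then show ?thesis using zb d'(2) by (simp add: d''_def)
  qed
  ultimately show "EX d''. flow_chart s b d d'' & z b : fst d''" unfolding flow_chart_def by blast
 qed
qed

text \<open>By \<open>flow_chart_step\<close> the existence of a transported chart is a locally
  constant property of the time, so it spreads over the interval from the trivial case of equal
  times. This takes the place of a global flow map.\<close>

lemma flow_chart_exists:
 assumes z: "icurve X T z" "convex T" "s : T" "t : T" and d: "d : charts" "z s : fst d"
 obtains d' where "flow_chart s t d d'" "z t : fst d'"
proof -
 let ?P = "%t. EX d'. flow_chart s t d d' & z t : fst d'"
 have "?P t"
 proof (rule connected_induction_simple[where P="?P" and a=s and S=T])
  show "connected T" using z(2) by (rule convex_connected)
  show "EX N. openin (top_of_set T) N & r : N & (ALL a:N. ALL b:N. ?P a --> ?P b)" if "r : T" for r by (rule flow_chart_step[OF z(1,2) that]) blast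
  have "icurve X (closed_segment s s) (%_. q)" for q using has_velocity_union[of "{s}" "%_. q" s "X q" "{s}"] by (simp add: trivial_limit_within islimpt_finite icurve_iff)
  then show "?P s" unfolding flow_chart_def using d by blast
 qed (fact z)+
 then show ?thesis using that by blast
qed

text \<open>Corresponding points of the two charts have equal coordinates and lie on one trajectory,
  so an invariant set satisfies the same equation in both. This spreads the slices known near a
  critical point.\<close>

lemma flow_chart_slice:
 assumes "flow_chart s t d d'" and W: "flow_invariant W" and sl: "slice d L W"
 shows "slice d' L W"
proof -
 have d': "d' : charts" and ex: "!!q. q : fst d' ==> EX q'. q' : fst d & (q' : W \<longleftrightarrow> q : W) & snd d q' = snd d' q"
  using assms(1) flow_invariantD[OF W] unfolding flow_chart_def by metis+
 then show ?thesis using sl unfolding slice_def by (metis IntD1 IntD2 IntI)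
qed

end

section \<open>Transverse intersections\<close>

context manifold
begin

text \<open>In the chart \<open>c\<close> both \<open>y - x0\<close> and \<open>D\<inverse> (transition c d y - snd d p)\<close> have derivative \<open>id\<close>
 at \<open>x0\<close>; the first detects \<open>V\<close> modulo \<open>L\<close>, the second \<open>W\<close> modulo \<open>L2\<close>, and mixing them by a projection
 \<open>pj\<close> with image in \<open>L\<close> and kernel part in \<open>L2\<close> detects both.\<close>

lemma transverse_slice:
 assumes V: "slice c L V" and W: "slice d L' W" and p: "p : V" "p : W" "p : fst c" "p : fst d"
  and trans: "{v + w | v w. v : TS V p & w : TS W p} = UNIV"
 obtains e K where "slice e K (V \<inter> W)" "p : fst e" "dim K + DIM('e) = dim L + dim L'"
  "TS (V \<inter> W) p = TS V p \<inter> TS W p"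
proof -
 have c: "c : charts" and d: "d : charts" and L: "subspace L" and L': "subspace L'" using V W by (auto simp: slice_def)
 define x0 where "x0 = snd c p"
 define D where "D = fd (transition c d) x0"
 define D' where "D' = fd (transition d c) (snd d p)"
 have Dd: "(transition c d has_derivative D) (at x0)" unfolding D_def x0_def by (rule transition_deriv[OF c d p(3,4)])
 have Dlin: "linear D" and D'lin: "linear D'"
  using has_derivative_linear[OF Dd] has_derivative_linear[OF transition_deriv[OF d c p(4,3)]] by (auto simp: D'_def)
 have Dpush: "D (push A c p v) = push A d p v" "D' (push A d p v) = push A c p v" for v
  using push_change[OF c d p(3,4), of v] push_change[OF d c p(4,3), of v] by (simp_all add: D_def D'_def x0_def)
 have DD': "D (D' v) = v" "D' (D v) = v" for v using Dpush[of "pull d p v"] Dpush[of "pull c p v"] c d p by auto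
 define L2 where "L2 = {v. D v : L'}"
 have L2: "subspace L2" unfolding L2_def using linear_subspace_vimage[OF Dlin L'] by (simp add: vimage_def)
 have tV: "TS V p = {v. push A c p v : L}" by (rule slice_tangent[OF V p(1,3)])
 have tW: "TS W p = {v. push A c p v : L2}" using slice_tangent[OF W p(2,4)] by (simp add: L2_def Dpush)
 have sum: "x : (%(a, b). a + b) ` (L \<times> L2)" for x
 proof -
  have "pull c p x : {v + w | v w. v : TS V p & w : TS W p}" using trans by simp
  then obtain v w where vw: "push A c p v : L" "push A c p w : L2" "pull c p x = v + w" by (auto simp: tV tW)
  have "x = push A c p v + push A c p w" using vw(3) c p linear_add[OF push_linear[OF c p(3)]] by (metis push_pull)
  then show ?thesis using vw by auto
 qed
 have "linear (%(a :: 'e, b). a + b)" by (rule linearI) (auto simp: algebra_simps)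
 from linear_exists_right_inverse_on[OF this subspace_Times[OF L L2]]
 obtain g where g: "range g \<subseteq> L \<times> L2" "linear g" "!!x. (%(a, b). a + b) (g x) = x" using sum by metis
 define pj where "pj x = fst (g x)" for x
 have pj: "pj x : L" "x - pj x : L2" for x using g(1) g(3)[of x] add_diff_cancel_left'[of "fst (g x)" "snd (g x)"]
  by (auto simp: pj_def image_subset_iff mem_Times_iff case_prod_beta)
 have blpj: "bounded_linear pj" "bounded_linear D'"
  using linear_compose[OF g(2) linear_fst] D'lin by (simp_all add: pj_def[abs_def] linear_conv_bounded_linear[symmetric] o_def)
 note bl = bounded_linear_sub[OF bounded_linear_ident blpj(1)] bounded_linear_compose[OF blpj]
 define U where "U = snd c ` (fst c \<inter> fst d)"
 have U: "open U" "x0 : U" using chart_overlap(1)[OF c d] p by (auto simp: U_def x0_def)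
 define Th where "Th y = ((y - x0) - pj (y - x0)) + pj (D' (transition c d y - snd d p))" for y
 have ThC: "Cinf_on U Th" unfolding Th_def
 proof (rule Cinf_on_add[OF U(1) Cinf_on_bounded_linear[OF U(1) bl(1)] Cinf_on_bounded_linear[OF U(1) bl(2)]])
  show "Cinf_on U (%y. y - x0)" "Cinf_on U (%y. transition c d y - snd d p)"
   using Cinf_on_add[OF U(1) Cinf_on_linear[OF U(1) bounded_linear_ident] Cinf_on_const[OF U(1), of "- x0"]] Cinf_on_add[OF U(1) transition_Cinf[OF c d, folded U_def] Cinf_on_const[OF U(1), of "- snd d p"]] by auto
 qed
 have "(Th has_derivative (%v. (v - pj v) + pj (D' (D v)))) (at x0)" unfolding Th_def
 proof (intro has_derivative_add bounded_linear.has_derivative[OF bl(1)] bounded_linear.has_derivative[OF bl(2)])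
  show "((%y. y - x0) has_derivative (%v. v)) (at x0)" by (auto intro!: derivative_eq_intros)
  show "((%y. transition c d y - snd d p) has_derivative D) (at x0)" using has_derivative_diff[OF Dd has_derivative_const[of "snd d p"]] by simp
 qed
 then have fdTh: "fd Th x0 = (%v. v)" by (simp add: has_derivative_unique_at DD')
 obtain U1 U2 R where D1: "diffeo U1 U2 Th R" "U1 \<subseteq> U" "x0 : U1" using smooth_inverse_diffeo[OF U(1) ThC U(2)] fdTh by auto
 define N where "N = {q : fst c. snd c q : U1}"
 have N: "open N" "N \<subseteq> fst c" "p : N" "snd c ` N = U1"
  using chart_open_preimage[OF c, of U1] D1 p by (auto simp: N_def diffeo_def x0_def U_def)
 have Nd: "N \<subseteq> fst d"
 proof
  fix q assume q: "q : N"
  then show "q : fst d" using D1(2) q N(2) chart_inj[OF c] by (auto simp: N_def U_def)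
 qed
 define e where "e = (N, %q. Th (snd c q))"
 note ed = charts_diffeo[OF c N(1,2) D1(1)[folded N(4)], folded e_def]
 have K: "subspace (L \<inter> L2)" by (rule subspace_inter[OF L L2])
 have shift: "x + y : S \<longleftrightarrow> y : S" if "subspace S" "x : S" for x y :: 'e and S
  using subspace_add[OF that, of y] subspace_diff[OF that(1) _ that(2), of "x + y"] by auto
 have mem: "q : V \<inter> W \<longleftrightarrow> Th (snd c q) : L \<inter> L2" if q: "q : N" for q
 proof -
  have q': "q : fst c" "q : fst d" using q N Nd by auto
  define a b where "a = snd c q - x0" and "b = D' (snd d q - snd d p)"
  have "q : V \<longleftrightarrow> a : L" using V q' p unfolding slice_def x0_def a_def by blast
  moreover have "q : W \<longleftrightarrow> b : L2" using W q' p unfolding slice_def L2_def b_def mem_Collect_eq DD' by blast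
  moreover have "Th (snd c q) = pj (b - a) + a" "Th (snd c q) = ((a - b) - pj (a - b)) + b"
   using q' c by (auto simp: Th_def a_def b_def linear_diff[OF bounded_linear.linear[OF blpj(1)]])
  ultimately show ?thesis using shift[OF L pj(1)[of "b - a"]] shift[OF L2 pj(2)[of "a - b"]] by (metis Int_iff)
 qed
 have sl: "slice e (L \<inter> L2) (V \<inter> W)" unfolding slice_def
 proof (intro conjI ed(1) K ballI)
  fix q r assume q: "q : (V \<inter> W) \<inter> fst e" and r: "r : fst e"
  then show "r : V \<inter> W \<longleftrightarrow> snd e r - snd e q : L \<inter> L2"
   using mem[of q] mem[of r] shift[OF K, of "snd e q" "snd e r - snd e q"] by (auto simp: e_def)
 qed
 have pe: "p : fst e" using N by (simp add: e_def)
 have "push A e p v = push A c p v" for v unfolding e_def using push_diffeo[OF c N(1,2,3) D1(1)[folded N(4)], of v] fdTh by (simp add: x0_def)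
 moreover have "TS (V \<inter> W) p = {v. push A e p v : L \<inter> L2}" by (rule slice_tangent[OF sl _ pe]) (use p in auto)
 ultimately have tan: "TS (V \<inter> W) p = TS V p \<inter> TS W p" by (auto simp: tV tW)
 have "D ` L2 = L'" using DD' by (auto simp: L2_def image_iff) metis
 then have dL2: "dim L2 = dim L'" using dim_image_eq[OF Dlin, of L2] inj_on_inverseI[of _ D' D] DD' by metis
 have "{x + y | x y. x : L & y : L2} = UNIV" using sum by (auto simp: image_iff) metis
 then have "dim (L \<inter> L2) + DIM('e) = dim L + dim L'" using dim_sums_Int[OF L L2] dL2 by simp
 with sl pe tan show ?thesis using that by blast
qed

end

section \<open>Stable and unstable manifolds as submanifolds\<close>

context gradient_like
begin

lemma Wu_flow_invariant: "flow_invariant (WU xi)" unfolding flow_invariant_def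
proof (intro allI impI)
 fix w s t assume w: "icurve X (closed_segment s t) w" and "w s : WU xi"
 then obtain y where y: "icurve X {..0} y" "y 0 = w s" "(y ---> xi) at_bot" by (auto simp: Wu_def)
 have lim: "filterlim (%r. r + (t - s)) at_bot at_bot" unfolding filterlim_at_bot eventually_at_bot_linorder
 proof
  fix Z
  show "EX N. ALL r<=N. r + (t - s) <= Z" by (rule exI[of _ "Z - (t - s)"]) auto
 qed
 have ylim: "((%r. y (r + (t - s))) ---> xi) at_bot" by (rule filterlim_compose[OF y(3) lim])
 have ysh: "icurve X {..s - t} (%r. y (r + (t - s)))" by (rule icurve_subset[OF integral_curve_shift[OF y(1), of "t - s"]]) auto
 show "w t : WU xi"
 proof (cases "s <= t")
  case True
  define z where "z r = (if r <= s - t then y (r + (t - s)) else w (r + t))" for r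
  have "icurve X ({..s - t} \<union> {s - t..0}) z"
  proof (rule integral_curve_union)
   show "icurve X {..s - t} z" by (rule integral_curve_cong[OF ysh]) (simp add: z_def)
   have "icurve X {s - t..0} (%r. w (r + t))" by (rule icurve_subset[OF integral_curve_shift[OF w, of t]])
     (auto simp: closed_segment_eq_real_ivl)
   then show "icurve X {s - t..0} z" by (rule integral_curve_cong) (use y(2) in \<open>auto simp: z_def\<close>)
  qed auto
  then have "icurve X {..0} z" by (rule icurve_subset) auto
  moreover have "z 0 = w t" using True y(2) by (auto simp: z_def)
  moreover have "(z ---> xi) at_bot"
   by (rule Lim_transform_eventually[OF ylim]) (rule eventually_mono[OF eventually_le_at_bot[of "s - t"]], simp add: z_def)
  ultimately show ?thesis by (auto simp: Wu_def)
 next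
  case False
  have "icurve X {t - s..0} (%r. w (r + s))" by (rule icurve_subset[OF integral_curve_shift[OF w, of s]])
    (auto simp: closed_segment_eq_real_ivl)
  from integral_unique[OF icurve_subset[OF y(1)] this, of 0 "t - s"]
  have "y (t - s) = w t" using False y(2) by auto
  moreover have "icurve X {..0} (%r. y (r + (t - s)))" by (rule icurve_subset[OF ysh]) (use False in auto)
  ultimately show ?thesis using ylim by (auto simp: Wu_def)
 qed
qed

lemma f_has_derivative_velocity:
 assumes z: "has_velocity A T z t v" "t : T"
 shows "((%s. f (z s)) has_real_derivative differential A f (z t) v) (at t within T)"
proof -
 define a where "a = chart_at A (z t)"
 have a: "a : charts" "z t : fst a" using chart_at chart_at_in by (auto simp: a_def)
 have zd: "(z ---> z t) (at t within T)" "((%s. snd a (z s)) has_derivative (%h. h *\<^sub>R push A a (z t) v)) (at t within T)"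
  using has_velocity_iff[of a z t T v] a z by (simp_all add: has_vector_derivative_def o_def continuous_within)
 have fd: "((f o chart_inv a) has_derivative fd (f o chart_inv a) (snd a (z t))) (at (snd a (z t)))"
  using a by (intro Cinf_deriv[OF function_Cinf[OF smooth_f]]) auto
 have 1: "((%s. (f o chart_inv a) (snd a (z s))) has_derivative (%h. h * differential A f (z t) v)) (at t within T)"
  using has_derivative_compose[OF zd(2) fd] linear_scale[OF has_derivative_linear[OF fd]] by (simp add: differential_chart[OF smooth_f a])
 have "\<forall>\<^sub>F s in at t within T. (f o chart_inv a) (snd a (z s)) = f (z s)" using ev_chart[OF a zd(1)] by eventually_elim (simp add: a)
 then have "((%s. f (z s)) has_derivative (%h. h * differential A f (z t) v)) (at t within T)"
  by (rule has_derivative_transform_eventually[OF 1]) (use a z in auto)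
 moreover have "(%h. h * differential A f (z t) v) = (*) (differential A f (z t) v)" by auto
 ultimately show ?thesis by (simp only: has_field_derivative_def)
qed

lemma f_has_derivative_curve:
 "icurve X T z ==> t : T ==>
  ((%s. f (z s)) has_real_derivative differential A f (z t) (X (z t))) (at t within T)" using f_has_derivative_velocity by (simp add: icurve_iff)

lemma f_decreasing:
 assumes z: "icurve X {s..t} z" and "s <= t"
 shows "f (z t) <= f (z s)" "s < t ==> X (z s) ~= 0 ==> f (z t) < f (z s)"
proof -
 have cont: "continuous_on {s..t} (%r. f (z r))" using f_has_derivative_curve[OF z] DERIV_continuous continuous_on_eq_continuous_within by blast
 have der: "((%r. f (z r)) has_real_derivative differential A f (z r) (X (z r))) (at r)" if "s < r" "r < t" for r
  using f_has_derivative_curve[OF z, of r] that at_within_interior[of r "{s..t}"] by simp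
 have mvt: "EX r:{s<..<t}. f (z t) - f (z s) = (t - s) * differential A f (z r) (X (z r))" if st: "s < t"
 by (metis MVT[OF st cont] der real_differentiable_def DERIV_unique greaterThanLessThan_iff)
 show "f (z t) <= f (z s)"
 proof (cases "s < t")
  case True
  then obtain r where "f (z t) - f (z s) = (t - s) * differential A f (z r) (X (z r))" using mvt by blast
  moreover have "(t - s) * differential A f (z r) (X (z r)) <= 0" using True differential_X(1) by (intro mult_nonneg_nonpos) auto
  ultimately show ?thesis by simp
 qed (use assms in auto)
 show "f (z t) < f (z s)" if st: "s < t" and nz: "X (z s) ~= 0"
 proof -
  obtain r where r: "r : {s<..<t}" "f (z t) - f (z s) = (t - s) * differential A f (z r) (X (z r))" using mvt[OF st] by blast
  have "differential A f (z r) (X (z r)) < 0" using crit_constant[OF z _ _ _, of r s] r(1) nz differential_X[of "z r"] X_zero_iff by fastforce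
  then have "(t - s) * differential A f (z r) (X (z r)) < 0" using st by (simp add: mult_pos_neg)
  then show ?thesis using r(2) by linarith
 qed
qed

lemma Crit_in_Wu: "xi : Crit A f ==> xi : WU xi"
proof -
 assume "xi : Crit A f"
 then have "has_velocity A T (%_. xi) r (X xi)" for r T using X_zero_iff[of xi] by (simp add: has_velocity_def)
 then have "icurve X {..0} (%_. xi)" by (simp add: icurve_iff)
 then show ?thesis by (auto simp: Wu_def)
qed

lemma morse_flow:
 assumes m: "morse_model xi c B" and x: "icurve X I x" and I: "convex I" "s : I" "r : I"
  and xc: "!!a. a : I ==> x a : fst c"
 shows "snd c (x s) = dflow B (s - r) (snd c (x r))"
proof -
 have c: "c : charts" and B: "B \<subseteq> Basis" using m by (auto simp: morse_model_def)
 define k where "k b = (if b : B then 2 else - 2 :: real)" for b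
 have der: "((%a. inner (u a) b) has_real_derivative 0 + k b * inner (u a) b) (at a within I)"
  if "(u has_vector_derivative hfield B (u a)) (at a within I)" "b : Basis" for u a b
  using bounded_linear.has_vector_derivative[OF bounded_linear_inner_left that(1), of b] that(2)
  by (simp add: inner_hfield[OF B] k_def has_real_derivative_iff_has_vector_derivative)
 have "snd c (x s) = dflow B s (dflow B (- r) (snd c (x r)))"
 proof (rule diagonal_ode_unique[where u="%a. snd c (x a)" and v="%a. dflow B a (dflow B (- r) (snd c (x r)))" and t=r,
    OF I(1) der der])
  show "((%a. snd c (x a)) has_vector_derivative hfield B (snd c (x a))) (at a within I)" if "a : I" for a
   using integral_curve_chart[OF x c that] m xc that by (simp add: morse_model_def)
  show "((%a. dflow B a (dflow B (- r) (snd c (x r)))) has_vector_derivative hfield B (dflow B a (dflow B (- r) (snd c (x r))))) (at a within I)" for a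
   by (rule dflow_has_vector_derivative[OF B])
  show "snd c (x r) = dflow B r (dflow B (- r) (snd c (x r)))" by (simp add: dflow_add[OF B, symmetric])
 qed (use I in auto)
 then show ?thesis by (simp add: dflow_add[OF B, symmetric])
qed

text \<open>An integral curve issuing from \<open>xi\<close> is an exponential in the Morse chart until it reaches norm
 \<open>sm\<close>, where it has dropped below the level of \<open>q\<close>.\<close>

lemma Wu_local:
 assumes m: "morse_model xi c B" and de: "cball 0 de \<subseteq> snd c ` fst c" and q: "q : fst c" "norm (snd c q) < de"
 shows "q : WU xi \<longleftrightarrow> snd c q : span B"
proof
 have c: "c : charts" and B: "B \<subseteq> Basis" and xic: "xi : fst c" "snd c xi = 0" using m by (auto simp: morse_model_def)
 have fc: "f p = f xi - (norm (proj B (snd c p)))\<^sup>2 + (norm (snd c p - proj B (snd c p)))\<^sup>2" if "p : fst c" for p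
  using m that c unfolding morse_model_def by (metis chart_inv_snd imageI)
 note mc = morse_model_chart[OF m]
 define sm where "sm = (norm (snd c q) + de) / 2"
 have sm: "norm (snd c q) < sm" "sm < de" using q(2) by (auto simp: sm_def)
 have sm0: "sm > 0" using sm(1) norm_ge_zero[of "snd c q"] by linarith
 {
  assume "q : WU xi"
  then obtain x where x: "icurve X {..0} x" "x 0 = q" "(x ---> xi) at_bot" by (auto simp: Wu_def)
  have lim0: "((%r. snd c (x r)) ---> 0) at_bot" using chart_tendsto[OF c xic(1) x(3)] xic(2) by simp
  have "\<forall>\<^sub>F r in at_bot. norm (snd c (x r)) < sm" using tendstoD[OF lim0 sm0] by simp
  with ev_chart[OF c xic(1) x(3)]
  have "\<forall>\<^sub>F r in at_bot. x r : fst c & norm (snd c (x r)) < sm" by eventually_elim auto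
  then obtain T0 where T0: "!!r. r <= T0 ==> x r : fst c & norm (snd c (x r)) < sm" unfolding eventually_at_bot_linorder by blast
  define t0 where "t0 = min T0 0"
  define y where "y = snd c (x t0)"
  text \<open>Far in the past the coordinates are bounded, so their stable part vanishes.\<close>
  have "y - proj B y = 0"
  proof (rule ccontr)
   assume "y - proj B y ~= 0"
   then have y: "norm (y - proj B y) > 0" by simp
   obtain n :: nat where n: "sm / norm (y - proj B y) < real n" using reals_Archimedean2 by blast
   define s where "s = t0 - real n"
   have "snd c (x s) = dflow B (s - t0) y" unfolding y_def
    by (rule morse_flow[OF m icurve_subset[OF x(1), of "{s..t0}"]]) (use T0 in \<open>auto simp: t0_def s_def\<close>)
   then have "exp (2 * real n) * norm (y - proj B y) <= norm (snd c (x s))" using proj_dflow(2)[OF B, of "s - t0" y] norm_proj_le(2)[OF B, of "snd c (x s)"] by (simp add: s_def)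
   moreover have "norm (snd c (x s)) < sm" using T0[of s] by (simp add: s_def t0_def)
   moreover have "sm < real n * norm (y - proj B y)" using n y by (simp add: field_simps)
   moreover have "real n <= exp (2 * real n)" using exp_ge_add_one_self[of "2 * real n"] by linarith
   then have "real n * norm (y - proj B y) <= exp (2 * real n) * norm (y - proj B y)" using y by (intro mult_right_mono) auto
   ultimately show False by simp
  qed
  then have yB: "proj B y = y" by simp
  have dy: "dflow B t y = exp (2 * t) *\<^sub>R y" for t by (simp add: dflow_def yB)
  have ysm: "norm y < sm" and t0: "t0 <= 0" "x t0 : fst c" using T0[of t0] by (simp_all add: y_def t0_def)
  have flow: "x s : fst c" "snd c (x s) = exp (2 * (s - t0)) *\<^sub>R y"
   if s: "t0 <= s" "s <= 0" "exp (2 * (s - t0)) * norm y <= sm" for s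
  proof -
   have P: "dflow B r (snd c (x t0)) : snd c ` fst c" if r: "r : closed_segment 0 (s - t0)" for r
   proof -
    have "exp (2 * r) * norm y <= exp (2 * (s - t0)) * norm y" using r s(1) by (intro mult_right_mono) (auto simp: closed_segment_eq_real_ivl)
    then have "dflow B r y : cball 0 de" using s(3) sm(2) by (simp add: dy)
    then show ?thesis using de by (auto simp: y_def)
   qed
   have "closed_segment t0 s \<subseteq> {..0}" using s by (auto simp: closed_segment_eq_real_ivl)
   from model_curve_eq[OF mc icurve_subset[OF x(1) this] t0(2) P]
   show "x s : fst c" "snd c (x s) = exp (2 * (s - t0)) *\<^sub>R y" by (simp_all add: y_def[symmetric] dy)
  qed
  have "exp (2 * (0 - t0)) * norm y <= sm"
  proof (rule ccontr)
   assume big: "\<not> ?thesis"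
   then have y0: "norm y > 0" using sm0 by (cases "y = 0") auto
   define s where "s = t0 + ln (sm / norm y) / 2"
   have e: "exp (2 * (s - t0)) * norm y = sm" using y0 sm0 by (simp add: s_def)
   then have "exp (2 * (s - t0)) * norm y < exp (2 * (0 - t0)) * norm y" using big by linarith
   then have s: "s <= 0" "t0 <= s" using y0 ysm by (simp_all add: s_def)
   note fl = flow[OF s(2,1) eq_refl[OF e]]
   have "f (x s) = f xi - sm\<^sup>2" using fc[OF fl(1)] e fl(2) by (simp add: fl(2) yB linear_scale[OF linear_proj])
   moreover have "f (x 0) <= f (x s)" using f_decreasing(1)[OF icurve_subset[OF x(1)] s(1)] by auto
   moreover have "(norm (proj B (snd c q)))\<^sup>2 < sm\<^sup>2" using norm_proj_le(1)[OF B, of "snd c q"] sm(1) by (intro power_strict_mono) auto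
   ultimately show False using fc[OF q(1)] zero_le_power2[of "norm (snd c q - proj B (snd c q))"] x(2) by simp
  qed
  from flow(2)[OF _ _ this] x(2) show "snd c q : span B" using in_span_iff[OF B, of y] yB by (simp add: t0_def span_scale)
 }
 {
  assume s: "snd c q : span B"
  have e: "dflow B t (snd c q) = exp (2 * t) *\<^sub>R snd c q" for t using in_span_iff[OF B] s by (simp add: dflow_def)
  have "dflow B t (snd c q) : snd c ` fst c" if "t : {..0}" for t
  proof -
   have "exp (2 * t) * norm (snd c q) <= 1 * norm (snd c q)" using that by (intro mult_right_mono) auto
   then show ?thesis using q(2) de by (intro subsetD[OF de]) (simp add: e)
  qed
  from model_curve[OF mc this]
  have "icurve X {..0} (%t. chart_inv c (dflow B t (snd c q)))" .
  moreover have "((%t. chart_inv c (dflow B t (snd c q))) ---> xi) at_bot"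
  proof -
   have "filterlim (%t::real. 2 * t) at_bot at_bot" by (rule filterlim_tendsto_pos_mult_at_bot[OF tendsto_const _ filterlim_ident]) simp
   then have "((%t. exp (2 * t)) ---> (0::real)) at_bot" by (rule filterlim_compose[OF exp_at_bot])
   then have "((%t. exp (2 * t) *\<^sub>R snd c q) ---> 0 *\<^sub>R snd c q) at_bot" by (intro tendsto_scaleR tendsto_const)
   then have "((%t. dflow B t (snd c q)) ---> snd c xi) at_bot" by (simp add: e xic)
   from isCont_tendsto_compose[OF chart_inv_isCont[OF c] this] show ?thesis using c xic(1) by simp
  qed
  ultimately show "q : WU xi" using c q by (auto simp: Wu_def)
 }
qed

lemma Wu_slice:
 assumes m: "morse_model xi c B" and de: "de > 0" "cball 0 de \<subseteq> snd c ` fst c"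
 shows "slice ({q : fst c. norm (snd c q) < de}, snd c) (span B) (WU xi)"
proof -
 have c: "c : charts" using m by (simp add: morse_model_def)
 have U: "open {q : fst c. norm (snd c q) < de}" using chart_open_preimage[OF c open_ball, of 0 de] by simp
 have ch: "({q : fst c. norm (snd c q) < de}, snd c) : charts" by (rule charts_restrict(1)[OF c U]) auto
 have diff: "y - x : span B \<longleftrightarrow> y : span B" if "x : span B" for x y :: 'e
  using span_add[OF _ that, of "y - x"] span_diff[OF _ that, of y] by auto
 show ?thesis unfolding slice_def using ch diff Wu_local[OF m de(2)] by auto
qed

text \<open>Backward in time each point of \<open>WU xi\<close> enters the ball described by
  \<open>Wu_slice\<close>; the slice there is carried forward along the trajectory by a flow chart,
  with the same linear model \<open>span B\<close>.\<close>

lemma Wu_submanifold: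
 assumes m: "morse_model xi c B"
 shows "is_submanifold A (card B) (WU xi)" unfolding submanifold_iff
proof
 have c: "c : charts" "xi : fst c" "snd c xi = 0" "B \<subseteq> Basis" using m by (auto simp: morse_model_def)
 obtain de where de: "de > 0" "cball 0 de \<subseteq> snd c ` fst c" using chart_open_range[OF c(1)] c(2,3) open_contains_cball by (metis imageI)
 fix p assume "p : WU xi"
 then obtain x where x: "icurve X {..0} x" "x 0 = p" "(x ---> xi) at_bot" by (auto simp: Wu_def)
 have lim0: "((%r. snd c (x r)) ---> 0) at_bot" using chart_tendsto[OF c(1,2) x(3)] c(3) by simp
 have "\<forall>\<^sub>F r in at_bot. norm (snd c (x r)) < de" using tendstoD[OF lim0 de(1)] by simp
 with ev_chart[OF c(1,2) x(3)] eventually_le_at_bot[of 0]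
 have "\<forall>\<^sub>F r in at_bot. r <= 0 & x r : fst c & norm (snd c (x r)) < de" by eventually_elim auto
 then obtain r where r: "r <= 0" "x r : {q : fst c. norm (snd c q) < de}" unfolding eventually_at_bot_linorder by auto
 note sl = Wu_slice[OF m de]
 have c': "({q : fst c. norm (snd c q) < de}, snd c) : charts" using sl by (simp add: slice_def)
 obtain d where "flow_chart r 0 ({q : fst c. norm (snd c q) < de}, snd c) d" "x 0 : fst d"
  by (rule flow_chart_exists[OF x(1) _ _ _ c', of r 0]) (use r in auto)
 from flow_chart_slice[OF this(1) Wu_flow_invariant sl] this(2)
 have "slice d (span B) (WU xi)" "x 0 : fst d" .
 then show "EX c L. slice c L (WU xi) & p : fst c & dim L = card B" using x(2) dim_span_Basis_subset[OF c(4)] by blast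
qed

lemma Ind_eq: "morse_model xi c B ==> xi : Crit A f ==> Ind A X xi = card B"
 unfolding Ind_def using dim_submanifold_eq[OF Wu_submanifold Crit_in_Wu] by blast

section \<open>Time reversal\<close>

lemma differential_minus: "differential A (%p. - f p) p v = - differential A f p v"
proof -
 have "((f o chart_inv (chart_at A p)) has_derivative fd (f o chart_inv (chart_at A p)) (snd (chart_at A p) p)) (at (snd (chart_at A p) p))"
  using chart_at by (intro Cinf_deriv[OF function_Cinf[OF smooth_f chart_at_in]]) auto
 from has_derivative_unique_at[OF has_derivative_minus[OF this]]
 show ?thesis unfolding differential_def by (simp add: o_def)
qed

lemma differential_linear: "linear (differential A f p)" unfolding differential_def
 using has_derivative_linear[OF Cinf_deriv[OF function_Cinf[OF smooth_f chart_at_in]]] chart_at by blast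

lemma Crit_minus: "Crit A (%p. - f p) = Crit A f" by (simp add: Crit_def differential_minus)

lemma hfield_compl: "B \<subseteq> Basis ==> hfield (Basis - B) x = - hfield B x" by (simp add: hfield_def proj_compl)

text \<open>Negating \<open>f\<close> and \<open>X\<close> replaces \<open>B\<close> by its
  complement in Morse charts and exchanges stable and unstable manifolds, so the facts about
  \<open>WS\<close> become instances of those about \<open>WU\<close>.\<close>

lemma reverse: "gradient_like A (%p. - f p) (%p. - X p)"
proof
 show "smooth_function A (%p. - f p)" unfolding smooth_function_def
 proof
  fix c assume "c : A"
  then have c: "c : charts" by (rule atlas_charts)
  show "smooth_on (snd c ` fst c) ((%p. - f p) o chart_inv c)" unfolding smooth_on_open[OF chart_open_range[OF c]] using Cinf_on_bounded_linear[OF chart_open_range[OF c] bounded_linear_minus[OF bounded_linear_ident] function_Cinf[OF smooth_f c]] by (simp add: o_def)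
 qed
 have push: "push A c p (- v) = - push A c p v" if "c : charts" "p : fst c" for c p v by (rule linear_neg[OF push_linear[OF that]])
 show "pseudo_gradient A (%p. - f p) (%p. - X p)" unfolding pseudo_gradient_def
 proof (intro conjI allI ballI)
  show "smooth_field A (%p. - X p)" unfolding smooth_field_def
  proof
   fix c assume "c : A"
   then have c: "c : charts" by (rule atlas_charts)
   have "Cinf_on (snd c ` fst c) (%x. push A c (chart_inv c x) (- X (chart_inv c x)))" using Cinf_on_bounded_linear[OF chart_open_range[OF c] bounded_linear_minus[OF bounded_linear_ident] field_Cinf[OF smooth_X c]] by (rule Cinf_on_cong[OF chart_open_range[OF c], rotated]) (simp add: push c chart_inv_in)
   then show "smooth_on (snd c ` fst c) (%x. push A c (chart_inv c x) (- X (chart_inv c x)))" unfolding smooth_on_open[OF chart_open_range[OF c]] .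
  qed
  fix p
  show "differential A (%p. - f p) p (- X p) <= 0" "differential A (%p. - f p) p (- X p) = 0 \<longleftrightarrow> p : Crit A (%p. - f p)"
   using differential_X[of p] by (simp_all add: differential_minus linear_neg[OF differential_linear] Crit_minus)
 next
  fix p assume "p : Crit A (%p. - f p)"
  then obtain c where c: "morse_chart A f p c" "ALL q:fst c. GDERIV (f o chart_inv c) (snd c q) :> - push A c q (X q)"
   using pg Crit_minus unfolding pseudo_gradient_def by blast
  then obtain B where B: "B \<subseteq> Basis" "c : charts" "p : fst c" "snd c p = 0" "ALL x:snd c ` fst c.
    f (chart_inv c x) = f p - (\<Sum>b\<in>B. (inner x b)\<^sup>2) + (\<Sum>b\<in>Basis - B. (inner x b)\<^sup>2)" unfolding morse_chart_def by blast
  have "morse_chart A (%p. - f p) p c" unfolding morse_chart_def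
  proof (intro conjI B(2-4) exI[of _ "Basis - B"] ballI)
   show "Basis - B \<subseteq> Basis" by blast
   have dd: "Basis - (Basis - B) = B" using B(1) by blast
   fix x assume "x : snd c ` fst c"
   then show "- f (chart_inv c x) = - f p - (\<Sum>b\<in>Basis - B. (inner x b)\<^sup>2) + (\<Sum>b\<in>Basis - (Basis - B). (inner x b)\<^sup>2)"
    unfolding dd using B(5)[rule_format, of x] by simp
  qed
  moreover have "GDERIV ((%p. - f p) o chart_inv c) (snd c q) :> - push A c q (- X q)" if "q : fst c" for q
   using GDERIV_minus[OF c(2)[rule_format, OF that]] push[OF B(2) that] by (simp add: o_def)
  ultimately show "EX c. morse_chart A (%p. - f p) p c &
    (ALL q:fst c. GDERIV ((%p. - f p) o chart_inv c) (snd c q) :> - push A c q (- X q))" by blast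
 qed
qed

interpretation rev: gradient_like A "%p. - f p" "%p. - X p" by (rule reverse)

lemma Ws_eq_Wu: "WS xi = Wu A (%p. - X p) xi"
proof (intro equalityI subsetI)
 fix p assume "p : WS xi"
 then obtain x where x: "icurve X {0..} x" "x 0 = p" "(x ---> xi) at_top" by (auto simp: Ws_def)
 have "icurve (%p. - X p) {..0} (%s. x (- s))" by (rule icurve_subset[OF integral_curve_reverse[OF x(1)]]) auto
 moreover have "((%s. x (- s)) ---> xi) at_bot" using x(3) by (simp add: filterlim_at_bot_mirror)
 ultimately show "p : Wu A (%p. - X p) xi" using x(2) by (auto simp: Wu_def)
next
 fix p assume "p : Wu A (%p. - X p) xi"
 then obtain x where x: "icurve (%p. - X p) {..0} x" "x 0 = p" "(x ---> xi) at_bot" by (auto simp: Wu_def)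
 have "icurve X {0..} (%s. x (- s))" by (rule icurve_subset[OF integral_curve_reverse[OF x(1), simplified]]) auto
 moreover have "((%s. x (- s)) ---> xi) at_top" using x(3) by (simp add: filterlim_at_bot_mirror)
 ultimately show "p : WS xi" using x(2) by (auto simp: Ws_def)
qed

lemma reverse_morse_model:
 assumes "morse_model xi c B"
 shows "gradient_like.morse_model A (%p. - f p) (%p. - X p) xi c (Basis - B)"
proof -
 have c: "c : charts" and B: "B \<subseteq> Basis" using assms by (auto simp: morse_model_def)
 show ?thesis unfolding rev.morse_model_def
 proof (intro conjI ballI)
  show "c : charts" "xi : fst c" "snd c xi = 0" "Basis - B \<subseteq> Basis" using assms by (auto simp: morse_model_def)
  show "- f (chart_inv c x) = - f xi - (norm (proj (Basis - B) x))\<^sup>2 + (norm (x - proj (Basis - B) x))\<^sup>2"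
   if "x : snd c ` fst c" for x using that assms by (auto simp: morse_model_def proj_compl[OF B])
  show "push A c q (- X q) = hfield (Basis - B) (snd c q)" if "q : fst c" for q
   using assms that unfolding morse_model_def hfield_compl[OF B] linear_neg[OF push_linear[OF c that]] by simp
 qed
qed

lemma Ws_local:
 assumes "morse_model xi c B" "cball 0 de \<subseteq> snd c ` fst c" "q : fst c" "norm (snd c q) < de"
 shows "q : WS xi \<longleftrightarrow> snd c q : span (Basis - B)"
proof -
 show ?thesis unfolding Ws_eq_Wu by (rule rev.Wu_local[OF reverse_morse_model[OF assms(1)] assms(2-4)])
qed

lemma Ws_slice:
 assumes "morse_model xi c B" "de > 0" "cball 0 de \<subseteq> snd c ` fst c"
 shows "slice ({q : fst c. norm (snd c q) < de}, snd c) (span (Basis - B)) (WS xi)"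
proof -
 show ?thesis unfolding Ws_eq_Wu by (rule rev.Wu_slice[OF reverse_morse_model[OF assms(1)] assms(2-3)])
qed

lemma Ws_submanifold:
 assumes "morse_model xi c B"
 shows "is_submanifold A (DIM('e) - card B) (WS xi)"
proof -
 have "card (Basis - B) = DIM('e) - card B"
 proof -
  have B: "B \<subseteq> Basis" using assms unfolding morse_model_def by blast
  show ?thesis by (rule card_Diff_subset[OF finite_subset[OF B finite_Basis] B])
 qed
 then show ?thesis unfolding Ws_eq_Wu using rev.Wu_submanifold[OF reverse_morse_model[OF assms]] by simp
qed

lemma Crit_in_Ws: "xi : Crit A f ==> xi : WS xi"
proof -
 show "xi : Crit A f ==> ?thesis" unfolding Ws_eq_Wu using rev.Crit_in_Wu Crit_minus by simp
qed

lemma Ws_flow_invariant: "flow_invariant (WS xi)" unfolding flow_invariant_def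
proof (intro allI impI)
 fix w s t assume w: "icurve X (closed_segment s t) w" "w s : WS xi"
 have "icurve (%p. - X p) (closed_segment (- s) (- t)) (%r. w (- r))" by (rule icurve_subset[OF integral_curve_reverse[OF w(1)]])
   (auto simp: closed_segment_eq_real_ivl)
 from rev.flow_invariantD[OF rev.Wu_flow_invariant this] w(2)
 show "w t : WS xi" by (simp add: Ws_eq_Wu)
qed

end

section \<open>Orientations of vector spaces by determinants\<close>

definition basis_list :: "'e::euclidean_space list" where
 "basis_list = (SOME xs. distinct xs & set xs = Basis)"

lemma basis_list: "distinct (basis_list :: 'e::euclidean_space list)" "set (basis_list :: 'e list) = Basis"
 "length (basis_list :: 'e list) = DIM('e)"
proof -
 have "EX xs :: 'e list. distinct xs & set xs = Basis" using finite_distinct_list[OF finite_Basis] by blast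
 from someI_ex[OF this] show *: "distinct (basis_list :: 'e list)" "set (basis_list :: 'e list) = Basis" unfolding basis_list_def by auto
 show "length (basis_list :: 'e list) = DIM('e)" using distinct_card[OF *(1)] *(2) by simp
qed

text \<open>Orientations are defined through change-of-basis matrices; measuring lists against one
  fixed order of the basis turns their signs into signs of a continuous function.\<close>

definition vol :: "'e::euclidean_space list => real" where
 "vol es = det (Matrix.mat DIM('e) DIM('e) (%(i, j). inner (es ! j) (basis_list ! i)))"

lemma tendsto_vol:
 fixes es0 :: "'e::euclidean_space list"
 assumes "!!j. j < DIM('e) ==> ((%t. es t ! j) ---> es0 ! j) F"
 shows "((%t. vol (es t)) ---> vol es0) F" unfolding vol_def Determinant.det_def using assms by (auto intro!: tendsto_intros)

lemma vol_mult:
 fixes es cs :: "'e::euclidean_space list"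
 assumes C: "C : carrier_mat DIM('e) DIM('e)"
  and cs: "!!j. j < DIM('e) ==> cs ! j = (\<Sum>i<DIM('e). C $$ (i, j) *\<^sub>R es ! i)"
 shows "vol cs = vol es * det C"
proof -
 define M where "M es = Matrix.mat DIM('e) DIM('e) (%(i, j). inner (es ! j) (basis_list ! i))" for es :: "'e list"
 have "M cs = M es * C"
 proof (rule eq_matI)
  fix i j assume ij: "i < dim_row (M es * C)" "j < dim_col (M es * C)"
  then have ij': "i < DIM('e)" "j < DIM('e)" using C by (auto simp: M_def)
  then show "M cs $$ (i, j) = (M es * C) $$ (i, j)" using C by (simp add: M_def scalar_prod_def cs inner_sum_left mult.commute atLeast0LessThan)
 qed (use C in \<open>auto simp: M_def\<close>)
 then show ?thesis unfolding vol_def using det_mult[of "M es" "DIM('e)" C] C by (simp add: M_def)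
qed

lemma in_span_list:
 assumes "x : span (set bs)"
 obtains u :: "nat => real" where "x = (\<Sum>i<length bs. u i *\<^sub>R bs ! i)"
proof -
 from assms have "EX u. x = (\<Sum>i<length bs. u i *\<^sub>R bs ! i)"
 proof (induction rule: span_induct_alt)
  case base
  show ?case by (rule exI[of _ "%_. 0"]) simp
 next
  case (step c b y)
  then obtain u j where u: "y = (\<Sum>i<length bs. u i *\<^sub>R bs ! i)" and j: "j < length bs" "bs ! j = b" by (auto simp: in_set_conv_nth)
  have "(\<Sum>i<length bs. (u i + (if i = j then c else 0)) *\<^sub>R bs ! i)
   = (\<Sum>i<length bs. u i *\<^sub>R bs ! i) + (\<Sum>i<length bs. if i = j then c *\<^sub>R bs ! i else 0)"
   unfolding sum.distrib[symmetric] by (intro sum.cong) (auto simp: scaleR_add_left)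
  also have "\<dots> = c *\<^sub>R b + y" using j u by simp
  finally show ?case by (intro exI[of _ "%i. u i + (if i = j then c else 0)"]) simp
 qed
 then show ?thesis using that by blast
qed

lemma coordinate_matrix:
 assumes "!!j. j < length cs ==> cs ! j : span (set bs)"
 obtains C :: "real Matrix.mat" where "C : carrier_mat (length bs) (length cs)"
  "!!j. j < length cs ==> cs ! j = (\<Sum>i<length bs. C $$ (i, j) *\<^sub>R bs ! i)"
proof -
 have "ALL j. EX u :: nat => real. j < length cs --> cs ! j = (\<Sum>i<length bs. u i *\<^sub>R bs ! i)" using assms in_span_list by metis
 then obtain u :: "nat => nat => real" where u: "!!j. j < length cs ==> cs ! j = (\<Sum>i<length bs. u j i *\<^sub>R bs ! i)" by metis
 show ?thesis by (rule that[of "Matrix.mat (length bs) (length cs) (%(i, j). u j i)"]) (use u in auto)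
qed

text \<open>A vector orthogonal to all of \<open>es\<close> has coordinates in the kernel of the
  transposed matrix; conversely a spanning list expresses the standard basis by a matrix that
  inverts the determinant.\<close>

lemma vol_nonzero_iff_span:
 fixes es :: "'e::euclidean_space list"
 assumes len: "length es = DIM('e)"
 shows "vol es ~= 0 \<longleftrightarrow> span (set es) = UNIV"
proof
 assume nz: "vol es ~= 0"
 define M where "M = Matrix.mat DIM('e) DIM('e) (%(i, j). inner (es ! j) (basis_list ! i))"
 have M: "transpose_mat M : carrier_mat DIM('e) DIM('e)" by (simp add: M_def)
 show "span (set es) = UNIV"
 proof (rule ccontr)
  assume "span (set es) ~= UNIV"
  then obtain a where a: "a ~= 0" "!!x. x : set es ==> inner a x = 0" using span_not_UNIV_orthogonal span_base by metis
  define w where "w = Matrix.vec DIM('e) (%i. inner a (basis_list ! i))"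
  have "transpose_mat M *\<^sub>v w = 0\<^sub>v DIM('e)"
  proof (rule eq_vecI)
   fix j assume "j < dim_vec (0\<^sub>v DIM('e) :: real Matrix.vec)"
   then have j: "j < DIM('e)" by simp
   have "(transpose_mat M *\<^sub>v w) $ j = (\<Sum>i<length (basis_list :: 'e list). inner (es ! j) (basis_list ! i) * inner a (basis_list ! i))"
    using j by (simp add: M_def w_def scalar_prod_def atLeast0LessThan basis_list(3))
   also have "\<dots> = inner a (es ! j)"
    unfolding sum.reindex_bij_betw[OF bij_betw_nth[OF basis_list(1) refl refl], of "%b. inner (es ! j) b * inner a b"]
     basis_list(2) by (simp only: euclidean_inner[of a "es ! j"] mult.commute)
   finally show "(transpose_mat M *\<^sub>v w) $ j = 0\<^sub>v DIM('e) $ j" using a(2) j len by simp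
  qed (simp add: M_def)
  moreover have "w ~= 0\<^sub>v DIM('e)"
  proof
   assume "w = 0\<^sub>v DIM('e)"
   then have "ALL b:set basis_list. inner a b = 0" unfolding all_set_conv_all_nth basis_list(3) w_def by (metis index_vec index_zero_vec(1))
   then show False using a(1) by (simp add: basis_list(2) euclidean_all_zero_iff)
  qed
  ultimately have "det (transpose_mat M) = 0" unfolding det_0_iff_vec_prod_zero[OF M] by (intro exI[of _ w]) (simp add: w_def)
  then show False using nz det_transpose[of M "DIM('e)"] by (simp add: vol_def M_def)
 qed
next
 assume s: "span (set es) = UNIV"
 obtain C :: "real Matrix.mat" where C: "C : carrier_mat (length es) (length (basis_list :: 'e list))"
  "!!j. j < length (basis_list :: 'e list) ==> basis_list ! j = (\<Sum>i<length es. C $$ (i, j) *\<^sub>R es ! i)"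
  using coordinate_matrix[of basis_list es] s by auto
 have "Matrix.mat DIM('e) DIM('e) (%(i, j). inner (basis_list ! j :: 'e) (basis_list ! i)) = 1\<^sub>m DIM('e)"
 proof (rule eq_matI)
  fix i j assume "i < dim_row (1\<^sub>m DIM('e) :: real Matrix.mat)" "j < dim_col (1\<^sub>m DIM('e) :: real Matrix.mat)"
  then have ij: "i < DIM('e)" "j < DIM('e)" by auto
  then have "basis_list ! i : (Basis :: 'e set)" "basis_list ! j : (Basis :: 'e set)"
   using nth_mem[of _ "basis_list :: 'e list"] by (auto simp: basis_list)
  then show "Matrix.mat DIM('e) DIM('e) (%(i, j). inner (basis_list ! j :: 'e) (basis_list ! i)) $$ (i, j) = 1\<^sub>m DIM('e) $$ (i, j)"
   using ij by (simp add: inner_Basis nth_eq_iff_index_eq[OF basis_list(1)] basis_list(3))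
 qed auto
 then show "vol es ~= 0" using vol_mult[of C basis_list es] C len by (auto simp: vol_def basis_list(3))
qed

lemma vol_nonzero_iff:
 fixes es :: "'e::euclidean_space list"
 assumes len: "length es = DIM('e)"
 shows "vol es ~= 0 \<longleftrightarrow> distinct es & independent (set es)" unfolding vol_nonzero_iff_span[OF len]
proof
 assume s: "span (set es) = UNIV"
 have "DIM('e) = dim (set es)" using s by (metis dim_UNIV dim_span)
 also have "\<dots> <= card (set es)" by (rule dim_le_card') simp
 finally have c: "card (set es) = length es" using card_length[of es] len by simp
 moreover have "independent (set es)" by (rule card_le_dim_spanning[of _ UNIV]) (use s c len in auto)
 ultimately show "distinct es & independent (set es)" using card_distinct by blast
next
 assume di: "distinct es & independent (set es)"
 have "UNIV \<subseteq> span (set es)" by (rule card_ge_dim_independent) (use di len distinct_card[of es] in auto)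
 then show "span (set es) = UNIV" by blast
qed

lemma obasis_UNIV_iff:
 "obasis UNIV (es :: 'e::euclidean_space list) \<longleftrightarrow> length es = DIM('e) & vol es ~= 0"
proof
 assume o: "obasis UNIV es"
 then show "length es = DIM('e) & vol es ~= 0" using distinct_card[of es] dim_eq_card_independent[of "set es"] unfolding ordered_basis_def using o vol_nonzero_iff[of es] by (metis dim_UNIV dim_span)
next
 assume "length es = DIM('e) & vol es ~= 0"
 then show "obasis UNIV es" using vol_nonzero_iff[of es] vol_nonzero_iff_span[of es] by (auto simp: ordered_basis_def)
qed

lemma sum_nth_append:
 "(\<Sum>i<length bs + length rs. g i *\<^sub>R (bs @ rs) ! i)
  = (\<Sum>i<length bs. g i *\<^sub>R bs ! i) + (\<Sum>i<length rs. g (length bs + i) *\<^sub>R rs ! i)"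
proof -
 have "(\<Sum>i<length bs + length rs. g i *\<^sub>R (bs @ rs) ! i)
  = (\<Sum>i\<in>{..<length bs} \<union> (%i. length bs + i) ` {..<length rs}. g i *\<^sub>R (bs @ rs) ! i)"
 proof (rule sum.cong[OF _ refl])
  have "x < a + b \<longleftrightarrow> x < a | (EX i<b. x = a + i)" for x a b :: nat by presburger
  then show "{..<length bs + length rs} = {..<length bs} \<union> (%i. length bs + i) ` {..<length rs}" by auto
 qed
 also have "\<dots> = (\<Sum>i<length bs. g i *\<^sub>R (bs @ rs) ! i) + (\<Sum>i\<in>(%i. length bs + i) ` {..<length rs}. g i *\<^sub>R (bs @ rs) ! i)"
  by (rule sum.union_disjoint) auto
 also have "(\<Sum>i\<in>(%i. length bs + i) ` {..<length rs}. g i *\<^sub>R (bs @ rs) ! i) = (\<Sum>i<length rs. g (length bs + i) *\<^sub>R rs ! i)"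
  by (subst sum.reindex) (auto)
 finally show ?thesis by (simp add: nth_append)
qed

lemma sum_scalar_mat:
 fixes g :: "nat => 'e::real_vector"
 assumes "j < n"
 shows "(\<Sum>i<n. (c \<cdot>\<^sub>m 1\<^sub>m n) $$ (i, j) *\<^sub>R g i) = c *\<^sub>R g j" "(\<Sum>i<n. 1\<^sub>m n $$ (i, j) *\<^sub>R g i) = g j"
proof -
 show *: "(\<Sum>i<n. (c \<cdot>\<^sub>m 1\<^sub>m n) $$ (i, j) *\<^sub>R g i) = c *\<^sub>R g j" for c
 proof -
  have "(\<Sum>i<n. (c \<cdot>\<^sub>m 1\<^sub>m n) $$ (i, j) *\<^sub>R g i) = (\<Sum>i<n. if i = j then c *\<^sub>R g i else 0)"
   by (rule sum.cong) (use assms in auto)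
  then show ?thesis using assms by simp
 qed
 from *[of 1] show "(\<Sum>i<n. 1\<^sub>m n $$ (i, j) *\<^sub>R g i) = g j" using assms by simp
qed

text \<open>Since \<open>ns'\<close> is known only modulo the span of \<open>ms\<close>, the change
  of basis is block upper triangular with diagonal blocks \<open>C\<close> and
  \<open>D\<close>.\<close>

lemma block_matrix:
 assumes len: "length ms' = length ms" "length ns' = length ns"
  and C: "C : carrier_mat (length ms) (length ms)" and D: "D : carrier_mat (length ns) (length ns)"
  and ms': "!!j. j < length ms ==> ms' ! j = (\<Sum>i<length ms. C $$ (i, j) *\<^sub>R ms ! i)"
  and ns': "!!j. j < length ns ==> ns' ! j - (\<Sum>i<length ns. D $$ (i, j) *\<^sub>R ns ! i) : span (set ms)"
 obtains Q :: "real Matrix.mat" where "Q : carrier_mat (length ms + length ns) (length ms + length ns)"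
  "!!j. j < length ms + length ns ==> (ms' @ ns') ! j = (\<Sum>i<length ms + length ns. Q $$ (i, j) *\<^sub>R (ms @ ns) ! i)"
  "det Q = det C * det D"
proof -
 let ?m = "length ms" and ?n = "length ns"
 define xs where "xs = map (%j. ns' ! j - (\<Sum>i<?n. D $$ (i, j) *\<^sub>R ns ! i)) [0..<?n]"
 have xs: "length xs = ?n" "!!j. j < ?n ==> xs ! j = ns' ! j - (\<Sum>i<?n. D $$ (i, j) *\<^sub>R ns ! i)" by (simp_all add: xs_def)
 obtain F where F: "F : carrier_mat ?m (length xs)" "!!j. j < length xs ==> xs ! j = (\<Sum>i<?m. F $$ (i, j) *\<^sub>R ms ! i)"
  by (rule coordinate_matrix[of xs ms]) (use ns' xs in auto)
 define Q where "Q = four_block_mat C F (0\<^sub>m ?n ?m) D"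
 have "(ms' @ ns') ! j = (\<Sum>i<?m + ?n. Q $$ (i, j) *\<^sub>R (ms @ ns) ! i)" if j: "j < ?m + ?n" for j
 proof (cases "j < ?m")
  case True
  then show ?thesis unfolding sum_nth_append using C D F xs ms' len by (simp add: Q_def nth_append)
 next
  case False
  show ?thesis using F(2)[of "j - ?m"] xs False j unfolding sum_nth_append using False C D F(1) xs len j by (auto simp: algebra_simps Q_def nth_append)
 qed
 moreover have "det Q = det C * det D" unfolding Q_def by (rule det_four_block_mat_lower_left_zero[OF C _ refl D]) (use F xs in simp)
 ultimately show ?thesis using that[of Q] C D F xs by (simp add: Q_def)
qed

lemma vol_prepend:
 fixes bs rs cs :: "'e::euclidean_space list"
 assumes len: "length bs + length rs = DIM('e)" "length cs = length bs"
  and C: "C : carrier_mat (length bs) (length bs)"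
  and cs: "!!j. j < length bs ==> cs ! j - (\<Sum>i<length bs. C $$ (i, j) *\<^sub>R bs ! i) : span (set rs)"
 shows "vol (rs @ cs) = det C * vol (rs @ bs)"
proof -
 obtain Q :: "real Matrix.mat" where Q: "Q : carrier_mat (length rs + length bs) (length rs + length bs)"
  "!!j. j < length rs + length bs ==> (rs @ cs) ! j = (\<Sum>i<length rs + length bs. Q $$ (i, j) *\<^sub>R (rs @ bs) ! i)"
  "det Q = det (1\<^sub>m (length rs)) * det C" by (rule block_matrix[OF refl len(2) one_carrier_mat C sum_scalar_mat(2)[symmetric] cs]) blast+
 then show ?thesis using vol_mult[of Q "rs @ cs" "rs @ bs"] len(1) by (simp add: add.commute)
qed

text \<open>The factor is the determinant of the permutation moving one block past the other. It
  depends only on the block lengths, so it cancels when lists of equal length are compared.\<close>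

lemma vol_swap:
 assumes n: "k + m = DIM('e::euclidean_space)"
 obtains r where "!!bs rs :: 'e list. length bs = k ==> length rs = m ==> vol (rs @ bs) = vol (bs @ rs) * r"
proof
 define sm where "sm j = (if j < m then k + j else j - m)" for j
 define P :: "real Matrix.mat" where "P = Matrix.mat DIM('e) DIM('e) (%(i, j). if i = sm j then 1 else 0)"
 fix bs rs :: "'e list" assume l: "length bs = k" "length rs = m"
 show "vol (rs @ bs) = vol (bs @ rs) * det P"
 proof (rule vol_mult)
  fix j assume j: "j < DIM('e)"
  have "(\<Sum>i<DIM('e). P $$ (i, j) *\<^sub>R (bs @ rs) ! i) = (\<Sum>i<DIM('e). if i = sm j then (bs @ rs) ! i else 0)"
   using j by (intro sum.cong) (auto simp: P_def)
  then show "(rs @ bs) ! j = (\<Sum>i<DIM('e). P $$ (i, j) *\<^sub>R (bs @ rs) ! i)" using j l n by (auto simp: sm_def nth_append)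
 qed (simp add: P_def)
qed

lemma vol_append:
 fixes bs rs cs :: "'e::euclidean_space list"
 assumes len: "length bs + length rs = DIM('e)" "length cs = length bs"
  and C: "C : carrier_mat (length bs) (length bs)"
  and cs: "!!j. j < length bs ==> cs ! j - (\<Sum>i<length bs. C $$ (i, j) *\<^sub>R bs ! i) : span (set rs)"
 shows "vol (cs @ rs) = det C * vol (bs @ rs)"
proof -
 obtain r where "!!cs :: 'e list. length cs = length bs ==> vol (cs @ rs) = vol (rs @ cs) * r"
  using vol_swap[of "length rs" "length bs"] len(1) by (metis add.commute)
 then show ?thesis using vol_prepend[OF assms] len(2) by simp
qed

lemma obasis_length: "obasis V bs ==> length bs = dim V"
 using distinct_card[of bs] dim_eq_card_independent[of "set bs"] unfolding ordered_basis_def by auto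

lemma obasis_subset: "obasis V bs ==> set bs \<subseteq> V" unfolding ordered_basis_def using span_superset by blast

lemma obasis_span: "obasis V bs ==> span (set bs) = V" by (simp add: ordered_basis_def)

lemma extend_to_obasis:
 assumes V: "subspace V" and ms: "set ms \<subseteq> V" "distinct ms" "independent (set ms)"
 obtains rs where "obasis V (ms @ rs)"
proof -
 obtain B where B: "set ms \<subseteq> B" "B \<subseteq> V" "independent B" "V \<subseteq> span B"
  using maximal_independent_subset_extend[OF ms(1,3)] by blast
 obtain rs where rs: "set rs = B - set ms" "distinct rs" using B(3) independent_imp_finite finite_distinct_list[of "B - set ms"] by auto
 have "set (ms @ rs) = B" using rs B by auto
 moreover have "span B = V" using B V span_minimal by blast
 ultimately have "obasis V (ms @ rs)" unfolding ordered_basis_def using rs ms B by auto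
 then show ?thesis using that by blast
qed

lemma obasis_exists:
 assumes "subspace V"
 obtains bs where "obasis V bs" using extend_to_obasis[OF assms, of "[]"] by (auto simp: independent_empty)

lemma obasis_appendD: "obasis V (ms @ rs) ==> distinct ms & independent (set ms) & set ms \<subseteq> V"
 using obasis_subset[of V "ms @ rs"] independent_mono[of "set (ms @ rs)" "set ms"] unfolding ordered_basis_def by auto

text \<open>\<open>rs\<close> completes bases of \<open>V\<close> to bases of the whole space, so
  that cs -> vol (cs @ rs) serves as a volume form on \<open>V\<close>, and orientations of
  \<open>V\<close> are its sign up to a constant.\<close>

definition complement_list :: "'e::euclidean_space set => 'e list => bool" where
 "complement_list V rs \<longleftrightarrow> (EX bs. obasis V bs & length bs + length rs = DIM('e) & vol (bs @ rs) ~= 0)"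

lemma complement_listD:
 fixes V :: "'e::euclidean_space set"
 assumes "complement_list V rs"
 shows "dim V + length rs = DIM('e)"
  "!!cs. length cs = dim V ==> set cs \<subseteq> V ==> obasis V cs \<longleftrightarrow> vol (cs @ rs) ~= 0"
proof -
 obtain bs where bs: "obasis V bs" "length bs + length rs = DIM('e)" "vol (bs @ rs) ~= 0" using assms by (auto simp: complement_list_def)
 show d: "dim V + length rs = DIM('e)" using bs obasis_length by metis
 fix cs assume cs: "length cs = dim V" "set cs \<subseteq> V"
 have len: "length (cs @ rs) = DIM('e)" using cs d by simp
 show "obasis V cs \<longleftrightarrow> vol (cs @ rs) ~= 0"
 proof
  assume "obasis V cs"
  then have "span (set (cs @ rs)) = span (set (bs @ rs))" using bs(1) by (simp add: ordered_basis_def span_Un)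
  moreover have "span (set (bs @ rs)) = UNIV" using bs vol_nonzero_iff_span[of "bs @ rs"] by simp
  ultimately show "vol (cs @ rs) ~= 0" using vol_nonzero_iff_span[OF len] by simp
 next
  assume "vol (cs @ rs) ~= 0"
  then have "distinct (cs @ rs)" "independent (set (cs @ rs))" using vol_nonzero_iff[OF len] by auto
  then have di: "distinct cs" "independent (set cs)" using independent_mono[of "set (cs @ rs)" "set cs"] by auto
  have "subspace V" using bs(1) subspace_span unfolding ordered_basis_def by metis
  moreover have "V \<subseteq> span (set cs)" by (rule card_ge_dim_independent[OF cs(2) di(2)]) (use cs(1) distinct_card[OF di(1)] in simp)
  ultimately show "obasis V cs" using di cs span_minimal unfolding ordered_basis_def by blast
 qed
qed

lemma complement_list_exists:
 fixes V :: "'e::euclidean_space set"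
 assumes "subspace V"
 obtains rs where "complement_list V rs"
proof -
 obtain bs where bs: "obasis V bs" using obasis_exists[OF assms] by blast
 then obtain rs where "obasis UNIV (bs @ rs)" using extend_to_obasis[OF subspace_UNIV, of bs] by (auto simp: ordered_basis_def)
 then have "complement_list V rs" unfolding complement_list_def using bs obasis_UNIV_iff by (metis length_append)
 then show ?thesis using that by blast
qed

lemma vs_values:
 "vs_orientation V sg ==> obasis V bs ==> sg bs = 1 | sg bs = - 1"
 "vs_orientation V sg ==> \<not> obasis V bs ==> sg bs = 0" unfolding vs_orientation_def by auto

lemma orientation_vol:
 fixes V :: "'e::euclidean_space set"
 assumes o: "vs_orientation V sg" and V: "subspace V" and rs: "complement_list V rs"
 obtains s where "s = 1 | s = - 1" "!!cs. length cs = dim V ==> set cs \<subseteq> V ==> sg cs = s * sgn (vol (cs @ rs))"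
proof -
 obtain bs where bs: "obasis V bs" using obasis_exists[OF V] by blast
 note cl = complement_listD[OF rs]
 have bl: "length bs = dim V" "set bs \<subseteq> V" using obasis_length[OF bs] obasis_subset[OF bs] .
 have vb: "vol (bs @ rs) ~= 0" using cl(2)[OF bl] bs by simp
 define s where "s = sg bs * sgn (vol (bs @ rs))"
 have sgb: "sg bs = 1 | sg bs = - 1" by (rule vs_values(1)[OF o bs])
 have svb: "sgn (vol (bs @ rs)) = 1 | sgn (vol (bs @ rs)) = - 1" using vb by (auto simp: sgn_if)
 show ?thesis
 proof (rule that[of s])
  show "s = 1 | s = - 1" using sgb svb by (auto simp: s_def)
  fix cs assume cs: "length cs = dim V" "set cs \<subseteq> V"
  show "sg cs = s * sgn (vol (cs @ rs))"
  proof (cases "obasis V cs")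
   case False
   then show ?thesis using vs_values(2)[OF o False] cl(2)[OF cs] by simp
  next
   case True
   obtain C :: "real Matrix.mat" where C: "C : carrier_mat (length bs) (length cs)"
    "!!j. j < length cs ==> cs ! j = (\<Sum>i<length bs. C $$ (i, j) *\<^sub>R bs ! i)"
    using coordinate_matrix[of cs bs] cs(2) obasis_span[OF bs] nth_mem by (metis subsetD)
   have C': "C : carrier_mat (length bs) (length bs)" using C(1) cs(1) bl by simp
   have "sg cs = sgn (det C) * sg bs" using o bs True C' C(2) cs(1) bl(1) unfolding vs_orientation_def by auto
   moreover have "vol (cs @ rs) = det C * vol (bs @ rs)" by (rule vol_append[OF _ _ C']) (use cl(1) bl cs C(2) in \<open>auto simp: span_zero\<close>)
   then have "sgn (vol (cs @ rs)) = sgn (det C) * sgn (vol (bs @ rs))" by (simp add: sgn_mult)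
   ultimately show ?thesis using svb by (auto simp: s_def)
  qed
 qed
qed

lemma vs_orientationI:
 fixes V :: "'e::euclidean_space set"
 assumes rs: "complement_list V rs" and s: "s = 1 | s = - 1"
  and sg: "!!cs. obasis V cs ==> sg cs = s * sgn (vol (cs @ rs))" "!!cs. \<not> obasis V cs ==> sg cs = 0"
 shows "vs_orientation V sg" unfolding vs_orientation_def
proof (intro conjI allI impI)
 note cl = complement_listD[OF rs]
 fix bs
 show "sg bs : {1, - 1}" if b: "obasis V bs" using sg(1)[OF b] s cl(2)[OF obasis_length[OF b] obasis_subset[OF b]] b by (auto simp: sgn_if)
 show "sg bs = 0" if "\<not> obasis V bs" by (rule sg(2)[OF that])
 fix cs C assume h: "obasis V bs & obasis V cs & C : carrier_mat (length bs) (length bs) &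
  (ALL j<length bs. cs ! j = (\<Sum>i<length bs. C $$ (i, j) *\<^sub>R bs ! i))"
 have "vol (cs @ rs) = det C * vol (bs @ rs)"
  by (rule vol_append) (use h cl(1) obasis_length[of V bs] obasis_length[of V cs] in \<open>auto simp: span_zero\<close>)
 then show "sg cs = sgn (det C) * sg bs" using sg(1) h by (simp add: sgn_mult)
qed

lemma vs_orientation_eq:
 fixes V :: "'e::euclidean_space set"
 assumes "vs_orientation V sg" "vs_orientation V sg'" "subspace V" "obasis V bs" "sg bs = sg' bs"
 shows "sg = sg'"
proof
 fix cs
 obtain rs where rs: "complement_list V rs" using complement_list_exists[OF assms(3)] by blast
 obtain s where s: "s = 1 | s = - 1" "!!cs. length cs = dim V ==> set cs \<subseteq> V ==> sg cs = s * sgn (vol (cs @ rs))"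
  using orientation_vol[OF assms(1,3) rs] by blast
 obtain s' where s': "s' = 1 | s' = - 1" "!!cs. length cs = dim V ==> set cs \<subseteq> V ==> sg' cs = s' * sgn (vol (cs @ rs))"
  using orientation_vol[OF assms(2,3) rs] by blast
 have b: "length bs = dim V" "set bs \<subseteq> V" using obasis_length[OF assms(4)] obasis_subset[OF assms(4)] .
 have "s = s'" using complement_listD(2)[OF rs b] assms(4) assms(5) s(2)[OF b] s'(2)[OF b] by (simp add: sgn_if split: if_splits)
 then show "sg cs = sg' cs" using s(2)[of cs] s'(2)[of cs] vs_values(2)[OF assms(1), of cs] vs_values(2)[OF assms(2), of cs]
   obasis_length[of V cs] obasis_subset[of V cs] by (cases "obasis V cs") auto
qed

lemma independent_inj_on_image_lin:
 "linear f ==> independent S ==> inj_on f (span S) ==> independent (f ` S)"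
 for f :: "'a::real_vector => 'b::real_vector" using linear_dependent_inj_imageD by blast

lemma obasis_image:
 assumes f: "linear f" and inj: "inj_on f V" and h: "obasis V bs"
 shows "obasis (f ` V) (map f bs)"
proof -
 have sub: "set bs \<subseteq> V" and sp: "span (set bs) = V" using h by (auto simp: obasis_subset obasis_span)
 have "distinct (map f bs)" using h inj_on_subset[OF inj sub] by (simp add: ordered_basis_def distinct_map)
 moreover have "independent (f ` set bs)" using h inj sp independent_inj_on_image_lin[OF f] by (simp add: ordered_basis_def)
 ultimately show ?thesis using sp linear_span_image[OF f, of "set bs"] by (simp add: ordered_basis_def)
qed

lemma obasis_linear_image:
 assumes f: "linear f" and V: "subspace V" and inj: "inj_on f V"
 shows "obasis (f ` V) (map f bs) & set bs \<subseteq> V \<longleftrightarrow> obasis V bs"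
proof
 assume h: "obasis (f ` V) (map f bs) & set bs \<subseteq> V"
 obtain g where g: "linear g" "!!v. v : V ==> g (f v) = v" using linear_exists_left_inverse_on[OF f V inj] by blast
 have "inj_on g (f ` V)" using g(2) by (auto intro: inj_onI)
 from obasis_image[OF g(1) this conjunct1[OF h]] h g(2)
 show "obasis V bs" by (simp add: image_image map_idI subset_iff)
qed (use obasis_image[OF f inj] obasis_subset in blast)

text \<open>The pulled-back orientation has to vanish on lists outside \<open>V\<close>, which
  \<open>f\<close> might still send to a basis of the image.\<close>

lemma vs_orientation_linear_image:
 fixes f :: "'e::euclidean_space => 'e"
 assumes f: "linear f" and V: "subspace V" and inj: "inj_on f V" and o: "vs_orientation (f ` V) sg"
 shows "vs_orientation V (%bs. if set bs \<subseteq> V then sg (map f bs) else 0)" unfolding vs_orientation_def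
proof (intro conjI allI impI)
 fix bs
 note oi = obasis_linear_image[OF f V inj]
 show "(if set bs \<subseteq> V then sg (map f bs) else 0) : {1, - 1}" if "obasis V bs" using oi[of bs] that vs_values(1)[OF o, of "map f bs"] by auto
 show "(if set bs \<subseteq> V then sg (map f bs) else 0) = 0" if "\<not> obasis V bs" using oi[of bs] that vs_values(2)[OF o, of "map f bs"] by auto
 fix cs C assume h: "obasis V bs & obasis V cs & C : carrier_mat (length bs) (length bs) &
  (ALL j<length bs. cs ! j = (\<Sum>i<length bs. C $$ (i, j) *\<^sub>R bs ! i))"
 have l: "length cs = length bs" using h obasis_length by metis
 have "ALL j<length (map f bs). map f cs ! j = (\<Sum>i<length (map f bs). C $$ (i, j) *\<^sub>R map f bs ! i)"
  using h l by (auto simp: linear_sum[OF f] linear_scale[OF f])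
 moreover have "obasis (f ` V) (map f bs)" "obasis (f ` V) (map f cs)" using h oi by blast+
 ultimately show "(if set cs \<subseteq> V then sg (map f cs) else 0) = sgn (det C) * (if set bs \<subseteq> V then sg (map f bs) else 0)" using o[unfolded vs_orientation_def, THEN conjunct2, THEN conjunct2, rule_format, of "map f bs" "map f cs" C] h h oi by auto
qed

section \<open>Orientations of submanifolds\<close>

context manifold
begin

lemma slice_push_image:
 assumes sl: "slice c L W" and q: "q : W" "q : fst c"
 shows "push A c q ` TS W q = L" "inj_on (push A c q) V" "inj_on (pull c q) V"
proof -
 have c: "c : charts" using sl by (simp add: slice_def)
 show "push A c q ` TS W q = L" unfolding tangent_space_pull[OF sl q] image_image using c q by simp
 show "inj_on (push A c q) V" "inj_on (pull c q) V" using c q by (metis inj_onI pull_push, metis inj_onI push_pull)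
qed

lemma slice_basis_iff:
 assumes sl: "slice c L W" and q: "q : W" "q : fst c"
 shows "obasis (TS W q) vs \<longleftrightarrow> obasis L (map (push A c q) vs)"
proof -
 have c: "c : charts" using sl by (simp add: slice_def)
 have "set vs \<subseteq> TS W q" if "obasis L (map (push A c q) vs)" using obasis_subset[OF that] by (auto simp: slice_tangent[OF sl q])
 then show ?thesis using obasis_linear_image[OF push_linear[OF c q(2)] slice_dim(1)[OF sl q] slice_push_image(2)[OF sl q], of vs]
  unfolding slice_push_image(1)[OF sl q] by blast
qed

lemma slice_basis_vol:
 assumes sl: "slice c L W" and q: "q : W" "q : fst c" and rs: "complement_list L rs"
  and vs: "obasis (TS W q) vs"
 shows "vol (map (push A c q) vs @ rs) ~= 0" "length vs + length rs = DIM('e)"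
proof -
 have b: "obasis L (map (push A c q) vs)" using vs unfolding slice_basis_iff[OF sl q] .
 show "vol (map (push A c q) vs @ rs) ~= 0" using complement_listD(2)[OF rs obasis_length[OF b] obasis_subset[OF b]] b by simp
 show "length vs + length rs = DIM('e)" using complement_listD(1)[OF rs] obasis_length[OF b] by simp
qed

text \<open>In a slice chart an orientation is a sign times that of the volume form given by
  \<open>rs\<close>, and its continuity becomes local constancy of \<open>s\<close>. The formula
  covers all tangent lists of the right length, since both sides vanish on those that are no
  bases.\<close>

definition or_formula :: "('a, 'e) chart => 'e list => real => 'a set => ('a => 'e list => real) => 'a => bool" where
 "or_formula c rs s W Or q \<longleftrightarrow> (ALL vs. length vs = dim (TS W q) --> set vs \<subseteq> TS W q -->
  Or q vs = s * sgn (vol (map (push A c q) vs @ rs)))"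

lemma or_formula_exists:
 assumes sl: "slice c L W" and q: "q : W" "q : fst c" and rs: "complement_list L rs"
  and o: "vs_orientation (TS W q) (Or q)"
 obtains s where "s = 1 | s = - 1" "or_formula c rs s W Or q"
proof -
 have c: "c : charts" and L: "subspace L" using sl by (auto simp: slice_def)
 have "vs_orientation (pull c q ` L) (Or q)" using o by (simp add: tangent_space_pull[OF sl q])
 note o' = vs_orientation_linear_image[OF pull_linear[OF c q(2)] L slice_push_image(3)[OF sl q] this]
 obtain s where s: "s = 1 | s = - 1"
  "!!cs. length cs = dim L ==> set cs \<subseteq> L ==> (if set cs \<subseteq> L then Or q (map (pull c q) cs) else 0) = s * sgn (vol (cs @ rs))"
  using orientation_vol[OF o' L rs] by blast
 have "or_formula c rs s W Or q" unfolding or_formula_def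
 proof (intro allI impI)
  fix vs assume vs: "length vs = dim (TS W q)" "set vs \<subseteq> TS W q"
  have "set (map (push A c q) vs) \<subseteq> L" using vs slice_push_image(1)[OF sl q] by auto
  moreover have "map (pull c q) (map (push A c q) vs) = vs" using c q by (simp add: o_def)
  ultimately show "Or q vs = s * sgn (vol (map (push A c q) vs @ rs))" using s(2)[of "map (push A c q) vs"] vs slice_dim(2)[OF sl q] by simp
 qed
 then show ?thesis using that s by blast
qed

lemma vs_orientation_formula:
 assumes sl: "slice c L W" and q: "q : W" "q : fst c" and rs: "complement_list L rs" and s: "s = 1 | s = - 1"
  and basis: "!!vs. obasis (TS W q) vs ==> sg vs = s * sgn (vol (map (push A c q) vs @ rs))"
  and nonbasis: "!!vs. \<not> obasis (TS W q) vs ==> sg vs = 0"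
 shows "vs_orientation (TS W q) sg"
proof -
 have c: "c : charts" using sl by (auto simp: slice_def)
 define sg' where "sg' cs = (if obasis L cs then s * sgn (vol (cs @ rs)) else 0)" for cs
 have "vs_orientation (push A c q ` TS W q) sg'" unfolding slice_push_image(1)[OF sl q] by (rule vs_orientationI[OF rs s]) (auto simp: sg'_def)
 note vs_orientation_linear_image[OF push_linear[OF c q(2)] slice_dim(1)[OF sl q] slice_push_image(2)[OF sl q] this]
 moreover have "(%vs. if set vs \<subseteq> TS W q then sg' (map (push A c q) vs) else 0) = sg"
 proof
  fix vs show "(if set vs \<subseteq> TS W q then sg' (map (push A c q) vs) else 0) = sg vs"
   using basis[of vs] nonbasis[of vs] obasis_subset[of "TS W q" vs] by (cases "obasis (TS W q) vs") (simp_all add: sg'_def slice_basis_iff[OF sl q])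
 qed
 ultimately show ?thesis by simp
qed

lemma push_vol_tendsto:
 assumes c: "c : charts" "q0 : fst c" and E: "list_all2 (%E v. tb_tendsto q E q0 v F) Es vs"
  and len: "length vs + length rs = DIM('e)"
 shows "((%t. vol (map (push A c (q t)) (map (%E. E t) Es) @ rs)) ---> vol (map (push A c q0) vs @ rs)) F"
proof (rule tendsto_vol)
 fix j :: nat
 have l: "length Es = length vs" using E by (rule list_all2_lengthD)
 show "((%t. (map (push A c (q t)) (map (%E. E t) Es) @ rs) ! j) ---> (map (push A c q0) vs @ rs) ! j) F"
 proof (cases "j < length vs")
  case True
  then show ?thesis using E l l c by (simp add: list_all2_conv_all_nth nth_append tb_tendsto_def)
 qed (simp add: nth_append l)
qed

text \<open>The local vector field with constant coordinates in \<open>c\<close> that extends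
  \<open>v\<close>; frames of such fields test the continuity of orientations.\<close>

definition frame_field :: "('a, 'e) chart => 'a => 'e => 'a => 'e" where
 "frame_field c q0 v q = pull c q (push A c q0 v)"

lemma frame_field_tb:
 assumes c: "c : charts" "q0 : fst c" and q: "(q ---> q0) F"
 shows "tb_tendsto q (%t. frame_field c q0 v (q t)) q0 v F" unfolding tb_tendsto_iff[OF c] frame_field_def
proof
 show "((%t. push A c (q t) (pull c (q t) (push A c q0 v))) ---> push A c q0 v) F"
  by (rule tendsto_eventually) (use ev_chart[OF c q] c in \<open>auto elim: eventually_mono\<close>)
qed (rule q)

lemma frame_field_continuous:
 assumes c: "c : charts" "q0 : fst c"
 shows "continuous_field_on A (W \<inter> fst c) (frame_field c q0 v)" unfolding continuous_field_on_def continuous_on_def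
proof (intro ballI)
 fix d q1 assume d: "d : A" and q1: "q1 : W \<inter> fst c \<inter> fst d"
 let ?F = "at q1 within W \<inter> fst c \<inter> fst d"
 have "tb_tendsto (%q. q) (%q. frame_field c q1 (frame_field c q0 v q1) q) q1 (frame_field c q0 v q1) ?F"
  using frame_field_tb[of c q1 "%q. q"] c q1 by simp
 moreover have "frame_field c q1 (frame_field c q0 v q1) q = frame_field c q0 v q" for q using c q1 by (simp add: frame_field_def)
 ultimately show "((%q. push A d q (frame_field c q0 v q)) ---> push A d q1 (frame_field c q0 v q1)) ?F"
  using atlas_charts[OF d] q1 by (simp add: tb_tendsto_def)
qed

lemma frame_field_basis:
 assumes sl: "slice c L W" and q0: "q0 : W" "q0 : fst c" and q: "q : W" "q : fst c"
  and vs: "obasis (TS W q0) vs"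
 shows "obasis (TS W q) (map (%v. frame_field c q0 v q) vs)"
proof -
 show ?thesis using sl using vs q q0 unfolding slice_basis_iff[OF sl q] slice_basis_iff[OF sl q0] by (simp add: slice_def frame_field_def o_def)
qed

text \<open>The sign at \<open>q\<close> is determined by the value of the orientation on a single
  basis, and the coordinates of a constant frame do not move; so constancy on one such frame fixes
  the sign near \<open>q0\<close>.\<close>

lemma formula_of_frame:
 assumes sl: "slice c L W" and q0: "q0 : W" "q0 : fst c" and rs: "complement_list L rs"
  and o: "!!q. q : W ==> vs_orientation (TS W q) (Or q)"
  and vs: "obasis (TS W q0) vs"
  and ev: "\<forall>\<^sub>F q in nhds q0. q : W --> Or q (map (%v. frame_field c q0 v q) vs) = Or q0 vs"
 obtains s where "s = 1 | s = - 1" "\<forall>\<^sub>F q in nhds q0. q : W --> or_formula c rs s W Or q"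
proof -
 have c: "c : charts" using sl by (simp add: slice_def)
 define V where "V = vol (map (push A c q0) vs @ rs)"
 have Vnz: "V ~= 0" using slice_basis_vol(1)[OF sl q0 rs vs] by (simp add: V_def)
 have eq: "s = Or q0 vs * sgn V" if q: "q : W" "q : fst c" "Or q (map (%v. frame_field c q0 v q) vs) = Or q0 vs"
  and f: "or_formula c rs s W Or q" for q s
 proof -
  note b = frame_field_basis[OF sl q0 q(1,2) vs]
  have "Or q (map (%v. frame_field c q0 v q) vs) = s * sgn (vol (map (push A c q) (map (%v. frame_field c q0 v q) vs) @ rs))"
   using f obasis_length[OF b] obasis_subset[OF b] unfolding or_formula_def by blast
  moreover have "map (push A c q) (map (%v. frame_field c q0 v q) vs) = map (push A c q0) vs" using c q(2) by (simp add: frame_field_def o_def)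
  ultimately have "Or q0 vs = s * sgn V" using q(3) by (simp only: V_def)
  then show ?thesis using Vnz by auto
 qed
 have ex: "EX s. (s = 1 | s = - 1) & or_formula c rs s W Or q" if "q : W" "q : fst c" for q
  by (rule or_formula_exists[where Or=Or, OF sl that rs o[OF that(1)]]) blast
 show ?thesis
 proof (rule that[of "Or q0 vs * sgn V"])
  show "Or q0 vs * sgn V = 1 | Or q0 vs * sgn V = - 1" using vs_values(1)[OF o[OF q0(1)] vs] Vnz by (auto simp: sgn_if)
  have "\<forall>\<^sub>F q in nhds q0. q : fst c" using chart_open[OF c] q0(2) by (rule eventually_nhds_in_open)
  then show "\<forall>\<^sub>F q in nhds q0. q : W --> or_formula c rs (Or q0 vs * sgn V) W Or q" using ev by eventually_elim (use ex eq in metis)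
 qed
qed

lemma orientation_formula:
 assumes o: "orientation A W Or" and sl: "slice c L W" and q0: "q0 : W" "q0 : fst c" and rs: "complement_list L rs"
 obtains s where "s = 1 | s = - 1" "\<forall>\<^sub>F q in nhds q0. q : W --> or_formula c rs s W Or q"
proof -
 have c: "c : charts" using sl by (simp add: slice_def)
 have ov: "!!q. q : W ==> vs_orientation (TS W q) (Or q)" using o by (simp add: orientation_def)
 obtain vs where vs: "obasis (TS W q0) vs" using obasis_exists[OF slice_dim(1)[OF sl q0]] by blast
 define g where "g q = Or q (map (%v. frame_field c q0 v q) vs)" for q
 have cont: "continuous_on S (%q. Or q (map (%E. E q) Es))"
  if "openin (top_of_set W) S" "ALL E:set Es. continuous_field_on A S E"
   "ALL q:S. obasis (TS W q) (map (%E. E q) Es)" for S Es using o that unfolding orientation_def by blast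
 have b: "obasis (TS W q) (map (%v. frame_field c q0 v q) vs)" if "q : W \<inter> fst c" for q using frame_field_basis[OF sl q0 _ _ vs] that by blast
 have "continuous_on (W \<inter> fst c) (%q. Or q (map (%E. E q) (map (frame_field c q0) vs)))"
  by (rule cont) (use frame_field_continuous[OF c q0(2)] chart_open[OF c] b in \<open>auto simp: o_def\<close>)
 then have "continuous_on (W \<inter> fst c) g" by (simp add: g_def o_def)
 then have "(g ---> g q0) (at q0 within W \<inter> fst c)" using q0 by (simp add: continuous_on_def)
 from tendstoD[OF this, of 1] have "\<forall>\<^sub>F q in nhds q0. q ~= q0 --> q : W \<inter> fst c --> dist (g q) (g q0) < 1" by (simp add: eventually_at_filter)
 moreover have "\<forall>\<^sub>F q in nhds q0. q : fst c" using chart_open[OF c] q0(2) by (rule eventually_nhds_in_open)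
 ultimately have ev: "\<forall>\<^sub>F q in nhds q0. q : W --> g q = g q0"
 proof eventually_elim
  case (elim q)
  have "g q = 1 | g q = - 1" "g q0 = 1 | g q0 = - 1" if "q : W" using vs_values(1)[OF ov b] elim that q0 by (auto simp: g_def)
  then show ?case using elim by (auto simp: dist_real_def)
 qed
 have "g q0 = Or q0 vs" using c q0 by (simp add: g_def frame_field_def)
 with ev have "\<forall>\<^sub>F q in nhds q0. q : W --> Or q (map (%v. frame_field c q0 v q) vs) = Or q0 vs" by (simp only: g_def)
 from formula_of_frame[where Or=Or, OF sl q0 rs ov vs this] show ?thesis using that by metis
qed

lemma orientationI:
 assumes o: "!!q. q : W ==> vs_orientation (TS W q) (Or q)"
  and zero: "!!p bs. p \<notin> W ==> Or p bs = 0"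
  and loc: "!!q0. q0 : W ==> EX c L rs s. slice c L W & q0 : fst c & complement_list L rs &
   (\<forall>\<^sub>F q in nhds q0. q : W --> or_formula c rs s W Or q)"
 shows "orientation A W Or" unfolding orientation_def
proof (intro conjI allI ballI impI)
 fix S Es assume S: "openin (top_of_set W) S & (ALL E:set Es. continuous_field_on A S E) &
    (ALL q:S. obasis (TS W q) (map (%E. E q) Es))"
 show "continuous_on S (%q. Or q (map (%E. E q) Es))" unfolding continuous_on_def
 proof
  fix q0 assume q0S: "q0 : S"
  have SW: "S \<subseteq> W" using S openin_imp_subset by blast
  then have q0: "q0 : W" using q0S by blast
  obtain c L rs s where sl: "slice c L W" "q0 : fst c" "complement_list L rs"
   and ev: "\<forall>\<^sub>F q in nhds q0. q : W --> or_formula c rs s W Or q" using loc[OF q0] by blast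
  let ?F = "at q0 within S"
  have c: "c : charts" using sl by (simp add: slice_def)
  have b: "obasis (TS W q) (map (%E. E q) Es)" if "q : S" for q using S that by blast
  have len: "length Es = dim (TS W q)" if "q : S" for q using obasis_length[OF b[OF that]] by simp
  have rep: "Or q (map (%E. E q) Es) = s * sgn (vol (map (push A c q) (map (%E. E q) Es) @ rs))"
   if "q : S" "or_formula c rs s W Or q" for q using that(2) obasis_subset[OF b[OF that(1)]] len[OF that(1)] unfolding or_formula_def by simp
  have "tb_tendsto (%q. q) E q0 (E q0) ?F" if "E : set Es" for E
  proof -
   define a where "a = chart_at A q0"
   have a: "a : A" "a : charts" "q0 : fst a" using chart_at chart_at_in by (auto simp: a_def)
   have "((%q. push A a q (E q)) ---> push A a q0 (E q0)) (at q0 within S \<inter> fst a)" using S that a(1) q0S a by (simp add: continuous_field_on_def continuous_on_def)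
   moreover have "at q0 within S \<inter> fst a = ?F" using at_within_nhd[OF a(3) chart_open[OF a(2)], of "S \<inter> fst a" S] by blast
   ultimately show ?thesis unfolding tb_tendsto_iff[OF a(2,3)] by simp
  qed
  then have E: "list_all2 (%E v. tb_tendsto (%q. q) E q0 v ?F) Es (map (%E. E q0) Es)" by (simp add: list_all2_conv_all_nth)
  note nz = slice_basis_vol[OF sl(1) q0 sl(2,3) b[OF q0S]]
  have lim: "((%q. s * sgn (vol (map (push A c q) (map (%E. E q) Es) @ rs))) --->
   s * sgn (vol (map (push A c q0) (map (%E. E q0) Es) @ rs))) ?F"
   by (intro tendsto_mult tendsto_const tendsto_sgn push_vol_tendsto[OF c sl(2) E nz(2)] nz(1))
  have "or_formula c rs s W Or q0" using eventually_nhds_x_imp_x[OF ev] q0 by simp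
  then have "Or q0 (map (%E. E q0) Es) = s * sgn (vol (map (push A c q0) (map (%E. E q0) Es) @ rs))" by (rule rep[OF q0S])
  moreover have "\<forall>\<^sub>F q in ?F. Or q (map (%E. E q) Es) = s * sgn (vol (map (push A c q) (map (%E. E q) Es) @ rs))"
   unfolding eventually_at_filter using ev by (rule eventually_mono) (use SW rep in blast)
  ultimately show "((%q. Or q (map (%E. E q) Es)) ---> Or q0 (map (%E. E q0) Es)) ?F" using lim by (simp add: tendsto_cong)
 qed
qed (use o zero in auto)

text \<open>The tool for passing to limits: the volume of the pushed frame converges to a nonzero
  number, so its sign, and with it the orientation, is eventually constant. Along the way the frame
  is assumed tangent, and being a basis comes out.\<close>

lemma orientation_tendsto:
 assumes o: "orientation A W Or" and W: "is_submanifold A d W" and q0: "q0 : W" and q: "(q ---> q0) F"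
  and qW: "\<forall>\<^sub>F t in F. q t : W" and E: "list_all2 (%E v. tb_tendsto q E q0 v F) Es vs"
  and vs: "obasis (TS W q0) vs"
  and T: "ALL E:set Es. \<forall>\<^sub>F t in F. E t : TS W (q t)"
 shows "\<forall>\<^sub>F t in F. Or (q t) (map (%E. E t) Es) = Or q0 vs"
proof -
 obtain c L where sl: "slice c L W" "q0 : fst c" "dim L = d" using W q0 by (auto simp: submanifold_iff)
 have c: "c : charts" and L: "subspace L" using sl by (auto simp: slice_def)
 obtain rs where rs: "complement_list L rs" using complement_list_exists[OF L] by blast
 obtain s where ev: "\<forall>\<^sub>F q in nhds q0. q : W --> or_formula c rs s W Or q" using orientation_formula[OF o sl(1) q0 sl(2) rs] by blast
 have dimT: "dim (TS W q) = d" if "q : W" for q using sub_dim(2)[OF W that] .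
 have lvs: "length vs = d" using obasis_length[OF vs] dimT[OF q0] by simp
 note nzv = slice_basis_vol[OF sl(1) q0 sl(2) rs vs]
 define V where "V = vol (map (push A c q0) vs @ rs)"
 have nz: "V ~= 0" using nzv(1) by (simp add: V_def)
 have Or0: "Or q0 vs = s * sgn V" using eventually_nhds_x_imp_x[OF ev] q0 obasis_subset[OF vs] obasis_length[OF vs]
  by (simp add: or_formula_def V_def)
 have "((%t. vol (map (push A c (q t)) (map (%E. E t) Es) @ rs)) ---> V) F" unfolding V_def by (rule push_vol_tendsto[OF c sl(2) E nzv(2)])
 from tendstoD[OF this, of "\<bar>V\<bar>"] nz
 have "\<forall>\<^sub>F t in F. dist (vol (map (push A c (q t)) (map (%E. E t) Es) @ rs)) V < \<bar>V\<bar>" by simp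
 moreover have "\<forall>\<^sub>F t in F. ALL E:set Es. E t : TS W (q t)" using T by (simp add: eventually_ball_finite_distrib)
 moreover have "\<forall>\<^sub>F t in F. q t : W --> or_formula c rs s W Or (q t)" using q ev by (rule filterlim_iff[THEN iffD1, rule_format])
 ultimately show ?thesis using qW
 proof eventually_elim
  case (elim t)
  have "length (map (%E. E t) Es) = dim (TS W (q t))" "set (map (%E. E t) Es) \<subseteq> TS W (q t)" using list_all2_lengthD[OF E] lvs elim dimT[of "q t"] by auto
  then have "Or (q t) (map (%E. E t) Es) = s * sgn (vol (map (push A c (q t)) (map (%E. E t) Es) @ rs))" using elim unfolding or_formula_def by blast
  moreover have "sgn (vol (map (push A c (q t)) (map (%E. E t) Es) @ rs)) = sgn V" using elim(1) nz by (auto simp: dist_real_def sgn_if)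
  ultimately show ?case using Or0 by simp
 qed
qed

lemma orientationI_frame:
 assumes o: "!!q. q : W ==> vs_orientation (TS W q) (Or q)"
  and zero: "!!p bs. p \<notin> W ==> Or p bs = 0"
  and loc: "!!q0. q0 : W ==> EX c L vs. slice c L W & q0 : fst c & obasis (TS W q0) vs &
   (\<forall>\<^sub>F q in nhds q0. q : W --> Or q (map (%v. frame_field c q0 v q) vs) = Or q0 vs)"
 shows "orientation A W Or"
proof (rule orientationI[OF o zero])
 fix q0 assume q0: "q0 : W"
 obtain c L vs where h: "slice c L W" "q0 : fst c" "obasis (TS W q0) vs"
  "\<forall>\<^sub>F q in nhds q0. q : W --> Or q (map (%v. frame_field c q0 v q) vs) = Or q0 vs" using loc[OF q0] by blast
 then obtain rs where rs: "complement_list L rs" using complement_list_exists by (auto simp: slice_def)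
 obtain s where "\<forall>\<^sub>F q in nhds q0. q : W --> or_formula c rs s W Or q"
  by (rule formula_of_frame[where Or=Or, OF h(1) q0 h(2) rs o h(3,4)]) simp_all
 then show "EX c L rs s. slice c L W & q0 : fst c & complement_list L rs &
   (\<forall>\<^sub>F q in nhds q0. q : W --> or_formula c rs s W Or q)" using h rs by blast
qed

lemma formula_sign_unique:
 assumes sl: "slice c L W" and q: "q : W" "q : fst c" and rs: "complement_list L rs"
  and o: "vs_orientation (TS W q) (Or q)" "vs_orientation (TS W q) (Or' q)"
  and f: "or_formula c rs s W Or q" "or_formula c rs s' W Or' q"
 shows "Or q = Or' q \<longleftrightarrow> s = s'"
proof -
 obtain vs where vs: "obasis (TS W q) vs" using obasis_exists[OF slice_dim(1)[OF sl q]] by blast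
 have e: "Or q vs = s * sgn (vol (map (push A c q) vs @ rs))" "Or' q vs = s' * sgn (vol (map (push A c q) vs @ rs))"
  using f obasis_length[OF vs] obasis_subset[OF vs] unfolding or_formula_def by blast+
 show ?thesis
 proof
  assume "s = s'"
  then show "Or q = Or' q" using vs_orientation_eq[OF o slice_dim(1)[OF sl q] vs] e by simp
 next
  assume "Or q = Or' q"
  then show "s = s'" using e slice_basis_vol(1)[OF sl q rs vs] by (simp add: sgn_if split: if_splits)
 qed
qed

text \<open>Near each point both orientations are given by constant signs in one slice chart, so
  whether they agree is a locally constant property.\<close>

lemma orientation_unique:
 assumes o: "orientation A W Or" "orientation A W Or'" and W: "is_submanifold A d W" "connected W" and p: "p : W"
  and eq: "Or p bs = Or' p bs" "Or p bs ~= 0"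
 shows "Or = Or'"
proof -
 have ov: "vs_orientation (TS W q) (Or q)" "vs_orientation (TS W q) (Or' q)" if "q : W" for q using o that by (auto simp: orientation_def)
 have eq_p: "Or p = Or' p" using vs_values(2)[OF ov(1)[OF p]] eq vs_orientation_eq[OF ov[OF p] sub_dim(1)[OF W(1) p]] eq by blast
 have "Or q = Or' q" if "q : W" for q
 proof (rule connected_induction_simple[where P="%q. Or q = Or' q" and a=p and S=W])
  fix q0 assume q0: "q0 : W"
  obtain c L where sl: "slice c L W" "q0 : fst c" using W(1) q0 by (auto simp: submanifold_iff)
  have c: "c : charts" and L: "subspace L" using sl by (auto simp: slice_def)
  obtain rs where rs: "complement_list L rs" using complement_list_exists[OF L] by blast
  obtain s where s: "\<forall>\<^sub>F q in nhds q0. q : W --> or_formula c rs s W Or q" using orientation_formula[OF o(1) sl(1) q0 sl(2) rs] by blast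
  obtain s' where s': "\<forall>\<^sub>F q in nhds q0. q : W --> or_formula c rs s' W Or' q"
   using orientation_formula[OF o(2) sl(1) q0 sl(2) rs] by blast
  have "\<forall>\<^sub>F q in nhds q0. q : fst c" using chart_open[OF c] sl(2) by (rule eventually_nhds_in_open)
  with s s' have "\<forall>\<^sub>F q in nhds q0. q : W --> (Or q = Or' q \<longleftrightarrow> s = s')"
   by eventually_elim (use formula_sign_unique[where Or=Or and Or'=Or', OF sl(1) _ _ rs ov] in blast)
  then obtain N where N: "open N" "q0 : N" "!!q. q : N ==> q : W ==> (Or q = Or' q \<longleftrightarrow> s = s')" unfolding eventually_nhds by blast
  then show "EX T. openin (top_of_set W) T & q0 : T & (ALL x:T. ALL y:T. Or x = Or' x --> Or y = Or' y)" using q0 by auto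
 qed (use W p that eq_p in auto)
 moreover have "Or q bs = 0" "Or' q bs = 0" if "q \<notin> W" for q bs using o that by (auto simp: orientation_def)
 ultimately show ?thesis by (metis ext)
qed

lemma openin_slice:
 assumes W: "is_submanifold A d W" and S: "openin (top_of_set W) S" and q: "q : S"
 obtains c L where "slice c L W" "slice c L S" "q : fst c" "dim L = d"
proof -
 obtain U where U: "open U" "S = W \<inter> U" using S by (auto simp: openin_open)
 obtain c L where sl: "slice c L W" "q : fst c" "dim L = d" using W q U by (auto simp: submanifold_iff)
 have c: "c : charts" using sl(1) by (simp add: slice_def)
 have "open (fst c \<inter> U)" using chart_open[OF c] U by blast
 from slice_restrict[OF sl(1) this] have "slice (fst c \<inter> U, snd c) L W" by simp
 moreover from this have "slice (fst c \<inter> U, snd c) L S" unfolding slice_def U(2) by auto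
 ultimately show ?thesis using that[of "(fst c \<inter> U, snd c)" L] q U sl by simp
qed

lemma openin_submanifold:
 assumes W: "is_submanifold A d W" and S: "openin (top_of_set W) S"
 shows "is_submanifold A d S" "q : S ==> TS S q = TS W q"
proof -
 show "is_submanifold A d S" unfolding submanifold_iff
 proof
  fix p assume "p : S"
  from openin_slice[OF W S this] show "EX c L. slice c L S & p : fst c & dim L = d" by metis
 qed
 assume q: "q : S"
 obtain c L where sl: "slice c L W" "slice c L S" "q : fst c" by (rule openin_slice[OF W S q])
 moreover have "q : W" using q openin_imp_subset[OF S] by blast
 ultimately show "TS S q = TS W q" using slice_tangent[OF sl(1) _ sl(3)] slice_tangent[OF sl(2) q sl(3)] by simp
qed

lemma orientation_restrict:
 assumes W: "is_submanifold A d W" and S: "openin (top_of_set W) S" and o: "orientation A W Or"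
 shows "orientation A S (restrict_or S Or)" unfolding orientation_def
proof (intro conjI allI ballI impI)
 have SW: "S \<subseteq> W" using openin_imp_subset[OF S] .
 show "vs_orientation (TS S p) (restrict_or S Or p)" if "p : S" for p
  using that SW o openin_submanifold(2)[OF W S that] by (auto simp: orientation_def restrict_or_def)
 show "restrict_or S Or p bs = 0" if "p \<notin> S" for p bs using that by (simp add: restrict_or_def)
 fix S' Es assume S': "openin (top_of_set S) S' & (ALL E:set Es. continuous_field_on A S' E) &
    (ALL q:S'. obasis (TS S q) (map (%E. E q) Es))"
 then have "S' \<subseteq> S" by (meson openin_imp_subset)
 have "continuous_on S' (%q. Or q (map (%E. E q) Es))"
 proof (rule o[unfolded orientation_def, THEN conjunct2, THEN conjunct2, rule_format], intro conjI ballI)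
  show "openin (top_of_set W) S'" using S' S openin_trans by blast
  show "continuous_field_on A S' E" if "E : set Es" for E using S' that by blast
  show "obasis (TS W q) (map (%E. E q) Es)" if "q : S'" for q
   using S' that openin_submanifold(2)[OF W S subsetD[OF \<open>S' \<subseteq> S\<close> that]] by metis
 qed
 then show "continuous_on S' (%q. restrict_or S Or q (map (%E. E q) Es))"
  by (rule continuous_on_eq) (use \<open>S' \<subseteq> S\<close> in \<open>auto simp: restrict_or_def\<close>)
qed

lemma orientation_scale:
 assumes o: "orientation A W Or" and a: "a = 1 | a = - 1"
 shows "orientation A W (scale_or a Or)"
proof -
 have "vs_orientation V (%bs. a * sg bs)" if sg: "vs_orientation V sg" for V :: "'e set" and sg unfolding vs_orientation_def
 proof (intro conjI allI impI)
  fix bs cs C assume h: "obasis V bs & obasis V cs & C : carrier_mat (length bs) (length bs) &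
    (ALL j<length bs. cs ! j = (\<Sum>i<length bs. C $$ (i, j) *\<^sub>R bs ! i))"
  show "a * sg cs = sgn (det C) * (a * sg bs)" using sg h unfolding vs_orientation_def by simp
 next
  show "a * sg bs : {1, - 1}" if "obasis V bs" for bs using vs_values(1)[OF sg that] a by auto
  show "a * sg bs = 0" if "\<not> obasis V bs" for bs using vs_values(2)[OF sg that] by simp
 qed
 then show ?thesis using o unfolding orientation_def scale_or_def by (auto intro!: continuous_on_mult_left)
qed

text \<open>A slice cut down to a coordinate ball is the image of a convex set and hence connected.
  Openness of components is what allows orientations and tangent spaces to be restricted to
  them.\<close>

lemma openin_component:
 assumes W: "is_submanifold A d W"
 shows "openin (top_of_set W) (connected_component_set W u)"
proof (rule openin_subopen[THEN iffD2], intro ballI)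
 fix q assume q: "q : connected_component_set W u"
 then have qW: "q : W" using connected_component_subset by blast
 obtain c L where sl: "slice c L W" "q : fst c" using W qW by (auto simp: submanifold_iff)
 have c: "c : charts" and L: "subspace L" using sl by (auto simp: slice_def)
 obtain r where r: "r > 0" "ball (snd c q) r \<subseteq> snd c ` fst c" using chart_open_range[OF c] sl(2) unfolding open_contains_ball by blast
 define K where "K = ball (snd c q) r \<inter> (%l. snd c q + l) ` L"
 define N where "N = {p : fst c. snd c p : ball (snd c q) r}"
 have eq: "W \<inter> N = chart_inv c ` K"
 proof (intro equalityI subsetI)
  fix p assume p: "p : W \<inter> N"
  then have "snd c p - snd c q : L" using sl qW unfolding slice_def N_def by blast
  then have "snd c p : K" using p by (auto simp: K_def N_def intro: image_eqI[of _ _ "snd c p - snd c q"])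
  moreover have "p = chart_inv c (snd c p)" using p c by (simp add: N_def)
  ultimately show "p : chart_inv c ` K" by blast
 next
  fix p assume "p : chart_inv c ` K"
  then obtain l where l: "l : L" "snd c q + l : ball (snd c q) r" "p = chart_inv c (snd c q + l)" by (auto simp: K_def)
  then have p: "p : fst c" "snd c p = snd c q + l" using r l c by auto
  then show "p : W \<inter> N" using sl qW l unfolding slice_def by (simp add: N_def)
 qed
 have "convex K" unfolding K_def by (intro convex_Int convex_ball convex_translation subspace_imp_convex L)
 then have "connected (chart_inv c ` K)"
  by (intro connected_continuous_image continuous_on_subset[OF chart_inv_cont[OF c]] convex_connected) (use r in \<open>auto simp: K_def\<close>)
 moreover have qN: "q : W \<inter> N" using qW sl r by (simp add: N_def)
 ultimately have "W \<inter> N \<subseteq> connected_component_set W q" unfolding eq[symmetric] by (intro connected_component_maximal) auto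
 also have "connected_component_set W q = connected_component_set W u" using q connected_component_eq by metis
 finally have "W \<inter> N \<subseteq> connected_component_set W u" .
 moreover have "openin (top_of_set W) (W \<inter> N)" unfolding N_def by (intro openin_open_Int chart_open_preimage[OF c] open_ball)
 ultimately show "EX T. openin (top_of_set W) T & q : T & T \<subseteq> connected_component_set W u" using qN by blast
qed

end

section \<open>Induced orientations\<close>

lemma complement_list_Nil: "complement_list UNIV ([] :: 'e::euclidean_space list)"
 unfolding complement_list_def using obasis_exists[OF subspace_UNIV] obasis_UNIV_iff by auto

lemma vs_orientation_det:
 "vs_orientation V sg ==> obasis V bs ==> obasis V cs ==> C : carrier_mat (length bs) (length bs) ==>
  (!!j. j < length bs ==> cs ! j = (\<Sum>i<length bs. C $$ (i, j) *\<^sub>R bs ! i)) ==> sg cs = sgn (det C) * sg bs"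
 unfolding vs_orientation_def by blast

text \<open>The product oM (ns @ ws) * oS ws is the orientation of the quotient by \<open>S\<close>:
  a change of \<open>ws\<close> contributes the same determinant sign twice, and \<open>ns\<close>
  enters only modulo \<open>S\<close>.\<close>

lemma normal_sign_change:
 fixes oM oS :: "'e::euclidean_space list => real"
 assumes oM: "vs_orientation UNIV oM" and oS: "vs_orientation S oS"
  and ws: "obasis S ws" "obasis S ws'"
  and len: "length ns + dim S = DIM('e)" "length ns' = length ns" and D: "D : carrier_mat (length ns) (length ns)"
  and ns': "!!j. j < length ns ==> ns' ! j - (\<Sum>i<length ns. D $$ (i, j) *\<^sub>R ns ! i) : S"
 shows "oM (ns' @ ws') * oS ws' = sgn (det D) * (oM (ns @ ws) * oS ws)"
proof -
 have l: "length ws = dim S" "length ws' = dim S" using ws obasis_length by blast+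
 obtain s where s: "s = 1 | s = - 1" "!!cs. length cs = DIM('e) ==> oM cs = s * sgn (vol cs)"
  using orientation_vol[OF oM subspace_UNIV complement_list_Nil] by auto
 have ws_in: "ws' ! j : span (set ws)" if "j < length ws'" for j using ws that obasis_subset[OF ws(2)] obasis_span[OF ws(1)] nth_mem by blast
 obtain E where E: "E : carrier_mat (length ws) (length ws')"
  "!!j. j < length ws' ==> ws' ! j = (\<Sum>i<length ws. E $$ (i, j) *\<^sub>R ws ! i)" by (rule coordinate_matrix[OF ws_in]) blast+
 have "vol (ns' @ ws') = det D * vol (ns @ ws')" by (rule vol_append[OF _ len(2) D]) (use ns' obasis_span[OF ws(2)] len l in simp_all)
 moreover have "vol (ns @ ws') = det E * vol (ns @ ws)" by (rule vol_prepend) (use E len l in \<open>simp_all add: span_zero\<close>)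
 moreover have "oS ws' = sgn (det E) * oS ws" by (rule vs_orientation_det[OF oS ws]) (use E l in auto)
 moreover from this have "sgn (det E) * sgn (det E) = 1" using vs_values(1)[OF oS ws(2)] by auto
 moreover have "oM (ns' @ ws') = s * sgn (vol (ns' @ ws'))" "oM (ns @ ws) = s * sgn (vol (ns @ ws))" using s(2) len l by auto
 ultimately have "oM (ns' @ ws') * oS ws' = sgn (det E) * sgn (det E) * (sgn (det D) * (oM (ns @ ws) * oS ws))"
  "sgn (det E) * sgn (det E) = 1" by (simp_all add: sgn_mult)
 then show ?thesis by simp
qed

lemma orientation_block:
 fixes sg :: "'e::euclidean_space list => real"
 assumes sg: "vs_orientation V sg" and b: "obasis V (ms @ ns)" "obasis V (ms' @ ns')"
  and len: "length ms' = length ms" and C: "C : carrier_mat (length ms) (length ms)" "D : carrier_mat (length ns) (length ns)"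
  and ms': "!!j. j < length ms ==> ms' ! j = (\<Sum>i<length ms. C $$ (i, j) *\<^sub>R ms ! i)"
  and ns': "!!j. j < length ns ==> ns' ! j - (\<Sum>i<length ns. D $$ (i, j) *\<^sub>R ns ! i) : span (set ms)"
 shows "sg (ms' @ ns') = sgn (det C) * sgn (det D) * sg (ms @ ns)"
proof -
 have "length ns' = length ns" using obasis_length[OF b(1)] obasis_length[OF b(2)] len by simp
 from block_matrix[OF len this C ms' ns']
 obtain Q :: "real Matrix.mat" where Q: "Q : carrier_mat (length ms + length ns) (length ms + length ns)"
  "!!j. j < length ms + length ns ==> (ms' @ ns') ! j = (\<Sum>i<length ms + length ns. Q $$ (i, j) *\<^sub>R (ms @ ns) ! i)"
  "det Q = det C * det D" by blast
 have "sg (ms' @ ns') = sgn (det Q) * sg (ms @ ns)" by (rule vs_orientation_det[OF sg b]) (use Q in auto)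
 then show ?thesis by (simp add: Q(3) sgn_mult)
qed

context manifold
begin

lemma tendsto_at_point: "((%q. q) ---> q0) (inf (nhds q0) G)" by (simp add: filterlim_def)

text \<open>\<open>N\<close> gives the orientations of the normal spaces of \<open>S\<close>.\<close>

lemma intersection_orientation:
 assumes V: "is_submanifold A dV V" and S: "is_submanifold A dS S" and C: "is_submanifold A d (V \<inter> S)"
  and dims: "d + DIM('e) = dV + dS"
  and trans: "!!p. p : V \<inter> S ==> {v + w | v w. v : TS V p & w : TS S p} = UNIV"
  and T: "!!p. p : V \<inter> S ==> TS (V \<inter> S) p = TS V p \<inter> TS S p"
  and OM: "orientation A UNIV OM" and OV: "orientation A V OV" and OS: "orientation A S OS"
  and N: "!!p ns ws. p : V \<inter> S ==> length ns + d = dV ==> obasis (TS S p) ws ==> OM p (ns @ ws) = N p ns * OS p ws"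
 defines "P \<equiv> %Or. orientation A (V \<inter> S) Or & (ALL p:V \<inter> S. ALL ms ns.
    obasis (TS (V \<inter> S) p) ms & obasis (TS V p) (ms @ ns) -->
    OV p (ms @ ns) = Or p ms * N p ns)"
 shows "P (THE Or. P Or)"
proof -
 define C where "C = V \<inter> S"
 have oM: "vs_orientation UNIV (OM p)" for p using OM by (simp add: orientation_def tangent_space_UNIV)
 have oV: "vs_orientation (TS V p) (OV p)" if "p : C" for p using OV that by (simp add: orientation_def C_def)
 have oS: "vs_orientation (TS S p) (OS p)" if "p : C" for p using OS that by (simp add: orientation_def C_def)
 have subs: "subspace (TS V p)" "subspace (TS S p)" "subspace (TS C p)"
  "dim (TS V p) = dV" "dim (TS S p) = dS" "dim (TS C p) = d" if "p : C" for p
  using that sub_dim[OF V, of p] sub_dim[OF S, of p] sub_dim[OF \<open>is_submanifold A d (V \<inter> S)\<close>, of p] by (simp_all add: C_def)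
 have Cn: "is_submanifold A d C" using \<open>is_submanifold A d (V \<inter> S)\<close> by (simp add: C_def)
 have T': "TS C p = TS V p \<inter> TS S p" if "p : C" for p using T that by (simp add: C_def)
 have extB: "EX ns. obasis (TS V p) (ms @ ns)" if p: "p : C" and ms: "obasis (TS C p) ms" for p ms by (rule extend_to_obasis[OF subs(1)[OF p], of ms])
   (use ms T'[OF p] obasis_subset[OF ms] in \<open>auto simp: ordered_basis_def\<close>)
 have len: "length ns + d = dV" if "p : C" "obasis (TS C p) ms" "obasis (TS V p) (ms @ ns)" for p ms ns
  using obasis_length[OF that(2)] obasis_length[OF that(3)] subs[OF that(1)] by simp
 have Neq: "N p ns = OM p (ns @ ws) * OS p ws" if "p : C" "length ns + d = dV" "obasis (TS S p) ws" for p ns ws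
  using N[of p ns ws] that vs_values(1)[OF oS that(3)] by (auto simp: C_def)
 \<comment> \<open>The sign that the defining equation forces on \<open>ms\<close>. A change of
   \<open>ns\<close> multiplies \<open>OV\<close> and \<open>N\<close> by the same determinant sign,
   so only the change of \<open>ms\<close> remains.\<close>
 define G where "G p ms ns = OV p (ms @ ns) * N p ns" for p ms ns
 have change: "G p ms' ns' = sgn (det Q) * G p ms ns"
  if p: "p : C" and ms: "obasis (TS C p) ms" "obasis (TS C p) ms'"
   and ns: "obasis (TS V p) (ms @ ns)" "obasis (TS V p) (ms' @ ns')"
   and Q: "Q : carrier_mat (length ms) (length ms)" "!!j. j < length ms ==> ms' ! j = (\<Sum>i<length ms. Q $$ (i, j) *\<^sub>R ms ! i)"
  for p ms ms' ns ns' Q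
 proof -
  have l: "length ms' = length ms" "length ns' = length ns" "length ns + dS = DIM('e)"
   using obasis_length[OF ms(1)] obasis_length[OF ms(2)] len[OF p ms(1) ns(1)] len[OF p ms(2) ns(2)] dims by auto
  obtain ws where ws: "obasis (TS S p) ws" using obasis_exists[OF subs(2)[OF p]] by blast
  have "ns' ! j : span (set (ms @ ns))" if "j < length ns'" for j using obasis_subset[OF ns(2)] obasis_span[OF ns(1)] nth_mem[OF that] by auto
  then obtain E where E: "E : carrier_mat (length (ms @ ns)) (length ns')"
   "!!j. j < length ns' ==> ns' ! j = (\<Sum>i<length (ms @ ns). E $$ (i, j) *\<^sub>R (ms @ ns) ! i)"
   by (rule coordinate_matrix[of ns' "ms @ ns"]) blast+
  define D where "D = Matrix.mat (length ns) (length ns) (%(i, j). E $$ (length ms + i, j))"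
  have D: "D : carrier_mat (length ns) (length ns)" by (simp add: D_def)
  have rest: "ns' ! j - (\<Sum>i<length ns. D $$ (i, j) *\<^sub>R ns ! i) : span (set ms)" if "j < length ns" for j
  proof -
   have "ns' ! j - (\<Sum>i<length ns. D $$ (i, j) *\<^sub>R ns ! i) = (\<Sum>i<length ms. E $$ (i, j) *\<^sub>R ms ! i)"
    using E(2)[of j] that l unfolding length_append sum_nth_append by (simp add: D_def)
   then show ?thesis by (simp only:) (intro span_sum span_scale span_base nth_mem, simp)
  qed
  have spanC: "span (set ms) \<subseteq> TS S p" using obasis_span[OF ms(1)] T'[OF p] by blast
  obtain e where e: "e = sgn (det D)" by blast
  have 1: "OV p (ms' @ ns') = sgn (det Q) * e * OV p (ms @ ns)" unfolding e by (rule orientation_block[OF oV[OF p] ns l(1) Q(1) D Q(2) rest])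
  have 2: "N p ns' = e * N p ns" unfolding e Neq[OF p len[OF p ms(1) ns(1)] ws] Neq[OF p len[OF p ms(2) ns(2)] ws]
   by (rule normal_sign_change[OF oM oS[OF p] ws ws _ l(2) D]) (use l subs[OF p] rest spanC in auto)
  have "e * e = 1" using vs_values(1)[OF oV[OF p] ns(2)] 1 by (auto simp: e)
  moreover have "G p ms' ns' = (e * e) * (sgn (det Q) * G p ms ns)" unfolding G_def 1 2 by simp
  ultimately show ?thesis by simp
 qed
 define Or where "Or p ms = (if p : C & obasis (TS C p) ms
   then G p ms (SOME ns. obasis (TS V p) (ms @ ns)) else 0)" for p ms
 have Or_eq: "Or p ms = G p ms ns"
  if p: "p : C" "obasis (TS C p) ms" "obasis (TS V p) (ms @ ns)" for p ms ns
 proof -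
  have b: "obasis (TS V p) (ms @ (SOME ns. obasis (TS V p) (ms @ ns)))" using extB[OF p(1,2)] by (rule someI_ex)
  from change[OF p(1,2,2,3) b one_carrier_mat, OF sum_scalar_mat(2)[symmetric]] show ?thesis using p by (simp add: Or_def)
 qed
 \<comment> \<open>Transversality makes \<open>ns\<close> together with a basis of the tangent space
   of \<open>S\<close> a basis of the whole space, so \<open>N\<close> does not vanish.\<close>
 have N_val: "N p ns = 1 | N p ns = - 1"
  if p: "p : C" and ms: "obasis (TS C p) ms" and ns: "obasis (TS V p) (ms @ ns)" for p ms ns
 proof -
  obtain ws where ws: "obasis (TS S p) ws" using obasis_exists[OF subs(2)[OF p]] by blast
  let ?U = "span (set (ns @ ws))"
  have "set (ms @ ns) \<subseteq> ?U" using obasis_subset[OF ms] T'[OF p] obasis_span[OF ws] span_mono[of "set ws" "set (ns @ ws)"] span_superset[of "set (ns @ ws)"] by auto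
  then have 1: "TS V p \<subseteq> ?U" using span_minimal[OF _ subspace_span, of "set (ms @ ns)"] obasis_span[OF ns] by metis
  have 2: "TS S p \<subseteq> ?U" using span_mono[of "set ws" "set (ns @ ws)"] obasis_span[OF ws] by auto
  have "x : ?U" for x
  proof -
   have "x : {v + w | v w. v : TS V p & w : TS S p}" using trans p by (simp add: C_def)
   then show ?thesis using 1 2 span_add by blast
  qed
  then have "span (set (ns @ ws)) = UNIV" by blast
  moreover have l: "length (ns @ ws) = DIM('e)" using obasis_length[OF ws] len[OF p ms ns] subs[OF p] dims by simp
  ultimately have "obasis UNIV (ns @ ws)" using obasis_UNIV_iff vol_nonzero_iff_span[OF l] by blast
  then show ?thesis using Neq[OF p len[OF p ms ns] ws] vs_values(1)[OF oM] vs_values(1)[OF oS[OF p] ws] by force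
 qed
 have vs: "vs_orientation (TS C p) (Or p)" if p: "p : C" for p unfolding vs_orientation_def
 proof (intro conjI allI impI)
  show "Or p ms : {1, - 1}" if ms: "obasis (TS C p) ms" for ms
  proof -
   obtain ns where ns: "obasis (TS V p) (ms @ ns)" using extB[OF p ms] by blast
   show ?thesis unfolding Or_eq[OF p ms ns] G_def using N_val[OF p ms ns] vs_values(1)[OF oV[OF p] ns] by auto
  qed
  fix bs cs Q assume h: "obasis (TS C p) bs & obasis (TS C p) cs &
    Q : carrier_mat (length bs) (length bs) & (ALL j<length bs. cs ! j = (\<Sum>i<length bs. Q $$ (i, j) *\<^sub>R bs ! i))"
  then obtain ns ns' where ns: "obasis (TS V p) (bs @ ns)" "obasis (TS V p) (cs @ ns')" using extB[OF p] by metis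
  show "Or p cs = sgn (det Q) * Or p bs" using Or_eq[OF p _ ns(1)] Or_eq[OF p _ ns(2)] change[OF p _ _ ns, of Q] h by simp
 qed (simp add: Or_def)
 have Or: "orientation A C Or"
 proof (rule orientationI_frame[OF vs])
  show "Or p bs = 0" if "p \<notin> C" for p bs using that by (simp add: Or_def)
  fix p0 assume p0: "p0 : C"
  \<comment> \<open>Bases of the three spaces at \<open>p0\<close> are extended as constant frames,
    each in a slice chart of its own submanifold. These frames are continuous at \<open>p0\<close>,
    so all orientations involved keep their values nearby.\<close>
  obtain c L where sl: "slice c L C" "p0 : fst c" using Cn p0 by (auto simp: submanifold_iff)
  obtain c1 L1 where sl1: "slice c1 L1 V" "p0 : fst c1" using V p0 by (auto simp: submanifold_iff C_def)
  obtain c2 L2 where sl2: "slice c2 L2 S" "p0 : fst c2" using S p0 by (auto simp: submanifold_iff C_def)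
  have ch: "c : charts" "c1 : charts" "c2 : charts" using sl sl1 sl2 by (auto simp: slice_def)
  obtain ms where ms: "obasis (TS C p0) ms" using obasis_exists[OF subs(3)[OF p0]] by blast
  obtain ns where ns: "obasis (TS V p0) (ms @ ns)" using extB[OF p0 ms] by blast
  obtain ws where ws: "obasis (TS S p0) ws" using obasis_exists[OF subs(2)[OF p0]] by blast
  let ?F = "inf (nhds p0) (principal C)"
  have lim: "((%q. q) ---> p0) ?F" by (rule tendsto_at_point)
  define MS NS WS where "MS = map (frame_field c p0) ms" and "NS = map (frame_field c1 p0) ns" and "WS = map (frame_field c2 p0) ws"
  have tb: "list_all2 (%E v. tb_tendsto (%q. q) E p0 v ?F) (map (frame_field d p0) vs) vs" if "d : charts" "p0 : fst d" for d vs
   using frame_field_tb[OF that lim] by (simp add: list_all2_conv_all_nth)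
  have evC: "\<forall>\<^sub>F q in ?F. q : C" by (simp add: eventually_inf_principal)
  have inT: "\<forall>\<^sub>F q in ?F. frame_field d p0 v q : TS W q"
   if "slice d K W" "p0 : fst d" "C \<subseteq> W" "v : TS W p0" for d K W v
  proof -
   have "d : charts" using that by (simp add: slice_def)
   from ev_chart[OF this that(2) lim] evC show ?thesis
   proof eventually_elim
    case (elim q)
    then have "q : W" "p0 : W" using that p0 by blast+
    then show ?case using that \<open>d : charts\<close> elim slice_tangent[OF that(1), of q] slice_tangent[OF that(1), of p0]
     by (simp add: frame_field_def)
   qed
  qed
  have sub: "set ms \<subseteq> TS C p0" "set ms \<subseteq> TS V p0" "set ns \<subseteq> TS V p0" "set ws \<subseteq> TS S p0"
   using obasis_subset[OF ms] obasis_subset[OF ns] obasis_subset[OF ws] by auto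
  have inC: "ALL E:set MS. \<forall>\<^sub>F q in ?F. E q : TS C q" using inT[OF sl] sub by (auto simp: MS_def)
  have inV: "ALL E:set (MS @ NS). \<forall>\<^sub>F q in ?F. E q : TS V q"
  proof
   fix E assume "E : set (MS @ NS)"
   then consider "E : set MS" | "E : set NS" by auto
   then show "\<forall>\<^sub>F q in ?F. E q : TS V q"
   proof cases
    case 1
    then have "\<forall>\<^sub>F q in ?F. E q : TS C q" using inC by blast
    with evC show ?thesis by eventually_elim (use T' in blast)
   next
    case 2
    then show ?thesis using inT[OF sl1] sub by (auto simp: NS_def C_def)
   qed
  qed
  have inS: "ALL E:set WS. \<forall>\<^sub>F q in ?F. E q : TS S q" using inT[OF sl2] sub by (auto simp: WS_def C_def)
  have evV: "\<forall>\<^sub>F q in ?F. OV q (map (%E. E q) (MS @ NS)) = OV p0 (ms @ ns)" by (rule orientation_tendsto[OF OV V _ lim _ _ ns inV])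
    (use p0 evC tb[OF ch(1) sl(2)] tb[OF ch(2) sl1(2)] in \<open>auto simp: C_def MS_def NS_def intro!: list_all2_appendI elim: eventually_mono\<close>)
  have evS: "\<forall>\<^sub>F q in ?F. OS q (map (%E. E q) WS) = OS p0 ws" by (rule orientation_tendsto[OF OS S _ lim _ _ ws inS])
    (use p0 evC tb[OF ch(3) sl2(2)] in \<open>auto simp: C_def WS_def elim: eventually_mono\<close>)
  have bM: "obasis UNIV (ns @ ws)"
   using N_val[OF p0 ms ns] Neq[OF p0 len[OF p0 ms ns] ws] vs_values(2)[OF oM] by (metis mult_zero_left zero_neq_neg_one zero_neq_one)
  have evM: "\<forall>\<^sub>F q in ?F. OM q (map (%E. E q) (NS @ WS)) = OM p0 (ns @ ws)" by (rule orientation_tendsto[OF OM UNIV_submanifold _ lim])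
    (use bM tb[OF ch(2) sl1(2)] tb[OF ch(3) sl2(2)] in \<open>auto simp: tangent_space_UNIV NS_def WS_def intro!: list_all2_appendI\<close>)
  have "\<forall>\<^sub>F q in ?F. Or q (map (%v. frame_field c p0 v q) ms) = Or p0 ms"
   using evC evV evS evM ev_chart[OF ch(1) sl(2) lim] ev_chart[OF ch(3) sl2(2) lim]
  proof eventually_elim
   case (elim q)
   let ?ms = "map (%E. E q) MS" and ?ns = "map (%E. E q) NS" and ?ws = "map (%E. E q) WS"
   have "OV q (?ms @ ?ns) ~= 0" using elim(2) vs_values(1)[OF oV[OF p0] ns] by auto
   then have ns': "obasis (TS V q) (?ms @ ?ns)" using vs_values(2)[OF oV[OF elim(1)]] by blast
   have "obasis (TS C q) (map (%v. frame_field c p0 v q) ms)" by (rule frame_field_basis[OF sl(1) p0 sl(2) elim(1,5) ms])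
   then have ms': "obasis (TS C q) ?ms" by (simp add: MS_def o_def)
   have "obasis (TS S q) (map (%v. frame_field c2 p0 v q) ws)"
    by (rule frame_field_basis[OF sl2(1) _ sl2(2) _ elim(6) ws]) (use p0 elim(1) in \<open>auto simp: C_def\<close>)
   then have ws': "obasis (TS S q) ?ws" by (simp add: WS_def o_def)
   have "Or q ?ms = Or p0 ms" unfolding Or_eq[OF p0 ms ns] Or_eq[OF elim(1) ms' ns'] G_def Neq[OF p0 len[OF p0 ms ns] ws]
     Neq[OF elim(1) len[OF elim(1) ms' ns'] ws'] using elim(2-4) by simp
   then show ?case by (simp add: MS_def o_def)
  qed
  then show "EX c L vs. slice c L C & p0 : fst c & obasis (TS C p0) vs &
   (\<forall>\<^sub>F q in nhds p0. q : C --> Or q (map (%v. frame_field c p0 v q) vs) = Or p0 vs)"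
   using sl ms unfolding eventually_inf_principal by blast
 qed
 have P_iff: "P Or' \<longleftrightarrow> orientation A C Or' & (ALL p:C. ALL ms ns. obasis (TS C p) ms &
  obasis (TS V p) (ms @ ns) --> OV p (ms @ ns) = Or' p ms * N p ns)" for Or' by (simp add: P_def C_def)
 have "P Or" unfolding P_iff
 proof (intro conjI Or ballI allI impI)
  fix p ms ns assume p: "p : C" and b: "obasis (TS C p) ms & obasis (TS V p) (ms @ ns)"
  then show "OV p (ms @ ns) = Or p ms * N p ns" using Or_eq[OF p, of ms ns] N_val[OF p, of ms ns] by (auto simp: G_def)
 qed
 moreover have "Or' = Or" if P': "P Or'" for Or'
 proof (intro HOL.ext)
  fix p ms
  show "Or' p ms = Or p ms"
  proof (cases "p : C & obasis (TS C p) ms")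
   case True
   then obtain ns where ns: "obasis (TS V p) (ms @ ns)" using extB by blast
   then have "OV p (ms @ ns) = Or' p ms * N p ns" using P' True unfolding P_iff by blast
   then show ?thesis using Or_eq[of p ms ns] N_val[of p ms ns] True ns by (auto simp: G_def)
  next
   case False
   moreover have "p : C ==> vs_orientation (TS C p) (Or' p)" "p \<notin> C ==> Or' p ms = 0" using P' unfolding P_iff orientation_def by blast+
   ultimately show ?thesis using vs_values(2)[of _ "Or' p" ms] by (cases "p : C") (auto simp: Or_def)
  qed
 qed
 ultimately show ?thesis by (rule theI)
qed

end

section \<open>Orientability of stable manifolds\<close>

lemma sgn_vol_scale:
 fixes bs :: "'e::euclidean_space list"
 assumes "length bs + length rs = DIM('e)" "c > 0"
 shows "sgn (vol (map ((*\<^sub>R) c) bs @ rs)) = sgn (vol (bs @ rs))"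
proof -
 let ?n = "length bs"
 have "vol (map ((*\<^sub>R) c) bs @ rs) = det (c \<cdot>\<^sub>m 1\<^sub>m ?n) * vol (bs @ rs)"
  by (intro vol_append) (use assms in \<open>simp_all add: span_zero sum_scalar_mat(1) del: index_smult_mat\<close>)
 then show ?thesis using assms(2) by (simp add: sgn_mult)
qed

lemma (in manifold) tangent_curve:
 assumes v: "v : TS W p" and U: "open U" "p : U"
 obtains x ro where "ro > 0" "at (0::real) within {-ro<..<ro} ~= bot" "has_velocity A {-ro<..<ro} x 0 v" "x 0 = p"
  "!!s. s : {-ro<..<ro} ==> x s : W \<inter> U"
proof -
 obtain x ep where x: "ep > 0" "smooth_curve_on A {-ep<..<ep} x" "x ` {-ep<..<ep} \<subseteq> W" "x 0 = p" "velocity A {-ep<..<ep} x 0 = v"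
  using v unfolding tangent_space_def by blast
 have nb: "at 0 within {- r<..<r} ~= bot" if "r > 0" for r :: real using that at_within_open[of 0 "{- r<..<r}"] by simp
 have "0 : {-ep<..<ep}" using x(1) by simp
 from smooth_curve_has_velocity[OF x(2) this nb[OF x(1)]] have hv: "has_velocity A {-ep<..<ep} x 0 v" by (simp only: x(5))
 have "continuous_on {-ep<..<ep} x" using x(2) by (simp add: smooth_curve_on_def)
 then obtain r where r: "r > 0" "!!s. s : {-ep<..<ep} \<inter> ball 0 r ==> x s : U" by (rule openin_interval_ball[of _ x 0 U]) (use x U in auto)
 define ro where "ro = min ep r"
 have ro: "ro > 0" "{-ro<..<ro} \<subseteq> {-ep<..<ep}" "!!s. s : {-ro<..<ro} ==> x s : U"
  using r x(1) by (simp_all add: ro_def subset_iff abs_less_iff min_def split: if_splits)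
 show ?thesis by (rule that[OF ro(1) nb[OF ro(1)] has_velocity_subset[OF hv ro(2)] x(4)]) (use ro(2,3) x(3) in blast)
qed

context gradient_like
begin

text \<open>Each point is joined to \<open>ga\<close> by its forward trajectory with the end point
  added, a set between the connected trajectory and its closure.\<close>

lemma Ws_connected:
 assumes "ga : Crit A f"
 shows "connected (WS ga)"
proof -
 have "connected_component (WS ga) p ga" if "p : WS ga" for p
 proof -
  obtain x where x: "icurve X {0..} x" "x 0 = p" "(x ---> ga) at_top" using \<open>p : _\<close> by (auto simp: Ws_def)
  have "x r : WS ga" if "r >= 0" for r using flow_invariant_curve[OF Ws_flow_invariant x(1), of 0 r] x(2) \<open>p : _\<close> that by simp
  moreover have "connected (x ` {0..})" by (intro connected_continuous_image icurve_continuous[OF x(1)]) (simp add: convex_connected)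
  moreover have "ga : closure (x ` {0..})"
  proof (rule Lim_in_closed_set[OF closed_closure _ _ x(3)])
   show "\<forall>\<^sub>F r in at_top. x r : closure (x ` {0..})"
    using eventually_ge_at_top[of 0] by eventually_elim (use closure_subset[of "x ` {0..}"] in auto)
  qed simp
  ultimately have "insert ga (x ` {0..}) \<subseteq> WS ga" "connected (insert ga (x ` {0..}))"
   using Crit_in_Ws[OF assms] connected_intermediate_closure[of "x ` {0..}" "insert ga (x ` {0..})"] closure_subset[of "x ` {0..}"] by auto
  then show ?thesis unfolding connected_component_def using x(2) by auto
 qed
 then have "connected_component (WS ga) p q" if "p : WS ga" "q : WS ga" for p q
  using connected_component_trans[OF _ connected_component_sym] that by blast
 then show ?thesis unfolding connected_iff_connected_component by blast
qed

text \<open>On the stable manifold the two charts differ by the flow over time T' - T inside the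
  Morse chart, which acts there as multiplication by exp (- 2 (T' - T)). A positive scalar preserves
  orientations.\<close>

lemma flow_chart_scaling:
 assumes m: "morse_model ga m B" and de: "cball 0 de \<subseteq> snd m ` fst m"
 defines "m' \<equiv> ({q : fst m. norm (snd m q) < de}, snd m)"
 assumes d: "flow_chart T 0 m' d" and d': "flow_chart T' 0 m' d'" and T: "0 <= T" "T <= T'"
  and p: "p : WS ga" "p : fst d" "p : fst d'" and v: "v : TS (WS ga) p"
 shows "push A d' p v = exp (- (2 * (T' - T))) *\<^sub>R push A d p v"
proof -
 define e where "e = exp (- (2 * (T' - T)))"
 have B: "B \<subseteq> Basis" using m unfolding morse_model_def by blast
 have ch: "d : charts" "d' : charts" using d d' by (auto simp: flow_chart_def)
 have eq: "snd d' q = e *\<^sub>R snd d q" if q: "q : WS ga" "q : fst d" "q : fst d'" for q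
 proof -
  obtain w where w: "icurve X (closed_segment T 0) w" "w T : fst m'" "w 0 = q" "snd m' (w T) = snd d q" using d q(2) unfolding flow_chart_def by blast
  obtain w' where w': "icurve X (closed_segment T' 0) w'" "w' 0 = q" "snd m' (w' T') = snd d' q" using d' q(3) unfolding flow_chart_def by blast
  have seg: "closed_segment T 0 \<subseteq> closed_segment T' 0" "closed_segment T T' \<subseteq> closed_segment T' 0"
   using T by (auto simp: closed_segment_eq_real_ivl)
  have wT: "w' T = w T" by (rule integral_unique[OF icurve_subset[OF w'(1) seg(1)] w(1), of 0]) (use w w' in auto)
  have L: "proj B (snd m (w T)) = 0" using flow_invariantD[OF Ws_flow_invariant w(1)] w(3) q(1) Ws_local[OF m de, of "w T"] w(2) in_span_compl_iff[OF B] by (simp add: m'_def)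
  then have df: "dflow B r (snd m (w T)) = exp (- (2 * r)) *\<^sub>R snd m (w T)" for r by (simp add: dflow_def)
  have "dflow B r (snd m (w' T)) : snd m ` fst m" if "r : closed_segment 0 (T' - T)" for r
  proof -
   have "r >= 0" using that T by (auto simp: closed_segment_eq_real_ivl)
   then have "norm (dflow B r (snd m (w T))) <= 1 * norm (snd m (w T))" unfolding df norm_scaleR by (intro mult_right_mono) auto
   then show ?thesis using w(2) de wT by (auto simp: m'_def)
  qed
  from model_curve_eq(2)[OF morse_model_chart[OF m] icurve_subset[OF w'(1) seg(2)] _ this]
  show ?thesis using wT w w' df[of "T' - T"] by (simp add: m'_def e_def)
 qed
 obtain x ro where x: "ro > 0" "at (0::real) within {-ro<..<ro} ~= bot" "has_velocity A {-ro<..<ro} x 0 v" "x 0 = p"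
  "!!s. s : {-ro<..<ro} ==> x s : WS ga \<inter> (fst d \<inter> fst d')"
  by (rule tangent_curve[OF v, of "fst d \<inter> fst d'"]) (use p chart_open[OF ch(1)] chart_open[OF ch(2)] in auto)
 have D: "((snd d o x) has_vector_derivative push A d p v) (at 0 within {-ro<..<ro})"
  "((snd d' o x) has_vector_derivative push A d' p v) (at 0 within {-ro<..<ro})"
  using x(1,3,4) has_velocity_iff[OF ch(1), of x 0 "{-ro<..<ro}" v] has_velocity_iff[OF ch(2), of x 0 "{-ro<..<ro}" v] p by auto
 have "((snd d' o x) has_vector_derivative e *\<^sub>R push A d p v) (at 0 within {-ro<..<ro})" using bounded_linear.has_vector_derivative[OF bounded_linear_scaleR_right D(1)] by (rule has_vector_derivative_transform[rotated 2]) (use x(1,5) eq in auto)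
 from vector_derivative_unique_within[OF x(2) D(2) this] show ?thesis by (simp add: e_def)
qed

text \<open>The coordinates of the Morse chart are carried backward along trajectories. Charts
  carried over different times differ on tangent spaces by positive scalars, so pulling back an
  orientation of span (Basis - B) does not depend on the chart.\<close>

lemma Ws_orientable:
 assumes ga: "ga : Crit A f"
 obtains Or where "orientation A (WS ga) Or"
proof -
 obtain m B where m: "morse_model ga m B" using morse_model_exists[OF ga] by blast
 have mc: "m : charts" "ga : fst m" "snd m ga = 0" using m unfolding morse_model_def by blast+
 obtain de where de: "de > 0" "cball 0 de \<subseteq> snd m ` fst m" using chart_open_range[OF mc(1)] mc(2,3) open_contains_cball by (metis imageI)
 define m' where "m' = ({q : fst m. norm (snd m q) < de}, snd m)"
 define W L where "W = WS ga" and "L = span (Basis - B)"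
 have sl': "slice m' L W" unfolding m'_def W_def L_def by (rule Ws_slice[OF m de])
 then have m'c: "m' : charts" and L: "subspace L" by (auto simp: slice_def)
 obtain rs where rs: "complement_list L rs" using complement_list_exists[OF L] by blast
 define FC where "FC d \<longleftrightarrow> (EX T>=0. flow_chart T 0 m' d)" for d
 have sl: "slice d L W" if "FC d" for d using that flow_chart_slice[OF _ Ws_flow_invariant] sl' unfolding FC_def W_def by blast
 have ex: "EX d. FC d & q : fst d" if "q : W" for q
 proof -
  obtain x where x: "icurve X {0..} x" "x 0 = q" "(x ---> ga) at_top" using \<open>q : W\<close> by (auto simp: W_def Ws_def)
  have "ga : fst m'" using mc de by (simp add: m'_def)
  from eventually_conj[OF ev_chart[OF m'c this x(3)] eventually_ge_at_top[of 0]]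
  obtain T where T: "x T : fst m'" "T >= 0" using eventually_happens'[OF trivial_limit_at_top_linorder] by blast
  obtain d where "flow_chart T 0 m' d" "x 0 : fst d" by (rule flow_chart_exists[OF x(1) _ _ _ m'c T(1), of 0]) (use T in auto)
  then show ?thesis using T x(2) unfolding FC_def by blast
 qed
 have scale: "EX c>0. ALL v:TS W q. push A d' q v = c *\<^sub>R push A d q v"
  if "FC d" "FC d'" "q : W" "q : fst d" "q : fst d'" for d d' q
 proof -
  obtain T T' where T: "T >= 0" "flow_chart T 0 m' d" "T' >= 0" "flow_chart T' 0 m' d'"
   using \<open>FC d\<close> \<open>FC d'\<close> by (auto simp: FC_def)
  show ?thesis
  proof (cases "T <= T'")
   case True
   then have "push A d' q v = exp (- (2 * (T' - T))) *\<^sub>R push A d q v" if "v : TS W q" for v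
    using flow_chart_scaling[OF m de(2) T(2,4)[unfolded m'_def] T(1)] that \<open>q : W\<close> \<open>q : fst d\<close> \<open>q : fst d'\<close> by (simp add: W_def)
   then show ?thesis by (intro exI[of _ "exp (- (2 * (T' - T)))"]) auto
  next
   case False
   then have "push A d q v = exp (- (2 * (T - T'))) *\<^sub>R push A d' q v" if "v : TS W q" for v
    using flow_chart_scaling[OF m de(2) T(4,2)[unfolded m'_def] T(3)] that \<open>q : W\<close> \<open>q : fst d\<close> \<open>q : fst d'\<close> by (simp add: W_def)
   then have "push A d' q v = exp (2 * (T - T')) *\<^sub>R push A d q v" if "v : TS W q" for v using that by (simp flip: exp_add)
   then show ?thesis by (intro exI[of _ "exp (2 * (T - T'))"]) auto
  qed
 qed
 define Or where "Or q ws = (if q : W & obasis (TS W q) ws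
  then sgn (vol (map (push A (SOME d. FC d & q : fst d) q) ws @ rs)) else 0)" for q ws
 have Or_eq: "Or q ws = 1 * sgn (vol (map (push A d q) ws @ rs))"
  if d: "FC d" "q : fst d" and q: "q : W" and ws: "obasis (TS W q) ws" for d q ws
 proof -
  define d' where "d' = (SOME d. FC d & q : fst d)"
  have d': "FC d'" "q : fst d'" using someI_ex[OF ex[OF q]] by (auto simp: d'_def)
  obtain c where c: "c > 0" "ALL v:TS W q. push A d' q v = c *\<^sub>R push A d q v" using scale[OF d(1) d'(1) q d(2) d'(2)] by blast
  have eq: "map (push A d' q) ws = map ((*\<^sub>R) c) (map (push A d q) ws)" using c(2) obasis_subset[OF ws] by auto
  have "sgn (vol (map (push A d' q) ws @ rs)) = sgn (vol (map (push A d q) ws @ rs))"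
   unfolding eq using sgn_vol_scale[OF _ c(1), of "map (push A d q) ws" rs] slice_basis_vol(2)[OF sl[OF d(1)] q d(2) rs ws] by simp
  then show ?thesis using q ws by (simp add: Or_def d'_def)
 qed
 have "orientation A W Or"
 proof (rule orientationI)
  fix q assume q: "q : W"
  obtain d where d: "FC d" "q : fst d" using ex[OF q] by blast
  show "vs_orientation (TS W q) (Or q)" by (rule vs_orientation_formula[OF sl[OF d(1)] q d(2) rs _ Or_eq[OF d q]]) (auto simp: Or_def)
  have "\<forall>\<^sub>F p in nhds q. p : fst d" by (rule eventually_nhds_in_open[OF chart_open d(2)]) (use sl[OF d(1)] in \<open>simp add: slice_def\<close>)
  then have "\<forall>\<^sub>F p in nhds q. p : W --> or_formula d rs 1 W Or p"
  proof eventually_elim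
   case (elim p)
   show ?case unfolding or_formula_def
   proof (intro impI allI)
    fix vs assume p: "p : W" and vs: "length vs = dim (TS W p)" "set vs \<subseteq> TS W p"
    show "Or p vs = 1 * sgn (vol (map (push A d p) vs @ rs))"
    proof (cases "obasis (TS W p) vs")
     case False
     then have nb: "\<not> obasis L (map (push A d p) vs)" using slice_basis_iff[OF sl[OF d(1)] p elim] by blast
     have "length (map (push A d p) vs) = dim L" using vs slice_dim(2)[OF sl[OF d(1)] p elim] by simp
     moreover have "set (map (push A d p) vs) \<subseteq> L" using vs slice_tangent[OF sl[OF d(1)] p elim] by auto
     ultimately have "vol (map (push A d p) vs @ rs) = 0" using complement_listD(2)[OF rs] nb by blast
     then show ?thesis using False by (simp add: Or_def)
    qed (rule Or_eq[OF d(1) elim p])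
   qed
  qed
  then show "EX c L rs s. slice c L W & q : fst c & complement_list L rs & (\<forall>\<^sub>F q in nhds q. q : W --> or_formula c rs s W Or q)"
   using sl[OF d(1)] d(2) rs by blast
 qed (simp add: Or_def)
 then show ?thesis using that by (simp add: W_def)
qed

text \<open>Justifies the definite description: an orientation exists by
  \<open>Ws_orientable\<close>, the sign \<open>a\<close> adjusts it to the value prescribed at
  \<open>ga\<close>, and connectedness of the stable manifold makes it unique.\<close>

lemma stable_orientation:
 assumes ga: "ga : Crit A f" and OM: "orientation A UNIV OM" and OU: "orientation A (WU ga) (OU ga)"
 shows "orientation A (WS ga) (stable_orientation A X OM OU ga)"
  "!!us ws. obasis (TS (WU ga) ga) us ==> obasis (TS (WS ga) ga) ws ==>
   OM ga (us @ ws) = OU ga ga us * stable_orientation A X OM OU ga ga ws"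
proof -
 let ?U = "TS (WU ga) ga" and ?S = "TS (WS ga) ga"
 obtain m B where m: "morse_model ga m B" using morse_model_exists[OF ga] by blast
 have mc: "m : charts" "ga : fst m" "snd m ga = 0" "B \<subseteq> Basis" using m unfolding morse_model_def by blast+
 obtain de where de: "de > 0" "cball 0 de \<subseteq> snd m ` fst m" using chart_open_range[OF mc(1)] mc(2,3) open_contains_cball by (metis imageI)
 define m' where "m' = ({q : fst m. norm (snd m q) < de}, snd m)"
 have g: "ga : fst m'" using mc de by (simp add: m'_def)
 have m'c: "m' : charts" using Ws_slice[OF m de] by (simp add: slice_def m'_def)
 note gu = Crit_in_Wu[OF ga] and gs = Crit_in_Ws[OF ga]
 have U: "?U = {v. push A m' ga v : span B}" using slice_tangent[OF Wu_slice[OF m de] gu] g by (simp add: m'_def)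
 have S: "?S = {v. push A m' ga v : span (Basis - B)}" using slice_tangent[OF Ws_slice[OF m de] gs] g by (simp add: m'_def)
 have dims: "subspace ?U" "subspace ?S" "dim ?U = card B" "dim ?S = DIM('e) - card B"
  using sub_dim[OF Wu_submanifold[OF m] gu] sub_dim[OF Ws_submanifold[OF m] gs] by auto
 have cB: "card B <= DIM('e)" using mc(4) by (simp add: card_mono)
 have oM: "vs_orientation UNIV (OM ga)" using OM by (simp add: orientation_def tangent_space_UNIV)
 have oU: "vs_orientation ?U (OU ga ga)" using OU gu by (simp add: orientation_def)
 obtain us0 ws0 where b0: "obasis ?U us0" "obasis ?S ws0" using obasis_exists dims by metis
 have sum: "EX u:?U. EX w:?S. v = u + w" for v
 proof (intro bexI)
  let ?u = "pull m' ga (proj B (push A m' ga v))" and ?w = "pull m' ga (push A m' ga v - proj B (push A m' ga v))"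
  have "?u + ?w = pull m' ga (push A m' ga v)" using linear_add[OF pull_linear[OF m'c g]] by (metis add_diff_cancel_left' diff_add_cancel add.commute)
  then show "v = ?u + ?w" using m'c g by simp
  show "?u : ?U" "?w : ?S" unfolding U S using m'c g mc(4) by (simp_all add: proj_in_span in_span_compl_iff linear_diff[OF linear_proj])
 qed
 have "span (set (us0 @ ws0)) = UNIV"
 proof -
  have "v : span (set (us0 @ ws0))" for v
  proof -
   obtain u w where "u : ?U" "w : ?S" "v = u + w" using sum by blast
   moreover have "?U \<subseteq> span (set (us0 @ ws0))" "?S \<subseteq> span (set (us0 @ ws0))"
    using span_mono[of "set us0" "set (us0 @ ws0)"] span_mono[of "set ws0" "set (us0 @ ws0)"]
     obasis_span[OF b0(1)] obasis_span[OF b0(2)] by auto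
   ultimately show ?thesis by (auto intro: span_add)
  qed
  then show ?thesis by blast
 qed
 moreover have len0: "length us0 + dim ?S = DIM('e)" "length (us0 @ ws0) = DIM('e)"
  using obasis_length[OF b0(1)] obasis_length[OF b0(2)] dims cB by auto
 ultimately have "obasis UNIV (us0 @ ws0)" using obasis_UNIV_iff vol_nonzero_iff_span by blast
 note vals = vs_values(1)[OF oM this] vs_values(1)[OF oU b0(1)]
 let ?R = "%Or. ALL us ws. obasis ?U us & obasis ?S ws --> OM ga (us @ ws) = OU ga ga us * Or ga ws"
 obtain Or where Or: "orientation A (WS ga) Or" by (rule Ws_orientable[OF ga])
 have oS: "vs_orientation ?S (Or ga)" using Or gs by (simp add: orientation_def)
 note valS = vs_values(1)[OF oS]
 define a where "a = OM ga (us0 @ ws0) * OU ga ga us0 * Or ga ws0"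
 have a: "a = 1 | a = - 1" using vals valS[OF b0(2)] by (auto simp: a_def)
 have R: "?R (scale_or a Or)"
 proof (intro allI impI)
  fix us ws assume b: "obasis ?U us & obasis ?S ws"
  have lu: "length us = length us0" using b obasis_length b0(1) by metis
  have "us ! j : span (set us0)" if "j < length us" for j using b obasis_subset obasis_span[OF b0(1)] nth_mem[OF that] by blast
  then obtain D where D: "D : carrier_mat (length us0) (length us)"
   "!!j. j < length us ==> us ! j = (\<Sum>i<length us0. D $$ (i, j) *\<^sub>R us0 ! i)" by (rule coordinate_matrix[of us us0]) blast+
  obtain e where e: "e = sgn (det D)" by blast
  have 1: "OM ga (us @ ws) * Or ga ws = e * (OM ga (us0 @ ws0) * Or ga ws0)"
   unfolding e by (rule normal_sign_change[OF oM oS b0(2) _ len0(1) lu]) (use b D lu dims(2) in \<open>auto simp: subspace_0\<close>)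
  have 2: "OU ga ga us = e * OU ga ga us0" unfolding e by (rule vs_orientation_det[OF oU b0(1)]) (use b D lu in auto)
  show "OM ga (us @ ws) = OU ga ga us * scale_or a Or ga ws" using 1 2 vals valS[OF b0(2)] valS[of ws] b vs_values(1)[OF oU, of us]
   by (auto simp: scale_or_def a_def)
 qed
 have uniq: "Or' = scale_or a Or" if "orientation A (WS ga) Or' & ?R Or'" for Or'
 proof (rule orientation_unique[OF _ orientation_scale[OF Or a] Ws_submanifold[OF m] Ws_connected[OF ga] gs])
  have "OU ga ga us0 * Or' ga ws0 = OU ga ga us0 * scale_or a Or ga ws0" using that R b0 by metis
  then show "Or' ga ws0 = scale_or a Or ga ws0" using vals by auto
  have "vs_orientation ?S (Or' ga)" using that gs by (simp add: orientation_def)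
  from vs_values(1)[OF this b0(2)] show "Or' ga ws0 ~= 0" by auto
 qed (use that in blast)
 have "orientation A (WS ga) (stable_orientation A X OM OU ga) & ?R (stable_orientation A X OM OU ga)"
  unfolding stable_orientation_def by (rule theI[where a="scale_or a Or"]) (use R uniq orientation_scale[OF Or a] in blast)+
 then show "orientation A (WS ga) (stable_orientation A X OM OU ga)"
  "!!us ws. obasis ?U us ==> obasis ?S ws ==> OM ga (us @ ws) = OU ga ga us * stable_orientation A X OM OU ga ga ws" by blast+
qed

end

section \<open>Normal and induced orientations of a Morse-Smale flow\<close>

context manifold
begin

text \<open>Along the segment between the two coordinate points, which convexity keeps in the chart,
  a constant frame moves continuously and stays tangent to \<open>W\<close>. This compares an
  orientation at points that need not be close.\<close>

lemma orientation_slice_const: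
 assumes sl: "slice d L W" and conv: "convex (snd d ` fst d)" and W: "is_submanifold A k W" and o: "orientation A W Or"
  and p: "p : W" "p : fst d" and q: "q : W" "q : fst d"
 shows "Or q (map (pull d q) bs) = Or p (map (pull d p) bs)"
proof -
 have d: "d : charts" and L: "subspace L" using sl by (auto simp: slice_def)
 have basis: "obasis (TS W r) (map (pull d r) bs) \<longleftrightarrow> obasis L bs" if "r : W" "r : fst d" for r
  unfolding slice_basis_iff[OF sl that] using d that by (simp add: o_def)
 have ov: "vs_orientation (TS W r) (Or r)" if "r : W" for r using o that by (simp add: orientation_def)
 show ?thesis
 proof (cases "obasis L bs")
  case False
  then show ?thesis using basis[OF p] basis[OF q] vs_values(2)[OF ov] p q by simp
 next
  case True
  define y where "y s = snd d p + s *\<^sub>R (snd d q - snd d p)" for s :: real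
  define c where "c s = chart_inv d (y s)" for s
  have y: "y s : snd d ` fst d" if "s : {0..1}" for s
  proof -
   have "(1 - s) *\<^sub>R snd d p + s *\<^sub>R snd d q : snd d ` fst d" using conv p q that by (intro convexD) auto
   then show ?thesis by (simp add: y_def algebra_simps)
  qed
  have c: "c s : fst d" "snd d (c s) = y s" if "s : {0..1}" for s using y[OF that] d by (auto simp: c_def)
  have cW: "c s : W" if s: "s : {0..1}" for s
  proof -
   have "snd d q - snd d p : L" using sl p q unfolding slice_def by blast
   then show ?thesis using c(2)[OF s] L using sl p c(1)[OF s] unfolding slice_def by (simp add: y_def subspace_scale)
  qed
  have cc: "continuous_on {0..1} c"
   unfolding c_def by (rule continuous_on_compose2[OF chart_inv_cont[OF d]]) (use y in \<open>auto simp: y_def intro!: continuous_intros\<close>)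
  let ?g = "%s. Or (c s) (map (pull d (c s)) bs)"
  have "?g 0 = ?g 1"
  proof (rule connected_local_const[where f="?g" and A="{0..1::real}"])
   show "ALL s:{0..1}. \<forall>\<^sub>F t in at s within {0..1}. ?g s = ?g t"
   proof
    fix s :: real assume s: "s : {0..1}"
    let ?F = "at s within {0..1}"
    have lim: "(c ---> c s) ?F" using cc s by (simp add: continuous_on_def)
    have ev: "\<forall>\<^sub>F t in ?F. t : {0..1}" by (simp add: eventually_at_filter)
    have "tb_tendsto c (%t. pull d (c t) b) (c s) (pull d (c s) b) ?F" for b
     using frame_field_tb[OF d c(1)[OF s] lim, of "pull d (c s) b"] d c(1)[OF s] by (simp add: frame_field_def)
    moreover have "\<forall>\<^sub>F t in ?F. pull d (c t) b : TS W (c t)" if "b : set bs" for b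
     using ev by eventually_elim (use tangent_space_pull[OF sl cW c(1)] obasis_subset[OF True] that in blast)
    ultimately have "\<forall>\<^sub>F t in ?F. Or (c t) (map (%E. E t) (map (%b t. pull d (c t) b) bs)) = ?g s"
     by (intro orientation_tendsto[OF o W cW[OF s] lim])
      (use ev cW basis[OF cW[OF s] c(1)[OF s]] True in \<open>auto simp: list_all2_conv_all_nth elim: eventually_mono\<close>)
    then show "\<forall>\<^sub>F t in ?F. ?g s = ?g t" by eventually_elim (simp add: o_def)
   qed
  qed (auto simp: convex_connected)
  moreover have "c 0 = p" "c 1 = q" using p q d by (simp_all add: c_def y_def)
  ultimately show ?thesis by simp
 qed
qed

end

locale morse_smale_flow = gradient_like A f X
 for A :: "('a::{t2_space,second_countable_topology}, 'e::euclidean_space) chart set" and f :: "'a => real" and X :: "'a => 'e" +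
 fixes OM :: "'a => 'e list => real" and OU :: "'a => 'a => 'e list => real"
 assumes trans: "!!xi ga. xi : Crit A f ==> ga : Crit A f ==> transverse A (WU xi) (WS ga)"
  and OM: "orientation A UNIV OM" and OU: "!!ga. ga : Crit A f ==> orientation A (WU ga) (OU ga)"
begin

abbreviation Nrm :: "'a => 'a => 'e list => real" where "Nrm \<equiv> normal_orientation A X OM OU"
abbreviation Ost :: "'a => 'a => 'e list => real" where "Ost \<equiv> stable_orientation A X OM OU"
abbreviation Ind\<^sub>o :: "'a => 'a => 'a => 'e list => real" where "Ind\<^sub>o \<equiv> induced_orientation A X OM OU"

lemma Wu_sub: "ga : Crit A f ==> is_submanifold A (Ind A X ga) (WU ga)"
 and Ws_sub: "ga : Crit A f ==> is_submanifold A (DIM('e) - Ind A X ga) (WS ga)"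
 and Ind_le: "ga : Crit A f ==> Ind A X ga <= DIM('e)"
proof -
 assume ga: "ga : Crit A f"
 obtain m B where m: "morse_model ga m B" using morse_model_exists[OF ga] by blast
 then show "is_submanifold A (Ind A X ga) (WU ga)" "is_submanifold A (DIM('e) - Ind A X ga) (WS ga)" "Ind A X ga <= DIM('e)" unfolding morse_model_def using Wu_submanifold[OF m] Ws_submanifold[OF m] Ind_eq[OF m ga] by (auto intro: card_mono)
qed

lemma Ost_orientation: "ga : Crit A f ==> orientation A (WS ga) (Ost ga)" using stable_orientation(1)[OF _ OM, of ga OU] OU by blast

lemma vs_OM: "vs_orientation UNIV (OM p)" using OM by (simp add: orientation_def tangent_space_UNIV)

lemma vs_Ost: "ga : Crit A f ==> p : WS ga ==> vs_orientation (TS (WS ga) p) (Ost ga p)" using Ost_orientation by (simp add: orientation_def)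

lemma Nrm_change:
 assumes ga: "ga : Crit A f" and p: "p : WS ga"
  and ws: "obasis (TS (WS ga) p) ws" "obasis (TS (WS ga) p) ws'"
  and len: "length ns = Ind A X ga" "length ns' = length ns"
  and ns': "!!j. j < length ns ==> ns' ! j - ns ! j : TS (WS ga) p"
 shows "OM p (ns' @ ws') * Ost ga p ws' = OM p (ns @ ws) * Ost ga p ws"
proof -
 have "OM p (ns' @ ws') * Ost ga p ws' = sgn (det (1\<^sub>m (length ns))) * (OM p (ns @ ws) * Ost ga p ws)"
  by (intro normal_sign_change[OF vs_OM vs_Ost[OF ga p] ws])
   (use len ns' sub_dim(2)[OF Ws_sub[OF ga] p] Ind_le[OF ga] sum_scalar_mat(2)[of _ "length ns" "(!) ns"] in auto)
 then show ?thesis by simp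
qed

text \<open>The definite description has a unique solution because the product with
  \<open>Ost\<close> does not depend on \<open>ws\<close>. So one basis of the tangent space
  computes it, also for lists \<open>ns\<close> representing no basis, where it is 0.\<close>

lemma Nrm_eq:
 assumes ga: "ga : Crit A f" and p: "p : WS ga" and len: "length ns = Ind A X ga"
  and ws: "obasis (TS (WS ga) p) ws"
 shows "Nrm ga p ns = OM p (ns @ ws) * Ost ga p ws" unfolding normal_orientation_def
proof (rule the_equality)
 have sq: "Ost ga p w * Ost ga p w = 1" if "obasis (TS (WS ga) p) w" for w using vs_values(1)[OF vs_Ost[OF ga p] that] by auto
 have "OM p (ns @ w) = OM p (ns @ ws) * Ost ga p ws * Ost ga p w" if w: "obasis (TS (WS ga) p) w" for w
 proof -
  have "OM p (ns @ w) * (Ost ga p w * Ost ga p w) = OM p (ns @ ws) * Ost ga p ws * Ost ga p w"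
   using Nrm_change[OF ga p ws w len refl] sub_dim(1)[OF Ws_sub[OF ga] p] by (simp add: subspace_0)
  then show ?thesis using sq[OF w] by simp
 qed
 then show "ALL w. obasis (TS (WS ga) p) w --> OM p (ns @ w) = OM p (ns @ ws) * Ost ga p ws * Ost ga p w" by blast
 fix s assume "ALL w. obasis (TS (WS ga) p) w --> OM p (ns @ w) = s * Ost ga p w"
 then show "s = OM p (ns @ ws) * Ost ga p ws" using ws sq[OF ws] by simp
qed

lemma Nrm_cong:
 assumes "ga : Crit A f" "p : WS ga" "length ns = Ind A X ga" "length ns' = length ns"
  and "!!j. j < length ns ==> ns' ! j - ns ! j : TS (WS ga) p"
 shows "Nrm ga p ns' = Nrm ga p ns"
proof -
 obtain ws where ws: "obasis (TS (WS ga) p) ws" using obasis_exists[OF sub_dim(1)[OF Ws_sub[OF assms(1)] assms(2)]] by blast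
 show ?thesis using Nrm_change[OF assms(1,2) ws ws assms(3-5)] Nrm_eq[OF assms(1,2) _ ws] assms(3,4) by simp
qed

text \<open>By \<open>nz\<close> the list \<open>ns\<close> represents a basis of the normal space
  at the limit, so the ambient and the stable orientation that define the normal one are both
  eventually constant along converging frames.\<close>

lemma Nrm_tendsto:
 assumes ga: "ga : Crit A f" and p0: "p0 : WS ga" and p: "(p ---> p0) F" and pW: "\<forall>\<^sub>F t in F. p t : WS ga"
  and E: "list_all2 (%E v. tb_tendsto p E p0 v F) Es ns" and len: "length ns = Ind A X ga" and nz: "Nrm ga p0 ns ~= 0"
 shows "\<forall>\<^sub>F t in F. Nrm ga (p t) (map (%E. E t) Es) = Nrm ga p0 ns"
proof -
 let ?W = "WS ga"
 obtain c L where sl: "slice c L ?W" "p0 : fst c" using Ws_sub[OF ga] p0 by (auto simp: submanifold_iff)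
 have c: "c : charts" using sl by (simp add: slice_def)
 obtain ws where ws: "obasis (TS ?W p0) ws" using obasis_exists[OF sub_dim(1)[OF Ws_sub[OF ga] p0]] by blast
 note nrm0 = Nrm_eq[OF ga p0 len ws]
 define WS where "WS = map (%w t. frame_field c p0 w (p t)) ws"
 have tb: "list_all2 (%E v. tb_tendsto p E p0 v F) WS ws" using frame_field_tb[OF c sl(2) p] by (simp add: WS_def list_all2_conv_all_nth)
 have bas: "\<forall>\<^sub>F t in F. obasis (TS ?W (p t)) (map (%E. E t) WS)" using pW ev_chart[OF c sl(2) p]
  by eventually_elim (use frame_field_basis[OF sl(1) p0 sl(2) _ _ ws] in \<open>simp add: WS_def o_def\<close>)
 have "\<forall>\<^sub>F t in F. Ost ga (p t) (map (%E. E t) WS) = Ost ga p0 ws"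
 proof (rule orientation_tendsto[OF Ost_orientation[OF ga] Ws_sub[OF ga] p0 p pW tb ws], intro ballI)
  fix E assume E: "E : set WS"
  show "\<forall>\<^sub>F t in F. E t : TS ?W (p t)" using bas by eventually_elim (use obasis_subset E in fastforce)
 qed
 moreover have "\<forall>\<^sub>F t in F. OM (p t) (map (%E. E t) (Es @ WS)) = OM p0 (ns @ ws)"
 proof (rule orientation_tendsto[OF OM UNIV_submanifold _ p _ list_all2_appendI[OF E tb]])
  show "obasis (TS UNIV p0) (ns @ ws)" using nz nrm0 vs_values(2)[OF vs_OM] unfolding tangent_space_UNIV by auto
 qed (simp_all add: tangent_space_UNIV)
 ultimately show ?thesis using bas pW by eventually_elim (use nrm0 list_all2_lengthD[OF E] len in \<open>simp add: Nrm_eq[OF ga]\<close>)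
qed

text \<open>At \<open>ga\<close> the unstable tangent space represents the normal space, and the
  stable manifold was oriented so that this identification preserves orientations.\<close>

lemma Nrm_crit:
 assumes ga: "ga : Crit A f" and us: "obasis (TS (WU ga) ga) us"
 shows "Nrm ga ga us = OU ga ga us"
proof -
 note gs = Crit_in_Ws[OF ga] and gu = Crit_in_Wu[OF ga]
 obtain ws where ws: "obasis (TS (WS ga) ga) ws" using obasis_exists[OF sub_dim(1)[OF Ws_sub[OF ga] gs]] by blast
 have "length us = Ind A X ga" using obasis_length[OF us] sub_dim(2)[OF Wu_sub[OF ga] gu] by simp
 from Nrm_eq[OF ga gs this ws] show ?thesis
  using stable_orientation(2)[where OU=OU, OF ga OM OU[OF ga] us ws] vs_values(1)[OF vs_Ost[OF ga gs] ws] by auto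
qed

definition local_box :: "'a => ('a, 'e) chart => 'e set => real => bool" where
 "local_box ga m B de \<longleftrightarrow> ga : Crit A f & morse_model ga m B & de > 0 & cball 0 de \<subseteq> snd m ` fst m"

lemma local_boxD:
 assumes "local_box ga m B de"
 defines "m' \<equiv> ({q : fst m. norm (snd m q) < de}, snd m)"
 shows "slice m' (span B) (WU ga)" "slice m' (span (Basis - B)) (WS ga)" "slice m' UNIV UNIV"
  "convex (snd m' ` fst m')" "ga : fst m'" "B \<subseteq> Basis" "Ind A X ga = card B" "m : charts"
  "!!q. q : fst m' ==> push A m' q = push A m q" "!!q. q : fst m' ==> pull m' q = pull m q"
proof -
 have h: "ga : Crit A f" "morse_model ga m B" "de > 0" "cball 0 de \<subseteq> snd m ` fst m" using assms(1) by (auto simp: local_box_def)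
 have mc: "m : charts" "ga : fst m" "snd m ga = 0" "B \<subseteq> Basis" using h(2) unfolding morse_model_def by blast+
 show "slice m' (span B) (WU ga)" "slice m' (span (Basis - B)) (WS ga)" unfolding m'_def using Wu_slice[OF h(2-4)] Ws_slice[OF h(2-4)] by auto
 then have m'c: "m' : charts" by (simp add: slice_def)
 then show "slice m' UNIV UNIV" by (rule UNIV_slice)
 have "snd m' ` fst m' = ball 0 de" using h(4) by (force simp: m'_def)
 then show "convex (snd m' ` fst m')" by simp
 show "ga : fst m'" using mc h by (simp add: m'_def)
 show "B \<subseteq> Basis" "m : charts" "Ind A X ga = card B" using mc Ind_eq[OF h(2,1)] by auto
 have o: "open (fst m')" using chart_open[OF m'c] .
 show push: "push A m' q = push A m q" if "q : fst m'" for q using push_restrict[OF mc(1) o _ that, of m'] by (simp add: m'_def fun_eq_iff)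
 show "pull m' q = pull m q" if q: "q : fst m'" for q
 proof
  fix v show "pull m' q v = pull m q v" using push_pull[OF m'c q] push[OF q] pull_push[OF mc(1), of q "pull m' q v"] q by (simp add: m'_def)
 qed
qed

lemma OU_local:
 assumes b: "local_box ga m B de" and q: "q : WU ga" "q : fst m" "norm (snd m q) < de"
 shows "OU ga q (map (pull m q) bs) = OU ga ga (map (pull m ga) bs)"
proof -
 have ga: "ga : Crit A f" using b by (simp add: local_box_def)
 note D = local_boxD[OF b]
 show ?thesis using orientation_slice_const[OF D(1,4) Wu_sub[OF ga] OU[OF ga] Crit_in_Wu[OF ga] D(5) q(1), of bs]
   D(10)[OF D(5)] D(10)[of q] q by simp
qed

lemma Nrm_local:
 assumes b: "local_box ga m B de" and q: "q : WS ga" "q : fst m" "norm (snd m q) < de"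
  and bs: "obasis (span B) (map (proj B) vs)"
 shows "Nrm ga q (map (pull m q) vs) = OU ga ga (map (%v. pull m ga (proj B v)) vs)"
proof -
 define m' where "m' = ({q : fst m. norm (snd m q) < de}, snd m)"
 have ga: "ga : Crit A f" using b by (simp add: local_box_def)
 note D = local_boxD[OF b, folded m'_def] and gs = Crit_in_Ws[OF ga] and gu = Crit_in_Wu[OF ga]
 have q': "q : fst m'" using q by (simp add: m'_def)
 have m'c: "m' : charts" using D(1) by (simp add: slice_def)
 have lvs: "length vs = Ind A X ga" using obasis_length[OF bs] D(7) dim_span_Basis_subset[OF D(6)] by simp
 obtain cs where cs: "obasis (span (Basis - B)) cs" using obasis_exists[OF subspace_span] by blast
 have basis: "obasis (TS (WS ga) r) (map (pull m' r) cs)" if "r : WS ga" "r : fst m'" for r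
  unfolding slice_basis_iff[OF D(2) that] using cs m'c that by (simp add: o_def)
 have 1: "OM q (map (pull m' q) (vs @ cs)) = OM ga (map (pull m' ga) (vs @ cs))"
  by (rule orientation_slice_const[OF D(3,4) UNIV_submanifold OM _ D(5) _ q']) auto
 have 2: "Ost ga q (map (pull m' q) cs) = Ost ga ga (map (pull m' ga) cs)"
  by (rule orientation_slice_const[OF D(2,4) Ws_sub[OF ga] Ost_orientation[OF ga] gs D(5) q(1) q'])
 have "Nrm ga q (map (pull m' q) vs) = Nrm ga ga (map (pull m' ga) vs)"
  using Nrm_eq[OF ga q(1) _ basis[OF q(1) q'], of "map (pull m' q) vs"] Nrm_eq[OF ga gs _ basis[OF gs D(5)], of "map (pull m' ga) vs"] 1 2 lvs by simp
 also have "\<dots> = Nrm ga ga (map (%v. pull m' ga (proj B v)) vs)"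
 proof (rule Nrm_cong[OF ga gs])
  fix j assume j: "j < length (map (%v. pull m' ga (proj B v)) vs)"
  have "pull m' ga (vs ! j) - pull m' ga (proj B (vs ! j)) = pull m' ga (vs ! j - proj B (vs ! j))"
   by (rule linear_diff[OF pull_linear[OF m'c D(5)], symmetric])
  then show "map (pull m' ga) vs ! j - map (%v. pull m' ga (proj B v)) vs ! j : TS (WS ga) ga" using j unfolding tangent_space_pull[OF D(2) gs D(5)]
   by (auto simp: in_span_compl_iff[OF D(6)] linear_diff[OF linear_proj] D(6))
 qed (use lvs in auto)
 also have "\<dots> = OU ga ga (map (%v. pull m' ga (proj B v)) vs)"
  by (rule Nrm_crit[OF ga], unfold slice_basis_iff[OF D(1) gu D(5)]) (use bs m'c D(5) in \<open>simp add: o_def\<close>)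
 finally show ?thesis using D(10)[OF D(5)] D(10)[OF q'] by simp
qed

lemma connecting_sub:
 assumes xi: "xi : Crit A f" and ga: "ga : Crit A f" and d: "d + Ind A X ga = Ind A X xi"
 shows "is_submanifold A d (CX xi ga)"
  "p : CX xi ga ==> TS (CX xi ga) p = TS (WU xi) p \<inter> TS (WS ga) p"
proof -
 have *: "EX e K. slice e K (CX xi ga) & p : fst e & dim K = d &
  TS (CX xi ga) p = TS (WU xi) p \<inter> TS (WS ga) p"
  if p: "p : CX xi ga" for p
 proof -
  have p': "p : WU xi" "p : WS ga" using p by (auto simp: connecting_def)
  obtain c L where sl: "slice c L (WU xi)" "p : fst c" "dim L = Ind A X xi" using Wu_sub[OF xi] p' by (auto simp: submanifold_iff)
  obtain c' L' where sl': "slice c' L' (WS ga)" "p : fst c'" "dim L' = DIM('e) - Ind A X ga" using Ws_sub[OF ga] p' by (auto simp: submanifold_iff)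
  have "{v + w | v w. v : TS (WU xi) p & w : TS (WS ga) p} = UNIV" using trans[OF xi ga] p' by (simp add: transverse_def)
  then obtain e K where "slice e K (WU xi \<inter> WS ga)" "p : fst e" "dim K + DIM('e) = dim L + dim L'"
   "TS (WU xi \<inter> WS ga) p = TS (WU xi) p \<inter> TS (WS ga) p" by (rule transverse_slice[OF sl(1) sl'(1) p' sl(2) sl'(2)])
  then show ?thesis using sl(3) sl'(3) d Ind_le[OF ga] unfolding connecting_def by (intro exI[of _ e] exI[of _ K]) auto
 qed
 then show "is_submanifold A d (CX xi ga)" unfolding submanifold_iff by blast
 show "TS (CX xi ga) p = TS (WU xi) p \<inter> TS (WS ga) p"
  if "p : CX xi ga" using *[OF that] by blast
qed

text \<open>Transversality guarantees that the definite description of the induced orientation is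
  met; this makes its defining equation available for computations.\<close>

lemma induced:
 assumes xi: "xi : Crit A f" and ga: "ga : Crit A f" and d: "d + Ind A X ga = Ind A X xi"
 shows "orientation A (CX xi ga) (Ind\<^sub>o xi ga)"
  "!!p ms ns. p : CX xi ga ==> obasis (TS (CX xi ga) p) ms ==>
   obasis (TS (WU xi) p) (ms @ ns) ==> OU xi p (ms @ ns) = Ind\<^sub>o xi ga p ms * Nrm ga p ns"
proof -
 note C = connecting_sub[OF assms, unfolded connecting_def]
 have N: "OM p (ns @ ws) = Nrm ga p ns * Ost ga p ws"
  if "p : WU xi \<inter> WS ga" "length ns + d = Ind A X xi" "obasis (TS (WS ga) p) ws" for p ns ws
  using Nrm_eq[OF ga _ _ that(3), of ns] vs_values(1)[OF vs_Ost[OF ga] that(3)] that d by auto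
 have T: "{v + w | v w. v : TS (WU xi) p & w : TS (WS ga) p} = UNIV"
  if "p : WU xi \<inter> WS ga" for p using trans[OF xi ga] that by (simp add: transverse_def)
 have "d + DIM('e) = Ind A X xi + (DIM('e) - Ind A X ga)" using d Ind_le[OF ga] by simp
 note I = intersection_orientation[where N="Nrm ga", OF Wu_sub[OF xi] Ws_sub[OF ga] C(1) this T C(2) OM OU[OF xi] Ost_orientation[OF ga] N]
 note I' = I[folded connecting_def, folded induced_orientation_def]
 show "orientation A (CX xi ga) (Ind\<^sub>o xi ga)" using I' by blast
 show "OU xi p (ms @ ns) = Ind\<^sub>o xi ga p ms * Nrm ga p ns"
  if "p : CX xi ga" "obasis (TS (CX xi ga) p) ms"
   "obasis (TS (WU xi) p) (ms @ ns)" for p ms ns using I' that by blast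
qed

end

section \<open>Flow lines and differentiable families of them\<close>

context gradient_like
begin

lemma f_tendsto: "(q ---> q0) F ==> ((%t. f (q t)) ---> f q0) F"
proof -
 assume q: "(q ---> q0) F"
 define c where "c = chart_at A q0"
 have c: "c : charts" "q0 : fst c" using chart_at chart_at_in by (auto simp: c_def)
 have "isCont (f o chart_inv c) (snd c q0)" by (rule continuous_on_interior[OF Cinf_on_continuous[OF function_Cinf[OF smooth_f c(1)]]])
   (use chart_open_range[OF c(1)] c(2) in \<open>simp add: interior_open\<close>)
 then have "((%t. (f o chart_inv c) (snd c (q t))) ---> (f o chart_inv c) (snd c q0)) F" by (rule isCont_tendsto_compose) (rule chart_tendsto[OF c q])
 moreover have "\<forall>\<^sub>F t in F. (f o chart_inv c) (snd c (q t)) = f (q t)" using ev_chart[OF c q] by eventually_elim (use c in simp)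
 ultimately show ?thesis using c by (simp add: tendsto_cong)
qed

lemma flow_line_eq: "icurve X UNIV x ==> x 0 = p ==> flow_line A X p = x"
 unfolding flow_line_def by (rule the_equality) (auto intro!: integral_unique[where T=UNIV and t=0])

text \<open>A backward and a forward half-trajectory fit together to a complete one, so flow lines
  between critical points exist for all times although \<open>X\<close> need not be
  complete.\<close>

lemma connecting_flow_line:
 assumes "p : CX xi ga"
 shows "icurve X UNIV (flow_line A X p)" "flow_line A X p 0 = p"
  "(flow_line A X p ---> xi) at_bot" "(flow_line A X p ---> ga) at_top" "!!t. flow_line A X p t : CX xi ga"
proof -
 obtain x where x: "icurve X {..0} x" "x 0 = p" "(x ---> xi) at_bot" using assms by (auto simp: connecting_def Wu_def)
 obtain y where y: "icurve X {0..} y" "y 0 = p" "(y ---> ga) at_top" using assms by (auto simp: connecting_def Ws_def)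
 define z where "z t = (if t <= 0 then x t else y t)" for t
 have "icurve X ({..0} \<union> {0..}) z"
 proof (rule integral_curve_union)
  show "icurve X {..0} z" by (rule integral_curve_cong[OF x(1)]) (simp add: z_def)
  show "icurve X {0..} z" by (rule integral_curve_cong[OF y(1)]) (use x y in \<open>auto simp: z_def\<close>)
 qed auto
 moreover have "{..0} \<union> {0..} = (UNIV :: real set)" by auto
 ultimately have z: "icurve X UNIV z" by simp
 have z0: "z 0 = p" using x by (simp add: z_def)
 note fl = flow_line_eq[OF z z0]
 show "icurve X UNIV (flow_line A X p)" "flow_line A X p 0 = p" using z z0 by (simp_all add: fl)
 show "(flow_line A X p ---> xi) at_bot" unfolding fl
  using x(3) by (rule Lim_transform_eventually) (use eventually_le_at_bot[of 0] in \<open>eventually_elim, simp add: z_def\<close>)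
 show "(flow_line A X p ---> ga) at_top" unfolding fl
  using y(3) by (rule Lim_transform_eventually) (use eventually_gt_at_top[of 0] in \<open>eventually_elim, simp add: z_def\<close>)
 show "flow_line A X p t : CX xi ga" for t
  using flow_invariant_curve[OF Wu_flow_invariant z, of 0 t] flow_invariant_curve[OF Ws_flow_invariant z, of 0 t] z0 assms
  by (simp add: fl connecting_def)
qed

text \<open>Within one normal-form chart the positions at times \<open>s\<close> and
  \<open>t\<close> differ by the explicit flow \<open>ps (t - s)\<close>, and its derivative
  transports the velocity with respect to the parameter \<open>H\<close>.\<close>

lemma velocity_transport:
 assumes m: "model_chart X c ps" and tube: "open U" "!!r x. \<bar>r\<bar> < d ==> x : U ==> ps r x : snd c ` fst c"
  and Ps: "!!H. H : S ==> icurve X UNIV (Ps H)" and H1: "H1 : S"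
  and s: "Ps H1 s : fst c" "snd c (Ps H1 s) : U" "\<bar>t - s\<bar> < d"
  and v: "has_velocity A S (%H. Ps H s) H1 v"
 shows "has_velocity A S (%H. Ps H t) H1
  (pull c (Ps H1 t) (fd (ps (t - s)) (snd c (Ps H1 s)) (push A c (Ps H1 s) v)))"
proof -
 have c: "c : charts" and psC: "Cinf_on UNIV (ps r)" for r using m by (auto simp: model_chart_def)
 let ?U = "{q : fst c. snd c q : U}" and ?F = "at H1 within S"
 have oU: "open ?U" by (rule chart_open_preimage[OF c tube(1)])
 have eq: "Ps H t : fst c & snd c (Ps H t) = ps (t - s) (snd c (Ps H s))" if "H : S" "Ps H s : ?U" for H
 proof -
  have "ps r (snd c (Ps H s)) : snd c ` fst c" if "r : closed_segment 0 (t - s)" for r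
   by (rule tube(2)) (use that \<open>Ps H s : ?U\<close> s(3) in \<open>auto simp: closed_segment_eq_real_ivl split: if_splits\<close>)
  then show ?thesis using model_curve_eq[OF m icurve_subset[OF Ps[OF that(1)]], of s t] that(2) by auto
 qed
 have e1: "Ps H1 t : fst c & snd c (Ps H1 t) = ps (t - s) (snd c (Ps H1 s))" using eq[OF H1] s by blast
 have "continuous ?F (%H. Ps H s)" using v by (simp add: has_velocity_def)
 then have "\<forall>\<^sub>F H in ?F. Ps H s : ?U" using oU s(1,2) unfolding continuous_within by (intro topological_tendstoD) auto
 then have ev: "\<forall>\<^sub>F H in ?F. Ps H t : fst c & ps (t - s) (snd c (Ps H s)) = snd c (Ps H t)"
  by (auto simp: eventually_at_filter elim!: eventually_mono dest: eq)
 have D1: "((%H. snd c (Ps H s)) has_vector_derivative push A c (Ps H1 s) v) ?F"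
  using v has_velocity_iff[OF c, of "%H. Ps H s" H1 S v] s(1) H1 by (auto simp: o_def)
 have "(ps (t - s) has_derivative fd (ps (t - s)) (snd c (Ps H1 s))) (at (snd c (Ps H1 s)))" using Cinf_deriv[OF psC] by blast
 from vector_derivative_diff_chain_within[OF D1 this[THEN has_derivative_at_withinI], unfolded o_def]
 have D: "((snd c o (%H. Ps H t)) has_vector_derivative
  fd (ps (t - s)) (snd c (Ps H1 s)) (push A c (Ps H1 s) v)) ?F" unfolding has_vector_derivative_def o_def
  by (rule has_derivative_transform_eventually) (use ev e1 H1 in \<open>auto elim: eventually_mono\<close>)
 have "((%H. Ps H t) ---> Ps H1 t) ?F" by (rule chart_tendstoD[OF c])
   (use e1 ev has_vector_derivative_continuous[OF D] in \<open>auto simp: continuous_within o_def elim: eventually_mono\<close>)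
 then show ?thesis by (intro has_velocityI[OF c _ _ _ D]) (use e1 H1 in \<open>auto simp: continuous_within\<close>)
qed

lemma curve_tube:
 assumes m: "model_chart X c ps" and z: "icurve X UNIV z" and zt: "z t0 : fst c"
 obtains d U N where "open U" "!!r x. \<bar>r\<bar> < d ==> x : U ==> ps r x : snd c ` fst c" "open N" "t0 : N"
  "!!s t. s : N ==> t : N ==> z s : fst c & snd c (z s) : U & \<bar>t - s\<bar> < d"
proof -
 have c: "c : charts" using m by (auto simp: model_chart_def)
 obtain d U where dU: "d > 0" "open U" "snd c (z t0) : U" "!!r x. \<bar>r\<bar> < d ==> x : U ==> ps r x : snd c ` fst c"
  using model_tube[OF m, of "snd c (z t0)"] zt by blast
 let ?U = "{q : fst c. snd c q : U}"
 have "open (z -` ?U)" by (rule open_vimage[OF chart_open_preimage[OF c dU(2)] icurve_continuous[OF z]])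
 moreover have "\<bar>t - s\<bar> < d" if "s : ball t0 (d / 2)" "t : ball t0 (d / 2)" for s t using that unfolding mem_ball dist_real_def by linarith
 ultimately show ?thesis using dU zt by (intro that[of U d "z -` ?U \<inter> ball t0 (d / 2)"]) auto
qed

text \<open>The glued curve provides the derivative in its parameter at one time, but the sign
  argument evaluates it at a time that depends on the parameter. Transport through charts spreads
  differentiability over the connected time axis.\<close>

lemma velocity_family:
 assumes Ps: "!!H. H : S ==> icurve X UNIV (Ps H)" and H1: "H1 : S"
  and v: "has_velocity A S (%H. Ps H t1) H1 v"
 shows "EX w. has_velocity A S (%H. Ps H t) H1 w"
proof (rule connected_induction_simple[where P="%t. EX w. has_velocity A S (%H. Ps H t) H1 w" and S=UNIV and a=t1])
 fix t0 :: real
 obtain c ps where m: "model_chart X c ps" "Ps H1 t0 : fst c" using model_exists by blast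
 obtain d U N where N: "open U" "!!r x. \<bar>r\<bar> < d ==> x : U ==> ps r x : snd c ` fst c" "open N" "t0 : N"
  "!!s t. s : N ==> t : N ==> Ps H1 s : fst c & snd c (Ps H1 s) : U & \<bar>t - s\<bar> < d" by (rule curve_tube[OF m(1) Ps[OF H1] m(2)]) blast
 have "EX w. has_velocity A S (%H. Ps H t) H1 w" if st: "s : N" "t : N" "EX w. has_velocity A S (%H. Ps H s) H1 w" for s t
 proof -
  obtain w where w: "has_velocity A S (%H. Ps H s) H1 w" using st(3) by blast
  note N5 = N(5)[OF st(1,2)]
  show ?thesis by (rule exI, rule velocity_transport[where Ps=Ps, OF m(1) N(1,2) Ps H1 _ _ _ w]) (use N5 in auto)
 qed
 then show "EX T. openin (top_of_set UNIV) T & t0 : T & (ALL s:T. ALL t:T. (EX w. has_velocity A S (%H. Ps H s) H1 w) -->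
   (EX w. has_velocity A S (%H. Ps H t) H1 w))" using N(3,4) by blast
qed (use v in auto)

text \<open>In charts that straighten the flow, the velocities of such a family do not depend on time.\<close>

lemma velocity_straight:
 assumes Ps: "!!H. H : S ==> icurve X UNIV (Ps H)" and H1: "H1 : S" "at H1 within S ~= bot"
  and v: "!!t. has_velocity A S (%H. Ps H t) H1 (v t)" and nz: "X (Ps H1 t0) ~= 0"
 obtains c N e w where "c : charts" "open N" "t0 : N" "e ~= 0" "!!t. t : N ==> Ps H1 t : fst c"
  "!!t. t : N ==> push A c (Ps H1 t) (X (Ps H1 t)) = e" "!!t. t : N ==> push A c (Ps H1 t) (v t) = w"
proof -
 obtain c ro e where c: "c : charts" "Ps H1 t0 : fst c" "e ~= 0" "!!q. q : fst c ==> push A c q (X q) = e"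
  "model_chart X c (%s x. x + s *\<^sub>R e)" by (rule straight_chart[OF smooth_X nz]) blast
 obtain d U N where N: "open U" "!!r x. \<bar>r\<bar> < d ==> x : U ==> x + r *\<^sub>R e : snd c ` fst c" "open N" "t0 : N"
  "!!s t. s : N ==> t : N ==> Ps H1 s : fst c & snd c (Ps H1 s) : U & \<bar>t - s\<bar> < d" by (rule curve_tube[OF c(5) Ps[OF H1(1)] c(2)]) blast
 have "push A c (Ps H1 t) (v t) = push A c (Ps H1 t0) (v t0)" if t: "t : N" for t
 proof -
  have "((%x. x + (t - t0) *\<^sub>R e) has_derivative (%h. h)) (at x)" for x by (auto intro!: derivative_eq_intros)
  from has_derivative_unique_at[OF this]
  have "fd (%x. x + (t - t0) *\<^sub>R e) x h = h" for x h by simp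
  moreover note N5 = N(5)[OF N(4) t]
  have "has_velocity A S (%H. Ps H t) H1 (pull c (Ps H1 t)
   (fd (%x. x + (t - t0) *\<^sub>R e) (snd c (Ps H1 t0)) (push A c (Ps H1 t0) (v t0))))"
   by (rule velocity_transport[where Ps=Ps, OF c(5) N(1,2) Ps H1(1) _ _ _ v[of t0]]) (use N5 in auto)
  ultimately have "v t = pull c (Ps H1 t) (push A c (Ps H1 t0) (v t0))" using velocity_eq[OF _ H1(2)] v[of t] by metis
  then show ?thesis using c(1) N(5)[OF t t] by simp
 qed
 then show ?thesis using that[of c N e] c N by blast
qed

text \<open>Since \<open>f\<close> strictly decreases along \<open>y\<close>, its values slightly
  before and after time \<open>r\<close> lie on either side of the level, and convergence carries
  this over to \<open>Ps H\<close>. Level crossings can thus replace the arbitrary time shifts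
  \<open>sm\<close>.\<close>

lemma hitting_time:
 assumes y: "icurve X UNIV y" "X (y r) ~= 0" and Ps: "\<forall>\<^sub>F H in F. icurve X UNIV (Ps H)"
  and lim: "!!t. ((%H. Ps H (sm H + t)) ---> y t) F" and ep: "ep > 0"
 shows "\<forall>\<^sub>F H in F. (EX s. f (Ps H s) = f (y r)) & (ALL s. f (Ps H s) = f (y r) --> \<bar>s - sm H - r\<bar> < ep)"
proof -
 define e where "e = ep / 2"
 have e: "e > 0" "e < ep" using ep by (auto simp: e_def)
 have nz: "X (y s) ~= 0" for s using crit_constant[OF y(1), of s r] y(2) by auto
 have lt: "f (y t) < f (y s)" if "s < t" for s t using f_decreasing(2)[OF icurve_subset[OF y(1)], of s t] nz that by simp
 have "\<forall>\<^sub>F H in F. f (Ps H (sm H + (r - e))) > f (y r)" "\<forall>\<^sub>F H in F. f (Ps H (sm H + (r + e))) < f (y r)"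
  using order_tendstoD(1)[OF f_tendsto[OF lim[of "r - e"]]] order_tendstoD(2)[OF f_tendsto[OF lim[of "r + e"]]] lt e by auto
 with Ps show ?thesis
 proof eventually_elim
  case (elim H)
  define a b where "a = sm H + (r - e)" and "b = sm H + (r + e)"
  have ab: "a <= b" using e by (simp add: a_def b_def)
  have mono: "f (Ps H t) <= f (Ps H s)" if "s <= t" for s t using f_decreasing(1)[OF icurve_subset[OF elim(1)] that] by simp
  have "continuous_on {a..b} (%s. f (Ps H s))" unfolding continuous_on_eq_continuous_within
   using f_has_derivative_curve[OF elim(1)] by (meson DERIV_continuous UNIV_I continuous_within_subset subset_UNIV)
  then have "EX s. f (Ps H s) = f (y r)" using IVT2'[of "%s. f (Ps H s)" b "f (y r)" a] elim ab by (auto simp: a_def b_def)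
  moreover have "\<bar>s - sm H - r\<bar> < ep" if "f (Ps H s) = f (y r)" for s
  proof -
   have "a <= s" using mono[of s a] that elim(2) by (force simp: a_def)
   moreover have "s <= b" using mono[of b s] that elim(3) by (force simp: b_def)
   ultimately show ?thesis using e by (auto simp: a_def b_def)
  qed
  ultimately show ?case by blast
 qed
qed

end

section \<open>Passing a critical point\<close>

text \<open>\<open>x\<close> is the entry point in Morse coordinates, \<open>w\<close> half the
  normalised tangent vector there, \<open>E\<close> is exp (2T), and \<open>z\<close> the image of
  \<open>w\<close> at the exit minus a multiple of \<open>X\<close>; \<open>e1\<close> and
  \<open>e2\<close> are the transversality bounds at the two ends. By \<open>o2\<close> the
  deviation of proj B (w t) from E proj B (x t) is orthogonal to proj B (x t), so it hardly enters
  inner x0 z. Then \<open>e2\<close> limits E times the deviation by the stable part of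
  \<open>z\<close>, which is at most |w| / E + O(1), and \<open>e1\<close> limits |w| by the
  deviation plus O(1). Together the deviation is O(1/E).\<close>

lemma saddle_estimate:
 fixes x w :: "'b => 'e::euclidean_space" and E :: "'b => real"
 assumes B: "B \<subseteq> Basis" and E: "\<forall>\<^sub>F t in F. E t > 0" "((%t. 1 / E t) ---> 0) F"
  and a: "((%t. E t *\<^sub>R proj B (x t)) ---> x0) F" and b: "((%t. x t - proj B (x t)) ---> y0) F"
  and x0: "proj B x0 = x0" and ka: "ka1 > 0" "ka2 > 0"
  and e1: "\<forall>\<^sub>F t in F. ka1 * norm (w t) <= norm (proj B (w t)) + \<bar>inner y0 (w t)\<bar>"
  and z: "!!t. z t = E t *\<^sub>R (proj B (w t) - E t *\<^sub>R proj B (x t)) + ((1 / E t) *\<^sub>R (w t - proj B (w t)) + (x t - proj B (x t)))"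
  and e2: "\<forall>\<^sub>F t in F. ka2 * norm (z t) <= norm (z t - proj B (z t)) + \<bar>inner x0 (z t)\<bar>"
  and o1: "\<forall>\<^sub>F t in F. inner (x t - proj B (x t)) (w t) = 0"
  and o2: "\<forall>\<^sub>F t in F. inner (proj B (x t)) (w t) = E t * (norm (proj B (x t)))\<^sup>2"
 shows "((%t. proj B (w t)) ---> x0) F" "((%t. inner y0 (w t)) ---> 0) F"
proof -
 define De where "De t = proj B (w t) - E t *\<^sub>R proj B (x t)" for t
 define K where "K = 2 * (norm x0 + 1) / ka1 + (norm y0 + 1)"
 \<comment> \<open>The thresholds absorb inner x0 z into half of \<open>ka2\<close>, inner y0 w into
   half of \<open>ka1\<close>, and the deviation that returns through |w| into a quarter of
   \<open>ka2\<close>.\<close>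
 have "min (ka2 / 2) 1 > 0" "min (ka1 / 2) 1 > 0" "min 1 (ka1 * ka2 / 8) > 0" using ka by auto
 note near = tendstoD[OF a this(1)] tendstoD[OF b this(2)] tendstoD[OF E(2) this(3)]
 have ev: "\<forall>\<^sub>F t in F. norm (De t) <= (1 / E t) * (4 / ka2 * K) & norm (w t) <= 2 / ka1 * (norm (De t) + (norm x0 + 1))"
  using E(1) e1 e2 o1 o2 near
 proof eventually_elim
  case (elim t)
  define i where "i = 1 / E t"
  have Ei: "E t > 0" "i > 0" "E t * i = 1" "i <= 1" "i <= ka1 * ka2 / 8" using elim by (auto simp: i_def)
  have near: "norm (x0 - E t *\<^sub>R proj B (x t)) <= ka2 / 2" "norm (E t *\<^sub>R proj B (x t)) <= norm x0 + 1"
   "norm (y0 - (x t - proj B (x t))) <= ka1 / 2" "norm (x t - proj B (x t)) <= norm y0 + 1"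
   using elim(6,7) norm_triangle_ineq2[of "E t *\<^sub>R proj B (x t)" x0] norm_triangle_ineq2[of "x t - proj B (x t)" y0] by (auto simp: dist_norm norm_minus_commute)
  have iw: "inner (proj B v) (proj B u) = inner (proj B v) u" for u v :: 'e using inner_proj_compl[OF B, of v u] by (simp add: inner_diff_right)
  have "\<bar>inner y0 (w t)\<bar> = \<bar>inner (y0 - (x t - proj B (x t))) (w t)\<bar>" using elim(4) by (simp add: inner_diff_left)
  also have "\<dots> <= ka1 / 2 * norm (w t)"
   using Cauchy_Schwarz_ineq2[of "y0 - (x t - proj B (x t))" "w t"] mult_right_mono[OF near(3), of "norm (w t)"] by simp
  finally have "ka1 / 2 * norm (w t) <= norm (proj B (w t))" using elim(2) by simp
  moreover have "norm (proj B (w t)) <= norm (De t) + norm (E t *\<^sub>R proj B (x t))"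
   using norm_triangle_ineq[of "De t" "E t *\<^sub>R proj B (x t)"] by (simp add: De_def)
  ultimately have w: "norm (w t) <= 2 / ka1 * (norm (De t) + (norm x0 + 1))" using near(2) ka by (simp add: field_simps)
  have Pz: "proj B (z t) = E t *\<^sub>R De t" "z t - proj B (z t) = i *\<^sub>R (w t - proj B (w t)) + (x t - proj B (x t))"
   using B by (simp_all add: z De_def i_def linear_add[OF linear_proj] linear_diff[OF linear_proj] linear_scale[OF linear_proj])
  have "inner (proj B (x t)) (De t) = 0" using elim(5) by (simp add: De_def inner_diff_right iw power2_norm_eq_inner)
  then have "\<bar>inner x0 (z t)\<bar> <= norm (x0 - E t *\<^sub>R proj B (x t)) * norm (E t *\<^sub>R De t)" using iw[of x0 "z t"] x0 Pz Cauchy_Schwarz_ineq2[of "x0 - E t *\<^sub>R proj B (x t)" "E t *\<^sub>R De t"] by (simp add: inner_diff_left)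
  also have "\<dots> <= ka2 / 2 * norm (E t *\<^sub>R De t)" using near(1) by (rule mult_right_mono) simp
  also have "\<dots> = ka2 / 2 * (E t * norm (De t))" using Ei by simp
  finally have "\<bar>inner x0 (z t)\<bar> <= ka2 / 2 * (E t * norm (De t))" .
  moreover have "ka2 * (E t * norm (De t)) <= ka2 * norm (z t)" using norm_proj_le(1)[OF B, of "z t"] Pz Ei ka by simp
  moreover have "i * norm (w t - proj B (w t)) <= i * norm (w t)" using norm_proj_le(2)[OF B] Ei by simp
  then have "norm (z t - proj B (z t)) <= i * norm (w t) + (norm y0 + 1)"
   unfolding Pz(2) using norm_triangle_ineq[of "i *\<^sub>R (w t - proj B (w t))" "x t - proj B (x t)"] near(4) Ei(2) by (simp only: norm_scaleR abs_of_pos)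
  ultimately have "ka2 / 2 * (E t * norm (De t)) <= i * norm (w t) + (norm y0 + 1)" using elim(3) by simp
  from mult_left_mono[OF this, of i] Ei(2)
  have "i * (ka2 / 2 * (E t * norm (De t))) <= i * (i * norm (w t) + (norm y0 + 1))" by simp
  moreover have "i * (ka2 / 2 * (E t * norm (De t))) = ka2 / 2 * norm (De t) * (E t * i)" by simp
  ultimately have "ka2 / 2 * norm (De t) <= i * (i * norm (w t) + (norm y0 + 1))" by (simp only: Ei(3))
  also have "i * (i * norm (w t)) <= i * (i * (2 / ka1 * (norm (De t) + (norm x0 + 1))))" using w Ei by (intro mult_left_mono) auto
  then have "i * (i * norm (w t) + (norm y0 + 1)) <= i * (i * (2 / ka1 * (norm (De t) + (norm x0 + 1))) + (norm y0 + 1))" by (simp add: distrib_left)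
  also have "\<dots> = (i * i) * (2 / ka1) * norm (De t) + i * (i * (2 * (norm x0 + 1) / ka1) + (norm y0 + 1))" by (simp add: algebra_simps add_divide_distrib)
  also have "\<dots> <= ka2 / 4 * norm (De t) + i * K"
  proof (rule add_mono)
   have "i * i <= 1 * (ka1 * ka2 / 8)" using Ei by (intro mult_mono) auto
   then have "(i * i) * (2 / ka1) <= (ka1 * ka2 / 8) * (2 / ka1)" using ka by (intro mult_right_mono) auto
   then show "(i * i) * (2 / ka1) * norm (De t) <= ka2 / 4 * norm (De t)" using ka by (intro mult_right_mono) auto
   have "i * (2 * (norm x0 + 1) / ka1) <= 1 * (2 * (norm x0 + 1) / ka1)" using Ei ka by (intro mult_right_mono) auto
   then show "i * (i * (2 * (norm x0 + 1) / ka1) + (norm y0 + 1)) <= i * K" unfolding K_def using Ei by (intro mult_left_mono) auto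
  qed
  finally have "norm (De t) <= i * (4 / ka2 * K)" using ka by (simp add: field_simps)
  with w show ?case by (simp add: i_def)
 qed
 have "((%t. (1 / E t) * (4 / ka2 * K)) ---> 0) F" using tendsto_mult_right[OF E(2), of "4 / ka2 * K"] by simp
 from Lim_null_comparison[OF eventually_mono[OF ev] this] have De0: "(De ---> 0) F" by blast
 from tendsto_add[OF this a] show P: "((%t. proj B (w t)) ---> x0) F" by (simp add: De_def)
 have "((%t. norm (y0 - (x t - proj B (x t))) * (2 / ka1 * (norm (De t) + (norm x0 + 1)))) ---> norm (y0 - y0) * (2 / ka1 * (norm (0::'e) + (norm x0 + 1)))) F"
  by (intro tendsto_intros b De0)
 then have lim: "((%t. norm (y0 - (x t - proj B (x t))) * (2 / ka1 * (norm (De t) + (norm x0 + 1)))) ---> 0) F" by simp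
 show "((%t. inner y0 (w t)) ---> 0) F"
 proof (rule Lim_null_comparison[OF _ lim])
  show "\<forall>\<^sub>F t in F. norm (inner y0 (w t)) <= norm (y0 - (x t - proj B (x t))) * (2 / ka1 * (norm (De t) + (norm x0 + 1)))" using ev o1
  proof eventually_elim
   case (elim t)
   have "inner y0 (w t) = inner (y0 - (x t - proj B (x t))) (w t)" using elim(2) by (simp add: inner_diff_left)
   then have "norm (inner y0 (w t)) <= norm (y0 - (x t - proj B (x t))) * norm (w t)" using Cauchy_Schwarz_ineq2 by (metis real_norm_def)
   also have "\<dots> <= norm (y0 - (x t - proj B (x t))) * (2 / ka1 * (norm (De t) + (norm x0 + 1)))" using elim(1) by (intro mult_left_mono) auto
   finally show ?case .
  qed
 qed
qed

lemma obasis_pair: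
 assumes V: "subspace V" "dim V = 2" and x: "x : V" "v : V" "x ~= 0" "!!r. v ~= r *\<^sub>R x"
 shows "obasis V [x, v]"
proof -
 have "v \<notin> span {x}" using x(4) by (auto simp: span_singleton)
 moreover have "x ~= v" using x(4)[of 1] by auto
 ultimately have ind: "independent {v, x}" using x(3) by (simp add: independent_insert)
 have "V \<subseteq> span {v, x}" using card_eq_dim[of "{v, x}" V] ind x V \<open>x ~= v\<close> by auto
 moreover have "span {v, x} \<subseteq> V" using span_minimal[of "{v, x}" V] x V by auto
 ultimately show ?thesis using ind \<open>x ~= v\<close> by (auto simp: ordered_basis_def insert_commute)
qed

lemma dim1_scaleR:
 assumes "subspace V" "dim V = 1" "x : V" "x ~= 0" "v : V"
 obtains r where "v = r *\<^sub>R (x :: 'e::euclidean_space)"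
proof -
 show ?thesis using card_eq_dim[of "{x}" V] assms that by (auto simp: span_singleton)
qed

context manifold
begin

lemma velocity_in_tangent:
 assumes W: "is_submanifold A d W" and v: "has_velocity A T x t v" "t : T" "at t within T ~= bot" "ALL s:T. x s : W"
 shows "v : TS W (x t)"
proof -
 have xt: "x t : W" using v by blast
 then obtain c L where sl: "slice c L W" "x t : fst c" using W by (auto simp: submanifold_iff)
 show ?thesis unfolding slice_tangent[OF sl(1) xt sl(2)] using slice_curve_velocity[OF sl(1) v sl(2)] by simp
qed

text \<open>Injectivity on one tangent space gives a lower bound there. Through a slice chart the
  nearby tangent spaces are images of the same \<open>L\<close> under maps close to the one at
  \<open>q0\<close>, so a uniform bound survives.\<close>

lemma tangent_bound:
 fixes Q :: "'e => 'f::euclidean_space"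
 assumes W: "is_submanifold A d W" and q0: "q0 : W" and m: "m : charts" "q0 : fst m" and Q: "linear Q"
  and inj: "!!v. v : TS W q0 ==> Q (push A m q0 v) = 0 ==> v = 0"
 obtains ka where "ka > 0" "\<forall>\<^sub>F q in nhds q0. q : W --> (ALL v:TS W q. ka * norm (push A m q v) <= norm (Q (push A m q v)))"
proof -
 obtain c L where sl: "slice c L W" "q0 : fst c" using W q0 by (auto simp: submanifold_iff)
 have c: "c : charts" and L: "subspace L" using sl by (auto simp: slice_def)
 define D where "D q l = push A m q (pull c q l)" for q l
 have lin: "linear (D q)" if "q : fst c" "q : fst m" for q
  unfolding D_def using linear_compose[OF pull_linear[OF c that(1)] push_linear[OF m(1) that(2)]] by (simp add: o_def)
 note l0 = lin[OF sl(2) m(2)]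
 have "bounded_linear (%l. Q (D q0 l))" using linear_compose[OF l0 Q] by (simp add: o_def linear_conv_bounded_linear)
 moreover have "ALL l:L. Q (D q0 l) = 0 --> l = 0"
 proof (intro ballI impI)
  fix l assume "l : L" "Q (D q0 l) = 0"
  then show "l = 0" using inj[of "pull c q0 l"] tangent_space_pull[OF sl(1) q0 sl(2)] push_pull[OF c sl(2), of l] linear_0[OF push_linear[OF c sl(2)]] by (simp add: D_def)
 qed
 ultimately obtain e where e: "e > 0" "ALL l:L. e * norm l <= norm (Q (D q0 l))"
  using injective_imp_isometric[OF closed_subspace[OF L] L, of "%l. Q (D q0 l)"] by blast
 obtain KQ where KQ: "KQ > 0" "!!x. norm (Q x) <= norm x * KQ" using bounded_linear.pos_bounded Q by (metis linear_conv_bounded_linear)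
 obtain KD where KD: "KD > 0" "!!x. norm (D q0 x) <= norm x * KD" using bounded_linear.pos_bounded l0 by (metis linear_conv_bounded_linear)
 obtain K where K: "K = KD + 1" "K > 0" using KD(1) by auto
 \<comment> \<open>A perturbation of \<open>D q0\<close> by \<open>de\<close> costs at most half of
   \<open>e\<close> after applying \<open>Q\<close>, and the cap 1 bounds \<open>D q\<close> by
   \<open>K\<close>.\<close>
 define de where "de = min 1 (e / (2 * KQ))"
 have de: "de > 0" "de <= 1" "de * KQ <= e / 2" using e KQ by (auto simp: de_def min_def)
 have lim: "((%q. q) ---> q0) (nhds q0)" by (simp add: filterlim_def)
 have "((%q. D q b) ---> D q0 b) (nhds q0)" for b using frame_field_tb[OF c sl(2) lim, of "pull c q0 b"] m c sl(2) unfolding tb_tendsto_iff[OF m]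
  by (simp add: frame_field_def D_def)
 from tendstoD[OF this] have "\<forall>\<^sub>F q in nhds q0. ALL b:Basis. dist (D q b) (D q0 b) < de / DIM('e)"
  using de(1) by (intro eventually_ball_finite) (auto)
 moreover have "\<forall>\<^sub>F q in nhds q0. q : fst c" "\<forall>\<^sub>F q in nhds q0. q : fst m"
  using eventually_nhds_in_open[OF chart_open[OF c] sl(2)] eventually_nhds_in_open[OF chart_open[OF m(1)] m(2)] by blast+
 ultimately have "\<forall>\<^sub>F q in nhds q0. q : W --> (ALL v:TS W q. e / (2 * K) * norm (push A m q v) <= norm (Q (push A m q v)))"
 proof (eventually_elim, intro impI ballI)
  fix q v assume near: "ALL b:Basis. dist (D q b) (D q0 b) < de / DIM('e)" and q: "q : fst c" "q : fst m" "q : W"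
   and v: "v : TS W q"
  obtain l where l: "l : L" "push A m q v = D q l" using v unfolding tangent_space_pull[OF sl(1) q(3,1)] D_def by blast
  have lin': "linear (%l. D q l - D q0 l)" by (intro linear_compose_sub lin q l0)
  have "norm (D q b - D q0 b) <= de / DIM('e)" if "b : Basis" for b using near that by (simp add: dist_norm less_imp_le)
  from linear_norm_le_Basis[OF lin' this] have d: "norm (D q l - D q0 l) <= de * norm l" by simp
  have "e * norm l <= norm (Q (D q0 l))" using e l by blast
  also have "\<dots> <= norm (Q (D q l)) + norm (Q (D q l - D q0 l))"
   using norm_triangle_ineq4[of "Q (D q l)" "Q (D q l - D q0 l)"] linear_diff[OF Q, of "D q l" "D q0 l"] by simp
  also have "norm (Q (D q l - D q0 l)) <= (de * norm l) * KQ" by (rule order.trans[OF KQ(2) mult_right_mono[OF d]]) (use KQ(1) in simp)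
  also have "\<dots> <= e / 2 * norm l" using mult_right_mono[OF de(3), of "norm l"] by (simp add: mult_ac)
  finally have 1: "e / 2 * norm l <= norm (Q (D q l))" by simp
  have "norm (D q l) <= K * norm l" using norm_triangle_ineq[of "D q0 l" "D q l - D q0 l"] d KD(2)[of l] mult_right_mono[OF de(2), of "norm l"] by (simp add: K algebra_simps)
  then have "e / (2 * K) * norm (D q l) <= e / (2 * K) * (K * norm l)" using e K(2) by (intro mult_left_mono) auto
  also have "\<dots> = e / 2 * norm l" using K(2) by simp
  finally show "e / (2 * K) * norm (push A m q v) <= norm (Q (push A m q v))" using 1 unfolding l(2) by simp
 qed
 then show ?thesis using that[of "e / (2 * K)"] e K(2) by simp
qed

text \<open>The vectors are compared with the constant extension of \<open>v0\<close>. The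
  difference is tangent to \<open>W\<close>, so its size is bounded by its image under
  \<open>Q\<close>, which tends to 0.\<close>

lemma tangent_limit:
 fixes Q :: "'e => 'f::euclidean_space"
 assumes W: "is_submanifold A d W" and q0: "q0 : W" and m: "m : charts" "q0 : fst m" and Q: "linear Q"
  and inj: "!!v. v : TS W q0 ==> Q (push A m q0 v) = 0 ==> v = 0"
  and q: "(q ---> q0) F" "\<forall>\<^sub>F t in F. q t : W" and v: "\<forall>\<^sub>F t in F. v t : TS W (q t)"
  and v0: "v0 : TS W q0" and lim: "((%t. Q (push A m (q t) (v t))) ---> Q (push A m q0 v0)) F"
 shows "tb_tendsto q v q0 v0 F"
proof -
 obtain ka where ka: "ka > 0" "\<forall>\<^sub>F q in nhds q0. q : W --> (ALL v:TS W q. ka * norm (push A m q v) <= norm (Q (push A m q v)))"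
  by (rule tangent_bound[OF W q0 m Q inj])
 obtain c L where sl: "slice c L W" "q0 : fst c" using W q0 by (auto simp: submanifold_iff)
 have c: "c : charts" and L: "subspace L" using sl by (auto simp: slice_def)
 define v' where "v' t = frame_field c q0 v0 (q t)" for t
 have v': "((%t. push A m (q t) (v' t)) ---> push A m q0 v0) F" using frame_field_tb[OF c sl(2) q(1), of v0] m by (simp add: tb_tendsto_def v'_def)
 define d where "d t = push A m (q t) (v t) - push A m (q t) (v' t)" for t
 have "bounded_linear Q" using Q by (simp add: linear_conv_bounded_linear)
 from tendsto_diff[OF lim bounded_linear.tendsto[OF this v']]
 have "((%t. norm (Q (d t)) / ka) ---> norm (0::'f) / ka) F"
  unfolding d_def linear_diff[OF Q] using ka(1) by (intro tendsto_divide tendsto_norm tendsto_const) simp_all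
 then have lim0: "((%t. norm (Q (d t)) / ka) ---> 0) F" by simp
 have "\<forall>\<^sub>F t in F. q t : W --> (ALL v:TS W (q t). ka * norm (push A m (q t) v) <= norm (Q (push A m (q t) v)))"
  using q(1) ka(2) by (rule filterlim_iff[THEN iffD1, rule_format])
 then have "\<forall>\<^sub>F t in F. norm (d t) <= norm (Q (d t)) / ka" using q(2) v ev_chart[OF c sl(2) q(1)] ev_chart[OF m q(1)]
 proof eventually_elim
  case (elim t)
  have "v' t : TS W (q t)" using v0 elim(2,4) c unfolding slice_tangent[OF sl(1) elim(2,4)] slice_tangent[OF sl(1) q0 sl(2)]
   by (simp add: v'_def frame_field_def)
  then have "v t - v' t : TS W (q t)" using elim(3) subspace_diff sub_dim(1)[OF W elim(2)] by blast
  moreover have "d t = push A m (q t) (v t - v' t)" by (simp add: d_def linear_diff[OF push_linear[OF m(1) elim(5)]])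
  ultimately show ?case using elim(1,2) ka(1) by (simp add: field_simps)
 qed
 from tendsto_add[OF Lim_null_comparison[OF this lim0] v'] show ?thesis unfolding tb_tendsto_iff[OF m] using q(1) by (simp add: d_def)
qed

end

context gradient_like
begin

text \<open>In charts that straighten the flow both \<open>X\<close> and the parameter derivative
  have constant coordinates along the curve, so independence and sign of the frame do not change
  with time. This moves the sign from the glued point to the neighbourhood of the saddle.\<close>

lemma flow_orientation_const:
 assumes W: "is_submanifold A 2 W" and o: "orientation A W Or"
  and Ps: "!!H. H : S ==> icurve X UNIV (Ps H)" "!!H t. H : S ==> Ps H t : W" and H1: "H1 : S" "at H1 within S ~= bot"
  and v: "!!t. has_velocity A S (%H. Ps H t) H1 (v t)" and nz: "!!t. X (Ps H1 t) ~= 0"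
  and ind: "!!r. v t1 ~= r *\<^sub>R X (Ps H1 t1)"
 shows "Or (Ps H1 t) [X (Ps H1 t), - v t] = Or (Ps H1 t1) [X (Ps H1 t1), - v t1]"
  "obasis (TS W (Ps H1 t)) [X (Ps H1 t), - v t]"
proof -
 define z where "z = Ps H1"
 have zi: "icurve X UNIV z" and zW: "z t : W" for t using Ps H1 by (auto simp: z_def)
 have str: "EX c N e w. c : charts & open N & t0 : N & e ~= 0 & (ALL t:N. z t : fst c & push A c (z t) (X (z t)) = e & push A c (z t) (v t) = w)" for t0
 proof -
  obtain c N e w where c: "c : charts" "open N" "t0 : N" "e ~= 0" "!!t. t : N ==> Ps H1 t : fst c"
   "!!t. t : N ==> push A c (Ps H1 t) (X (Ps H1 t)) = e" "!!t. t : N ==> push A c (Ps H1 t) (v t) = w"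
   by (rule velocity_straight[where Ps=Ps and v=v, OF Ps(1) H1 v nz[of t0]], assumption) (rule that, assumption+)
  show ?thesis by (rule exI[of _ c], rule exI[of _ N], rule exI[of _ e], rule exI[of _ w]) (use c in \<open>simp add: z_def\<close>)
 qed
 have indep: "ALL r. v t ~= r *\<^sub>R X (z t)" for t
 proof (rule connected_induction_simple[where P="%t. ALL r. v t ~= r *\<^sub>R X (z t)" and S=UNIV and a=t1])
  fix t0
  obtain c N e w where c: "c : charts" "open N" "t0 : N"
   "ALL t:N. z t : fst c & push A c (z t) (X (z t)) = e & push A c (z t) (v t) = w" using str by metis
  have "(ALL r. v t ~= r *\<^sub>R X (z t)) \<longleftrightarrow> (ALL r. w ~= r *\<^sub>R e)" if t: "t : N" for t
  proof -
   have q: "z t : fst c" using c(4) t by blast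
   have "v t = r *\<^sub>R X (z t) \<longleftrightarrow> push A c (z t) (v t) = push A c (z t) (r *\<^sub>R X (z t))" for r using pull_push[OF c(1) q] by metis
   then show ?thesis using c(4) t by (simp add: linear_scale[OF push_linear[OF c(1) q]])
  qed
  then show "EX T. openin (top_of_set UNIV) T & t0 : T & (ALL s:T. ALL t:T. (ALL r. v s ~= r *\<^sub>R X (z s)) --> (ALL r. v t ~= r *\<^sub>R X (z t)))"
   using c(2,3) unfolding subtopology_UNIV open_openin[symmetric] by blast
 qed (use ind in \<open>auto simp: z_def\<close>)
 have T: "X (z t) : TS W (z t)" "- v t : TS W (z t)" for t
 proof -
  show "X (z t) : TS W (z t)" using velocity_in_tangent[OF W, of UNIV z t] zi zW by (simp add: icurve_iff)
  have "v t : TS W (z t)" unfolding z_def by (rule velocity_in_tangent[OF W v H1]) (use Ps(2) in blast)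
  then show "- v t : TS W (z t)" using sub_dim(1)[OF W zW[of t]] by (rule subspace_neg[rotated])
 qed
 have basis: "obasis (TS W (z t)) [X (z t), - v t]" for t
 proof (rule obasis_pair[OF sub_dim[OF W zW] T])
  show "- v t ~= r *\<^sub>R X (z t)" for r using indep[of t, rule_format, of "- r"] by (metis minus_minus scaleR_minus_left)
 qed (use nz in \<open>simp add: z_def\<close>)
 have "Or (z t) [X (z t), - v t] = Or (z t1) [X (z t1), - v t1]"
 proof (rule connected_local_const[where f="%t. Or (z t) [X (z t), - v t]" and A=UNIV])
  show "ALL s:UNIV. \<forall>\<^sub>F t in at s within UNIV. Or (z s) [X (z s), - v s] = Or (z t) [X (z t), - v t]"
  proof
   fix s
   obtain c N e w where c: "c : charts" "open N" "s : N"
    "ALL t:N. z t : fst c & push A c (z t) (X (z t)) = e & push A c (z t) (v t) = w" using str by metis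
   have lim: "(z ---> z s) (at s)" using icurve_continuous[OF zi] by (simp add: continuous_on_def)
   have ev: "\<forall>\<^sub>F t in at s. t : N" using c(2,3) by (rule eventually_at_in_open')
   have neg: "push A c (z t) (- v t) = - w" if "t : N" for t using linear_neg[OF push_linear[OF c(1)]] c(4) that by metis
   have "tb_tendsto z (%t. X (z t)) (z s) (X (z s)) (at s)" "tb_tendsto z (%t. - v t) (z s) (- v s) (at s)"
    using c lim by (auto simp: tb_tendsto_iff neg intro!: tendsto_eventually intro: eventually_mono[OF ev])
   then have "\<forall>\<^sub>F t in at s. Or (z t) (map (%E. E t) [%t. X (z t), %t. - v t]) = Or (z s) [X (z s), - v s]"
    by (intro orientation_tendsto[OF o W zW lim _ _ basis]) (use zW T in auto)
   then show "\<forall>\<^sub>F t in at s. Or (z s) [X (z s), - v s] = Or (z t) [X (z t), - v t]" by eventually_elim simp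
  qed
 qed auto
 then show "Or (Ps H1 t) [X (Ps H1 t), - v t] = Or (Ps H1 t1) [X (Ps H1 t1), - v t1]"
  "obasis (TS W (Ps H1 t)) [X (Ps H1 t), - v t]" using basis by (simp_all add: z_def)
qed

text \<open>If the unstable part exceeded \<open>ro\<close> before time \<open>T\<close>, it would
  have norm \<open>ro\<close> at some moment; the first integral then gives the norm of the stable
  part, and \<open>f\<close> would already be below its value at time \<open>T\<close>. Monotonicity
  of \<open>f\<close> excludes this.\<close>

lemma saddle_passage:
 assumes m: "morse_model ga m B" and ro: "ro > 0" "cball 0 (2 * ro) \<subseteq> snd m ` fst m"
  and z: "icurve X UNIV z" "z s : fst m" and T: "T >= 0"
 defines "x \<equiv> snd m (z s)"
 assumes x: "norm (proj B x) <= ro" "norm (x - proj B x) <= ro"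
  and fT: "f (z (s + T)) > f ga - ro\<^sup>2 + (norm (proj B x) * norm (x - proj B x) / ro)\<^sup>2"
 shows "!!r. r : {0..T} ==> z (s + r) : fst m & snd m (z (s + r)) = dflow B r x & norm (dflow B r x) <= 2 * ro"
proof -
 have B: "B \<subseteq> Basis" and mc: "m : charts" using m unfolding morse_model_def by blast+
 have fm: "f (chart_inv m y) = f ga - (norm (proj B y))\<^sup>2 + (norm (y - proj B y))\<^sup>2" if "y : snd m ` fst m" for y
  using m that unfolding morse_model_def by blast
 have *: "z (s + r) : fst m & snd m (z (s + r)) = dflow B r x & norm (dflow B r x) <= 2 * ro"
  if r: "r >= 0" "exp (2 * r) * norm (proj B x) <= ro" for r
 proof -
  have le: "norm (dflow B r' x) <= 2 * ro" if "0 <= r'" "r' <= r" for r'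
  proof -
   have "norm (dflow B r' x) <= exp (2 * r') * norm (proj B x) + exp (- (2 * r')) * norm (x - proj B x)"
    unfolding dflow_def by (rule norm_triangle_le) simp
   also have "exp (2 * r') * norm (proj B x) <= exp (2 * r) * norm (proj B x)" using that by (intro mult_right_mono) auto
   also have "exp (- (2 * r')) * norm (x - proj B x) <= 1 * norm (x - proj B x)" using that by (intro mult_right_mono) auto
   finally show ?thesis using r x by simp
  qed
  have "dflow B r' x : snd m ` fst m" if "r' : closed_segment 0 (s + r - s)" for r'
   by (rule subsetD[OF ro(2)]) (use le[of r'] that r in \<open>auto simp: closed_segment_eq_real_ivl\<close>)
  from model_curve_eq[OF morse_model_chart[OF m] icurve_subset[OF z(1) subset_UNIV] z(2), where t="s + r", folded x_def, OF this]
  show ?thesis using le[of r] r by simp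
 qed
 show "z (s + r) : fst m & snd m (z (s + r)) = dflow B r x & norm (dflow B r x) <= 2 * ro" if r: "r : {0..T}" for r
 proof (cases "exp (2 * r) * norm (proj B x) <= ro")
  case False
  have a: "norm (proj B x) > 0" using False ro by auto
  \<comment> \<open>The moment at which the unstable part has norm \<open>ro\<close>.\<close>
  define t where "t = ln (ro / norm (proj B x)) / 2"
  have et: "exp (2 * t) * norm (proj B x) = ro" using a ro by (simp add: t_def)
  have t: "0 <= t" using a x(1) by (simp add: t_def)
  have "t < r" using False et a by auto
  have "exp (2 * t) = ro / norm (proj B x)" using et a by (simp add: field_simps)
  then have et': "exp (- (2 * t)) = norm (proj B x) / ro" by (simp add: exp_minus)
  note zt = *[OF t] 
  have "dflow B t x : snd m ` fst m" using zt et ro(2) by auto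
  moreover have "z (s + t) = chart_inv m (dflow B t x)" using zt et mc chart_inv_snd[OF mc, of "z (s + t)"] by simp
  ultimately have "f (z (s + t)) = f ga - (norm (proj B (dflow B t x)))\<^sup>2 + (norm (dflow B t x - proj B (dflow B t x)))\<^sup>2" using fm by simp
  also have "\<dots> = f ga - ro\<^sup>2 + (norm (proj B x) * norm (x - proj B x) / ro)\<^sup>2"
   unfolding proj_dflow(2)[OF B] unfolding proj_dflow(1)[OF B] using et et' ro by simp
  finally have "f (z (s + t)) < f (z (s + T))" using fT by simp
  moreover have "f (z (s + T)) <= f (z (s + t))"
   using f_decreasing(1)[OF icurve_subset[OF z(1) subset_UNIV], of "s + t" "s + T"] \<open>t < r\<close> r by simp
  ultimately show ?thesis by simp
 qed (use * r in auto)
qed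

end

lemma obasis_spanning:
 assumes "subspace V" "set bs \<subseteq> V" "V \<subseteq> span (set bs)" "length bs = dim V"
 shows "obasis V (bs :: 'e::euclidean_space list)"
proof -
 have "distinct bs" using dim_le_card[OF assms(3)] card_distinct card_length[of bs] assms(4) by force
 moreover have "independent (set bs)" using card_le_dim_spanning[OF assms(2,3)] card_length[of bs] assms(4) by simp
 ultimately show ?thesis using assms span_minimal[OF assms(2,1)] by (auto simp: ordered_basis_def)
qed

lemma obasis_independent:
 assumes "subspace V" "set bs \<subseteq> V" "distinct bs" "independent (set bs)" "length bs = dim V"
 shows "obasis V (bs :: 'e::euclidean_space list)"
proof -
 show ?thesis using card_eq_dim[OF assms(2)] distinct_card[OF assms(3)] assms span_minimal[OF assms(2,1)] by (auto simp: ordered_basis_def)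
qed

context gradient_like
begin

lemma X_tb: "(q ---> q0) F ==> tb_tendsto q (%t. X (q t)) q0 (X q0) F"
proof -
 assume q: "(q ---> q0) F"
 define c where "c = chart_at A q0"
 have c: "c : charts" "q0 : fst c" using chart_at chart_at_in by (auto simp: c_def)
 let ?g = "%x. push A c (chart_inv c x) (X (chart_inv c x))"
 have "isCont ?g (snd c q0)" by (rule continuous_on_interior[OF Cinf_on_continuous[OF field_Cinf[OF smooth_X c(1)]]])
   (use chart_open_range[OF c(1)] c(2) in \<open>simp add: interior_open\<close>)
 then have "((%t. ?g (snd c (q t))) ---> ?g (snd c q0)) F" by (rule isCont_tendsto_compose) (rule chart_tendsto[OF c q])
 moreover have "\<forall>\<^sub>F t in F. ?g (snd c (q t)) = push A c (q t) (X (q t))" using ev_chart[OF c q] by eventually_elim (use c in simp)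
 ultimately show ?thesis unfolding tb_tendsto_iff[OF c] using c q by (simp add: tendsto_cong)
qed

lemma connecting_X:
 assumes W: "is_submanifold A d (CX xi ga)" and p: "p : CX xi ga"
 shows "X p : TS (CX xi ga) p"
proof -
 have "has_velocity A UNIV (flow_line A X p) 0 (X (flow_line A X p 0))" using connecting_flow_line(1)[OF p] by (simp add: icurve_iff)
 then show ?thesis using velocity_in_tangent[OF W, of UNIV "flow_line A X p" 0 "X p"] connecting_flow_line(2,5)[OF p] by simp
qed

lemma flow_sign_const:
 assumes W: "is_submanifold A 1 (CX xi ga)" "orientation A (CX xi ga) Or"
  and nz: "!!p. p : CX xi ga ==> X p ~= 0"
  and K: "connected K" "K \<subseteq> CX xi ga" "p : K" "q : K"
 shows "Or p [X p] = Or q [X q]" "obasis (TS (CX xi ga) p) [X p]"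
proof -
 let ?C = "CX xi ga"
 have b: "obasis (TS ?C p) [X p]" if "p : ?C" for p
  by (rule obasis_independent) (use sub_dim[OF W(1) that] connecting_X[OF W(1) that] nz[OF that] in auto)
 show "Or p [X p] = Or q [X q]"
 proof (rule connected_local_const[OF K(1,3,4), where f="%p. Or p [X p]"], intro ballI)
  fix s assume s: "s : K"
  have "\<forall>\<^sub>F t in at s within K. t : ?C" using K(2) by (auto simp: eventually_at_filter intro: always_eventually)
  moreover have "((%t. t) ---> s) (at s within K)" by simp
  ultimately have "\<forall>\<^sub>F t in at s within K. Or t (map (%E. E t) [X]) = Or s [X s]"
   using s K(2) X_tb[of "%t. t"] connecting_X[OF W(1)] by (intro orientation_tendsto[OF W(2,1)] b) (auto elim: eventually_mono)
  then show "\<forall>\<^sub>F t in at s within K. Or s [X s] = Or t [X t]" by eventually_elim simp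
 qed
 show "obasis (TS ?C p) [X p]" using b K by blast
qed

end

section \<open>Orientations carried through a saddle\<close>

locale saddle = gradient_like A f X
 for A :: "('a::{t2_space,second_countable_topology}, 'e::euclidean_space) chart set" and f :: "'a => real" and X :: "'a => 'e" +
 fixes ga :: 'a and m :: "('a, 'e) chart" and B :: "'e set" and ro :: real
 assumes m: "morse_model ga m B" and ro: "ro > 0" "cball 0 (2 * ro) \<subseteq> snd m ` fst m"
begin

lemma mB: "m : charts" "B \<subseteq> Basis" and push_X: "q : fst m ==> push A m q (X q) = hfield B (snd m q)"
 using m unfolding morse_model_def by blast+

text \<open>Entry points whose orbit stays in the chart during [0,T]: the unstable part is largest
  at time T and the stable part at time 0, and both are below \<open>ro\<close>, so the orbit stays
  in the ball of radius 2 \<open>ro\<close>.\<close>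

definition box :: "real => 'a set" where
 "box T = {p : fst m. exp (2 * T) * norm (proj B (snd m p)) < ro & norm (snd m p - proj B (snd m p)) < ro}"

definition Ph :: "real => 'a => 'a" where
 "Ph r p = chart_inv m (dflow B r (snd m p))"

definition La :: "real => 'a => 'e => 'e" where
 "La r p v = pull m (Ph r p) (dflow B r (push A m p v))"

lemma open_box: "open (box T)"
proof -
 have "open {x. exp (2 * T) * norm (proj B x) < ro & norm (x - proj B x) < ro}"
  by (intro open_Collect_conj open_Collect_less continuous_intros bounded_linear.continuous_on[OF bounded_linear_proj])
 from chart_open_preimage[OF mB(1) this] show ?thesis by (simp add: box_def)
qed

lemma dflow_invertible: "dflow B (- r) (dflow B r x) = x" "dflow B r (dflow B (- r) x) = x"
 using dflow_add[OF mB(2), of "- r" r x] dflow_add[OF mB(2), of r "- r" x] by auto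

lemma box_flow:
 assumes p: "p : box T" and r: "0 <= r" "r <= T"
 shows "Ph r p : fst m" "snd m (Ph r p) = dflow B r (snd m p)" "Ph 0 p = p" "p : fst m" "p : box r"
proof -
 have in_image: "dflow B r (snd m p) : snd m ` fst m" if "0 <= r" "r <= T" for r
 proof -
  have "norm (dflow B r (snd m p)) <= exp (2 * r) * norm (proj B (snd m p)) + exp (- (2 * r)) * norm (snd m p - proj B (snd m p))"
   unfolding dflow_def by (rule norm_triangle_le) simp
  also have "exp (2 * r) * norm (proj B (snd m p)) <= exp (2 * T) * norm (proj B (snd m p))" using that by (intro mult_right_mono) auto
  also have "exp (- (2 * r)) * norm (snd m p - proj B (snd m p)) <= 1 * norm (snd m p - proj B (snd m p))" using that by (intro mult_right_mono) auto
  finally show ?thesis using p ro(2) by (auto simp: box_def)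
 qed
 then show "Ph r p : fst m" "snd m (Ph r p) = dflow B r (snd m p)" using mB(1) r by (auto simp: Ph_def intro: chart_inv_in)
 show "p : fst m" "Ph 0 p = p" using p mB by (auto simp: box_def Ph_def)
 have "exp (2 * r) * norm (proj B (snd m p)) <= exp (2 * T) * norm (proj B (snd m p))" using r by (intro mult_right_mono) auto
 then show "p : box r" using p by (simp add: box_def)
qed

lemma box_curve: "p : box T ==> icurve X {0..T} (%r. Ph r p)"
 unfolding Ph_def using box_flow(1,2)[of p T] by (intro model_curve[OF morse_model_chart[OF m]]) (metis atLeastAtMost_iff image_eqI)

lemma La_linear: "p : box T ==> 0 <= r ==> r <= T ==> linear (La r p)" "p : box T ==> 0 <= r ==> r <= T ==> inj (La r p)"
 "p : box T ==> 0 <= r ==> r <= T ==> push A m (Ph r p) (La r p v) = dflow B r (push A m p v)"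
proof -
 assume h: "p : box T" "0 <= r" "r <= T"
 note b = box_flow[OF h]
 show "push A m (Ph r p) (La r p v) = dflow B r (push A m p v)" for v using b mB(1) by (simp add: La_def)
 then show "inj (La r p)" using pull_push[OF mB(1) b(4)] dflow_invertible(1) by (intro injI) metis
 show "linear (La r p)" using linear_compose[OF linear_compose[OF push_linear[OF mB(1) b(4)] linear_dflow] pull_linear[OF mB(1) b(1)]]
  by (simp add: La_def[abs_def] o_def)
qed

text \<open>The explicit flow takes curves in \<open>W\<close> to curves in \<open>W\<close>, so its
  derivative \<open>La\<close> preserves tangency.\<close>

lemma box_tangent:
 assumes W: "is_submanifold A d W" "flow_invariant W" and p: "p : W" "p : box T" and r: "0 <= r" "r <= T" and v: "v : TS W p"
 shows "Ph r p : W" "La r p v : TS W (Ph r p)"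
proof -
 note b = box_flow[OF p(2) r]
 have inW: "Ph r q : W" if "q : W" "q : box T" for q
  using flow_invariant_curve[OF W(2) box_curve[OF that(2)], of 0 r] box_flow(3)[OF that(2) r] that r by simp
 show "Ph r p : W" by (rule inW[OF p])
 obtain x ep where x: "ep > 0" "at (0::real) within {-ep<..<ep} ~= bot" "has_velocity A {-ep<..<ep} x 0 v" "x 0 = p"
  "!!s. s : {-ep<..<ep} ==> x s : W \<inter> box T" by (rule tangent_curve[OF v open_box p(2)]) blast
 let ?I = "{-ep<..<ep}"
 have "((snd m o x) has_vector_derivative push A m p v) (at 0 within ?I)" using x(1,3,4) has_velocity_iff[OF mB(1), of x 0 ?I v] b(4) by auto
 from bounded_linear.has_vector_derivative[OF bounded_linear_dflow this]
 have "((%s. dflow B r ((snd m o x) s)) has_vector_derivative dflow B r (push A m p v)) (at 0 within ?I)" .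
 then have D: "((snd m o (%s. Ph r (x s))) has_vector_derivative dflow B r (push A m p v)) (at 0 within ?I)"
  by (rule has_vector_derivative_transform[rotated 2]) (use x(1,5) box_flow(2)[OF _ r] in auto)
 have "((%s. Ph r (x s)) ---> Ph r p) (at 0 within ?I)"
 proof (rule chart_tendstoD[OF mB(1) b(1)])
  show "\<forall>\<^sub>F s in at 0 within ?I. Ph r (x s) : fst m" using x(5) box_flow(1)[OF _ r] by (auto simp: eventually_at_filter)
  show "((%s. snd m (Ph r (x s))) ---> snd m (Ph r p)) (at 0 within ?I)"
   using has_vector_derivative_continuous[OF D] x(4) by (simp add: continuous_within o_def)
 qed
 then have "has_velocity A ?I (%s. Ph r (x s)) 0 (La r p v)" using has_velocityI[OF mB(1) _ _ _ D] b(1) x(1,4) by (simp add: continuous_within La_def)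
 then show "La r p v : TS W (Ph r p)" using velocity_in_tangent[OF W(1) _ _ x(2)] x(1,4,5) inW by force
qed

lemma box_orientation_const:
 assumes W: "is_submanifold A d W" "flow_invariant W" "orientation A W Or" and p: "p : W" "p : box T" and T: "T >= 0"
  and vs: "obasis (TS W p) vs"
 shows "Or (Ph T p) (map (La T p) vs) = Or p vs" "obasis (TS W (Ph T p)) (map (La T p) vs)"
proof -
 have p0: "Ph 0 p = p" using box_flow(3)[OF p(2), of 0] T by simp
 have La0: "La 0 p v = v" for v using p p0 mB(1) by (simp add: La_def box_def)
 have inW: "Ph r p : W" if "r : {0..T}" for r using box_tangent(1)[OF W(1,2) p, of r 0] that subspace_0[OF sub_dim(1)[OF W(1) p(1)]] by simp
 have b: "obasis (TS W (Ph r p)) (map (La r p) vs)" if r: "r : {0..T}" for r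
 proof (rule obasis_independent[OF sub_dim(1)[OF W(1) inW[OF r]]])
  have r': "0 <= r" "r <= T" using r by auto
  note L = La_linear[OF p(2) r']
  show "set (map (La r p) vs) \<subseteq> TS W (Ph r p)" using box_tangent(2)[OF W(1,2) p r'] obasis_subset[OF vs] by auto
  show "distinct (map (La r p) vs)" using vs by (simp add: ordered_basis_def distinct_map inj_on_subset[OF L(2)])
  show "independent (set (map (La r p) vs))" using independent_inj_on_image_lin[OF L(1)] vs inj_on_subset[OF L(2)] by (simp add: ordered_basis_def)
  show "length (map (La r p) vs) = dim (TS W (Ph r p))" using obasis_length[OF vs] sub_dim(2)[OF W(1)] inW[OF r] p(1) by simp
 qed
 have "Or (Ph 0 p) (map (La 0 p) vs) = Or (Ph T p) (map (La T p) vs)"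
 proof (rule connected_local_const[where f="%r. Or (Ph r p) (map (La r p) vs)" and A="{0..T}"], safe)
  fix r assume r: "r : {0..T}"
  let ?F = "at r within {0..T}"
  have lim: "((%s. Ph s p) ---> Ph r p) ?F" using icurve_continuous[OF box_curve[OF p(2)]] r by (simp add: continuous_on_def)
  have ev: "\<forall>\<^sub>F s in ?F. s : {0..T}" by (simp add: eventually_at_filter)
  have "tb_tendsto (%s. Ph s p) (%s. La s p v) (Ph r p) (La r p v) ?F" for v
  proof -
   have rm: "Ph r p : fst m" using box_flow(1)[OF p(2)] r by simp
   have "((%s. dflow B s (push A m p v)) ---> dflow B r (push A m p v)) ?F" unfolding dflow_def by (intro tendsto_intros)
   moreover have "\<forall>\<^sub>F s in ?F. dflow B s (push A m p v) = push A m (Ph s p) (La s p v)"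
    using ev by eventually_elim (use La_linear(3)[OF p(2)] in simp)
   ultimately show ?thesis unfolding tb_tendsto_iff[OF mB(1) rm] using lim La_linear(3)[OF p(2)] r Lim_transform_eventually by simp
  qed
  then have "list_all2 (%E v. tb_tendsto (%s. Ph s p) E (Ph r p) v ?F) (map (%v s. La s p v) vs) (map (La r p) vs)"
   by (simp add: list_all2_conv_all_nth)
  moreover have "\<forall>\<^sub>F s in ?F. Ph s p : W" using ev by eventually_elim (rule inW)
  moreover have "\<forall>\<^sub>F s in ?F. La s p v : TS W (Ph s p)" if "v : set vs" for v
   using ev by eventually_elim (use box_tangent(2)[OF W(1,2) p] obasis_subset[OF vs] that in auto)
  ultimately have "\<forall>\<^sub>F s in ?F. Or (Ph s p) (map (%E. E s) (map (%v s. La s p v) vs)) = Or (Ph r p) (map (La r p) vs)"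
   by (intro orientation_tendsto[OF W(3,1) inW[OF r] lim _ _ b[OF r]]) auto
  then show "\<forall>\<^sub>F s in ?F. Or (Ph r p) (map (La r p) vs) = Or (Ph s p) (map (La s p) vs)" by eventually_elim (simp add: o_def)
 qed (use T in \<open>auto simp: convex_connected\<close>)
 then show "Or (Ph T p) (map (La T p) vs) = Or p vs" by (simp add: p0 La0 map_idI)
 show "obasis (TS W (Ph T p)) (map (La T p) vs)" using b[of T] T by simp
qed

end

locale oriented_saddle = morse_smale_flow A f X OM OU + saddle A f X ga m B ro
 for A :: "('a::{t2_space,second_countable_topology}, 'e::euclidean_space) chart set" and f :: "'a => real" and X :: "'a => 'e"
  and OM OU ga m B ro +
 assumes ga: "ga : Crit A f"
begin

lemma lbox: "local_box ga m B (2 * ro)" using ga m ro by (simp add: local_box_def)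

lemma Nrm_scale:
 assumes ze: "ze : Crit A f" and p: "p : WS ze" and c: "c > 0" and len: "length ns = Ind A X ze"
 shows "Nrm ze p (map ((*\<^sub>R) c) ns) = Nrm ze p ns"
proof -
 obtain ws where ws: "obasis (TS (WS ze) p) ws" using obasis_exists[OF sub_dim(1)[OF Ws_sub[OF ze] p]] by blast
 have l: "length ns + length ws = DIM('e)" using obasis_length[OF ws] sub_dim(2)[OF Ws_sub[OF ze] p] Ind_le[OF ze] len by simp
 obtain s where s: "!!cs. length cs = DIM('e) ==> OM p cs = s * sgn (vol cs)"
  using orientation_vol[OF vs_OM[of p] subspace_UNIV complement_list_Nil] by auto
 show ?thesis using Nrm_eq[OF ze p _ ws, of ns] Nrm_eq[OF ze p _ ws, of "map ((*\<^sub>R) c) ns"] len l by (simp add: s sgn_vol_scale[OF l c])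
qed

text \<open>The ambient space and the stable manifold are both flow-invariant, so both orientations
  defining the normal one are constant along the passage.\<close>

lemma Nrm_flow:
 assumes ze: "ze : Crit A f" and p: "p : WS ze" "p : box T" "T >= 0" and len: "length ns = Ind A X ze" and nz: "Nrm ze p ns ~= 0"
 shows "Nrm ze (Ph T p) (map (La T p) ns) = Nrm ze p ns"
proof -
 obtain ws where ws: "obasis (TS (WS ze) p) ws" using obasis_exists[OF sub_dim(1)[OF Ws_sub[OF ze] p(1)]] by blast
 note S = box_orientation_const[OF Ws_sub[OF ze] Ws_flow_invariant Ost_orientation[OF ze] p ws]
 have "obasis (TS UNIV p) (ns @ ws)" using nz Nrm_eq[OF ze p(1) len ws] vs_values(2)[OF vs_OM] unfolding tangent_space_UNIV by auto
 from box_orientation_const(1)[OF UNIV_submanifold _ OM _ p(2,3) this]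
 have "OM (Ph T p) (map (La T p) (ns @ ws)) = OM p (ns @ ws)" by (simp add: flow_invariant_def)
 moreover have "Ph T p : WS ze"
  using box_tangent(1)[OF Ws_sub[OF ze] Ws_flow_invariant p(1,2), of T 0] p(3) subspace_0[OF sub_dim(1)[OF Ws_sub[OF ze] p(1)]] by simp
 ultimately show ?thesis using Nrm_eq[OF ze p(1) len ws] Nrm_eq[OF ze _ _ S(2), of "map (La T p) ns"] S(1) len by simp
qed

text \<open>Transversality at \<open>u\<close> makes the unstable coordinates surjective on the
  tangent space of \<open>WU xi\<close>; their kernel there is the tangent line of the connecting
  manifold, spanned by \<open>X u\<close>. So they determine a tangent vector up to
  \<open>X\<close>.\<close>

lemma end_u:
 assumes xi: "xi : Crit A f" "Ind A X xi = Ind A X ga + 1" and u: "u : CX xi ga" "u : fst m" "norm (snd m u) < ro" "X u ~= 0"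
 shows "proj B (snd m u) = 0" "snd m u ~= 0" "push A m u (X u) = - 2 *\<^sub>R snd m u"
  "X u : TS (WU xi) u"
  "!!v. v : TS (WU xi) u ==> proj B (push A m u v) = 0 ==> EX r. v = r *\<^sub>R X u"
  "!!b. b : span B ==> EX v:TS (WU xi) u. proj B (push A m u v) = b"
proof -
 define m' where "m' = ({q : fst m. norm (snd m q) < 2 * ro}, snd m)"
 note D = local_boxD[OF lbox, folded m'_def]
 have u': "u : WS ga" "u : WU xi" "u : fst m'" using u ro by (auto simp: connecting_def m'_def)
 have Pu: "snd m u : span (Basis - B)" using Ws_local[OF m ro(2) u(2)] u' u(3) ro(1) by simp
 then show P0: "proj B (snd m u) = 0" using in_span_compl_iff[OF mB(2)] by simp
 have T: "v : TS (WS ga) u \<longleftrightarrow> proj B (push A m u v) = 0" for v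
  unfolding slice_tangent[OF D(2) u'(1,3)] by (simp add: D(9)[OF u'(3)] in_span_compl_iff[OF mB(2)])
 show pX: "push A m u (X u) = - 2 *\<^sub>R snd m u" using push_X[OF u(2)] P0 by (simp add: hfield_def)
 show y0: "snd m u ~= 0" using pX u(4) pull_push[OF mB(1) u(2), of "X u"] linear_0[OF pull_linear[OF mB(1) u(2)]] by auto
 have d: "1 + Ind A X ga = Ind A X xi" using xi by simp
 note C = connecting_sub[OF xi(1) ga d]
 note XC = connecting_X[OF C(1) u(1)]
 then show "X u : TS (WU xi) u" using C(2)[OF u(1)] by blast
 show "EX r. v = r *\<^sub>R X u" if v: "v : TS (WU xi) u" "proj B (push A m u v) = 0" for v
 using v T C(2)[OF u(1)] dim1_scaleR[OF sub_dim[OF C(1) u(1)] XC u(4)] by blast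
 show "EX v:TS (WU xi) u. proj B (push A m u v) = b" if b: "b : span B" for b
 proof -
  have "pull m u b : {v + w | v w. v : TS (WU xi) u & w : TS (WS ga) u}" using trans[OF xi(1) ga] u' by (simp add: transverse_def)
  then obtain v w where vw: "pull m u b = v + w" "v : TS (WU xi) u" "proj B (push A m u w) = 0" using T by blast
  have "b = push A m u v + push A m u w" using push_pull[OF mB(1) u(2), of b] linear_add[OF push_linear[OF mB(1) u(2)]] vw(1) by simp
  then have "proj B (push A m u v) = b" using vw(3) b in_span_iff[OF mB(2)] linear_add[OF linear_proj, of B "push A m u v" "push A m u w"] by simp
  then show ?thesis using vw(2) by blast
 qed
qed

text \<open>A vector tangent to \<open>WS ze\<close> with purely unstable coordinates is also
  tangent to \<open>WU ga\<close>, hence to the connecting manifold, which has dimension 1.\<close>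

lemma end_v:
 assumes ze: "ze : Crit A f" "Ind A X ga = Ind A X ze + 1" and v: "v : CX ga ze" "v : fst m" "norm (snd m v) < ro" "X v ~= 0"
 shows "proj B (snd m v) = snd m v" "snd m v ~= 0" "push A m v (X v) = 2 *\<^sub>R snd m v"
  "!!w. w : TS (WS ze) v ==> proj B (push A m v w) = push A m v w ==> EX r. w = r *\<^sub>R X v"
proof -
 define m' where "m' = ({q : fst m. norm (snd m q) < 2 * ro}, snd m)"
 note D = local_boxD[OF lbox, folded m'_def]
 have v': "v : WU ga" "v : WS ze" "v : fst m'" using v ro by (auto simp: connecting_def m'_def)
 show P0: "proj B (snd m v) = snd m v" using Wu_local[OF m ro(2) v(2)] v' v(3) ro(1) in_span_iff[OF mB(2)] by auto
 show pX: "push A m v (X v) = 2 *\<^sub>R snd m v" using push_X[OF v(2)] P0 by (simp add: hfield_def)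
 show "snd m v ~= 0" using pX v(4) pull_push[OF mB(1) v(2), of "X v"] linear_0[OF pull_linear[OF mB(1) v(2)]] by auto
 have d: "1 + Ind A X ze = Ind A X ga" using ze by simp
 note C = connecting_sub[OF ga ze(1) d]
 show "EX r. w = r *\<^sub>R X v" if w: "w : TS (WS ze) v" "proj B (push A m v w) = push A m v w" for w
 proof -
  have "w : TS (WU ga) v" unfolding slice_tangent[OF D(1) v'(1,3)] using w(2) by (simp add: D(9)[OF v'(3)] in_span_iff[OF mB(2)])
  then have "w : TS (CX ga ze) v" using w C(2)[OF v(1)] by blast
  then show ?thesis using dim1_scaleR[OF sub_dim[OF C(1) v(1)] connecting_X[OF C(1) v(1)] v(4)] by blast
 qed
qed

text \<open>Two equations normalise \<open>w\<close>: orthogonality to the stable coordinates of the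
  point fixes the multiple of \<open>X\<close>, and the second matches its component along the
  unstable coordinates with that of 2 exp (2T) proj B x, which tends to the coordinates of
  \<open>X v\<close>.\<close>

lemma passage_limit:
 fixes p :: "'b => 'a" and w :: "'b => 'e" and T :: "'b => real"
 assumes xi: "xi : Crit A f" "Ind A X xi = Ind A X ga + 1" and ze: "ze : Crit A f" "Ind A X ga = Ind A X ze + 1"
  and u: "u : CX xi ga" "u : fst m" "norm (snd m u) < ro" "X u ~= 0"
  and v: "v : CX ga ze" "v : fst m" "norm (snd m v) < ro" "X v ~= 0"
  and p: "(p ---> u) F" and q: "((%t. Ph (T t) (p t)) ---> v) F"
  and ev: "\<forall>\<^sub>F t in F. p t : CX xi ze & p t : box (T t) & T t >= 0"
  and w: "\<forall>\<^sub>F t in F. w t : TS (CX xi ze) (p t) &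
   inner (snd m (p t) - proj B (snd m (p t))) (push A m (p t) (w t)) = 0 &
   inner (proj B (snd m (p t))) (push A m (p t) (w t)) = 2 * exp (2 * T t) * (norm (proj B (snd m (p t))))\<^sup>2"
 obtains v0 where "v0 : TS (WU xi) u" "proj B (push A m u v0) = 2 *\<^sub>R snd m v" "tb_tendsto p w u v0 F"
  "((%t. 1 / exp (2 * T t)) ---> 0) F"
proof -
 have d: "2 + Ind A X ze = Ind A X xi" using xi ze by simp
 note C = connecting_sub[OF xi(1) ze(1) d]
 define x0 y0 x E where "x0 = snd m v" and "y0 = snd m u" and "x t = snd m (p t)" and "E t = exp (2 * T t)" for t
 note eu = end_u[OF xi u, folded y0_def] and ev' = end_v[OF ze v, folded x0_def]
 have uW: "u : WU xi" and vW: "v : WS ze" using u v by (auto simp: connecting_def)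
 have Epos: "E t > 0" "exp (- (2 * T t)) = 1 / E t" for t by (simp_all add: E_def exp_minus inverse_eq_divide)
 have P: "((%t. proj B (g t)) ---> proj B g0) F" if "(g ---> g0) F" for g g0 by (rule bounded_linear.tendsto[OF bounded_linear_proj that])
 have xlim: "(x ---> y0) F" unfolding x_def y0_def by (rule chart_tendsto[OF mB(1) u(2) p])
 have bl: "((%t. x t - proj B (x t)) ---> y0) F" using tendsto_diff[OF xlim P[OF xlim]] eu(1) by simp
 have al: "((%t. proj B (x t)) ---> 0) F" using P[OF xlim] eu(1) by simp
 have evq: "\<forall>\<^sub>F t in F. snd m (Ph (T t) (p t)) = dflow B (T t) (x t)"
  using ev by eventually_elim (use box_flow(2) in \<open>auto simp: x_def\<close>)
 have "((%t. proj B (snd m (Ph (T t) (p t)))) ---> x0) F" using P[OF chart_tendsto[OF mB(1) v(2) q]] ev'(1) by (simp add: x0_def)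
 moreover have "\<forall>\<^sub>F t in F. proj B (snd m (Ph (T t) (p t))) = E t *\<^sub>R proj B (x t)"
  using evq by eventually_elim (simp add: proj_dflow[OF mB(2)] E_def)
 ultimately have Al: "((%t. E t *\<^sub>R proj B (x t)) ---> x0) F" by (rule Lim_transform_eventually)
 have Einv: "((%t. 1 / E t) ---> 0) F"
 proof -
  have "((%t. norm (proj B (x t)) / norm (E t *\<^sub>R proj B (x t))) ---> norm (0::'e) / norm x0) F"
   by (intro tendsto_intros al Al) (use ev'(2) in simp)
  moreover have "\<forall>\<^sub>F t in F. E t *\<^sub>R proj B (x t) ~= 0" by (rule tendsto_imp_eventually_ne[OF Al ev'(2)])
  then have "\<forall>\<^sub>F t in F. norm (proj B (x t)) / norm (E t *\<^sub>R proj B (x t)) = 1 / E t"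
   by eventually_elim (simp add: abs_of_pos[OF Epos(1)])
  ultimately show ?thesis by (simp add: tendsto_cong)
 qed
 \<comment> \<open>\<open>?Q1\<close> is injective on the tangent space of \<open>WU xi\<close> at
   \<open>u\<close> and \<open>?Q2\<close> on that of \<open>WS ze\<close> at \<open>v\<close>: what
   the projections leave undetermined is a multiple of \<open>X\<close>, and it is parallel to
   \<open>y0\<close> respectively \<open>x0\<close>.\<close>
 let ?Q1 = "%v. (proj B v, inner y0 v)" and ?Q2 = "%v. (v - proj B v, inner x0 v)"
 have Q: "linear ?Q1" "linear ?Q2"
  by (intro bounded_linear.linear bounded_linear_Pair bounded_linear_proj bounded_linear_inner_right bounded_linear_sub bounded_linear_ident)+
 have inj1: "v = 0" if h: "v : TS (WU xi) u" "?Q1 (push A m u v) = 0" for v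
 using eu(5)[OF h(1)] h(2) eu(2) by (auto simp: prod_eq_iff linear_scale[OF push_linear[OF mB(1) u(2)]] eu(3))
 have inj2: "w = 0" if h: "w : TS (WS ze) v" "?Q2 (push A m v w) = 0" for w
 using ev'(4)[OF h(1)] h(2) ev'(2) by (auto simp: prod_eq_iff linear_scale[OF push_linear[OF mB(1) v(2)]] ev'(3))
 obtain ka1 where ka1: "ka1 > 0" "\<forall>\<^sub>F q in nhds u. q : WU xi --> (ALL v:TS (WU xi) q. ka1 * norm (push A m q v) <= norm (?Q1 (push A m q v)))"
  by (rule tangent_bound[OF Wu_sub[OF xi(1)] uW mB(1) u(2) Q(1) inj1])
 obtain ka2 where ka2: "ka2 > 0" "\<forall>\<^sub>F q in nhds v. q : WS ze --> (ALL v:TS (WS ze) q. ka2 * norm (push A m q v) <= norm (?Q2 (push A m q v)))"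
  by (rule tangent_bound[OF Ws_sub[OF ze(1)] vW mB(1) v(2) Q(2) inj2])
 note ka1' = filterlim_iff[THEN iffD1, rule_format, OF p ka1(2)] and ka2' = filterlim_iff[THEN iffD1, rule_format, OF q ka2(2)]
 define W where "W t = (1 / 2) *\<^sub>R push A m (p t) (w t)" for t
 define z where "z t = E t *\<^sub>R (proj B (W t) - E t *\<^sub>R proj B (x t)) + ((1 / E t) *\<^sub>R (W t - proj B (W t)) + (x t - proj B (x t)))" for t
 have pm: "\<forall>\<^sub>F t in F. p t : fst m" using ev_chart[OF mB(1) u(2) p] .
 have e1: "\<forall>\<^sub>F t in F. ka1 * norm (W t) <= norm (proj B (W t)) + \<bar>inner y0 (W t)\<bar>" using ka1' ev w pm
 proof eventually_elim
  case (elim t)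
  have "p t : WU xi" "(1 / 2) *\<^sub>R w t : TS (WU xi) (p t)"
   using elim C(2)[of "p t"] subspace_scale[OF sub_dim(1)[OF Wu_sub[OF xi(1)]]] by (auto simp: connecting_def)
  then have "ka1 * norm (W t) <= norm (?Q1 (W t))"
   using elim(1) linear_scale[OF push_linear[OF mB(1) elim(4)], of "1 / 2" "w t"] unfolding W_def by metis
  then show ?case using norm_Pair_le[of "proj B (W t)" "inner y0 (W t)"] by simp
 qed
 have e2: "\<forall>\<^sub>F t in F. ka2 * norm (z t) <= norm (z t - proj B (z t)) + \<bar>inner x0 (z t)\<bar>" using ka2' ev w evq
 proof eventually_elim
  case (elim t)
  let ?q = "Ph (T t) (p t)"
  have h: "p t : WS ze" "p t : box (T t)" "0 <= T t" "T t <= T t" "w t : TS (WS ze) (p t)" using elim C(2)[of "p t"] by (auto simp: connecting_def)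
  note bt = box_tangent[OF Ws_sub[OF ze(1)] Ws_flow_invariant h] and bf = box_flow[OF h(2-4)]
  have qC: "?q : CX xi ze"
  proof -
   have "X (p t) : TS (WU xi) (p t)" using connecting_X[OF C(1)] elim(2) C(2) elim(2) by blast
   then show ?thesis using box_tangent(1)[OF Wu_sub[OF xi(1)] Wu_flow_invariant _ h(2-4)] elim(2) bt(1) by (simp add: connecting_def)
  qed
  then have "X ?q : TS (WS ze) ?q" using connecting_X[OF C(1) qC] C(2)[OF qC] by blast
  \<comment> \<open>Subtracting a multiple of \<open>X\<close>, which is tangent too, cancels the
    large component of the carried vector along the unstable coordinates of the exit point.\<close>
  then have "(1 / 2) *\<^sub>R La (T t) (p t) (w t) - (E t / 2) *\<^sub>R X ?q : TS (WS ze) ?q" (is "?z : _")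
   by (intro subspace_diff subspace_scale sub_dim(1)[OF Ws_sub[OF ze(1)] bt(1)] bt(2))
  moreover have "push A m ?q ?z = z t"
  proof -
   have "push A m ?q ?z = (1 / 2) *\<^sub>R dflow B (T t) (push A m (p t) (w t)) - (E t / 2) *\<^sub>R hfield B (dflow B (T t) (x t))"
    using linear_diff[OF push_linear[OF mB(1) bf(1)]] linear_scale[OF push_linear[OF mB(1) bf(1)]] La_linear(3)[OF h(2-4)] push_X[OF bf(1)] elim(4) by simp
   also have "(1 / 2) *\<^sub>R dflow B (T t) (push A m (p t) (w t)) = dflow B (T t) (W t)" by (simp add: W_def linear_scale[OF linear_dflow])
   also have "hfield B (dflow B (T t) (x t)) = (2 * E t) *\<^sub>R proj B (x t) - (2 / E t) *\<^sub>R (x t - proj B (x t))"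
    unfolding hfield_def proj_dflow(2)[OF mB(2)] unfolding proj_dflow(1)[OF mB(2)] Epos(2) by (simp add: E_def)
   also have "(E t / 2) *\<^sub>R ((2 * E t) *\<^sub>R proj B (x t) - (2 / E t) *\<^sub>R (x t - proj B (x t))) = (E t * E t) *\<^sub>R proj B (x t) - (x t - proj B (x t))"
    using Epos(1)[of t] by (simp add: scaleR_diff_right)
   also have "dflow B (T t) (W t) = E t *\<^sub>R proj B (W t) + (1 / E t) *\<^sub>R (W t - proj B (W t))" by (simp only: dflow_def Epos(2)) (simp add: E_def)
   finally show ?thesis by (simp add: z_def scaleR_diff_right)
  qed
  ultimately show ?case using elim(1) bt(1) norm_Pair_le[of "z t - proj B (z t)" "inner x0 (z t)"] by auto
 qed
 have o1: "\<forall>\<^sub>F t in F. inner (x t - proj B (x t)) (W t) = 0" using w by eventually_elim (simp add: W_def x_def)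
 have o2: "\<forall>\<^sub>F t in F. inner (proj B (x t)) (W t) = E t * (norm (proj B (x t)))\<^sup>2" using w by eventually_elim (simp add: W_def x_def E_def)
 have E0: "\<forall>\<^sub>F t in F. E t > 0" using Epos by simp
 note est = saddle_estimate[OF mB(2) E0 Einv Al bl ev'(1) ka1(1) ka2(1) e1 z_def e2 o1 o2]
 have "2 *\<^sub>R x0 : span B" using ev'(1) proj_in_span[of B x0] by (simp add: span_scale)
 from eu(6)[OF this] obtain v1 where v1: "v1 : TS (WU xi) u" "proj B (push A m u v1) = 2 *\<^sub>R x0" by blast
 \<comment> \<open>Adding this multiple of \<open>X u\<close> makes \<open>v0\<close> orthogonal to
   \<open>y0\<close>, as the normalisation of \<open>w\<close> demands in the limit.\<close>
 define r where "r = inner y0 (push A m u v1) / (2 * inner y0 y0)"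
 define v0 where "v0 = v1 + r *\<^sub>R X u"
 have v0: "v0 : TS (WU xi) u" unfolding v0_def using v1(1) eu(4) sub_dim(1)[OF Wu_sub[OF xi(1)] uW] by (intro subspace_add subspace_scale)
 have pv0: "push A m u v0 = push A m u v1 - (2 * r) *\<^sub>R y0"
  unfolding v0_def linear_add[OF push_linear[OF mB(1) u(2)]] linear_scale[OF push_linear[OF mB(1) u(2)]] eu(3) by simp
 have Pv0: "proj B (push A m u v0) = 2 *\<^sub>R x0" unfolding pv0 linear_diff[OF linear_proj] linear_scale[OF linear_proj] eu(1) v1(2) by simp
 have iv0: "inner y0 (push A m u v0) = 0" unfolding pv0 by (simp add: inner_diff_right r_def)
 have "((%t. ?Q1 (2 *\<^sub>R W t)) ---> ?Q1 (push A m u v0)) F" unfolding Pv0 iv0 linear_scale[OF linear_proj] inner_scaleR_right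
  using tendsto_Pair[OF tendsto_scaleR[OF tendsto_const est(1), of 2] tendsto_mult[OF tendsto_const est(2), of 2]] by simp
 then have "tb_tendsto p w u v0 F" by (intro tangent_limit[OF Wu_sub[OF xi(1)] uW mB(1) u(2) Q(1) inj1 p _ _ v0])
   (use ev w C(2) in \<open>auto simp: W_def connecting_def elim: eventually_elim2\<close>)
 then show ?thesis using that[OF v0] Pv0 Einv by (simp add: x0_def E_def)
qed

text \<open>A frame (X, w, n) of \<open>WU xi\<close> is evaluated twice. In the limit at
  \<open>u\<close> it gives the sign at \<open>u\<close> times \<open>th\<close>, the orientation of
  \<open>WU ga\<close> on the unstable coordinates; the first of these is that of
  \<open>X v\<close>, so \<open>th\<close> is the sign at \<open>v\<close> times the normal sign
  \<open>nu\<close> of \<open>WS ze\<close>. At \<open>p t\<close> it gives the wanted sign times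
  the normal orientation of \<open>n\<close>, which the flow carries to the exit, where it equals
  \<open>nu\<close>. Thus \<open>nu\<close> cancels.\<close>

lemma passage_sign:
 fixes p :: "'b => 'a" and w :: "'b => 'e" and T :: "'b => real"
 assumes xi: "xi : Crit A f" "Ind A X xi = Ind A X ga + 1" and ze: "ze : Crit A f" "Ind A X ga = Ind A X ze + 1"
  and u: "u : CX xi ga" "u : fst m" "norm (snd m u) < ro" "X u ~= 0"
  and v: "v : CX ga ze" "v : fst m" "norm (snd m v) < ro" "X v ~= 0"
  and p: "(p ---> u) F" and q: "((%t. Ph (T t) (p t)) ---> v) F"
  and ev: "\<forall>\<^sub>F t in F. p t : CX xi ze & p t : box (T t) & T t >= 0"
  and w: "\<forall>\<^sub>F t in F. w t : TS (CX xi ze) (p t) &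
   inner (snd m (p t) - proj B (snd m (p t))) (push A m (p t) (w t)) = 0 &
   inner (proj B (snd m (p t))) (push A m (p t) (w t)) = 2 * exp (2 * T t) * (norm (proj B (snd m (p t))))\<^sup>2"
 shows "\<forall>\<^sub>F t in F. Ind\<^sub>o xi ze (p t) [X (p t), w t] = Ind\<^sub>o xi ga u [X u] * Ind\<^sub>o ga ze v [X v]"
proof -
 note eu = end_u[OF xi u] and ev' = end_v[OF ze v]
 have d1: "1 + Ind A X ga = Ind A X xi" and d2: "1 + Ind A X ze = Ind A X ga" and d3: "2 + Ind A X ze = Ind A X xi" using xi ze by auto
 note C1 = connecting_sub[OF xi(1) ga d1] and C2 = connecting_sub[OF ga ze(1) d2] and C3 = connecting_sub[OF xi(1) ze(1) d3]
 have uW: "u : WU xi" "u : WS ga" and vW: "v : WU ga" "v : WS ze" using u v by (auto simp: connecting_def)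
 obtain v0 where v0: "v0 : TS (WU xi) u" "proj B (push A m u v0) = 2 *\<^sub>R snd m v" "tb_tendsto p w u v0 F"
  and Einv: "((%t. 1 / exp (2 * T t)) ---> 0) F" by (rule passage_limit[OF xi ze u v p q ev w])
 define x1 where "x1 = 2 *\<^sub>R snd m v"
 have x1: "x1 : span B" "x1 ~= 0" "pull m v x1 = X v"
  using ev'(1,2) proj_in_span[of B "snd m v"] pull_push[OF mB(1) v(2), of "X v"] ev'(3) by (simp_all add: x1_def span_scale)
 obtain ms where ms: "obasis (span B) ([x1] @ ms)"
  by (rule extend_to_obasis[OF subspace_span, of "[x1]" B]) (use x1 in \<open>simp_all add: independent_insert\<close>)
 have msB: "set ms \<subseteq> span B" using obasis_subset[OF ms] by simp
 have lms: "length ms + 1 = Ind A X ga" using obasis_length[OF ms] dim_span_Basis_subset[OF mB(2)] local_boxD(7)[OF lbox] by simp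
 obtain N where N: "!!b. b : span B ==> N b : TS (WU xi) u & proj B (push A m u (N b)) = b" using eu(6) by metis
 have lin: "linear (%v. proj B (push A m u v))" using linear_compose[OF push_linear[OF mB(1) u(2)] linear_proj] by (simp add: o_def)
 have maps: "map (proj B) (map (push A m u) (v0 # map N ms)) = [x1] @ ms" using v0(2) N msB by (auto simp: x1_def o_def intro!: map_idI)
 have bu: "obasis (TS (WU xi) u) ([X u] @ (v0 # map N ms))"
 proof (rule obasis_spanning[OF sub_dim(1)[OF Wu_sub[OF xi(1)] uW(1)]])
  let ?V = "TS (WU xi) u" and ?ns = "v0 # map N ms"
  have sub: "set ?ns \<subseteq> ?V" using v0(1) N msB by auto
  then show "set ([X u] @ ?ns) \<subseteq> ?V" using eu(4) by auto
  show "length ([X u] @ ?ns) = dim ?V" using lms xi(2) sub_dim(2)[OF Wu_sub[OF xi(1)] uW(1)] by simp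
  show "?V \<subseteq> span (set ([X u] @ ?ns))"
  proof
   fix x assume x: "x : ?V"
   have "set ([x1] @ ms) = (%v. proj B (push A m u v)) ` set ?ns" unfolding maps[symmetric] by (simp only: set_map image_image)
   then have "proj B (push A m u x) : (%v. proj B (push A m u v)) ` span (set ?ns)"
    using proj_in_span obasis_span[OF ms] linear_span_image[OF lin] by metis
   then obtain y where y: "y : span (set ?ns)" "proj B (push A m u x) = proj B (push A m u y)" by auto
   have "x - y : ?V" using y(1) span_minimal[OF sub sub_dim(1)[OF Wu_sub[OF xi(1)] uW(1)]] x subspace_diff[OF sub_dim(1)[OF Wu_sub[OF xi(1)] uW(1)]] by blast
   moreover have "proj B (push A m u (x - y)) = 0" using y(2) linear_diff[OF lin] by simp
   ultimately obtain r where "x - y = r *\<^sub>R X u" using eu(5) by blast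
   then have "x = r *\<^sub>R X u + y" by (simp add: algebra_simps)
   moreover have "y : span (set ([X u] @ ?ns))" using y(1) span_mono[of "set ?ns" "set ([X u] @ ?ns)"] by auto
   ultimately show "x : span (set ([X u] @ ?ns))" by (simp add: span_add span_scale span_base)
  qed
 qed
 define sa sb nu th where "sa = Ind\<^sub>o xi ga u [X u]" and "sb = Ind\<^sub>o ga ze v [X v]" and "nu = Nrm ze v (map (pull m v) ms)"
  and "th = OU ga ga (map (pull m ga) ([x1] @ ms))"
 have Xu: "obasis (TS (CX xi ga) u) [X u]" 
  by (rule obasis_independent[OF sub_dim(1)[OF C1(1) u(1)]]) (use connecting_X[OF C1(1) u(1)] u(4) sub_dim(2)[OF C1(1) u(1)] in auto)
 have Xv: "obasis (TS (CX ga ze) v) [X v]"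
  by (rule obasis_independent[OF sub_dim(1)[OF C2(1) v(1)]]) (use connecting_X[OF C2(1) v(1)] v(4) sub_dim(2)[OF C2(1) v(1)] in auto)
 have n1: "Nrm ga u (map (pull m u) (map (push A m u) (v0 # map N ms))) = OU ga ga (map (%v. pull m ga (proj B v)) (map (push A m u) (v0 # map N ms)))"
  by (rule Nrm_local[OF lbox uW(2) u(2)]) (use u(3) ro(1) ms maps in auto)
 have n2: "map (pull m u) (map (push A m u) ns) = ns" for ns using mB(1) u(2) by (simp add: o_def)
 have n3: "map (%v. pull m ga (proj B v)) (map (push A m u) (v0 # map N ms)) = map (pull m ga) ([x1] @ ms)" unfolding maps[symmetric] by simp
 have "Nrm ga u (v0 # map N ms) = th" using n1 unfolding th_def n2 n3 .
 then have OU_u: "OU xi u ([X u] @ (v0 # map N ms)) = sa * th" using induced(2)[OF xi(1) ga d1 u(1) Xu bu] by (simp add: sa_def)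
 have bv: "obasis (TS (WU ga) v) (map (pull m v) ([x1] @ ms))"
 proof -
  define m' where "m' = ({q : fst m. norm (snd m q) < 2 * ro}, snd m)"
  note D = local_boxD[OF lbox, folded m'_def]
  have v': "v : fst m'" using v ro by (simp add: m'_def)
  have "map (push A m' v) (map (pull m v) ([x1] @ ms)) = [x1] @ ms" using D(9)[OF v'] mB(1) v(2) by (simp add: o_def)
  then show ?thesis using ms slice_basis_iff[OF D(1) vW(1) v'] by simp
 qed
 have th: "th = sb * nu" using OU_local[OF lbox vW(1) v(2), of "[x1] @ ms"] v(3) ro(1) induced(2)[OF ga ze(1) d2 v(1) Xv, of "map (pull m v) ms"] bv
  by (simp add: th_def sb_def nu_def x1(3))
 have "OU ga v (map (pull m v) ([x1] @ ms)) ~= 0" using OU[OF ga] vW(1) vs_values(1)[OF _ bv] by (fastforce simp: orientation_def)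
 then have nu0: "nu ~= 0" "th ~= 0" using OU_local[OF lbox vW(1) v(2), of "[x1] @ ms"] v(3) ro(1) th by (auto simp: th_def)
 have nu1: "nu * nu = 1"
 proof -
  obtain ws where ws: "obasis (TS (WS ze) v) ws" using obasis_exists[OF sub_dim(1)[OF Ws_sub[OF ze(1)] vW(2)]] by blast
  have e: "nu = OM v (map (pull m v) ms @ ws) * Ost ze v ws" unfolding nu_def by (rule Nrm_eq[OF ze(1) vW(2) _ ws]) (use lms ze(2) in simp)
  define es where "es = map (pull m v) ms @ ws"
  have "OM v es = 1 | OM v es = - 1 | OM v es = 0" using vs_values[OF vs_OM[of v]] by blast
  moreover have "Ost ze v ws = 1 | Ost ze v ws = - 1" by (rule vs_values(1)[OF vs_Ost[OF ze(1) vW(2)] ws])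
  ultimately show ?thesis using nu0(1) unfolding e es_def[symmetric] by (elim disjE) simp_all
 qed
 obtain c L where sl: "slice c L (WU xi)" "u : fst c" using Wu_sub[OF xi(1)] uW by (auto simp: submanifold_iff)
 have c: "c : charts" using sl by (simp add: slice_def)
 define n where "n b t = frame_field c u (N b) (p t)" for b t
 \<comment> \<open>The passage stretches unstable coordinates by exp (2T). Dividing by this factor
   makes the carried vectors converge at \<open>v\<close>; as it is positive, the normal orientation
   is unchanged.\<close>
 define n' where "n' b t = (1 / exp (2 * T t)) *\<^sub>R La (T t) (p t) (n b t)" for b t
 have evm: "\<forall>\<^sub>F t in F. p t : fst m" "\<forall>\<^sub>F t in F. p t : fst c" using ev_chart[OF mB(1) u(2) p] ev_chart[OF c sl(2) p] .
 have evT: "\<forall>\<^sub>F t in F. ALL b:set ms. n b t : TS (WU xi) (p t)" using ev evm(2)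
 proof eventually_elim
  case (elim t)
  then have pW: "p t : WU xi" by (simp add: connecting_def)
  show ?case using N msB c elim(2) unfolding slice_tangent[OF sl(1) pW elim(2)] slice_tangent[OF sl(1) uW(1) sl(2)]
   by (auto simp: n_def frame_field_def)
 qed
 have tbn: "tb_tendsto p (n b) u (N b) F" for b unfolding n_def by (rule frame_field_tb[OF c sl(2) p])
 have XT: "X (p t) : TS (WU xi) (p t)" "w t : TS (WU xi) (p t)"
  if "p t : CX xi ze" "w t : TS (CX xi ze) (p t)" for t using connecting_X[OF C3(1) that(1)] C3(2)[OF that(1)] that by auto
 have evOU: "\<forall>\<^sub>F t in F. OU xi (p t) (map (%E. E t) ([%t. X (p t), w] @ map n ms)) = OU xi u ([X u] @ (v0 # map N ms))"
 proof (rule orientation_tendsto[OF OU[OF xi(1)] Wu_sub[OF xi(1)] uW(1) p _ _ bu])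
  show "\<forall>\<^sub>F t in F. p t : WU xi" using ev by eventually_elim (simp add: connecting_def)
  show "list_all2 (%E v. tb_tendsto p E u v F) ([%t. X (p t), w] @ map n ms) ([X u] @ (v0 # map N ms))"
   using X_tb[OF p] v0(3) tbn by (simp add: list.rel_map list_all2_same)
  show "ALL E:set ([%t. X (p t), w] @ map n ms). \<forall>\<^sub>F t in F. E t : TS (WU xi) (p t)"
  proof -
   have "\<forall>\<^sub>F t in F. X (p t) : TS (WU xi) (p t) & w t : TS (WU xi) (p t)" using ev w by eventually_elim (use XT in blast)
   moreover have "ALL b:set ms. \<forall>\<^sub>F t in F. n b t : TS (WU xi) (p t)" using evT by (simp add: eventually_ball_finite_distrib)
   ultimately show ?thesis by (simp add: eventually_conj_iff)
  qed
 qed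
 have qW: "\<forall>\<^sub>F t in F. Ph (T t) (p t) : WS ze" using ev by eventually_elim
   (use box_tangent(1)[OF Ws_sub[OF ze(1)] Ws_flow_invariant] subspace_0[OF sub_dim(1)[OF Ws_sub[OF ze(1)]]] in \<open>force simp: connecting_def\<close>)
 have tbn': "tb_tendsto (%t. Ph (T t) (p t)) (n' b) v (pull m v b) F" if b: "b : span B" for b
  unfolding tb_tendsto_iff[OF mB(1) v(2)] push_pull[OF mB(1) v(2)]
 proof
  let ?i = "%t. 1 / exp (2 * T t)" and ?n = "%t. push A m (p t) (n b t)"
  have nl: "(?n ---> push A m u (N b)) F" using tbn[of b] mB(1) u(2) by (simp add: tb_tendsto_def)
  have Pl: "((%t. proj B (?n t)) ---> b) F" using bounded_linear.tendsto[OF bounded_linear_proj nl, of B] N[OF b] by simp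
  have "((%t. proj B (?n t) + (?i t * ?i t) *\<^sub>R (?n t - proj B (?n t))) --->
   b + (0 * 0) *\<^sub>R (push A m u (N b) - b)) F" by (intro tendsto_intros Einv nl Pl)
  moreover have "\<forall>\<^sub>F t in F. proj B (?n t) + (?i t * ?i t) *\<^sub>R (?n t - proj B (?n t)) = push A m (Ph (T t) (p t)) (n' b t)"
   using ev
  proof eventually_elim
   case (elim t)
   then have h: "p t : box (T t)" "0 <= T t" "T t <= T t" by auto
   show ?case unfolding n'_def linear_scale[OF push_linear[OF mB(1) box_flow(1)[OF h]]] La_linear(3)[OF h]
    by (simp add: dflow_def scaleR_add_right exp_minus inverse_eq_divide)
  qed
  ultimately show "((%t. push A m (Ph (T t) (p t)) (n' b t)) ---> b) F" using Lim_transform_eventually by force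
 qed (rule q)
 have "\<forall>\<^sub>F t in F. Nrm ze (Ph (T t) (p t)) (map (%E. E t) (map n' ms)) = Nrm ze v (map (pull m v) ms)"
 proof (rule Nrm_tendsto[OF ze(1) vW(2) q qW])
  show "list_all2 (%E va. tb_tendsto (%t. Ph (T t) (p t)) E v va F) (map n' ms) (map (pull m v) ms)"
   using tbn' msB by (simp add: list_all2_conv_all_nth subset_iff)
 qed (use lms ze(2) nu0 in \<open>auto simp: nu_def\<close>)
 then show ?thesis using evOU ev w
 proof eventually_elim
  case (elim t)
  let ?n = "map (%b. n b t) ms"
  have pC: "p t : CX xi ze" and h: "p t : box (T t)" "T t >= 0" and pWs: "p t : WS ze" and pWu: "p t : WU xi"
   using elim(3) by (auto simp: connecting_def)
  have O1: "OU xi (p t) ([X (p t), w t] @ ?n) = sa * th" using elim(2) OU_u by (simp add: o_def)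
  have "OU xi u ([X u] @ (v0 # map N ms)) ~= 0" using OU[OF xi(1)] uW(1) vs_values(1)[OF _ bu] by (fastforce simp: orientation_def)
  then have b: "obasis (TS (WU xi) (p t)) ([X (p t), w t] @ ?n)" using O1 OU_u OU[OF xi(1)] pWu vs_values(2) unfolding orientation_def by metis
  have "obasis (TS (CX xi ze) (p t)) [X (p t), w t]" using obasis_appendD[OF b] elim(4) connecting_X[OF C3(1) pC] sub_dim[OF C3(1) pC]
   by (intro obasis_independent) auto
  from induced(2)[OF xi(1) ze(1) d3 pC this b]
  have I: "sa * th = Ind\<^sub>o xi ze (p t) [X (p t), w t] * Nrm ze (p t) ?n" using O1 by simp
  have len: "length ?n = Ind A X ze" using lms ze(2) by simp
  have "sa * th ~= 0" using OU_u \<open>OU xi u _ ~= 0\<close> by simp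
  then have nz: "Nrm ze (p t) ?n ~= 0" using I by auto
  have qWs: "Ph (T t) (p t) : WS ze"
   using box_tangent(1)[OF Ws_sub[OF ze(1)] Ws_flow_invariant pWs h(1,2) order.refl] subspace_0[OF sub_dim(1)[OF Ws_sub[OF ze(1)] pWs]] by blast
  have sc: "map (%E. E t) (map n' ms) = map ((*\<^sub>R) (1 / exp (2 * T t))) (map (La (T t) (p t)) ?n)" by (simp add: n'_def)
  have "nu = Nrm ze (Ph (T t) (p t)) (map ((*\<^sub>R) (1 / exp (2 * T t))) (map (La (T t) (p t)) ?n))" using elim(1) unfolding sc nu_def by simp
  also have "\<dots> = Nrm ze (Ph (T t) (p t)) (map (La (T t) (p t)) ?n)" by (rule Nrm_scale[OF ze(1) qWs]) (use len in auto)
  also have "\<dots> = Nrm ze (p t) ?n" by (rule Nrm_flow[OF ze(1) pWs h len nz])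
  finally have "nu = Nrm ze (p t) ?n" .
  then show ?case using I th nu1 by (auto simp: mult.assoc sa_def sb_def)
 qed
qed

end

section \<open>The sign of the frame of flow and gluing parameter\<close>

context gradient_like
begin

text \<open>All crossing times of the level lie close to sm H + r, so an arbitrary choice among them
  converges.\<close>

lemma hitting_limit:
 fixes Ps :: "real => real => 'a"
 assumes y: "icurve X UNIV y" "X (y r) ~= 0" and Ps: "\<forall>\<^sub>F H in at_top. icurve X UNIV (Ps H)"
  and lim: "!!r. ((%(H, t). Ps H (sm H + t)) ---> y r) (at_top \<times>\<^sub>F nhds r)"
 obtains s where "\<forall>\<^sub>F H in at_top. f (Ps H (s H)) = f (y r)" "((%H. Ps H (s H)) ---> y r) at_top"
proof -
 have lim': "((%H. Ps H (sm H + g H)) ---> y t) at_top" if "(g ---> t) at_top" for g t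
  using filterlim_compose[OF lim[of t] filterlim_Pair[OF filterlim_ident that]] by simp
 define s where "s H = (SOME s. f (Ps H s) = f (y r))" for H
 note hit = hitting_time[where Ps=Ps and sm=sm, OF y Ps lim'[OF tendsto_const]]
 have s: "\<forall>\<^sub>F H in at_top. f (Ps H (s H)) = f (y r)" using hit[of 1, simplified] by eventually_elim (auto simp: s_def intro: someI)
 have "((%H. s H - sm H) ---> r) at_top"
 proof (rule tendstoI)
  fix ep :: real assume "ep > 0"
  from hit[OF this] s show "\<forall>\<^sub>F H in at_top. dist (s H - sm H) r < ep" by eventually_elim (auto simp: dist_real_def)
 qed
 from lim'[OF this] s show ?thesis using that by simp
qed

lemma connecting_noncrit: "p : CX xi ga ==> xi ~= ga ==> X p ~= 0"
proof
 assume p: "p : CX xi ga" and "X p = 0" "xi ~= ga"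
 note fl = connecting_flow_line[OF p]
 have "flow_line A X p t = p" for t using crit_constant[OF fl(1) convex_UNIV UNIV_I, of 0 t] fl(2) \<open>X p = 0\<close> by simp
 then have "flow_line A X p = (%_. p)" by blast
 with fl(3,4) have "((%_::real. p) ---> xi) at_bot" "((%_::real. p) ---> ga) at_top" by auto
 then have "p = xi" "p = ga" by (simp_all add: tendsto_const_iff)
 then show False using \<open>xi ~= ga\<close> by simp
qed

end

context morse_smale_flow
begin

theorem gluing_sign:
 fixes om :: "real => 'a" and w :: "real => 'e"
 assumes ga: "ga : Crit A f" and xi: "xi : Crit A f" "Ind A X xi = Ind A X ga + 1" and ze: "ze : Crit A f" "Ind A X ga = Ind A X ze + 1"
  and u: "u : CX xi ga" and v: "v : CX ga ze"
  and om: "!!H. H >= H\<^sub>0 ==> om H : CX xi ze"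
  and w: "!!H. H >= H\<^sub>0 ==> has_velocity A {H\<^sub>0..} om H (w H)" "!!H r. H >= H\<^sub>0 ==> w H ~= r *\<^sub>R X (om H)"
  and conv: "converges_to_broken A X om u v"
 shows "EX H>=H\<^sub>0. Ind\<^sub>o xi ze (om H) [X (om H), - w H] = Ind\<^sub>o xi ga u [X u] * Ind\<^sub>o ga ze v [X v]"
proof -
 obtain m B where m: "morse_model ga m B" using morse_model_exists[OF ga] by blast
 have mc: "m : charts" "ga : fst m" "snd m ga = 0" "B \<subseteq> Basis" using m unfolding morse_model_def by blast+
 obtain r where r: "r > 0" "cball 0 r \<subseteq> snd m ` fst m" using chart_open_range[OF mc(1)] mc(2,3) open_contains_cball by (metis imageI)
 \<comment> \<open>Stable and unstable parts bounded by \<open>ro\<close> leave room for coordinates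
   of norm up to 2 \<open>ro\<close>.\<close>
 define ro where "ro = r / 2"
 have ro: "ro > 0" "cball 0 (2 * ro) \<subseteq> snd m ` fst m" using r by (simp_all add: ro_def)
 interpret S: oriented_saddle A f X OM OU ga m B ro by unfold_locales (use m ro ga in auto)
 have d: "1 + Ind A X ga = Ind A X xi" "1 + Ind A X ze = Ind A X ga" "2 + Ind A X ze = Ind A X xi" using xi ze by auto
 note C1 = connecting_sub[OF xi(1) ga d(1)] and C2 = connecting_sub[OF ga ze(1) d(2)] and C3 = connecting_sub[OF xi(1) ze(1) d(3)]
 have ne: "xi ~= ga" "ga ~= ze" "xi ~= ze" using xi ze by auto
 have ev_near: "\<forall>\<^sub>F t in F. g t : fst m & norm (snd m (g t)) < ro" if "(g ---> ga) F" for g and F :: "real filter"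
  using ev_chart[OF mc(1,2) that] tendstoD[OF chart_tendsto[OF mc(1,2) that] ro(1)] by eventually_elim (simp add: mc(3))
 note fu = connecting_flow_line[OF u] and fv = connecting_flow_line[OF v]
 \<comment> \<open>Both parts of the broken trajectory are followed into the Morse chart; by
   \<open>flow_sign_const\<close> the signs at \<open>u\<close> and \<open>v\<close> do not change
   on the way.\<close>
 obtain ru where ru: "flow_line A X u ru : fst m" "norm (snd m (flow_line A X u ru)) < ro"
  using eventually_happens'[OF trivial_limit_at_top_linorder ev_near[OF fu(4)]] by blast
 obtain rv where rv: "flow_line A X v rv : fst m" "norm (snd m (flow_line A X v rv)) < ro"
  using eventually_happens'[OF trivial_limit_at_bot_linorder ev_near[OF fv(3)]] by blast
 note nc = connecting_noncrit[OF fu(5) ne(1)] connecting_noncrit[OF fv(5) ne(2)]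
 define u' v' where "u' = flow_line A X u ru" and "v' = flow_line A X v rv"
 have u': "u' : CX xi ga" "u' : fst m" "norm (snd m u') < ro" "X u' ~= 0"
  and v': "v' : CX ga ze" "v' : fst m" "norm (snd m v') < ro" "X v' ~= 0" using fu(5) fv(5) ru rv nc by (simp_all add: u'_def v'_def)
 note eu = S.end_u[OF xi u'] and ev' = S.end_v[OF ze v']
 have fm: "f q = f ga - (norm (proj B (snd m q)))\<^sup>2 + (norm (snd m q - proj B (snd m q)))\<^sup>2" if "q : fst m" for q
  using m that unfolding morse_model_def by (metis chart_inv_snd image_eqI)
 have fu': "f u' > f ga" using fm[OF u'(2)] eu(1,2) by simp
 have fv': "f v' < f ga" "f v' > f ga - ro\<^sup>2" using fm[OF v'(2)] ev'(1,2) v'(3) power_strict_mono[of "norm (snd m v')" ro 2] by auto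
 define Ps where "Ps H = flow_line A X (om H)" for H
 have Ps: "icurve X UNIV (Ps H)" "Ps H 0 = om H" "Ps H t : CX xi ze" "X (Ps H t) ~= 0" if "H >= H\<^sub>0" for H t
  using connecting_flow_line[OF om[OF that]] connecting_noncrit[OF _ ne(3)] by (simp_all add: Ps_def)
 have ge: "\<forall>\<^sub>F H in at_top. H >= H\<^sub>0" by simp
 then have evPs: "\<forall>\<^sub>F H in at_top. icurve X UNIV (Ps H)" by eventually_elim (rule Ps(1))
 obtain sm ta where st: "!!r. ((%(H, t). Ps H (sm H + t)) ---> flow_line A X u r) (at_top \<times>\<^sub>F nhds r)"
  "!!r. ((%(H, t). Ps H (ta H + t)) ---> flow_line A X v r) (at_top \<times>\<^sub>F nhds r)"
  using conv unfolding converges_to_broken_def Ps_def by blast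
 \<comment> \<open>Times are chosen by the levels of \<open>u'\<close> and \<open>v'\<close>, since
   the shifts from the convergence carry no regularity in the parameter. All entry points then
   eventually lie on one level of \<open>f\<close>.\<close>
 obtain a where a: "\<forall>\<^sub>F H in at_top. f (Ps H (a H)) = f u'" "((%H. Ps H (a H)) ---> u') at_top"
  using hitting_limit[where Ps=Ps, OF fu(1) nc(1) evPs st(1)] unfolding u'_def by blast
 obtain b where b: "\<forall>\<^sub>F H in at_top. f (Ps H (b H)) = f v'" "((%H. Ps H (b H)) ---> v') at_top"
  using hitting_limit[where Ps=Ps, OF fv(1) nc(2) evPs st(2)] unfolding v'_def by blast
 define p T x where "p H = Ps H (a H)" and "T H = b H - a H" and "x H = snd m (p H)" for H
 let ?P = "%H. proj B (x H)" and ?R = "%H. x H - proj B (x H)"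
 have xl: "(x ---> snd m u') at_top" unfolding x_def p_def by (rule chart_tendsto[OF mc(1) u'(2) a(2)])
 have Pl: "(?P ---> 0) at_top" using bounded_linear.tendsto[OF bounded_linear_proj xl, of B] eu(1) by simp
 have Rl: "(?R ---> snd m u') at_top" using tendsto_diff[OF xl Pl] by simp
 \<comment> \<open>The level at which a trajectory would leave through the unstable side tends to f
   ga - ro^2, which is below the level of \<open>v'\<close>; so \<open>saddle_passage\<close>
   eventually applies up to time \<open>T H\<close>.\<close>
 have Kl: "((%H. f ga - ro\<^sup>2 + (norm (?P H) * norm (?R H) / ro)\<^sup>2) ---> f ga - ro\<^sup>2 + (norm (0::'e) * norm (snd m u') / ro)\<^sup>2) at_top"
  by (intro tendsto_intros Pl Rl) (use ro in simp)
 have "f ga - ro\<^sup>2 + (norm (0::'e) * norm (snd m u') / ro)\<^sup>2 < f v'" "norm (0::'e) < ro" using fv' ro by auto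
 note small = order_tendstoD(2)[OF Kl this(1)] order_tendstoD(2)[OF tendsto_norm[OF Pl] this(2)] order_tendstoD(2)[OF tendsto_norm[OF Rl] u'(3)]
 have pass: "\<forall>\<^sub>F H in at_top. T H >= 0 & norm (?R H) < ro & p H : fst m & Ps H (b H) = S.Ph (T H) (p H) & snd m (Ps H (b H)) = dflow B (T H) (x H)"
  using ge a(1) b(1) ev_chart[OF mc(1) u'(2) a(2)] small
 proof (eventually_elim)
  case (elim H)
  have T0: "T H >= 0" using f_decreasing(1)[OF icurve_subset[OF Ps(1)[OF elim(1)] subset_UNIV], of "b H" "a H"] elim fu' fv' by (force simp: T_def)
  have pm: "p H : fst m" using elim by (simp add: p_def)
  have "norm (?P H) <= ro" "norm (?R H) <= ro" using elim by auto
  moreover have "Ps H (a H + T H) = Ps H (b H)" by (simp add: T_def)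
  ultimately have "Ps H (b H) : fst m & snd m (Ps H (b H)) = dflow B (T H) (x H)"
   using saddle_passage[OF m ro Ps(1)[OF elim(1)], of "a H" "T H" "T H"] pm elim fv' T0 by (simp add: p_def x_def)
  then show ?case using T0 elim pm chart_inv_snd[OF mc(1), of "Ps H (b H)"] by (simp add: S.Ph_def x_def)
 qed
 have "((%H. proj B (snd m (Ps H (b H)))) ---> snd m v') at_top"
  using bounded_linear.tendsto[OF bounded_linear_proj chart_tendsto[OF mc(1) v'(2) b(2)], of B] ev'(1) by simp
 moreover have "\<forall>\<^sub>F H in at_top. proj B (snd m (Ps H (b H))) = exp (2 * T H) *\<^sub>R ?P H" using pass
 proof eventually_elim
  case (elim H)
  then have "snd m (Ps H (b H)) = dflow B (T H) (x H)" by blast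
  then show ?case by (simp only: proj_dflow(1)[OF mc(4)])
 qed
 ultimately have El: "((%H. exp (2 * T H) *\<^sub>R ?P H) ---> snd m v') at_top" by (rule Lim_transform_eventually)
 have good: "\<forall>\<^sub>F H in at_top. H > H\<^sub>0 & f (p H) = f u' & T H >= 0 & p H : S.box (T H) & ?P H ~= 0 & ?R H ~= 0"
  using eventually_gt_at_top[of H\<^sub>0] a(1) pass order_tendstoD(2)[OF tendsto_norm[OF El] v'(3)] tendsto_imp_eventually_ne[OF El ev'(2)] tendsto_imp_eventually_ne[OF Rl eu(2)]
  by eventually_elim (auto simp: S.box_def p_def x_def)
 then obtain H2 where H2: "!!H. H >= H2 ==> H > H\<^sub>0 & f (p H) = f u' & T H >= 0 & p H : S.box (T H) & ?P H ~= 0 & ?R H ~= 0"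
  unfolding eventually_at_top_linorder by blast
 let ?S = "{H\<^sub>0..}"
 have nb: "at H within ?S ~= bot" if "H > H\<^sub>0" for H using at_within_interior[of H ?S] that by simp
 have "EX V. ALL t. has_velocity A ?S (%H. Ps H t) H1 (V t)" if "H1 >= H\<^sub>0" for H1
 proof -
  have "has_velocity A ?S (%H. Ps H 0) H1 (w H1)" by (rule has_velocity_cong[OF w(1)[OF that]]) (use Ps(2) that in auto)
  from velocity_family[where Ps=Ps, OF _ _ this] show ?thesis using Ps(1) that by (intro choice) auto
 qed
 then obtain V where V: "!!H t. H >= H\<^sub>0 ==> has_velocity A ?S (%H. Ps H t) H (V H t)" by metis
 define y D h where "y H = push A m (p H) (V H (a H))" and "D H = 2 * inner (?P H) (y H) * (norm (?R H))\<^sup>2 + (norm (?P H))\<^sup>2 * (2 * inner (?R H) (y H))"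
  and "h H = (norm (?P H))\<^sup>2 * (norm (?R H))\<^sup>2" for H
 text \<open>\<open>h\<close> is a first integral of the linear flow in the Morse chart, so it can be computed at a fixed time.\<close>
 have h': "(h has_real_derivative D H1) (at H1)" if H1: "H1 > H2" for H1
 proof -
  note g1 = H2[OF less_imp_le[OF H1]]
  have H1': "H1 : ?S" "H1 >= H\<^sub>0" "at H1 within ?S = at H1" using g1 at_within_interior[of H1 ?S] by auto
  have pm: "p H1 : fst m" using g1 by (auto simp: S.box_def)
  define Y where "Y H = snd m (Ps H (a H1))" for H
  have lim: "((%H. Ps H (0 + t)) ---> Ps H1 t) (at H1)" for t using V[OF H1'(2), of t] by (simp add: has_velocity_def continuous_within H1'(3))
  have evS: "\<forall>\<^sub>F H in at H1. H > H2" using order_tendstoD(1)[OF tendsto_ident_at H1] .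
  then have evPs1: "\<forall>\<^sub>F H in at H1. icurve X UNIV (Ps H)" by eventually_elim (use H2 Ps(1) in \<open>meson less_imp_le\<close>)
  obtain e U where U: "e > 0" "open U" "x H1 : U" "!!r x. \<bar>r\<bar> < e ==> x : U ==> dflow B r x : snd m ` fst m"
   using model_tube[OF morse_model_chart[OF m], of "x H1"] pm unfolding x_def by blast
  have "open {q : fst m. snd m q : U}" by (rule chart_open_preimage[OF mc(1) U(2)])
  from topological_tendstoD[OF lim[of "a H1"] this]
  have evU: "\<forall>\<^sub>F H in at H1. Ps H (a H1) : fst m & Y H : U" using pm U(3) by (simp add: p_def x_def Y_def)
  have "\<forall>\<^sub>F H in at H1. h H = (norm (proj B (Y H)))\<^sup>2 * (norm (Y H - proj B (Y H)))\<^sup>2"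
   using hitting_time[where Ps=Ps and sm="%_. 0", OF Ps(1,4)[OF H1'(2)] evPs1 lim U(1), of "a H1"] evS evU evPs1
  proof eventually_elim
   case (elim H)
   have "f (Ps H (a H)) = f (Ps H1 (a H1))" using H2[OF less_imp_le[OF elim(2)]] g1 by (simp add: p_def)
   then have t: "\<bar>a H - a H1\<bar> < e" using elim(1) by simp
   have "dflow B r (Y H) : snd m ` fst m" if "r : closed_segment 0 (a H - a H1)" for r
    by (rule U(4)) (use that t elim(3) in \<open>auto simp: closed_segment_eq_real_ivl split: if_splits\<close>)
   then obtain r where e: "x H = dflow B r (Y H)"
    using model_curve_eq(2)[OF morse_model_chart[OF m] icurve_subset[OF elim(4) subset_UNIV], of "a H1" "a H"] elim(3) by (simp add: x_def p_def Y_def)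
   have "(exp (2 * r) * i)\<^sup>2 * (exp (- (2 * r)) * j)\<^sup>2 = i\<^sup>2 * j\<^sup>2" for r i j :: real
    by (simp add: power_mult_distrib exp_minus field_simps)
   then show ?case unfolding h_def e proj_dflow(2)[OF mc(4)] unfolding proj_dflow(1)[OF mc(4)] by simp
  qed
  moreover have "h H1 = (norm (proj B (Y H1)))\<^sup>2 * (norm (Y H1 - proj B (Y H1)))\<^sup>2" by (simp add: h_def Y_def x_def p_def)
  moreover have "((%H. (norm (proj B (Y H)))\<^sup>2 * (norm (Y H - proj B (Y H)))\<^sup>2) has_real_derivative D H1) (at H1)"
  proof -
   have Y: "(Y has_vector_derivative y H1) (at H1)" using V[OF H1'(2), of "a H1"] has_velocity_iff[OF mc(1), of "%H. Ps H (a H1)" H1 ?S] pm H1'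
    by (simp add: p_def y_def Y_def[abs_def] o_def)
   note PY = bounded_linear.has_vector_derivative[OF bounded_linear_proj Y, of B]
   have sq: "((%H. (norm (g H))\<^sup>2) has_real_derivative 2 * inner (g H1) g') (at H1)" if "(g has_vector_derivative g') (at H1)" for g and g' :: 'e
    using bounded_bilinear.has_vector_derivative[OF bounded_bilinear_inner that that]
    by (simp add: power2_norm_eq_inner has_real_derivative_iff_has_vector_derivative inner_commute)
   have "inner (proj B (Y H1)) (proj B (y H1)) = inner (?P H1) (y H1)"
    using inner_proj_compl[OF mc(4), of "x H1" "y H1"] by (simp add: Y_def x_def p_def inner_diff_right)
   moreover have "inner (Y H1 - proj B (Y H1)) (y H1 - proj B (y H1)) = inner (?R H1) (y H1)"
    using inner_proj_compl[OF mc(4), of "y H1" "x H1"] by (simp add: Y_def x_def p_def inner_diff_left inner_diff_right inner_commute)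
   ultimately have "2 * inner (proj B (Y H1)) (proj B (y H1)) = 2 * inner (?P H1) (y H1)"
    "2 * inner (Y H1 - proj B (Y H1)) (y H1 - proj B (y H1)) = 2 * inner (?R H1) (y H1)" by auto
   with DERIV_mult[OF sq[OF PY] sq[OF has_vector_derivative_diff[OF Y PY]]] show ?thesis
    by (simp add: D_def Y_def x_def p_def mult.commute add.commute mult.left_commute)
  qed
  ultimately show ?thesis using has_field_derivative_cong_eventually[of h _ H1 UNIV] by simp
 qed
 have hl: "(h ---> 0) at_top"
  using tendsto_mult[OF tendsto_power[OF tendsto_norm[OF Pl], of 2] tendsto_power[OF tendsto_norm[OF Rl], of 2]] by (simp add: h_def[abs_def])
 \<comment> \<open>Limits are taken along the parameters with negative \<open>D\<close>; this filter
   is nontrivial since a nonnegative \<open>D\<close> would keep the positive function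
   \<open>h\<close> away from 0.\<close>
 let ?F = "inf at_top (principal {H. D H < 0})"
 have F: "?F ~= bot"
 proof
  assume "?F = bot"
  then have "\<forall>\<^sub>F H in at_top. D H >= 0" by (simp add: trivial_limit_def eventually_inf_principal not_less)
  then obtain H3 where H3: "!!H. H >= H3 ==> D H >= 0" unfolding eventually_at_top_linorder by blast
  define H4 where "H4 = max (H2 + 1) H3"
  have "h H4 <= h H" if "H >= H4" for H by (rule DERIV_nonneg_imp_nondecreasing[OF that]) (use h' H3 in \<open>force simp: H4_def\<close>)
  then have "\<forall>\<^sub>F H in at_top. h H4 <= h H" by (auto simp: eventually_at_top_linorder)
  from tendsto_lowerbound[OF hl this] have "h H4 <= 0" by simp
  moreover have "h H4 > 0" using H2[of H4] by (simp add: h_def H4_def)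
  ultimately show False by simp
 qed
 \<comment> \<open>\<open>c\<close> removes the component along the stable part and \<open>l\<close>
   produces the component along the unstable part that \<open>passage_sign\<close> requires. The
   factor \<open>l\<close> is positive because \<open>D\<close> is negative.\<close>
 define l c w' where "l H = - 4 * exp (2 * T H) * (norm (?P H))\<^sup>2 * (norm (?R H))\<^sup>2 / D H"
  and "c H = - l H * inner (?R H) (y H) / (2 * (norm (?R H))\<^sup>2)"
  and "w' H = l H *\<^sub>R (- V H (a H)) + c H *\<^sub>R X (p H)" for H
 have evF: "\<forall>\<^sub>F H in ?F. H >= H2 & D H < 0"
  unfolding eventually_inf_principal using eventually_ge_at_top[of H2] by eventually_elim blast
 have tan: "V H t : TS (CX xi ze) (Ps H t)" if "H > H\<^sub>0" for H t by (rule velocity_in_tangent[OF C3(1) V _ nb]) (use that Ps(3) in auto)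
 have V0: "V H 0 = w H" if "H > H\<^sub>0" for H
 proof -
  have "has_velocity A ?S (%H. Ps H 0) H (w H)" by (rule has_velocity_cong[OF w(1)]) (use Ps(2) that in auto)
  then show ?thesis using velocity_eq[OF _ nb[OF that]] V[of H 0] that by (metis less_imp_le)
 qed
 have const: "Ind\<^sub>o xi ze (p H) [X (p H), - V H (a H)] = Ind\<^sub>o xi ze (om H) [X (om H), - w H]"
  "obasis (TS (CX xi ze) (p H)) [X (p H), - V H (a H)]" if H: "H > H\<^sub>0" for H
 proof -
  have n: "V H 0 ~= r *\<^sub>R X (Ps H 0)" for r using w(2)[of H r] V0[OF H] Ps(2) H by simp
  note fc = flow_orientation_const[where Ps=Ps and v="V H" and ?H1.0=H and S="?S", OF C3(1) induced(1)[OF xi(1) ze(1) d(3)] _ _ _ nb[OF H] _ _ n]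
  show "Ind\<^sub>o xi ze (p H) [X (p H), - V H (a H)] = Ind\<^sub>o xi ze (om H) [X (om H), - w H]"
   using fc(1)[of "a H"] Ps V V0[OF H] H by (simp add: p_def)
  show "obasis (TS (CX xi ze) (p H)) [X (p H), - V H (a H)]" using fc(2)[of "a H"] Ps V H by (simp add: p_def)
 qed
 have "\<forall>\<^sub>F H in ?F. Ind\<^sub>o xi ze (p H) [X (p H), w' H] = Ind\<^sub>o xi ga u' [X u'] * Ind\<^sub>o ga ze v' [X v']"
 proof (rule S.passage_sign[OF xi ze u' v', where T=T])
  show "(p ---> u') ?F" using a(2) by (simp add: p_def[abs_def] tendsto_mono[OF inf_le1])
  have "\<forall>\<^sub>F H in at_top. Ps H (b H) = S.Ph (T H) (p H)" using pass by eventually_elim blast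
  from Lim_transform_eventually[OF b(2) this] show "((%H. S.Ph (T H) (p H)) ---> v') ?F" by (rule tendsto_mono[OF inf_le1])
  show "\<forall>\<^sub>F H in ?F. p H : CX xi ze & p H : S.box (T H) & T H >= 0"
   using evF by eventually_elim (use H2 Ps(3) in \<open>auto simp: p_def less_imp_le\<close>)
  show "\<forall>\<^sub>F H in ?F. w' H : TS (CX xi ze) (p H) &
   inner (snd m (p H) - proj B (snd m (p H))) (push A m (p H) (w' H)) = 0 &
   inner (proj B (snd m (p H))) (push A m (p H) (w' H)) = 2 * exp (2 * T H) * (norm (proj B (snd m (p H))))\<^sup>2" using evF
  proof eventually_elim
   case (elim H)
   then have g: "H > H\<^sub>0" "p H : S.box (T H)" "?P H ~= 0" "?R H ~= 0" using H2[of H] by auto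
   then have pm: "p H : fst m" by (simp add: S.box_def)
   have pC: "p H : CX xi ze" using Ps(3) g(1) by (simp add: p_def)
   have "w' H : TS (CX xi ze) (p H)" unfolding w'_def using tan[OF g(1), of "a H"] connecting_X[OF C3(1) pC] sub_dim(1)[OF C3(1) pC]
    by (intro subspace_add subspace_scale subspace_neg) (auto simp: p_def)
   moreover have pw: "push A m (p H) (w' H) = c H *\<^sub>R (2 *\<^sub>R ?P H - 2 *\<^sub>R ?R H) - l H *\<^sub>R y H"
   proof -
    note L = push_linear[OF mc(1) pm]
    show ?thesis unfolding w'_def linear_add[OF L] linear_scale[OF L] linear_neg[OF L] S.push_X[OF pm] by (simp add: hfield_def y_def x_def)
   qed
   define P R where PR: "P = ?P H" "R = ?R H"
   have o: "inner P R = 0" "inner R P = 0" using inner_proj_compl[OF mc(4)] by (simp_all add: PR inner_commute)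
   have nz: "inner R R ~= 0" using g(4) by (simp add: PR)
   note e = pw[folded PR] c_def[of H, folded PR, unfolded power2_norm_eq_inner] D_def[of H, folded PR, unfolded power2_norm_eq_inner]
   have "inner R (push A m (p H) (w' H)) = 0" unfolding e by (simp add: inner_diff_right o)
   moreover have "inner P (push A m (p H) (w' H)) = - l H * D H / (2 * (norm R)\<^sup>2)"
    unfolding e power2_norm_eq_inner using nz by (simp add: inner_diff_right inner_add_right o field_simps)
   then have "inner P (push A m (p H) (w' H)) = 2 * exp (2 * T H) * (norm P)\<^sup>2" using elim(1) g(4) by (simp add: l_def PR)
   ultimately show ?case by (simp add: x_def PR)
  qed
 qed
 from eventually_happens'[OF F eventually_conj[OF this evF]]
 obtain H where H: "H >= H2" "D H < 0" "Ind\<^sub>o xi ze (p H) [X (p H), w' H] = Ind\<^sub>o xi ga u' [X u'] * Ind\<^sub>o ga ze v' [X v']" by blast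
 have g: "H > H\<^sub>0" "?P H ~= 0" "?R H ~= 0" using H2[OF H(1)] by auto
 have l: "l H > 0" using g unfolding l_def using H(2) by (intro divide_neg_neg) simp_all
 have pC: "p H : CX xi ze" using Ps(3) g(1) by (simp add: p_def)
 let ?T = "TS (CX xi ze) (p H)"
 have vs: "vs_orientation ?T (Ind\<^sub>o xi ze (p H))" using induced(1)[OF xi(1) ze(1) d(3)] pC by (simp add: orientation_def)
 have bX: "obasis ?T ([X (p H)] @ [- V H (a H)])" using const(2)[OF g(1)] by simp
 have con: "connected (range z)" if "icurve X UNIV z" for z by (rule connected_continuous_image[OF icurve_continuous[OF that] connected_UNIV])
 have sa: "Ind\<^sub>o xi ga u' [X u'] = Ind\<^sub>o xi ga u [X u]" "obasis (TS (CX xi ga) u') [X u']"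
  using flow_sign_const[OF C1(1) induced(1)[OF xi(1) ga d(1)] _ con[OF fu(1)], of u' u] connecting_noncrit[OF _ ne(1)] fu(5) rangeI[of "flow_line A X u" 0] rangeI[of "flow_line A X u" ru]
  by (auto simp: u'_def fu(2) image_subset_iff)
 have sb: "Ind\<^sub>o ga ze v' [X v'] = Ind\<^sub>o ga ze v [X v]" "obasis (TS (CX ga ze) v') [X v']"
  using flow_sign_const[OF C2(1) induced(1)[OF ga ze(1) d(2)] _ con[OF fv(1)], of v' v] connecting_noncrit[OF _ ne(2)] fv(5) rangeI[of "flow_line A X v" 0] rangeI[of "flow_line A X v" rv]
  by (auto simp: v'_def fv(2) image_subset_iff)
 have "Ind\<^sub>o xi ze (p H) ([X (p H)] @ [w' H]) ~= 0"
 proof -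
  have "vs_orientation (TS (CX xi ga) u') (Ind\<^sub>o xi ga u')" "vs_orientation (TS (CX ga ze) v') (Ind\<^sub>o ga ze v')"
   using induced(1)[OF xi(1) ga d(1)] induced(1)[OF ga ze(1) d(2)] u'(1) v'(1) by (auto simp: orientation_def)
  from vs_values(1)[OF this(1) sa(2)] vs_values(1)[OF this(2) sb(2)] show ?thesis using H(3) by auto
 qed
 then have bw: "obasis ?T ([X (p H)] @ [w' H])" using vs_values(2)[OF vs] by blast
 \<comment> \<open>Modulo \<open>X\<close> the normalised vector is \<open>l H\<close> times - V, so
   the two frames differ by a positive determinant.\<close>
 define K where "K = Matrix.mat 1 1 (%_. l H)"
 have "Ind\<^sub>o xi ze (p H) ([X (p H)] @ [w' H]) = sgn (det (1\<^sub>m 1 :: real Matrix.mat)) * sgn (det K) * Ind\<^sub>o xi ze (p H) ([X (p H)] @ [- V H (a H)])"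
  by (rule orientation_block[OF vs bX bw]) (auto simp: K_def w'_def span_singleton)
 moreover have "det K = l H" by (simp add: K_def det_single)
 ultimately show ?thesis using const(1)[OF g(1)] l H(3) sa(1) sb(1) g(1) by (intro exI[of _ H]) simp
qed

end

section \<open>Orientations of components and the comparison\<close>

context manifold
begin

text \<open>The velocity is read off from a smooth local extension of the coordinate curve, hence is
  continuous up to the end point of the half-line.\<close>

lemma smooth_curve_velocity_tb:
 assumes x: "smooth_curve_on A T x" and t: "t : T" and nb: "!!s. s : T ==> at s within T ~= bot"
 shows "tb_tendsto x (velocity A T x) (x t) (velocity A T x t) (at t within T)"
proof -
 define c where "c = chart_at A (x t)"
 have c: "c : A" "x t : fst c" "c : charts" using chart_at chart_at_in by (auto simp: c_def)
 obtain U h where U: "open U" "t : U" "Cinf_on U h"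
  "!!s. s : T \<inter> U ==> x s : fst c ==> has_velocity A T x s (pull c (x s) (fd h s 1))" by (rule smooth_curve_chart[OF x c(1) t c(2)]) blast
 have push: "push A c (x s) (velocity A T x s) = fd h s 1" if "s : T \<inter> U" "x s : fst c" for s
  using velocity_eq[OF U(4)[OF that]] nb that c(3) by simp
 have lim: "(x ---> x t) (at t within T)" using x t by (simp add: smooth_curve_on_def continuous_on_def)
 have "isCont (%s. fd h s 1) t"
  by (rule continuous_on_interior[OF Cinf_on_continuous[OF Cinf_on_deriv[OF U(3)]]]) (use U in \<open>simp add: interior_open\<close>)
 then have "((%s. fd h s 1) ---> fd h t 1) (at t within T)" by (simp add: isCont_def tendsto_within_subset[of _ _ _ UNIV])
 moreover have "\<forall>\<^sub>F s in at t within T. s : T \<inter> U" using U(1,2) by (auto simp: eventually_at_topological)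
 then have "\<forall>\<^sub>F s in at t within T. fd h s 1 = push A c (x s) (velocity A T x s)"
  using ev_chart[OF c(3,2) lim] by eventually_elim (simp add: push)
 ultimately show ?thesis unfolding tb_tendsto_iff[OF c(3,2)] using lim push[of t] t U(2) c(2) Lim_transform_eventually by simp
qed

lemma tb_tendsto_minus:
 assumes "tb_tendsto q v q0 v0 F"
 shows "tb_tendsto q (%t. - v t) q0 (- v0) F"
proof -
 define c where "c = chart_at A q0"
 have c: "c : charts" "q0 : fst c" using chart_at chart_at_in by (auto simp: c_def)
 have l: "(q ---> q0) F" "((%t. push A c (q t) (v t)) ---> push A c q0 v0) F" using assms unfolding tb_tendsto_iff[OF c] by auto
 have "\<forall>\<^sub>F t in F. - push A c (q t) (v t) = push A c (q t) (- v t)"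
  using ev_chart[OF c l(1)] by eventually_elim (simp add: linear_neg[OF push_linear[OF c(1)]])
 from Lim_transform_eventually[OF tendsto_minus[OF l(2)] this] show ?thesis
  unfolding tb_tendsto_iff[OF c] using l(1) by (simp add: linear_neg[OF push_linear[OF c]])
qed

text \<open>Multiplying by the value \<open>a\<close> on the frame makes that value 1; connectedness
  leaves no other orientation with this property.\<close>

lemma frame_orientation_eq:
 assumes "orientation A W Or" "is_submanifold A d W" "connected W" "p : W" "Or p bs = a" "a = 1 | a = - 1"
 shows "frame_orientation A W p bs = scale_or a Or" unfolding frame_orientation_def
proof (rule the_equality)
 show "orientation A W (scale_or a Or) & scale_or a Or p bs = 1" using orientation_scale[OF assms(1,6)] assms(5,6) by (auto simp: scale_or_def)
 then show "Or' = scale_or a Or" if "orientation A W Or' & Or' p bs = 1" for Or'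
  using orientation_unique[of W Or' "scale_or a Or" d p bs] that assms by simp
qed

text \<open>Rescaling by \<open>a\<close> gives the flow orientation, unique by connectedness, and
  since \<open>a\<close> is its own inverse the original orientation is \<open>a\<close> times
  it.\<close>

lemma flow_sign_eq:
 assumes Or: "orientation A W Or" and W: "is_submanifold A d W" "connected W" "u : W"
  and a: "!!p. p : W ==> Or p [X p] = a" "a = 1 | a = - 1"
 shows "flow_sign A X W Or = a"
proof -
 have sc: "orientation A W (scale_or a Or) & (ALL p:W. scale_or a Or p [X p] = 1)" using orientation_scale[OF Or a(2)] a by (auto simp: scale_or_def)
 have "flow_orientation A X W = scale_or a Or" unfolding flow_orientation_def
 proof (rule the_equality)
  show "orientation A W (scale_or a Or) & (ALL p:W. scale_or a Or p [X p] = 1)" by (rule sc)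
  show "Or' = scale_or a Or" if "orientation A W Or' & (ALL p:W. Or' p [X p] = 1)" for Or'
   using orientation_unique[of W Or' "scale_or a Or" d u "[X u]"] that sc W by simp
 qed
 moreover have "scale_or a (scale_or a Or) = Or" using a(2) by (auto simp: scale_or_def)
 moreover have "b = a" if "Or = scale_or b (scale_or a Or)" for b
 proof -
  have "Or u [X u] = b * (a * Or u [X u])" using that by (metis scale_or_def)
  then show ?thesis using a W(3) by auto
 qed
 ultimately show ?thesis unfolding flow_sign_def using a(2) by (intro the_equality) auto
qed

end

theorem proposition2:
  fixes A :: "('a::{t2_space,second_countable_topology}, 'e::euclidean_space) chart set"
    and f :: "'a \<Rightarrow> real"
    and X :: "'a \<Rightarrow> 'e"
    and OM :: "'a \<Rightarrow> 'e list \<Rightarrow> real"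
    and OU :: "'a \<Rightarrow> 'a \<Rightarrow> 'e list \<Rightarrow> real"
    and \<xi> \<gamma> \<zeta> u v :: 'a
    and k :: nat
    and c1 c2 c3 \<eta>\<^sub>0 \<eta> :: real
    and G :: "'a \<Rightarrow> real \<Rightarrow> 'a \<Rightarrow> 'a"
    and \<omega> :: "real \<Rightarrow> 'a"
  assumes manifold: "smooth_atlas A"
    and oriented: "orientation A UNIV OM"
    and morse_smale: "morse_smale_pair A f X"
    and unstable_oriented: "\<And>x. x \<in> Crit A f \<Longrightarrow> orientation A (Wu A X x) (OU x)"
    and crit: "\<xi> \<in> Crit A f" "\<gamma> \<in> Crit A f" "\<zeta> \<in> Crit A f"
    and k: "k \<ge> 1"
    and index: "Ind A X \<xi> = k + 1" "Ind A X \<gamma> = k" "Ind A X \<zeta> = k - 1"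
    and levels: "regular_level_between A f \<xi> \<gamma> c1" "regular_level_between A f \<gamma> \<zeta> c2"
      "regular_level_between A f \<xi> \<zeta> c3"
    and gluing: "gluing_map A X (trajectories A f X c1 \<xi> \<gamma>) (trajectories A f X c2 \<gamma> \<zeta>)
      (trajectories A f X c3 \<xi> \<zeta>) \<eta>\<^sub>0 G"
    and u: "u \<in> trajectories A f X c1 \<xi> \<gamma>"
    and v: "v \<in> trajectories A f X c2 \<gamma> \<zeta>"
    and \<eta>: "\<eta> \<ge> \<eta>\<^sub>0"
    and glued: "\<omega> = (\<lambda>\<eta>. G u \<eta> v)"
  shows "gluing_orientation A X (connecting_component A X \<xi> \<gamma> u)
      (connecting_component A X \<gamma> \<zeta> v) (connecting_component A X \<xi> \<zeta> (\<omega> \<eta>)) \<eta>\<^sub>0 \<omega> \<eta>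
      (restrict_or (connecting_component A X \<xi> \<gamma> u) (induced_orientation A X OM OU \<xi> \<gamma>))
      (restrict_or (connecting_component A X \<gamma> \<zeta> v) (induced_orientation A X OM OU \<gamma> \<zeta>)) =
    restrict_or (connecting_component A X \<xi> \<zeta> (\<omega> \<eta>)) (induced_orientation A X OM OU \<xi> \<zeta>)"
proof -
 interpret morse_smale_flow A f X OM OU
  by unfold_locales (use manifold oriented morse_smale unstable_oriented in \<open>auto simp: morse_smale_pair_def morse_function_def\<close>)
 have ind: "Ind A X \<xi> = Ind A X \<gamma> + 1" "Ind A X \<gamma> = Ind A X \<zeta> + 1" and d: "1 + Ind A X \<gamma> = Ind A X \<xi>" "1 + Ind A X \<zeta> = Ind A X \<gamma>" "2 + Ind A X \<zeta> = Ind A X \<xi>"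
  using index k by auto
 have ne: "\<xi> ~= \<gamma>" "\<gamma> ~= \<zeta>" "\<xi> ~= \<zeta>" using ind by auto
 note C1 = connecting_sub[OF crit(1,2) d(1)] and C2 = connecting_sub[OF crit(2,3) d(2)] and C3 = connecting_sub[OF crit(1,3) d(3)]
 note I1 = induced(1)[OF crit(1,2) d(1)] and I2 = induced(1)[OF crit(2,3) d(2)] and I3 = induced(1)[OF crit(1,3) d(3)]
 let ?S = "{\<eta>\<^sub>0..}" and ?C = "CX \<xi> \<zeta>"
 have uC: "u : CX \<xi> \<gamma>" and vC: "v : CX \<gamma> \<zeta>" using u v by (auto simp: trajectories_def)
 define w where "w = velocity A ?S \<omega>"
 have sm: "smooth_curve_on A ?S \<omega>" and w0: "!!\<eta>. \<eta> >= \<eta>\<^sub>0 ==> w \<eta> ~= 0" and conv: "converges_to_broken A X \<omega> u v"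
  using gluing u v unfolding gluing_map_def glued w_def by blast+
 \<comment> \<open>An embedding into the subspace topology of the set of trajectories is onto the
   intersection of that set with its image, so the glued points are trajectories.\<close>
 have \<omega>T: "\<omega> \<eta> : trajectories A f X c3 \<xi> \<zeta>" if "\<eta> >= \<eta>\<^sub>0" for \<eta>
 proof -
  let ?G = "%(u, \<eta>, v). G u \<eta> v" and ?D = "trajectories A f X c1 \<xi> \<gamma> \<times> ?S \<times> trajectories A f X c2 \<gamma> \<zeta>"
  have "homeomorphic_map (top_of_set ?D) (subtopology (top_of_set (trajectories A f X c3 \<xi> \<zeta>)) (?G ` topspace (top_of_set ?D))) ?G"
   using gluing unfolding gluing_map_def embedding_map_def by blast
  from homeomorphic_imp_surjective_map[OF this] have "?G ` ?D = trajectories A f X c3 \<xi> \<zeta> \<inter> ?G ` ?D"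
   unfolding topspace_subtopology topspace_euclidean Int_UNIV_left .
  moreover have "\<omega> \<eta> : ?G ` ?D" unfolding glued by (rule image_eqI[of _ _ "(u, \<eta>, v)"]) (use u v that in auto)
  ultimately show ?thesis by blast
 qed
 have \<omega>: "\<omega> \<eta> : ?C" "f (\<omega> \<eta>) = c3" "X (\<omega> \<eta>) ~= 0" if "\<eta> >= \<eta>\<^sub>0" for \<eta>
  using \<omega>T[OF that] connecting_noncrit[OF _ ne(3)] by (auto simp: trajectories_def)
 have nb: "at s within ?S ~= bot" if "s : ?S" for s
 proof -
  have "{s<..} \<subseteq> ?S" using that by auto
  from at_le[OF this, of s] show ?thesis by (auto simp: bot_unique)
 qed
 have vel: "has_velocity A ?S \<omega> \<eta> (w \<eta>)" if "\<eta> >= \<eta>\<^sub>0" for \<eta>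
  unfolding w_def by (rule smooth_curve_has_velocity[OF sm]) (use nb that in auto)
 \<comment> \<open>The glued curve stays in the level \<open>c3\<close>, so df vanishes on its
   velocity, while df (X) is nonzero off the critical points; as the velocity is nonzero, it is no
   multiple of \<open>X\<close>.\<close>
 have indep: "w \<eta> ~= r *\<^sub>R X (\<omega> \<eta>)" if \<eta>: "\<eta> >= \<eta>\<^sub>0" for \<eta> r
 proof
  assume r: "w \<eta> = r *\<^sub>R X (\<omega> \<eta>)"
  have "((%s. f (\<omega> s)) has_vector_derivative differential A f (\<omega> \<eta>) (w \<eta>)) (at \<eta> within ?S)"
   using f_has_derivative_velocity[OF vel[OF \<eta>]] \<eta> by (simp add: has_real_derivative_iff_has_vector_derivative)
  then have "((%s. c3) has_vector_derivative differential A f (\<omega> \<eta>) (w \<eta>)) (at \<eta> within ?S)"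
   by (rule has_vector_derivative_transform[rotated 2]) (use \<eta> \<omega>(2) in auto)
  then have "differential A f (\<omega> \<eta>) (w \<eta>) = 0"
   using vector_derivative_unique_within[OF nb _ has_vector_derivative_const] \<eta> by auto
  then show False using linear_scale[OF differential_linear] using differential_X(2)[of "\<omega> \<eta>"] X_zero_iff \<omega>(3)[OF \<eta>] r w0[OF \<eta>] by auto
 qed
 define \<alpha> \<beta> g where "\<alpha> = Ind\<^sub>o \<xi> \<gamma> u [X u]" and "\<beta> = Ind\<^sub>o \<gamma> \<zeta> v [X v]" and "g \<eta> = Ind\<^sub>o \<xi> \<zeta> (\<omega> \<eta>) [X (\<omega> \<eta>), - w \<eta>]" for \<eta>
 obtain \<eta>1 where \<eta>1: "\<eta>1 >= \<eta>\<^sub>0" "g \<eta>1 = \<alpha> * \<beta>" unfolding g_def \<alpha>_def \<beta>_def using gluing_sign[OF crit(2,1) ind(1) crit(3) ind(2) uC vC \<omega>(1) vel indep conv] by blast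
 have T: "X (\<omega> \<eta>) : TS ?C (\<omega> \<eta>)" "- w \<eta> : TS ?C (\<omega> \<eta>)" if "\<eta> >= \<eta>\<^sub>0" for \<eta>
  using connecting_X[OF C3(1) \<omega>(1)[OF that]] velocity_in_tangent[OF C3(1) vel[OF that]] nb that \<omega>(1) subspace_neg[OF sub_dim(1)[OF C3(1) \<omega>(1)[OF that]]] by auto
 have basis: "obasis (TS ?C (\<omega> \<eta>)) [X (\<omega> \<eta>), - w \<eta>]" if \<eta>: "\<eta> >= \<eta>\<^sub>0" for \<eta>
 proof (rule obasis_pair[OF sub_dim[OF C3(1) \<omega>(1)[OF \<eta>]] T[OF \<eta>] \<omega>(3)[OF \<eta>]])
  show "- w \<eta> ~= r *\<^sub>R X (\<omega> \<eta>)" for r using indep[OF \<eta>, of "- r"] by (metis minus_minus scaleR_minus_left)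
 qed
 have "g \<eta> = g \<eta>1"
 proof (rule connected_local_const[where f=g and A="?S"], intro connected_Ici)
  show "ALL s:?S. \<forall>\<^sub>F t in at s within ?S. g s = g t"
  proof
   fix s assume s: "s : ?S"
   let ?F = "at s within ?S"
   have lim: "(\<omega> ---> \<omega> s) ?F" using sm s by (simp add: smooth_curve_on_def continuous_on_def)
   have ev: "\<forall>\<^sub>F t in ?F. t : ?S" by (simp add: eventually_at_filter)
   have "tb_tendsto \<omega> w (\<omega> s) (w s) ?F" unfolding w_def by (rule smooth_curve_velocity_tb[OF sm s nb])
   then have "tb_tendsto \<omega> (%t. - w t) (\<omega> s) (- w s) ?F" by (rule tb_tendsto_minus)
   then have "\<forall>\<^sub>F t in ?F. Ind\<^sub>o \<xi> \<zeta> (\<omega> t) (map (%E. E t) [%t. X (\<omega> t), %t. - w t]) = Ind\<^sub>o \<xi> \<zeta> (\<omega> s) [X (\<omega> s), - w s]"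
    using X_tb[OF lim] s ev T \<omega>(1) by (intro orientation_tendsto[OF I3 C3(1) _ lim _ _ basis]) (auto elim: eventually_mono)
   then show "\<forall>\<^sub>F t in ?F. g s = g t" by eventually_elim (simp add: g_def)
  qed
 qed (use \<eta> \<eta>1 in auto)
 then have g\<eta>: "g \<eta> = \<alpha> * \<beta>" using \<eta>1 by simp
 let ?U = "connecting_component A X \<xi> \<gamma> u" and ?V = "connecting_component A X \<gamma> \<zeta> v" and ?W = "connecting_component A X \<xi> \<zeta> (\<omega> \<eta>)"
 have self: "u : ?U" "v : ?V" "\<omega> \<eta> : ?W" using uC vC \<omega>(1)[OF \<eta>] by auto
 have \<alpha>: "Ind\<^sub>o \<xi> \<gamma> p [X p] = \<alpha>" "obasis (TS (CX \<xi> \<gamma>) p) [X p]" if "p : ?U" for p unfolding \<alpha>_def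
  by (rule flow_sign_const[OF C1(1) I1 connecting_noncrit[OF _ ne(1)] connected_connected_component connected_component_subset that self(1)], assumption)+
 have \<beta>: "Ind\<^sub>o \<gamma> \<zeta> p [X p] = \<beta>" "obasis (TS (CX \<gamma> \<zeta>) p) [X p]" if "p : ?V" for p unfolding \<beta>_def
  by (rule flow_sign_const[OF C2(1) I2 connecting_noncrit[OF _ ne(2)] connected_connected_component connected_component_subset that self(2)], assumption)+
 have \<alpha>1: "\<alpha> = 1 | \<alpha> = - 1" and \<beta>1: "\<beta> = 1 | \<beta> = - 1" unfolding \<alpha>_def \<beta>_def using I1 I2 uC vC
  by (intro vs_values(1)[OF _ \<alpha>(2)[OF self(1)]] vs_values(1)[OF _ \<beta>(2)[OF self(2)]]; simp add: orientation_def)+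
 note oU = openin_component[OF C1(1), of u] and oV = openin_component[OF C2(1), of v] and oW = openin_component[OF C3(1), of "\<omega> \<eta>"]
 have "flow_sign A X ?U (restrict_or ?U (Ind\<^sub>o \<xi> \<gamma>)) = \<alpha>"
  by (rule flow_sign_eq[OF orientation_restrict[OF C1(1) oU I1] openin_submanifold(1)[OF C1(1) oU] _ self(1) _ \<alpha>1])
   (use \<alpha> in \<open>simp_all add: restrict_or_def\<close>)
 moreover have "flow_sign A X ?V (restrict_or ?V (Ind\<^sub>o \<gamma> \<zeta>)) = \<beta>"
  by (rule flow_sign_eq[OF orientation_restrict[OF C2(1) oV I2] openin_submanifold(1)[OF C2(1) oV] _ self(2) _ \<beta>1])
   (use \<beta> in \<open>simp_all add: restrict_or_def\<close>)
 moreover have "frame_orientation A ?W (\<omega> \<eta>) [X (\<omega> \<eta>), - w \<eta>] = scale_or (\<alpha> * \<beta>) (restrict_or ?W (Ind\<^sub>o \<xi> \<zeta>))"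
  by (rule frame_orientation_eq[OF orientation_restrict[OF C3(1) oW I3] openin_submanifold(1)[OF C3(1) oW] _ self(3)])
   (use g\<eta> self(3) \<alpha>1 \<beta>1 in \<open>auto simp: restrict_or_def g_def\<close>)
 \<comment> \<open>The product of the two flow signs enters once through
   \<open>gluing_orientation\<close> and once through the frame orientation, and its square is
   1.\<close>
 moreover have "scale_or (\<alpha> * \<beta>) (scale_or (\<alpha> * \<beta>) Or) = Or" for Or :: "'a => 'e list => real"
  using \<alpha>1 \<beta>1 by (auto simp: scale_or_def)
 ultimately show ?thesis by (simp add: gluing_orientation_def w_def)
qed

end
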